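(* Let $G$ be a Polish group and $H \leq G$ a closed subgroup. Then $H$ is strongly amenable if and only if the affine $G$-flow $P(\mathrm{Sa}(G/H))$ is proximally irreducible, i.e. has no nontrivial proximally irreducible extensions.
   Context: All topological spaces are Hausdorff. A $G$-flow is a (nonempty) compact Hausdorff space with a continuous left action of $G$; a $G$-map is a continuous $G$-equivariant map. For a compact space $X$, $P(X)$ is the space of regular Borel probability measures on $X$ with the weak$^*$ topology. An affine $G$-flow is a (nonempty) compact convex set $K$ (a compact convex subset of a Hausdorff locally convex topological vector space) with a continuous action of $G$ by affine homeomorphisms; if $X$ is a $G$-flow then $P(X)$ is an affine $G$-flow with the push-forward action. An affine subflow is a nonempty closed convex $G$-invariant subset. An affine extension is a surjective continuous affine $G$-equivariant map between affine $G$-flows. $\mathrm{ext}(K)$ is the set of extreme points of $K$, $\overline{\mathrm{ext}}(K)$ its closure, and $\mathrm{conv}(A)$ the set of (finite) convex combinations of elements of $A$. A flow $X$ of a topological group is proximal if for all $x,y\in X$ there is a net $(g_\lambda)$ in the group with $\lim g_\lambda x=\lim g_\lambda y$. A topological group is strongly amenable if every proximal flow of it has a fixed point. An affine extension $\phi\colon L\to K$ of affine $G$-flows is a proximally irreducible extension if every affine subflow $C\subseteq L$ satisfying $C\cap\mathrm{conv}(\overline{\mathrm{ext}}(L)\cap\phi^{-1}(\{y\}))\neq\emptyset$ for all $y\in\overline{\mathrm{ext}}(K)$ equals $L$. An affine $G$-flow $K$ is proximally irreducible if it has no nontrivial proximally irreducible extensions, i.e. every proximally irreducible extension $\phi\colon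 L\to K$ is an isomorphism. For a closed subgroup $H\le G$, $\mathrm{Sa}(G/H)$ is the Samuel compactification of $G/H$: the Gelfand spectrum of the unital commutative $C^*$-algebra $\mathrm{RUC}^b(G/H)$ of bounded functions $f\colon G/H\to\mathbb{C}$ such that for every $\varepsilon>0$ there is an open neighbourhood $U$ of $1_G$ with $|f(ux)-f(x)|<\varepsilon$ for all $u\in U$, $x\in G/H$. It is a $G$-flow (with the action induced by translation) containing $G/H$ as a dense $G$-invariant subset, and if $X$ is a $G$-flow and $x\in X$ is fixed by $H$, there is a unique $G$-map $\mathrm{Sa}(G/H)\to X$ with $gH\mapsto gx$. *)

theory Defs
  imports
    "HOL-Analysis.Analysis"
    "HOL-Probability.Probability_Measure"
    "HOL-Algebra.Left_Coset"
    "HOL-Algebra.Group_Action"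
    "HOL-Library.Function_Algebras"
begin

section \<open>Pointwise real vector space structure on functions\<close>

instantiation "fun" :: (type, scaleR) scaleR
begin

definition scaleR_fun_def: "c *\<^sub>R f = (\<lambda>x. c *\<^sub>R f x)"

instance ..

end

instance "fun" :: (type, real_vector) real_vector
  by standard (simp_all add: scaleR_fun_def plus_fun_def fun_eq_iff algebra_simps)


section \<open>Topological groups and flows\<close>

definition topological_group :: "('g, 'm) monoid_scheme \<Rightarrow> 'g topology \<Rightarrow> bool" where
  "topological_group G T \<longleftrightarrow>
     group G \<and> topspace T = carrier G \<and> Hausdorff_space T \<and>
     continuous_map (prod_topology T T) T (\<lambda>(x, y). x \<otimes>\<^bsub>G\<^esub> y) \<and>
     continuous_map T T (\<lambda>x. inv\<^bsub>G\<^esub> x)"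

definition polish_group :: "('g, 'm) monoid_scheme \<Rightarrow> 'g topology \<Rightarrow> bool" where
  "polish_group G T \<longleftrightarrow>
     topological_group G T \<and> completely_metrizable_space T \<and> separable_space T"

definition flow ::
  "('g, 'm) monoid_scheme \<Rightarrow> 'g topology \<Rightarrow> 'x topology \<Rightarrow> ('g \<Rightarrow> 'x \<Rightarrow> 'x) \<Rightarrow> bool" where
  "flow G T X a \<longleftrightarrow>
     topspace X \<noteq> {} \<and> compact_space X \<and> Hausdorff_space X \<and>
     group_action G (topspace X) a \<and>
     continuous_map (prod_topology T X) X (\<lambda>(g, x). a g x)"

text \<open>A net in \<open>G\<close> is represented by its filter of tails, a proper filter on \<open>G\<close>.\<close>

definition proximal :: "('g, 'm) monoid_scheme \<Rightarrow> 'x topology \<Rightarrow> ('g \<Rightarrow> 'x \<Rightarrow> 'x) \<Rightarrow> bool" where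
  "proximal G X a \<longleftrightarrow>
     (\<forall>x\<in>topspace X. \<forall>y\<in>topspace X.
        \<exists>F z. F \<noteq> bot \<and> eventually (\<lambda>g. g \<in> carrier G) F \<and>
              limitin X (\<lambda>g. a g x) z F \<and> limitin X (\<lambda>g. a g y) z F)"

definition has_fixed_point :: "('g, 'm) monoid_scheme \<Rightarrow> 'x topology \<Rightarrow> ('g \<Rightarrow> 'x \<Rightarrow> 'x) \<Rightarrow> bool" where
  "has_fixed_point G X a \<longleftrightarrow> (\<exists>x\<in>topspace X. \<forall>g\<in>carrier G. a g x = x)"

text \<open>
  HOL cannot quantify over the underlying types of all flows, so flows are taken on subsets of
  \<open>'x + 'g set set\<close>, where \<open>'x\<close> is arbitrary.  The second summand makes the notion independent
  of \<open>'x\<close> and equivalent to the unrestricted one: a flow of any size contains a minimal subflow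
  \<open>M\<close> (proximal, or without fixed points, if the flow is), and for \<open>m \<in> M\<close> the orbit of \<open>m\<close>
  is dense, so that mapping \<open>x\<close> to the set of all sets \<open>A\<close> of group elements such that \<open>x\<close>
  lies in the closure of \<open>A m\<close> injects \<open>M\<close> into \<open>'g set set\<close>.
\<close>

definition strongly_amenable ::
  "'x itself \<Rightarrow> ('g, 'm) monoid_scheme \<Rightarrow> 'g topology \<Rightarrow> bool" where
  "strongly_amenable _ G T \<longleftrightarrow>
     (\<forall>(X :: ('x + 'g set set) topology) a.
        flow G T X a \<and> proximal G X a \<longrightarrow> has_fixed_point G X a)"


section \<open>Affine flows\<close>

text \<open>A Hausdorff locally convex topology on a linear subspace, its underlying set, of \<open>'v\<close>.\<close>

definition hausdorff_locally_convex :: "'v::real_vector topology \<Rightarrow> bool" where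
  "hausdorff_locally_convex E \<longleftrightarrow>
     subspace (topspace E) \<and> Hausdorff_space E \<and>
     continuous_map (prod_topology E E) E (\<lambda>(x, y). x + y) \<and>
     continuous_map (prod_topology euclideanreal E) E (\<lambda>(c, x). c *\<^sub>R x) \<and>
     (\<forall>U. openin E U \<and> 0 \<in> U \<longrightarrow> (\<exists>C. openin E C \<and> convex C \<and> 0 \<in> C \<and> C \<subseteq> U))"

definition affine_map_on :: "'v::real_vector set \<Rightarrow> ('v \<Rightarrow> 'w::real_vector) \<Rightarrow> bool" where
  "affine_map_on K f \<longleftrightarrow>
     (\<forall>x\<in>K. \<forall>y\<in>K. \<forall>t\<in>{0..1}.
        f ((1 - t) *\<^sub>R x + t *\<^sub>R y) = (1 - t) *\<^sub>R f x + t *\<^sub>R f y)"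

text \<open>An affine flow is given by its set \<open>topspace K\<close> with the topology \<open>K\<close> induced by the
  ambient locally convex space, and the action; compactness is part of \<open>flow\<close>.\<close>

definition affine_flow ::
  "('g, 'm) monoid_scheme \<Rightarrow> 'g topology \<Rightarrow> 'v::real_vector topology \<Rightarrow> ('g \<Rightarrow> 'v \<Rightarrow> 'v) \<Rightarrow> bool" where
  "affine_flow G T K a \<longleftrightarrow>
     (\<exists>E. hausdorff_locally_convex E \<and> K = subtopology E (topspace K)) \<and>
     convex (topspace K) \<and> flow G T K a \<and>
     (\<forall>g\<in>carrier G. affine_map_on (topspace K) (a g))"

definition affine_subflow ::
  "('g, 'm) monoid_scheme \<Rightarrow> 'v::real_vector topology \<Rightarrow> ('g \<Rightarrow> 'v \<Rightarrow> 'v) \<Rightarrow> 'v set \<Rightarrow> bool" where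
  "affine_subflow G K a C \<longleftrightarrow>
     C \<noteq> {} \<and> closedin K C \<and> convex C \<and> (\<forall>g\<in>carrier G. a g ` C \<subseteq> C)"

definition affine_extension ::
  "('g, 'm) monoid_scheme \<Rightarrow> 'g topology \<Rightarrow>
   'v::real_vector topology \<Rightarrow> ('g \<Rightarrow> 'v \<Rightarrow> 'v) \<Rightarrow>
   'w::real_vector topology \<Rightarrow> ('g \<Rightarrow> 'w \<Rightarrow> 'w) \<Rightarrow> ('v \<Rightarrow> 'w) \<Rightarrow> bool" where
  "affine_extension G T L b K a \<phi> \<longleftrightarrow>
     affine_flow G T L b \<and> affine_flow G T K a \<and>
     continuous_map L K \<phi> \<and> \<phi> ` topspace L = topspace K \<and>
     affine_map_on (topspace L) \<phi> \<and>
     (\<forall>g\<in>carrier G. \<forall>x\<in>topspace L. \<phi> (b g x) = a g (\<phi> x))"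

definition ext_closure :: "'v::real_vector topology \<Rightarrow> 'v set" where
  "ext_closure K = K closure_of {x. x extreme_point_of topspace K}"

definition proximally_irreducible_extension ::
  "('g, 'm) monoid_scheme \<Rightarrow> 'g topology \<Rightarrow>
   'v::real_vector topology \<Rightarrow> ('g \<Rightarrow> 'v \<Rightarrow> 'v) \<Rightarrow>
   'w::real_vector topology \<Rightarrow> ('g \<Rightarrow> 'w \<Rightarrow> 'w) \<Rightarrow> ('v \<Rightarrow> 'w) \<Rightarrow> bool" where
  "proximally_irreducible_extension G T L b K a \<phi> \<longleftrightarrow>
     affine_extension G T L b K a \<phi> \<and>
     (\<forall>C. affine_subflow G L b C \<and>
          (\<forall>y\<in>ext_closure K. C \<inter> convex hull (ext_closure L \<inter> \<phi> -` {y}) \<noteq> {}) \<longrightarrow>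
          C = topspace L)"

text \<open>
  As for \<open>strongly_amenable\<close>, the extensions have to live in a fixed type; here \<open>'v\<close> is
  arbitrary, and the second factor makes the notion independent of \<open>'v\<close> and equivalent to the
  unrestricted one.  Let \<open>L\<close> be a proximally irreducible extension of \<open>K\<close> and choose, for
  each \<open>y\<close> in the closure of the extreme points of \<open>K\<close>, a point \<open>z y\<close> in the convex hull of
  the fibre of that of \<open>L\<close> over \<open>y\<close>.  The closed convex hull of all the \<open>g (z y)\<close> is an
  affine subflow, hence it is \<open>L\<close>, so a continuous affine function \<open>f\<close> on \<open>L\<close> is determined by
  the function taking \<open>(y, g)\<close> to \<open>f (g (z y))\<close>.  Evaluation at these \<open>f\<close> thus embeds \<open>L\<close>
  affinely and homeomorphically into \<open>('w \<times> 'g \<Rightarrow> real) \<Rightarrow> real\<close> with the product topology.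

  A surjective extension is an isomorphism as soon as it is a homeomorphism, since the inverse
  is then affine and equivariant.
\<close>

definition proximally_irreducible ::
  "'v::real_vector itself \<Rightarrow> ('g, 'm) monoid_scheme \<Rightarrow> 'g topology \<Rightarrow>
   'w::real_vector topology \<Rightarrow> ('g \<Rightarrow> 'w \<Rightarrow> 'w) \<Rightarrow> bool" where
  "proximally_irreducible _ G T K a \<longleftrightarrow>
     affine_flow G T K a \<and>
     (\<forall>(L :: ('v \<times> (('w \<times> 'g \<Rightarrow> real) \<Rightarrow> real)) topology) b \<phi>.
        proximally_irreducible_extension G T L b K a \<phi> \<longrightarrow> homeomorphic_map L K \<phi>)"


section \<open>Regular Borel probability measures\<close>

definition regular_prob_measures :: "'x topology \<Rightarrow> 'x measure set" where
  "regular_prob_measures X =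
     {\<mu>. prob_space \<mu> \<and> space \<mu> = topspace X \<and>
         sets \<mu> = sigma_sets (topspace X) {U. openin X U} \<and>
         (\<forall>A\<in>sets \<mu>.
            emeasure \<mu> A = (SUP C\<in>{C. C \<subseteq> A \<and> compactin X C}. emeasure \<mu> C) \<and>
            emeasure \<mu> A = (INF U\<in>{U. A \<subseteq> U \<and> openin X U}. emeasure \<mu> U))}"

text \<open>
  A regular Borel probability measure on a compact Hausdorff space is identified with the
  integration functional it induces on real continuous functions (this is injective by
  uniqueness in the Riesz representation theorem).  Functionals are extended by 0 to
  discontinuous functions, so that they form a linear subspace of
  \<open>('x \<Rightarrow> real) \<Rightarrow> real\<close> on which the product topology is the weak-* topology.
\<close>

definition integral_functional :: "'x topology \<Rightarrow> 'x measure \<Rightarrow> ('x \<Rightarrow> real) \<Rightarrow> real" where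
  "integral_functional X \<mu> =
     (\<lambda>f. if continuous_map X euclideanreal f then \<integral>x. f x \<partial>\<mu> else 0)"

definition P_space :: "'x topology \<Rightarrow> (('x \<Rightarrow> real) \<Rightarrow> real) topology" where
  "P_space X =
     subtopology (product_topology (\<lambda>_. euclideanreal) UNIV)
       (integral_functional X ` regular_prob_measures X)"

text \<open>Push-forward of measures, under the above identification.\<close>

definition P_action ::
  "'x topology \<Rightarrow> ('g \<Rightarrow> 'x \<Rightarrow> 'x) \<Rightarrow> 'g \<Rightarrow> (('x \<Rightarrow> real) \<Rightarrow> real) \<Rightarrow> (('x \<Rightarrow> real) \<Rightarrow> real)" where
  "P_action X a g =
     (\<lambda>\<Lambda>\<in>topspace (P_space X).
        let \<mu> = inv_into (regular_prob_measures X) (integral_functional X) \<Lambda>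
        in integral_functional X (distr \<mu> \<mu> (a g)))"


section \<open>The Samuel compactification of a coset space\<close>

text \<open>Functions on \<open>G/H\<close> are extensional functions on the set of left cosets.\<close>

definition RUC ::
  "('g, 'm) monoid_scheme \<Rightarrow> 'g topology \<Rightarrow> 'g set \<Rightarrow> ('g set \<Rightarrow> complex) set" where
  "RUC G T H =
     {f \<in> extensional (lcosets\<^bsub>G\<^esub> H).
        bounded (f ` (lcosets\<^bsub>G\<^esub> H)) \<and>
        (\<forall>\<epsilon>>0. \<exists>U. openin T U \<and> \<one>\<^bsub>G\<^esub> \<in> U \<and>
           (\<forall>u\<in>U. \<forall>x\<in>lcosets\<^bsub>G\<^esub> H. cmod (f (u <#\<^bsub>G\<^esub> x) - f x) < \<epsilon>))}"

text \<open>The spectrum of a unital algebra \<open>A\<close> of complex functions on \<open>S\<close>: its unital characters,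
  as extensional functions on \<open>A\<close>, with the topology of pointwise convergence on \<open>A\<close>.\<close>

definition gelfand_spectrum ::
  "'s set \<Rightarrow> ('s \<Rightarrow> complex) set \<Rightarrow> (('s \<Rightarrow> complex) \<Rightarrow> complex) topology" where
  "gelfand_spectrum S A =
     subtopology (product_topology (\<lambda>_. euclidean) A)
       {\<omega> \<in> extensional A.
          \<omega> (\<lambda>x\<in>S. 1) = 1 \<and>
          (\<forall>c. \<forall>f\<in>A. \<omega> (\<lambda>x\<in>S. c * f x) = c * \<omega> f) \<and>
          (\<forall>f\<in>A. \<forall>h\<in>A. \<omega> (\<lambda>x\<in>S. f x + h x) = \<omega> f + \<omega> h) \<and>
          (\<forall>f\<in>A. \<forall>h\<in>A. \<omega> (\<lambda>x\<in>S. f x * h x) = \<omega> f * \<omega> h)}"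

definition Sa ::
  "('g, 'm) monoid_scheme \<Rightarrow> 'g topology \<Rightarrow> 'g set \<Rightarrow> (('g set \<Rightarrow> complex) \<Rightarrow> complex) topology" where
  "Sa G T H = gelfand_spectrum (lcosets\<^bsub>G\<^esub> H) (RUC G T H)"

text \<open>The dual of translation, so that \<open>g\<close> takes evaluation at \<open>x\<close> to evaluation at \<open>g x\<close>.\<close>

definition Sa_action ::
  "('g, 'm) monoid_scheme \<Rightarrow> 'g topology \<Rightarrow> 'g set \<Rightarrow>
   'g \<Rightarrow> (('g set \<Rightarrow> complex) \<Rightarrow> complex) \<Rightarrow> (('g set \<Rightarrow> complex) \<Rightarrow> complex)" where
  "Sa_action G T H g =
     (\<lambda>\<omega>\<in>topspace (Sa G T H). \<lambda>f\<in>RUC G T H. \<omega> (\<lambda>x\<in>lcosets\<^bsub>G\<^esub> H. f (g <#\<^bsub>G\<^esub> x)))"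

end

theory Submission
  imports Defs
begin

text \<open>
  Let \<open>X\<close> be the Samuel compactification of \<open>G/H\<close> and \<open>K = P(X)\<close>.  By the Riesz representation
  theorem, \<open>K\<close> is the state space of \<open>C(X)\<close>; its extreme points are point masses, \<open>H\<close> fixes the
  point mass \<open>y\<close> at the coset \<open>H\<close>, and \<open>K\<close> is the closed convex hull of the orbit of \<open>y\<close>.

  Let \<open>H\<close> be strongly amenable and \<open>\<phi> : L \<rightarrow> K\<close> proximally irreducible.  Let \<open>Y\<close> be the part of
  the closure of the extreme points of \<open>L\<close> that lies over \<open>y\<close>.  For \<open>x, x' \<in> Y\<close> the orbit of the
  midpoint of \<open>x\<close> and \<open>x'\<close> generates an affine subflow that meets all the required convex hulls,
  so it generates \<open>L\<close> (\<open>midpoint_generates\<close>).  By Milman's theorem an extreme point \<open>e\<close> of \<open>L\<close>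
  over \<open>y\<close> is a limit of such midpoints \<open>g (x + x') / 2\<close>, and since \<open>e\<close> is extreme, both \<open>g x\<close> and
  \<open>g x'\<close> tend to \<open>e\<close>.  Then \<open>g y\<close> tends to \<open>y\<close>, that is \<open>g H\<close> tends to \<open>H\<close>, so \<open>g\<close> can be corrected
  by a small group element to lie in \<open>H\<close> (\<open>Y_proximal_pair\<close>).  Hence \<open>Y\<close> is a proximal
  \<open>H\<close>-flow and contains an \<open>H\<close>-fixed point \<open>x\<close>.  Continuous affine functions \<open>f\<close> on \<open>L\<close> are
  determined by the functions \<open>gH \<mapsto> f (g x)\<close> on \<open>G/H\<close>, which extend to \<open>X\<close>; so \<open>f\<close> factors
  through \<open>\<phi>\<close>, and \<open>\<phi>\<close> is injective (\<open>fixed_point_imp_injective\<close>).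

  Conversely let \<open>M\<close> be a minimal proximal \<open>H\<close>-flow without fixed points.  An extension of \<open>K\<close> whose
  fibre over \<open>y\<close> is \<open>M\<close> would consist of states on an algebra of functions on \<open>G \<times>\<^sub>H M\<close> that are
  uniformly continuous in the direction of \<open>G\<close> and continuous on \<open>M\<close>.  Extending a
  continuous function from \<open>H\<close> to \<open>G\<close> involves an infimum over \<open>H\<close>, however, which is only
  upper semicontinuous on \<open>M\<close>.  Continuity on \<open>M\<close> is therefore relaxed to small oscillation on a
  dense family of open sets, and states are required to ignore nowhere dense sets: the order on the
  algebra is that of inequality on such a family.  An extreme point \<open>\<omega>\<close> over \<open>y\<close> is represented by a
  point of \<open>M\<close> (\<open>multiplicative_represents\<close>), so a fibre with only one point would give an \<open>H\<close>-fixed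
  point of \<open>M\<close>.  If a function in the algebra exceeds \<open>t\<close>, then some translate of it exceeds \<open>t\<close> on
  an open set of points of \<open>M\<close>, into which proximality and minimality move any finite set of points of
  \<open>M\<close> (\<open>translate_exceeds_at_states\<close>).  By the Hahn--Banach theorem a subflow that contains a finite convex
  combination of points such as \<open>\<omega>\<close> is then the whole state space: the extension is proximally irreducible.
\<close>

section \<open>The Hahn--Banach theorem\<close>

definition sublinear_on :: "'v::real_vector set \<Rightarrow> ('v \<Rightarrow> real) \<Rightarrow> bool" where
  "sublinear_on V p \<longleftrightarrow> 
     (\<forall>x\<in>V. \<forall>y\<in>V. p (x + y) \<le> p x + p y) \<and> (\<forall>x\<in>V. \<forall>c>0. p (c *\<^sub>R x) = c * p x)"

definition linear_functional_on :: "'v::real_vector set \<Rightarrow> ('v \<Rightarrow> real) \<Rightarrow> bool" where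
  "linear_functional_on V f \<longleftrightarrow>
     (\<forall>x\<in>V. \<forall>y\<in>V. f (x + y) = f x + f y) \<and> (\<forall>x\<in>V. \<forall>c. f (c *\<^sub>R x) = c * f x)"

lemma sublinear_on_add: "sublinear_on V p \<Longrightarrow> x \<in> V \<Longrightarrow> y \<in> V \<Longrightarrow> p (x + y) \<le> p x + p y"
  and sublinear_on_scale: "sublinear_on V p \<Longrightarrow> x \<in> V \<Longrightarrow> c > 0 \<Longrightarrow> p (c *\<^sub>R x) = c * p x"
  by (auto simp: sublinear_on_def)

lemma sublinear_on_zero:
  assumes "subspace V" "sublinear_on V p" shows "p 0 = 0"
  using sublinear_on_scale[OF assms(2), of 0 2] subspace_0[OF assms(1)] by simp

lemma sublinear_on_minus:
  assumes "subspace V" "sublinear_on V p" "x \<in> V" shows "- p (- x) \<le> p x"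
  using sublinear_on_add[OF assms(2,3), of "-x"] sublinear_on_zero[OF assms(1,2)]
    subspace_neg[OF assms(1,3)] by simp

text \<open>Lowering \<open>p\<close> as far as sublinearity permits while keeping its value at \<open>v\<close>.\<close>

definition sublinear_shift :: "('v::real_vector \<Rightarrow> real) \<Rightarrow> 'v \<Rightarrow> 'v \<Rightarrow> real" where
  "sublinear_shift p v x = (INF t\<in>{0..}. p (x + t *\<^sub>R v) - t * p v)"

lemma sublinear_shift:
  assumes V: "subspace V" and p: "sublinear_on V p" and v: "v \<in> V"
  shows "sublinear_on V (sublinear_shift p v)"
    and "x \<in> V \<Longrightarrow> t \<ge> 0 \<Longrightarrow> sublinear_shift p v x \<le> p (x + t *\<^sub>R v) - t * p v"
proof -
  have inV: "x + t *\<^sub>R v \<in> V" if "x \<in> V" for x t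
    using V v that by (simp add: subspace_add subspace_scale)
  have bound: "- p (- x) \<le> p (x + t *\<^sub>R v) - t * p v" if "x \<in> V" "t \<ge> 0" for x t
  proof -
    have "p (t *\<^sub>R v) \<le> p (x + t *\<^sub>R v) + p (- x)"
      using sublinear_on_add[OF p inV[OF that(1), of t] subspace_neg[OF V that(1)]] by simp
    moreover have "p (t *\<^sub>R v) = t * p v"
      using that sublinear_on_scale[OF p v, of t] sublinear_on_zero[OF V p] by (cases "t = 0") auto
    ultimately show ?thesis by simp
  qed
  have bdd: "bdd_below ((\<lambda>t. p (x + t *\<^sub>R v) - t * p v) ` {0..})" if "x \<in> V" for x
    using bound[OF that] by (intro bdd_belowI2[of _ "- p (-x)"]) auto
  show le: "sublinear_shift p v x \<le> p (x + t *\<^sub>R v) - t * p v" if "x \<in> V" "t \<ge> 0" for x t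
    unfolding sublinear_shift_def using that by (intro cINF_lower bdd) auto
  show "sublinear_on V (sublinear_shift p v)"
    unfolding sublinear_on_def
  proof (intro conjI ballI allI impI)
    fix x y assume x: "x \<in> V" and y: "y \<in> V"
    have *: "sublinear_shift p v (x + y) \<le> (p (x + t *\<^sub>R v) - t * p v) + (p (y + s *\<^sub>R v) - s * p v)"
      if "t \<ge> 0" "s \<ge> 0" for t s
    proof -
      have "sublinear_shift p v (x + y) \<le> p ((x + y) + (t + s) *\<^sub>R v) - (t + s) * p v"
        using that x y V by (intro le) (auto simp: subspace_add)
      also have "(x + y) + (t + s) *\<^sub>R v = (x + t *\<^sub>R v) + (y + s *\<^sub>R v)"
        by (simp add: algebra_simps)
      also have "p \<dots> \<le> p (x + t *\<^sub>R v) + p (y + s *\<^sub>R v)"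
        by (rule sublinear_on_add[OF p inV[OF x] inV[OF y]])
      finally show ?thesis by (simp add: algebra_simps)
    qed
    have "sublinear_shift p v (x + y) - (p (x + t *\<^sub>R v) - t * p v) \<le> sublinear_shift p v y"
      if "t \<ge> 0" for t
      unfolding sublinear_shift_def[of p v y] using *[OF that] by (intro cINF_greatest) force+
    hence "sublinear_shift p v (x + y) - sublinear_shift p v y \<le> sublinear_shift p v x"
      unfolding sublinear_shift_def[of p v x] by (intro cINF_greatest) force+
    thus "sublinear_shift p v (x + y) \<le> sublinear_shift p v x + sublinear_shift p v y" by simp
  next
    fix x :: 'a and c :: real assume x: "x \<in> V" and c: "c > 0"
    have half: "sublinear_shift p v (c *\<^sub>R x) \<le> c * sublinear_shift p v x" if "c > 0" "x \<in> V" for c x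
    proof -
      have "sublinear_shift p v (c *\<^sub>R x) / c \<le> p (x + t *\<^sub>R v) - t * p v" if "t \<ge> 0" for t
      proof -
        have "sublinear_shift p v (c *\<^sub>R x) \<le> p (c *\<^sub>R x + (c * t) *\<^sub>R v) - (c * t) * p v"
          using \<open>c > 0\<close> \<open>x \<in> V\<close> that V by (intro le) (auto simp: subspace_scale)
        also have "c *\<^sub>R x + (c * t) *\<^sub>R v = c *\<^sub>R (x + t *\<^sub>R v)" by (simp add: algebra_simps)
        also have "p \<dots> = c * p (x + t *\<^sub>R v)"
          by (rule sublinear_on_scale[OF p inV[OF \<open>x \<in> V\<close>] \<open>c > 0\<close>])
        finally show ?thesis using \<open>c > 0\<close> by (simp add: field_simps)
      qed
      hence "sublinear_shift p v (c *\<^sub>R x) / c \<le> sublinear_shift p v x"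
        unfolding sublinear_shift_def[of p v x] by (intro cINF_greatest) auto
      thus ?thesis using \<open>c > 0\<close> by (simp add: field_simps)
    qed
    have "sublinear_shift p v ((1/c) *\<^sub>R (c *\<^sub>R x)) \<le> (1/c) * sublinear_shift p v (c *\<^sub>R x)"
      using c x V by (intro half) (auto simp: subspace_scale)
    hence "c * sublinear_shift p v x \<le> sublinear_shift p v (c *\<^sub>R x)"
      using c by (simp add: field_simps)
    thus "sublinear_shift p v (c *\<^sub>R x) = c * sublinear_shift p v x"
      using half[OF c x] by simp
  qed
qed

text \<open>By minimality \<open>p\<close> agrees with each of its shifts, which makes it additive.\<close>

lemma sublinear_minimal_imp_linear:
  assumes V: "subspace V" and p: "sublinear_on V p"
    and min: "\<And>q. sublinear_on V q \<Longrightarrow> (\<And>x. x \<in> V \<Longrightarrow> q x \<le> p x) \<Longrightarrow> (\<And>x. x \<in> V \<Longrightarrow> q x = p x)"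
  shows "linear_functional_on V p"
proof -
  have add: "p (x + v) = p x + p v" if "x \<in> V" "v \<in> V" for x v
  proof -
    note sh = sublinear_shift[OF V p \<open>v \<in> V\<close>]
    have "sublinear_shift p v x = p x"
      by (rule min[OF sh(1) _ \<open>x \<in> V\<close>]) (use sh(2)[of _ 0] in auto)
    hence "p x \<le> p (x + v) - p v" using sh(2)[OF \<open>x \<in> V\<close>, of 1] by simp
    thus ?thesis using sublinear_on_add[OF p that] by simp
  qed
  have neg: "p (- x) = - p x" if "x \<in> V" for x
    using add[OF that subspace_neg[OF V that]] sublinear_on_zero[OF V p] by simp
  have "p (c *\<^sub>R x) = c * p x" if "x \<in> V" for x c
  proof (cases "c = 0" "c > 0" rule: case_split[case_product case_split])
    case False_False
    have "p (c *\<^sub>R x) = p ((-c) *\<^sub>R (-x))" by simp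
    also have "\<dots> = (-c) * p (-x)"
      using False_False that V by (intro sublinear_on_scale[OF p]) (auto simp: subspace_neg)
    finally show ?thesis using neg[OF that] by simp
  qed (use that sublinear_on_scale[OF p that] sublinear_on_zero[OF V p] in auto)
  with add show ?thesis by (auto simp: linear_functional_on_def)
qed

text \<open>
  A minimal sublinear functional below \<open>p\<close> is linear.  Minimal ones exist since the pointwise
  infimum of a chain of sublinear functionals is sublinear; it is finite because \<open>q \<le> p\<close>
  implies \<open>q x \<ge> - p (- x)\<close>.
\<close>

theorem hahn_banach_dominated:
  assumes V: "subspace V" and p: "sublinear_on V p"
  obtains f where "linear_functional_on V f" "\<And>x. x \<in> V \<Longrightarrow> f x \<le> p x"
proof -
  define A where "A = {q \<in> extensional V. sublinear_on V q \<and> (\<forall>x\<in>V. q x \<le> p x)}"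
  define R where "R = (\<lambda>q r :: 'a \<Rightarrow> real. \<forall>x\<in>V. r x \<le> q x)"
  have Aext: "q = r" if "q \<in> A" "r \<in> A" "\<And>x. x \<in> V \<Longrightarrow> q x = r x" for q r
    using that by (auto simp: A_def intro: extensionalityI)
  have cong: "sublinear_on V (restrict q V) = sublinear_on V q" for q
    unfolding sublinear_on_def using V by (auto simp: subspace_add subspace_scale)
  have "\<exists>m\<in>A. \<forall>a\<in>A. R m a \<longrightarrow> a = m"
  proof (rule predicate_Zorn)
    show "partial_order_on A (relation_of R A)"
      by (rule partial_order_on_relation_ofI)
         (auto simp: R_def intro!: Aext intro: order_trans antisym)
  next
    fix C assume C: "C \<in> Chains (relation_of R A)"
    hence CA: "C \<subseteq> A" and tot: "\<And>q r. q \<in> C \<Longrightarrow> r \<in> C \<Longrightarrow> R q r \<or> R r q"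
      by (auto simp: Chains_def relation_of_def)
    show "\<exists>u\<in>A. \<forall>a\<in>C. R a u"
    proof (cases "C = {}")
      case True
      have "restrict p V \<in> A" using p by (auto simp: A_def cong)
      with True show ?thesis by blast
    next
      case False
      define i where "i = (\<lambda>x. INF q\<in>C. q x)"
      have lb: "- p (- x) \<le> q x" if "q \<in> C" "x \<in> V" for q x
      proof -
        have "sublinear_on V q" "q (-x) \<le> p (-x)"
          using that CA V by (auto simp: A_def subspace_neg)
        thus ?thesis using sublinear_on_minus[OF V _ that(2), of q] by simp
      qed
      have le: "i x \<le> q x" if "q \<in> C" "x \<in> V" for q x
        unfolding i_def using that lb by (intro cINF_lower bdd_belowI2[of _ "- p (- x)"]) auto
      have gr: "t \<le> i x" if "\<And>q. q \<in> C \<Longrightarrow> t \<le> q x" for t x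
        unfolding i_def using False that by (rule cINF_greatest)
      have sub: "sublinear_on V i"
        unfolding sublinear_on_def
      proof (intro conjI ballI allI impI)
        fix x y assume xy: "x \<in> V" "y \<in> V"
        have *: "i (x + y) \<le> q x + r y" if qr: "q \<in> C" "r \<in> C" for q r
        proof -
          obtain s where s: "s \<in> C" "\<And>z. z \<in> V \<Longrightarrow> s z \<le> q z" "\<And>z. z \<in> V \<Longrightarrow> s z \<le> r z"
            using tot[OF qr] qr unfolding R_def by blast
          have "i (x + y) \<le> s (x + y)" using s xy V by (intro le) (auto simp: subspace_add)
          also have "\<dots> \<le> s x + s y" using s CA xy by (intro sublinear_on_add) (auto simp: A_def)
          finally show ?thesis using s(2)[OF xy(1)] s(3)[OF xy(2)] by simp
        qed
        have "i (x + y) - q x \<le> i y" if "q \<in> C" for q using *[OF that] by (intro gr) force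
        hence "i (x + y) - i y \<le> i x" by (intro gr) force
        thus "i (x + y) \<le> i x + i y" by simp
      next
        fix x :: 'a and c :: real assume xc: "x \<in> V" "c > 0"
        have sc: "q (c *\<^sub>R x) = c * q x" if "q \<in> C" for q
          using that CA xc by (intro sublinear_on_scale) (auto simp: A_def)
        have "i (c *\<^sub>R x) / c \<le> i x"
        proof (rule gr)
          fix q assume q: "q \<in> C"
          have "i (c *\<^sub>R x) \<le> q (c *\<^sub>R x)" using q xc V by (intro le) (auto simp: subspace_scale)
          thus "i (c *\<^sub>R x) / c \<le> q x" using sc[OF q] xc by (simp add: field_simps)
        qed
        moreover have "c * i x \<le> i (c *\<^sub>R x)"
          using le xc by (intro gr) (simp add: sc)
        ultimately show "i (c *\<^sub>R x) = c * i x" using xc by (simp add: field_simps)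
      qed
      have "restrict i V \<in> A"
      proof -
        obtain q where "q \<in> C" using False by blast
        hence "i x \<le> p x" if "x \<in> V" for x
          using le[OF _ that, of q] CA that by (fastforce simp: A_def)
        thus ?thesis using sub by (auto simp: A_def cong)
      qed
      moreover have "\<forall>a\<in>C. R a (restrict i V)" using le by (auto simp: R_def)
      ultimately show ?thesis by blast
    qed
  qed
  then obtain m where m: "m \<in> A" "\<And>a. a \<in> A \<Longrightarrow> R m a \<Longrightarrow> a = m" by blast
  have "linear_functional_on V m"
  proof (rule sublinear_minimal_imp_linear[OF V])
    show "sublinear_on V m" using m by (simp add: A_def)
    fix q x assume q: "sublinear_on V q" "\<And>x. x \<in> V \<Longrightarrow> q x \<le> m x" and x: "x \<in> V"
    have "restrict q V \<in> A" using q m(1) by (fastforce simp: A_def cong)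
    moreover have "R m (restrict q V)" using q by (auto simp: R_def)
    ultimately have "restrict q V = m" by (rule m(2))
    thus "q x = m x" using x by (metis restrict_apply')
  qed
  with m(1) show ?thesis by (intro that[of m]) (auto simp: A_def)
qed

corollary hahn_banach_supporting:
  assumes V: "subspace V" and p: "sublinear_on V p" and v: "v \<in> V"
  obtains f where "linear_functional_on V f" "\<And>x. x \<in> V \<Longrightarrow> f x \<le> p x" "f v = p v"
proof -
  note sh = sublinear_shift[OF V p v]
  obtain f where f: "linear_functional_on V f" "\<And>x. x \<in> V \<Longrightarrow> f x \<le> sublinear_shift p v x"
    using hahn_banach_dominated[OF V sh(1)] by blast
  have le: "f x \<le> p x" if "x \<in> V" for x using f(2)[OF that] sh(2)[OF that, of 0] by simp
  have "f (- v) \<le> - p v"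
    using f(2)[OF subspace_neg[OF V v]] sh(2)[OF subspace_neg[OF V v], of 1]
      sublinear_on_zero[OF V p] by simp
  moreover have "f (- v) = - f v"
    using f(1) v unfolding linear_functional_on_def by (metis mult_minus1 scaleR_minus1_left)
  ultimately have "f v = p v" using le[OF v] by simp
  with f le that show ?thesis by blast
qed

section \<open>Separation in locally convex spaces\<close>

lemma lc_continuous_add:
  assumes "hausdorff_locally_convex E" "continuous_map X E f" "continuous_map X E g"
  shows "continuous_map X E (\<lambda>x. f x + g x)"
proof -
  have "continuous_map X E ((\<lambda>(x, y). x + y) \<circ> (\<lambda>x. (f x, g x)))"
    using assms by (intro continuous_map_compose[of _ "prod_topology E E"] continuous_map_pairedI)
      (auto simp: hausdorff_locally_convex_def)
  thus ?thesis by (simp add: o_def)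
qed

lemma lc_continuous_scale:
  assumes "hausdorff_locally_convex E" "continuous_map X euclideanreal c" "continuous_map X E f"
  shows "continuous_map X E (\<lambda>x. c x *\<^sub>R f x)"
proof -
  have "continuous_map X E ((\<lambda>(c, x). c *\<^sub>R x) \<circ> (\<lambda>x. (c x, f x)))"
    using assms by (intro continuous_map_compose[of _ "prod_topology euclideanreal E"] continuous_map_pairedI)
      (auto simp: hausdorff_locally_convex_def)
  thus ?thesis by (simp add: o_def)
qed

definition gauge :: "'v::real_vector set \<Rightarrow> 'v \<Rightarrow> real" where
  "gauge D x = Inf {t. t > 0 \<and> (1 / t) *\<^sub>R x \<in> D}"

lemma gauge_sublinear:
  assumes V: "subspace V" and D: "convex D" "0 \<in> D"
    and absorbing: "\<And>x. x \<in> V \<Longrightarrow> \<exists>t>0. (1 / t) *\<^sub>R x \<in> D"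
  shows "sublinear_on V (gauge D)"
    and "x \<in> D \<Longrightarrow> gauge D x \<le> 1"
    and "x \<in> V \<Longrightarrow> x \<notin> D \<Longrightarrow> 1 \<le> gauge D x"
proof -
  have le: "gauge D x \<le> t" if "t > 0" "(1 / t) *\<^sub>R x \<in> D" for x t
    unfolding gauge_def using that by (intro cInf_lower bdd_belowI[of _ 0]) auto
  have gr: "s \<le> gauge D x" if "x \<in> V" "\<And>t. t > 0 \<Longrightarrow> (1 / t) *\<^sub>R x \<in> D \<Longrightarrow> s \<le> t" for x s
    unfolding gauge_def using that absorbing[of x] by (intro cInf_greatest) auto
  show "gauge D x \<le> 1" if "x \<in> D" using le[of 1 x] that by simp
  show "1 \<le> gauge D x" if "x \<in> V" "x \<notin> D"
  proof (rule gr[OF that(1)], rule ccontr)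
    fix t :: real assume t: "t > 0" "(1 / t) *\<^sub>R x \<in> D" "\<not> 1 \<le> t"
    have "(1 - t) *\<^sub>R 0 + t *\<^sub>R ((1 / t) *\<^sub>R x) \<in> D"
      using t D by (intro convexD_alt) auto
    with t that show False by simp
  qed
  show "sublinear_on V (gauge D)"
    unfolding sublinear_on_def
  proof (intro conjI ballI allI impI)
    fix x y assume xy: "x \<in> V" "y \<in> V"
    have *: "gauge D (x + y) \<le> t + s" if t: "t > 0" "(1 / t) *\<^sub>R x \<in> D" and s: "s > 0" "(1 / s) *\<^sub>R y \<in> D" for t s
    proof (rule le)
      have "(t / (t + s)) *\<^sub>R ((1 / t) *\<^sub>R x) + (s / (t + s)) *\<^sub>R ((1 / s) *\<^sub>R y) \<in> D"
        using t s by (intro mem_convex_alt D) auto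
      thus "(1 / (t + s)) *\<^sub>R (x + y) \<in> D" using t s by (simp add: scaleR_add_right)
    qed (use that in auto)
    have "gauge D (x + y) - t \<le> gauge D y" if "t > 0" "(1 / t) *\<^sub>R x \<in> D" for t
      using *[OF that] xy by (intro gr) (auto simp: algebra_simps)
    hence "gauge D (x + y) - gauge D y \<le> gauge D x"
      using xy by (intro gr) (auto simp: algebra_simps)
    thus "gauge D (x + y) \<le> gauge D x + gauge D y" by simp
  next
    fix x :: 'a and c :: real assume xc: "x \<in> V" "c > 0"
    have half: "gauge D (c *\<^sub>R x) \<le> c * gauge D x" if "c > 0" "x \<in> V" for c x
    proof -
      have "gauge D (c *\<^sub>R x) / c \<le> gauge D x"
      proof (rule gr[OF that(2)])
        fix t :: real assume t: "t > 0" "(1 / t) *\<^sub>R x \<in> D"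
        hence "gauge D (c *\<^sub>R x) \<le> c * t" using \<open>c > 0\<close> by (intro le) auto
        thus "gauge D (c *\<^sub>R x) / c \<le> t" using \<open>c > 0\<close> by (simp add: field_simps)
      qed
      thus ?thesis using that by (simp add: field_simps)
    qed
    have "gauge D ((1/c) *\<^sub>R (c *\<^sub>R x)) \<le> (1/c) * gauge D (c *\<^sub>R x)"
      using xc V by (intro half) (auto simp: subspace_scale)
    hence "c * gauge D x \<le> gauge D (c *\<^sub>R x)" using xc by (simp add: field_simps)
    thus "gauge D (c *\<^sub>R x) = c * gauge D x" using half[OF xc(2,1)] by simp
  qed
qed

lemma lc_linear_continuous:
  assumes E: "hausdorff_locally_convex E" and f: "linear_functional_on (topspace E) f"
    and U: "openin E U" "0 \<in> U" and bnd: "\<And>u. u \<in> U \<Longrightarrow> \<bar>f u\<bar> \<le> 1"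
  shows "continuous_map E euclideanreal f"
proof -
  have V: "subspace (topspace E)" using E by (simp add: hausdorff_locally_convex_def)
  have fadd: "f (x + y) = f x + f y" if "x \<in> topspace E" "y \<in> topspace E" for x y
    using f that by (auto simp: linear_functional_on_def)
  have fscale: "f (c *\<^sub>R x) = c * f x" if "x \<in> topspace E" for x c
    using f that by (auto simp: linear_functional_on_def)
  have "\<exists>W. openin E W \<and> x \<in> W \<and> (\<forall>y\<in>W. f y \<in> ball (f x) e)" if x: "x \<in> topspace E" and e: "e > 0" for x e
  proof -
    let ?m = "\<lambda>y. (2 / e) *\<^sub>R (y + (- x))"
    let ?W = "{y \<in> topspace E. ?m y \<in> U}"
    have "continuous_map E E ?m"
      using x subspace_neg[OF V x] by (intro lc_continuous_scale[OF E] lc_continuous_add[OF E]) auto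
    hence "openin E ?W" using U by (intro openin_continuous_map_preimage)
    moreover have "f y \<in> ball (f x) e" if y: "y \<in> ?W" for y
    proof -
      have d: "y + - x \<in> topspace E" using y x V by (simp add: subspace_diff)
      have "f (?m y) = (2 / e) * (f y - f x)"
        using fscale[OF d] fadd[of y "-x"] fscale[OF x, of "-1"] y subspace_neg[OF V x] by simp
      moreover have "\<bar>f (?m y)\<bar> \<le> 1" using y bnd by blast
      ultimately have "\<bar>2 / e\<bar> * \<bar>f y - f x\<bar> \<le> 1" by (simp only: abs_mult)
      hence "(2 / e) * \<bar>f y - f x\<bar> \<le> 1" using e by simp
      hence "\<bar>f y - f x\<bar> \<le> e / 2" using e by (simp add: field_simps)
      thus ?thesis using e by (simp add: dist_real_def abs_minus_commute)
    qed
    ultimately show ?thesis using x U by (intro exI[of _ ?W]) auto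
  qed
  thus ?thesis
    using Met_TC.continuous_map_to_metric[of E f]
    by (auto simp: mball_eq_ball)
qed

text \<open>For a symmetric convex neighbourhood \<open>U\<close> of \<open>0\<close> such that \<open>z + U\<close> misses \<open>C\<close>, the set
  \<open>D = C - c0 + U\<close> does not contain \<open>z - c0\<close>.  A linear functional that is dominated by the gauge of
  \<open>D\<close> and supports it at \<open>z - c0\<close> separates weakly; it separates strictly because it is positive
  somewhere on \<open>U\<close>.\<close>

theorem lc_separation:
  assumes E: "hausdorff_locally_convex E" and C: "convex C" "closedin E C" "C \<noteq> {}"
    and z: "z \<in> topspace E" "z \<notin> C"
  obtains f \<alpha> where "linear_functional_on (topspace E) f" "continuous_map E euclideanreal f"
    "\<And>c. c \<in> C \<Longrightarrow> f c \<le> \<alpha>" "\<alpha> < f z"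
proof -
  define V where "V = topspace E"
  have V: "subspace V" using E by (simp add: hausdorff_locally_convex_def V_def)
  have CV: "C \<subseteq> V" using C closedin_subset V_def by blast
  obtain c0 where c0: "c0 \<in> C" using C by blast
  have "continuous_map E E (\<lambda>w. z + w)"
    using z by (intro lc_continuous_add[OF E]) auto
  hence "openin E {w \<in> topspace E. z + w \<in> topspace E - C}"
    using C by (intro openin_continuous_map_preimage) auto
  moreover have "0 \<in> {w \<in> topspace E. z + w \<in> topspace E - C}"
    using z subspace_0[OF V] by (auto simp: V_def)
  ultimately obtain U0 where U0: "openin E U0" "convex U0" "0 \<in> U0" "\<And>w. w \<in> U0 \<Longrightarrow> z + w \<notin> C"
  proof -
    assume *: "\<And>U0. openin E U0 \<Longrightarrow> convex U0 \<Longrightarrow> 0 \<in> U0 \<Longrightarrow> (\<And>w. w \<in> U0 \<Longrightarrow> z + w \<notin> C) \<Longrightarrow> thesis"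
    assume "openin E {w \<in> topspace E. z + w \<in> topspace E - C}" "0 \<in> {w \<in> topspace E. z + w \<in> topspace E - C}"
    then obtain U0 where "openin E U0 \<and> convex U0 \<and> 0 \<in> U0 \<and> U0 \<subseteq> {w \<in> topspace E. z + w \<in> topspace E - C}"
      using E unfolding hausdorff_locally_convex_def by blast
    thus thesis by (intro *[of U0]) auto
  qed
  define U where "U = {w \<in> U0. - w \<in> U0}"
  have U0V: "U0 \<subseteq> V" using U0 openin_subset V_def by blast
  have neg: "continuous_map E E (\<lambda>w. (-1) *\<^sub>R w)" by (intro lc_continuous_scale[OF E]) auto
  have "U = U0 \<inter> {w \<in> topspace E. (-1) *\<^sub>R w \<in> U0}" using U0V by (auto simp: U_def V_def)
  hence openU: "openin E U" using U0(1) openin_continuous_map_preimage[OF neg] by auto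
  have UV: "U \<subseteq> V" using U0V by (auto simp: U_def)
  have Uneg: "- w \<in> U" if "w \<in> U" for w using that by (auto simp: U_def)
  have U0': "0 \<in> U" using U0 by (auto simp: U_def)
  have convU: "convex U"
  proof (rule convexI)
    fix x y :: 'a and u v :: real
    assume "x \<in> U" "y \<in> U" "0 \<le> u" "0 \<le> v" "u + v = 1"
    moreover have "- (u *\<^sub>R x + v *\<^sub>R y) = u *\<^sub>R (-x) + v *\<^sub>R (-y)" by simp
    ultimately show "u *\<^sub>R x + v *\<^sub>R y \<in> U"
      using convexD[OF U0(2), of x y u v] convexD[OF U0(2), of "-x" "-y" u v] by (simp add: U_def)
  qed
  have absU: "\<exists>t>0. (1 / t) *\<^sub>R x \<in> U" if x: "x \<in> V" for x
  proof -
    have cont: "continuous_map euclideanreal E (\<lambda>s. s *\<^sub>R x)"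
      using x by (intro lc_continuous_scale[OF E]) (auto simp: V_def)
    have "openin euclideanreal {s \<in> topspace euclideanreal. s *\<^sub>R x \<in> U}"
      by (rule openin_continuous_map_preimage[OF cont openU])
    hence "open {s. s *\<^sub>R x \<in> U}" by simp
    moreover have "0 \<in> {s. s *\<^sub>R x \<in> U}" using U0' by simp
    ultimately obtain d where d: "d > 0" "ball 0 d \<subseteq> {s. s *\<^sub>R x \<in> U}"
      by (meson open_contains_ball)
    hence "(d / 2) *\<^sub>R x \<in> U" by (auto simp: subset_iff dist_real_def)
    thus ?thesis using d by (intro exI[of _ "2 / d"]) auto
  qed
  define D where "D = {c - c0 + u | c u. c \<in> C \<and> u \<in> U}"
  have UD: "U \<subseteq> D" unfolding D_def using c0 by force
  have convD: "convex D"
  proof (rule convexI)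
    fix x y :: 'a and a b :: real
    assume x: "x \<in> D" and y: "y \<in> D" and ab: "0 \<le> a" "0 \<le> b" "a + b = 1"
    from x y obtain c u c' u' where *: "x = c - c0 + u" "c \<in> C" "u \<in> U" "y = c' - c0 + u'" "c' \<in> C" "u' \<in> U"
      unfolding D_def by blast
    have "a *\<^sub>R x + b *\<^sub>R y = (a *\<^sub>R c + b *\<^sub>R c') - (a + b) *\<^sub>R c0 + (a *\<^sub>R u + b *\<^sub>R u')"
      unfolding * by (simp add: algebra_simps)
    hence "a *\<^sub>R x + b *\<^sub>R y = (a *\<^sub>R c + b *\<^sub>R c') - c0 + (a *\<^sub>R u + b *\<^sub>R u')" using ab by simp
    thus "a *\<^sub>R x + b *\<^sub>R y \<in> D"
      unfolding D_def using convexD[OF C(1) *(2,5) ab] convexD[OF convU *(3,6) ab] by blast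
  qed
  note g = gauge_sublinear[OF V convD]
  have absD: "\<exists>t>0. (1 / t) *\<^sub>R x \<in> D" if "x \<in> V" for x using absU[OF that] UD by blast
  have D0: "0 \<in> D" using UD U0' by blast
  have zc0: "z - c0 \<in> V" using z c0 CV V V_def by (auto simp: subspace_diff)
  have zD: "z - c0 \<notin> D"
  proof
    assume "z - c0 \<in> D"
    then obtain c u where "c \<in> C" "u \<in> U" "z - c0 = c - c0 + u" unfolding D_def by blast
    hence "c = z + (- u)" by (simp add: algebra_simps)
    moreover have "- u \<in> U0" using \<open>u \<in> U\<close> by (simp add: U_def)
    ultimately show False using U0(4) \<open>c \<in> C\<close> by blast
  qed
  obtain f where f: "linear_functional_on V f" "\<And>x. x \<in> V \<Longrightarrow> f x \<le> gauge D x"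
      "f (z - c0) = gauge D (z - c0)"
    using hahn_banach_supporting[OF V g(1)[OF D0 absD] zc0] by blast
  have fadd: "f (x + y) = f x + f y" if "x \<in> V" "y \<in> V" for x y
    using f(1) that by (auto simp: linear_functional_on_def)
  have fscale: "f (c *\<^sub>R x) = c * f x" if "x \<in> V" for x c
    using f(1) that by (auto simp: linear_functional_on_def)
  have fdiff: "f (x - y) = f x - f y" if "x \<in> V" "y \<in> V" for x y
    using fadd[of x "-y"] fscale[OF that(2), of "-1"] that V by (simp add: subspace_neg)
  have DV: "D \<subseteq> V" unfolding D_def using CV UV V c0 by (auto intro!: subspace_add subspace_diff)
  have fD: "f x \<le> 1" if "x \<in> D" for x
    using f(2)[of x] g(2)[OF D0 absD, of x] that DV by fastforce
  have fz: "f (z - c0) \<ge> 1" using f(3) g(3)[OF D0 absD zc0 zD] by simp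
  have "\<bar>f u\<bar> \<le> 1" if "u \<in> U" for u
  proof -
    have "f (- u) = - f u" using fscale[of u "-1"] that UV by auto
    moreover have "u \<in> D" "- u \<in> D" using that Uneg[OF that] UD by auto
    ultimately show ?thesis using fD[of u] fD[of "-u"] by auto
  qed
  hence cont: "continuous_map E euclideanreal f"
    using lc_linear_continuous[OF E _ openU U0'] f(1) by (auto simp: V_def)
  obtain t where t: "t > 0" "(1 / t) *\<^sub>R (z - c0) \<in> U" using absU[OF zc0] by blast
  have ft: "f ((1 / t) *\<^sub>R (z - c0)) \<ge> 1 / t"
    using fscale[OF zc0, of "1/t"] fz t by (simp add: field_simps)
  have le: "f c \<le> f c0 + 1 - 1 / t" if c: "c \<in> C" for c
  proof -
    have "f (c - c0 + (1 / t) *\<^sub>R (z - c0)) \<le> 1" using c t by (intro fD) (auto simp: D_def)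
    moreover have "f (c - c0 + (1 / t) *\<^sub>R (z - c0)) = f c - f c0 + f ((1 / t) *\<^sub>R (z - c0))"
    proof -
      have "c \<in> V" "c0 \<in> V" "(1 / t) *\<^sub>R (z - c0) \<in> V" using c c0 CV t UV by blast+
      thus ?thesis using V by (simp add: fadd fdiff subspace_diff)
    qed
    ultimately show ?thesis using ft by simp
  qed
  have "f (z - c0) = f z - f c0" using z c0 CV by (intro fdiff) (auto simp: V_def)
  moreover have "1 / t > 0" using t by simp
  ultimately have "f c0 + 1 - 1 / t < f z" using fz by linarith
  with le cont f(1) that show ?thesis by (auto simp: V_def)
qed

section \<open>Compact convex sets\<close>

text \<open>Zorn's lemma; the intersection of a chain is nonempty by compactness.  Both minimal faces and
  minimal subflows arise in this way.\<close>

lemma minimal_closed_subset: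
  assumes X: "compact_space X" and F: "closedin X F" "F \<noteq> {}" "Q F"
    and Q: "\<And>C. C \<noteq> {} \<Longrightarrow> (\<And>B. B \<in> C \<Longrightarrow> Q B) \<Longrightarrow> Q (\<Inter>C)"
  obtains m where "closedin X m" "m \<noteq> {}" "Q m" "m \<subseteq> F"
    "\<And>a. closedin X a \<Longrightarrow> a \<noteq> {} \<Longrightarrow> Q a \<Longrightarrow> a \<subseteq> m \<Longrightarrow> a = m"
proof -
  define A where "A = {B. closedin X B \<and> B \<noteq> {} \<and> Q B \<and> B \<subseteq> F}"
  define R where "R = (\<lambda>B C :: 'a set. C \<subseteq> B)"
  have "\<exists>m\<in>A. \<forall>a\<in>A. R m a \<longrightarrow> a = m"
  proof (rule predicate_Zorn)
    show "partial_order_on A (relation_of R A)"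
      by (rule partial_order_on_relation_ofI) (auto simp: R_def)
  next
    fix C assume C: "C \<in> Chains (relation_of R A)"
    hence CA: "C \<subseteq> A" and tot: "\<And>q r. q \<in> C \<Longrightarrow> r \<in> C \<Longrightarrow> R q r \<or> R r q"
      by (auto simp: Chains_def relation_of_def)
    show "\<exists>u\<in>A. \<forall>a\<in>C. R a u"
    proof (cases "C = {}")
      case True
      have "F \<in> A" using F by (auto simp: A_def)
      with True show ?thesis by blast
    next
      case False
      have fin: "finite \<F> \<Longrightarrow> \<F> \<noteq> {} \<Longrightarrow> \<F> \<subseteq> C \<Longrightarrow> \<Inter>\<F> \<in> C" for \<F>
      proof (induction \<F> rule: finite_ne_induct)
        case (insert x \<F>)
        hence "x \<inter> \<Inter>\<F> = x \<or> x \<inter> \<Inter>\<F> = \<Inter>\<F>" using tot[of x "\<Inter>\<F>"] by (auto simp: R_def)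
        thus ?case using insert by auto
      qed auto
      have "\<Inter>C \<noteq> {}"
      proof -
        have *: "\<Inter>\<F> \<noteq> {}" if "finite \<F>" "\<F> \<subseteq> C" for \<F>
          using fin[OF that(1) _ that(2)] CA by (cases "\<F> = {}") (auto simp: A_def)
        have "\<forall>B\<in>C. closedin X B" using CA by (auto simp: A_def)
        with * show ?thesis
          using X[unfolded compact_space_fip, rule_format, of C] by blast
      qed
      moreover have "Q (\<Inter>C)" using False CA by (intro Q) (auto simp: A_def)
      moreover have "closedin X (\<Inter>C)" using False CA by (intro closedin_Inter) (auto simp: A_def)
      moreover have "\<Inter>C \<subseteq> F" using False CA by (auto simp: A_def)
      ultimately have "\<Inter>C \<in> A" by (simp add: A_def)
      thus ?thesis by (auto simp: R_def)
    qed
  qed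
  then obtain m where m: "m \<in> A" "\<And>a. a \<in> A \<Longrightarrow> a \<subseteq> m \<Longrightarrow> a = m" by (auto simp: R_def)
  have "a = m" if "closedin X a" "a \<noteq> {}" "Q a" "a \<subseteq> m" for a
    using that m(1) by (intro m(2)) (auto simp: A_def)
  with m(1) that show ?thesis by (auto simp: A_def)
qed

definition compact_convex_space :: "'v::real_vector topology \<Rightarrow> bool" where
  "compact_convex_space L \<longleftrightarrow>
     (\<exists>E. hausdorff_locally_convex E \<and> L = subtopology E (topspace L)) \<and>
     convex (topspace L) \<and> compact_space L"

lemma affine_flow_imp_compact_convex: "affine_flow G T L b \<Longrightarrow> compact_convex_space L"
  by (auto simp: affine_flow_def compact_convex_space_def flow_def)

lemma compact_convex_Hausdorff: "compact_convex_space L \<Longrightarrow> Hausdorff_space L"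
  unfolding compact_convex_space_def hausdorff_locally_convex_def by (metis Hausdorff_space_subtopology)

lemma compact_convex_convex: "compact_convex_space L \<Longrightarrow> convex (topspace L)"
  by (simp add: compact_convex_space_def)

lemma compact_convex_compact: "compact_convex_space L \<Longrightarrow> compact_space L"
  by (simp add: compact_convex_space_def)

lemma convex_combination_continuous:
  assumes L: "compact_convex_space L" and f: "continuous_map X L f" and g: "continuous_map X L g"
    and t: "continuous_map X euclideanreal t" and t01: "\<And>x. x \<in> topspace X \<Longrightarrow> t x \<in> {0..1}"
  shows "continuous_map X L (\<lambda>x. (1 - t x) *\<^sub>R f x + t x *\<^sub>R g x)"
proof -
  obtain E where E: "hausdorff_locally_convex E" "L = subtopology E (topspace L)"
    using L unfolding compact_convex_space_def by blast
  have fE: "continuous_map X E f" "continuous_map X E g"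
    using f g E(2) by (metis continuous_map_in_subtopology)+
  have "continuous_map X E (\<lambda>x. (1 - t x) *\<^sub>R f x + t x *\<^sub>R g x)"
    using t fE by (intro lc_continuous_add[OF E(1)] lc_continuous_scale[OF E(1)] continuous_map_diff) auto
  moreover have "(1 - t x) *\<^sub>R f x + t x *\<^sub>R g x \<in> topspace L" if "x \<in> topspace X" for x
  proof -
    have "f x \<in> topspace L" "g x \<in> topspace L"
      using f g that continuous_map_image_subset_topspace by fastforce+
    thus ?thesis using t01[OF that] compact_convex_convex[OF L] by (intro convexD_alt) auto
  qed
  ultimately show ?thesis
    by (subst E(2)) (auto simp: continuous_map_in_subtopology)
qed

lemma compact_convex_separation:
  assumes L: "compact_convex_space L" and C: "convex C" "closedin L C" "C \<noteq> {}"
    and z: "z \<in> topspace L" "z \<notin> C"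
  obtains f \<alpha> where "continuous_map L euclideanreal f" "affine_map_on (topspace L) f"
    "\<And>c. c \<in> C \<Longrightarrow> f c \<le> \<alpha>" "\<alpha> < f z"
proof -
  obtain E where E: "hausdorff_locally_convex E" "L = subtopology E (topspace L)"
    using L unfolding compact_convex_space_def by blast
  have "compactin L C" using C closedin_compact_space compact_convex_compact[OF L] by blast
  hence "compactin E C" using E(2) by (metis compactin_subtopology)
  hence "closedin E C" using E(1) by (auto intro: compactin_imp_closedin simp: hausdorff_locally_convex_def)
  moreover have sub: "topspace L \<subseteq> topspace E" using E(2) by (metis inf.cobounded1 topspace_subtopology)
  ultimately obtain f \<alpha> where f: "linear_functional_on (topspace E) f" "continuous_map E euclideanreal f"
    "\<And>c. c \<in> C \<Longrightarrow> f c \<le> \<alpha>" "\<alpha> < f z"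
    using lc_separation[OF E(1) C(1) _ C(3), of z] z by blast
  have "continuous_map L euclideanreal f"
    using f(2) E(2) by (metis continuous_map_from_subtopology)
  moreover have "affine_map_on (topspace L) f"
    using f(1) sub E(1) unfolding affine_map_on_def linear_functional_on_def hausdorff_locally_convex_def
    by (auto simp: subset_iff subspace_scale)
  ultimately show ?thesis using f(3,4) that by blast
qed

corollary compact_convex_separation_points:
  assumes L: "compact_convex_space L" and "p \<in> topspace L" "q \<in> topspace L" "p \<noteq> q"
  obtains f where "continuous_map L euclideanreal f" "affine_map_on (topspace L) f" "f p < f q"
proof -
  have "closedin L {p}" using assms compact_convex_Hausdorff[OF L] by (auto intro: closedin_Hausdorff_singleton)
  then obtain f \<alpha> where "continuous_map L euclideanreal f" "affine_map_on (topspace L) f" "f p \<le> \<alpha>" "\<alpha> < f q"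
    using compact_convex_separation[OF L convex_singleton[of p], of q] assms by auto
  thus ?thesis using that by force
qed

text \<open>The Krein--Milman argument: a minimal closed face is a single point, since otherwise the
  points of it that maximise a separating functional form a smaller face.\<close>

lemma closed_face_contains_extreme_point:
  assumes L: "compact_convex_space L" and F: "F face_of topspace L" "closedin L F" "F \<noteq> {}"
  obtains e where "e \<in> F" "e extreme_point_of topspace L"
proof -
  have Inter: "\<Inter>C face_of topspace L" if "C \<noteq> {}" "\<And>B. B \<in> C \<Longrightarrow> B face_of topspace L" for C
    using that by (intro face_of_Inter) auto
  from minimal_closed_subset[of L F "\<lambda>B. B face_of topspace L", OF compact_convex_compact[OF L] F(2,3,1) Inter]
  obtain m where mc: "closedin L m" and mne: "m \<noteq> {}" and mf: "m face_of topspace L" and mF: "m \<subseteq> F"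
    and min: "\<And>a. closedin L a \<Longrightarrow> a \<noteq> {} \<Longrightarrow> a face_of topspace L \<Longrightarrow> a \<subseteq> m \<Longrightarrow> a = m"
    by blast
  have "p = q" if pq: "p \<in> m" "q \<in> m" for p q
  proof (rule ccontr)
    assume "p \<noteq> q"
    have mL: "m \<subseteq> topspace L" using mc by (rule closedin_subset)
    obtain f where f: "continuous_map L euclideanreal f" "affine_map_on (topspace L) f" "f p < f q"
      using compact_convex_separation_points[OF L, of p q] pq mL \<open>p \<noteq> q\<close> by blast
    have "compactin L m" using mc closedin_compact_space compact_convex_compact[OF L] by blast
    hence "compact (f ` m)" using image_compactin[OF _ f(1)] by simp
    then obtain s where s: "s \<in> m" "\<And>x. x \<in> m \<Longrightarrow> f x \<le> f s"
      using compact_attains_sup[of "f ` m"] mne by auto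
    define m' where "m' = {x \<in> m. f x = f s}"
    have "closedin L m'"
    proof -
      have "closedin L {x \<in> topspace L. f x \<in> {f s}}"
        by (rule closedin_continuous_map_preimage[OF f(1)]) simp
      moreover have "m' = m \<inter> {x \<in> topspace L. f x \<in> {f s}}" using mL by (auto simp: m'_def)
      ultimately show ?thesis using mc by auto
    qed
    moreover have "m' face_of topspace L"
      unfolding face_of_def
    proof (intro conjI ballI impI)
      show "m' \<subseteq> topspace L" using mL by (auto simp: m'_def)
      show "convex m'"
        unfolding convex_alt
      proof (intro ballI allI impI)
        fix x y and u :: real assume xy: "x \<in> m'" "y \<in> m'" and u: "0 \<le> u \<and> u \<le> 1"
        have "(1 - u) *\<^sub>R x + u *\<^sub>R y \<in> m"
          using xy u face_of_imp_convex[OF mf] by (intro convexD_alt) (auto simp: m'_def)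
        moreover have "f ((1 - u) *\<^sub>R x + u *\<^sub>R y) = (1 - u) *\<^sub>R f x + u *\<^sub>R f y"
          using f(2) xy u mL unfolding affine_map_on_def m'_def by (simp add: subset_iff)
        moreover have "(1 - u) *\<^sub>R f x + u *\<^sub>R f y = f s"
          using xy by (simp add: m'_def algebra_simps)
        ultimately show "(1 - u) *\<^sub>R x + u *\<^sub>R y \<in> m'" by (simp add: m'_def)
      qed
      fix a b x assume ab: "a \<in> topspace L" "b \<in> topspace L" "x \<in> m'" "x \<in> open_segment a b"
      have m: "a \<in> m" "b \<in> m" using ab mf unfolding face_of_def m'_def by blast+
      obtain u where u: "0 < u" "u < 1" "x = (1 - u) *\<^sub>R a + u *\<^sub>R b"
        using ab(4) by (auto simp: in_segment)
      have "f x = (1 - u) * f a + u * f b" using f(2) ab(1,2) u by (auto simp: affine_map_on_def)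
      moreover have "f x = f s" using ab by (simp add: m'_def)
      ultimately have "(1 - u) * (f s - f a) + u * (f s - f b) = 0" by (simp add: algebra_simps)
      moreover have "(1 - u) * (f s - f a) \<ge> 0" "u * (f s - f b) \<ge> 0" using s(2) m u by auto
      ultimately have "(1 - u) * (f s - f a) = 0" "u * (f s - f b) = 0" by linarith+
      hence "f a = f s" "f b = f s" using u by auto
      thus "a \<in> m'" "b \<in> m'" using m by (auto simp: m'_def)
    qed
    ultimately have "m' = m" using s by (intro min) (auto simp: m'_def)
    hence "f p = f s" "f q = f s" using pq by (auto simp: m'_def)
    thus False using f(3) by simp
  qed
  then obtain e where "m = {e}" using mne by blast
  thus ?thesis using mf mF that by (auto simp: face_of_singleton)
qed

lemma extreme_point_convex_combination:
  assumes "e extreme_point_of S" "x \<in> S" "y \<in> S" "e = (1 - t) *\<^sub>R x + t *\<^sub>R y" "0 \<le> t" "t \<le> 1"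
  shows "e = x \<or> e = y"
proof (rule ccontr)
  assume ne: "\<not> ?thesis"
  have "t \<noteq> 0" "t \<noteq> 1" using assms(4) ne by auto
  hence "0 < t" "t < 1" using assms(5,6) by auto
  moreover have "x \<noteq> y" using assms(4) ne by (auto simp: algebra_simps)
  ultimately have "e \<in> open_segment x y" unfolding in_segment using assms(4) by blast
  thus False using assms(1-3) unfolding extreme_point_of_def by blast
qed

lemma extreme_midpoint:
  assumes "e extreme_point_of S" "x \<in> S" "y \<in> S" "e = (1/2) *\<^sub>R x + (1/2) *\<^sub>R y"
  shows "x = e" "y = e"
proof -
  have "e = x \<or> e = y" using extreme_point_convex_combination[OF assms(1-3), of "1/2"] assms(4) by simp
  moreover have "2 *\<^sub>R e = x + y" using assms(4) by (simp add: scaleR_add_right)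
  hence "e + e = x + y" by (simp add: scaleR_2)
  ultimately show "x = e" "y = e" by auto
qed

lemma convex_join:
  assumes S: "convex S" and T: "convex T"
  shows "convex {(1 - t) *\<^sub>R x + t *\<^sub>R y | t x y. 0 \<le> t \<and> t \<le> (1::real) \<and> x \<in> S \<and> y \<in> T}" (is "convex ?J")
proof -
  have comb: "\<exists>z\<in>S. p *\<^sub>R x + q *\<^sub>R y = (p + q) *\<^sub>R z"
    if "convex S" "x \<in> S" "y \<in> S" "p \<ge> 0" "q \<ge> 0" for S and x y :: 'a and p q :: real
  proof (cases "p + q = 0")
    case True
    hence "p = 0 \<and> q = 0" using that(4,5) by simp
    thus ?thesis using that by auto
  next
    case False
    hence "p + q > 0" using that by auto
    hence "(p / (p + q)) *\<^sub>R x + (q / (p + q)) *\<^sub>R y \<in> S" using that by (intro mem_convex_alt) auto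
    moreover have "p *\<^sub>R x + q *\<^sub>R y = (p + q) *\<^sub>R ((p / (p + q)) *\<^sub>R x + (q / (p + q)) *\<^sub>R y)"
      using False by (simp add: scaleR_add_right)
    ultimately show ?thesis by blast
  qed
  show ?thesis
  proof (rule convexI)
    fix x y :: 'a and a b :: real
    assume "x \<in> ?J" "y \<in> ?J" and ab: "0 \<le> a" "0 \<le> b" "a + b = 1"
    then obtain t s x1 x2 y1 y2 where *: "0 \<le> t" "t \<le> 1" "x1 \<in> S" "x2 \<in> T" "x = (1 - t) *\<^sub>R x1 + t *\<^sub>R x2"
      "0 \<le> s" "s \<le> 1" "y1 \<in> S" "y2 \<in> T" "y = (1 - s) *\<^sub>R y1 + s *\<^sub>R y2" by blast
    obtain z1 where z1: "z1 \<in> S" "(a * (1 - t)) *\<^sub>R x1 + (b * (1 - s)) *\<^sub>R y1 = (a * (1 - t) + b * (1 - s)) *\<^sub>R z1"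
      using comb[OF S *(3,8), of "a * (1 - t)" "b * (1 - s)"] * ab by auto
    obtain z2 where z2: "z2 \<in> T" "(a * t) *\<^sub>R x2 + (b * s) *\<^sub>R y2 = (a * t + b * s) *\<^sub>R z2"
      using comb[OF T *(4,9), of "a * t" "b * s"] * ab by auto
    have w: "a * (1 - t) + b * (1 - s) = 1 - (a * t + b * s)" using ab(3) by (simp add: algebra_simps)
    have "a *\<^sub>R x + b *\<^sub>R y = ((a * (1 - t)) *\<^sub>R x1 + (b * (1 - s)) *\<^sub>R y1) + ((a * t) *\<^sub>R x2 + (b * s) *\<^sub>R y2)"
      unfolding *(5,10) by (simp add: algebra_simps)
    also have "\<dots> = (1 - (a * t + b * s)) *\<^sub>R z1 + (a * t + b * s) *\<^sub>R z2" by (simp add: z1 z2 w)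
    finally have eq: "a *\<^sub>R x + b *\<^sub>R y = (1 - (a * t + b * s)) *\<^sub>R z1 + (a * t + b * s) *\<^sub>R z2" .
    have "0 \<le> a * t + b * s" using ab * by simp
    moreover have "0 \<le> a * (1 - t) + b * (1 - s)" using ab * by simp
    hence "a * t + b * s \<le> 1" using w by simp
    ultimately show "a *\<^sub>R x + b *\<^sub>R y \<in> ?J" using eq z1(1) z2(1) by blast
  qed
qed

text \<open>The closed convex hull of the union of finitely many closed convex sets, obtained by joining one
  set at a time.  An extreme point that lies on a segment is one of its ends, so the joins create no
  extreme points.\<close>

lemma finite_union_closed_convex:
  assumes L: "compact_convex_space L" and "finite I" and "\<And>i. i \<in> I \<Longrightarrow> closedin L (C i) \<and> convex (C i)"
  shows "\<exists>D. closedin L D \<and> convex D \<and> (\<forall>i\<in>I. C i \<subseteq> D) \<and>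
    (\<forall>e\<in>D. e extreme_point_of topspace L \<longrightarrow> (\<exists>i\<in>I. e \<in> C i))"
  using assms(2,3)
proof (induction I rule: finite_induct)
  case empty
  show ?case by (intro exI[of _ "{}"]) auto
next
  case (insert i I)
  then obtain D where D: "closedin L D" "convex D" "\<And>i. i \<in> I \<Longrightarrow> C i \<subseteq> D"
    "\<And>e. e \<in> D \<Longrightarrow> e extreme_point_of topspace L \<Longrightarrow> \<exists>i\<in>I. e \<in> C i" by (metis insertCI)
  have Ci: "closedin L (C i)" "convex (C i)" using insert by auto
  have sub: "D \<subseteq> topspace L" "C i \<subseteq> topspace L" using closedin_subset[OF D(1)] closedin_subset[OF Ci(1)] by blast+
  define J where "J = {(1 - t) *\<^sub>R x + t *\<^sub>R y | t x y. 0 \<le> t \<and> t \<le> (1::real) \<and> x \<in> D \<and> y \<in> C i}"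
  show ?case
  proof (cases "D = {} \<or> C i = {}")
    case True
    thus ?thesis
    proof
      assume "D = {}" thus ?thesis using D Ci by (intro exI[of _ "C i"]) auto
    next
      assume "C i = {}" thus ?thesis using D Ci by (intro exI[of _ D]) auto
    qed
  next
    case False
    let ?T = "prod_topology (top_of_set {0..1::real}) (prod_topology L L)"
    let ?g = "\<lambda>(t::real, x, y). (1 - t) *\<^sub>R x + t *\<^sub>R y"
    have cont: "continuous_map ?T L (\<lambda>z. (1 - fst z) *\<^sub>R fst (snd z) + fst z *\<^sub>R snd (snd z))"
    proof (rule convex_combination_continuous[OF L])
      show "continuous_map ?T L (\<lambda>z. fst (snd z))" "continuous_map ?T L (\<lambda>z. snd (snd z))"
        using continuous_map_compose[OF continuous_map_snd continuous_map_fst]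
          continuous_map_compose[OF continuous_map_snd continuous_map_snd] by (auto simp: o_def)
      show "continuous_map ?T euclideanreal fst"
        by (rule continuous_map_into_fulltopology[OF continuous_map_fst])
    qed (auto simp: mem_Times_iff)
    have J: "J = (\<lambda>z. (1 - fst z) *\<^sub>R fst (snd z) + fst z *\<^sub>R snd (snd z)) ` ({0..1} \<times> (D \<times> C i))"
      unfolding J_def by (force simp: image_iff)
    have "compactin ?T ({0..1} \<times> (D \<times> C i))"
      using D Ci closedin_compact_space[OF compact_convex_compact[OF L]]
      by (auto simp: compactin_Times compactin_subtopology)
    hence "compactin L J" unfolding J by (rule image_compactin[OF _ cont])
    hence "closedin L J" using compact_convex_Hausdorff[OF L] compactin_imp_closedin by blast
    moreover have "convex J" unfolding J_def by (rule convex_join[OF D(2) Ci(2)])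
    moreover have "D \<subseteq> J" "C i \<subseteq> J"
    proof -
      show "D \<subseteq> J"
      proof
        fix x assume "x \<in> D"
        moreover obtain y where "y \<in> C i" using False by blast
        ultimately show "x \<in> J" unfolding J_def by (intro CollectI exI[of _ 0] exI[of _ x] exI[of _ y]) auto
      qed
      show "C i \<subseteq> J"
      proof
        fix y assume "y \<in> C i"
        moreover obtain x where "x \<in> D" using False by blast
        ultimately show "y \<in> J" unfolding J_def by (intro CollectI exI[of _ 1] exI[of _ x] exI[of _ y]) auto
      qed
    qed
    moreover have "\<exists>j\<in>insert i I. e \<in> C j" if ej: "e \<in> J" "e extreme_point_of topspace L" for e
    proof -
      obtain t x y where *: "0 \<le> t" "t \<le> (1::real)" "x \<in> D" "y \<in> C i" "e = (1 - t) *\<^sub>R x + t *\<^sub>R y"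
        using ej(1) unfolding J_def by blast
      have "x \<in> topspace L" "y \<in> topspace L" using sub * by blast+
      hence "e = x \<or> e = y" using extreme_point_convex_combination[OF ej(2) _ _ *(5,1,2)] by blast
      hence "e \<in> D \<or> e \<in> C i" using *(3,4) by metis
      thus ?thesis using D(4)[OF _ ej(2)] by blast
    qed
    moreover have "C j \<subseteq> J" if "j \<in> insert i I" for j using that D(3) \<open>D \<subseteq> J\<close> \<open>C i \<subseteq> J\<close> by blast
    ultimately show ?thesis by blast
  qed
qed

text \<open>Milman's partial converse of the Krein--Milman theorem: if \<open>e \<notin> Q\<close>, then \<open>Q\<close> is covered by
  finitely many closed convex sets that miss \<open>e\<close>, and no extreme point outside these can lie in
  the closed convex hull of their union.\<close>

theorem milman:
  assumes L: "compact_convex_space L" and Q: "closedin L Q"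
    and hull: "\<And>C. closedin L C \<Longrightarrow> convex C \<Longrightarrow> Q \<subseteq> C \<Longrightarrow> C = topspace L"
    and e: "e extreme_point_of topspace L"
  shows "e \<in> Q"
proof (rule ccontr)
  assume eQ: "e \<notin> Q"
  have eL: "e \<in> topspace L" using e by (simp add: extreme_point_of_def)
  have QL: "Q \<subseteq> topspace L" using Q closedin_subset by blast
  have "\<exists>f. continuous_map L euclideanreal f \<and> affine_map_on (topspace L) f \<and> f q < f e" if "q \<in> Q" for q
    using compact_convex_separation_points[OF L, of q e] that QL eL eQ by blast
  then obtain f where f: "\<And>q. q \<in> Q \<Longrightarrow> continuous_map L euclideanreal (f q)"
    "\<And>q. q \<in> Q \<Longrightarrow> affine_map_on (topspace L) (f q)" "\<And>q. q \<in> Q \<Longrightarrow> f q q < f q e" by metis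
  define W where "W = (\<lambda>q. {x \<in> topspace L. f q x \<in> {..< (f q q + f q e) / 2}})"
  define C where "C = (\<lambda>q. {x \<in> topspace L. f q x \<in> {.. (f q q + f q e) / 2}})"
  have Wopen: "openin L (W q)" if "q \<in> Q" for q
    unfolding W_def using f(1)[OF that] by (intro openin_continuous_map_preimage) auto
  have "compactin L Q" using Q closedin_compact_space compact_convex_compact[OF L] by blast
  moreover have "Q \<subseteq> \<Union>(W ` Q)" using f(3) QL by (fastforce simp: W_def)
  ultimately obtain \<F> where "finite \<F>" "\<F> \<subseteq> W ` Q" "Q \<subseteq> \<Union>\<F>"
  proof -
    assume *: "\<And>\<F>. finite \<F> \<Longrightarrow> \<F> \<subseteq> W ` Q \<Longrightarrow> Q \<subseteq> \<Union>\<F> \<Longrightarrow> thesis"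
    assume "compactin L Q" "Q \<subseteq> \<Union>(W ` Q)"
    moreover have "\<forall>U\<in>W ` Q. openin L U" using Wopen by blast
    ultimately show thesis using * unfolding compactin_def by meson
  qed
  then obtain I where I: "finite I" "I \<subseteq> Q" "Q \<subseteq> \<Union>(W ` I)"
    by (metis finite_subset_image)
  have CC: "closedin L (C q) \<and> convex (C q)" if "q \<in> I" for q
  proof
    have q: "q \<in> Q" using I that by blast
    show "closedin L (C q)" unfolding C_def using f(1)[OF q] by (intro closedin_continuous_map_preimage) auto
    show "convex (C q)"
      unfolding convex_alt
    proof (intro ballI allI impI)
      fix x y and u :: real assume xy: "x \<in> C q" "y \<in> C q" and u: "0 \<le> u \<and> u \<le> 1"
      have "(1 - u) *\<^sub>R x + u *\<^sub>R y \<in> topspace L"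
        using xy u compact_convex_convex[OF L] by (intro convexD_alt) (auto simp: C_def)
      moreover have "f q ((1 - u) *\<^sub>R x + u *\<^sub>R y) = (1 - u) *\<^sub>R f q x + u *\<^sub>R f q y"
        using f(2)[OF q] xy u by (auto simp: affine_map_on_def C_def)
      moreover have "(1 - u) *\<^sub>R f q x + u *\<^sub>R f q y \<le> (f q q + f q e) / 2"
        using xy u convex_bound_le[of "f q x" "(f q q + f q e) / 2" "f q y" "1 - u" u] by (auto simp: C_def)
      ultimately show "(1 - u) *\<^sub>R x + u *\<^sub>R y \<in> C q" by (auto simp: C_def)
    qed
  qed
  obtain D where D: "closedin L D" "convex D" "\<And>q. q \<in> I \<Longrightarrow> C q \<subseteq> D"
    "\<And>e. e \<in> D \<Longrightarrow> e extreme_point_of topspace L \<Longrightarrow> \<exists>q\<in>I. e \<in> C q"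
    using finite_union_closed_convex[OF L I(1), of C] CC by blast
  have "W q \<subseteq> C q" for q by (auto simp: W_def C_def)
  hence "Q \<subseteq> D" using I(3) D(3) by fastforce
  hence "e \<in> D" using hull[OF D(1,2)] eL by blast
  then obtain q where "q \<in> I" "e \<in> C q" using D(4) e by blast
  thus False using f(3)[of q] I(2) by (auto simp: C_def)
qed

section \<open>State spaces of ordered function algebras\<close>

lemma continuous_map_real_iff:
  "continuous_map X euclideanreal f \<longleftrightarrow>
     (\<forall>x\<in>topspace X. \<forall>e>0. \<exists>U. openin X U \<and> x \<in> U \<and> (\<forall>y\<in>U. \<bar>f y - f x\<bar> < e))"
  using Met_TC.continuous_map_to_metric[of X f]
  by (simp add: mball_eq_ball dist_real_def abs_minus_commute)

abbreviation pointwise_topology :: "('i \<Rightarrow> real) topology" where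
  "pointwise_topology \<equiv> product_topology (\<lambda>_. euclideanreal) UNIV"

lemma pointwise_topology_nbhd:
  assumes "openin pointwise_topology U" "x \<in> U"
  obtains I e where "finite I" "e > 0" "\<And>y. (\<And>i. i \<in> I \<Longrightarrow> \<bar>y i - x i\<bar> < e) \<Longrightarrow> y \<in> U"
proof -
  obtain X where X: "x \<in> (\<Pi>\<^sub>E i\<in>UNIV. X i)" "\<And>i. openin euclideanreal (X i)"
    "finite {i. X i \<noteq> topspace euclideanreal}" "(\<Pi>\<^sub>E i\<in>UNIV. X i) \<subseteq> U"
    using product_topology_open_contains_basis[OF assms] by auto
  define I where "I = {i. X i \<noteq> UNIV}"
  have "\<exists>e>0. \<forall>t. \<bar>t - x i\<bar> < e \<longrightarrow> t \<in> X i" for i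
  proof -
    have "open (X i)" "x i \<in> X i" using X by auto
    thus ?thesis unfolding open_dist by (simp add: dist_real_def)
  qed
  then obtain e where e: "\<And>i. e i > 0" "\<And>i t. \<bar>t - x i\<bar> < e i \<Longrightarrow> t \<in> X i" by metis
  have fin: "finite I" using X(3) by (simp add: I_def)
  define d where "d = Min (insert 1 (e ` I))"
  have d: "d > 0" "\<And>i. i \<in> I \<Longrightarrow> d \<le> e i" using fin e(1) by (auto simp: d_def)
  have "y \<in> U" if "\<And>i. i \<in> I \<Longrightarrow> \<bar>y i - x i\<bar> < d" for y
  proof -
    have "y i \<in> X i" for i
      using that[of i] e(2)[of "y i" i] d(2)[of i] by (cases "i \<in> I") (auto simp: I_def)
    thus ?thesis using X(4) by auto
  qed
  with fin d(1) that show ?thesis by blast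
qed

lemma pointwise_topology_basic_open:
  assumes "finite I"
  shows "openin pointwise_topology {y. \<forall>i\<in>I. \<bar>y i - x i\<bar> < (e::real)}"
proof -
  have *: "openin pointwise_topology {y \<in> topspace pointwise_topology. y i \<in> ball (x i) e}" for i
    by (rule openin_continuous_map_preimage[OF continuous_map_product_projection]) auto
  have "{y. \<forall>i\<in>I. \<bar>y i - x i\<bar> < e} =
      topspace pointwise_topology \<inter> (\<Inter>i\<in>I. {y \<in> topspace pointwise_topology. y i \<in> ball (x i) e})"
    by (auto simp: dist_real_def abs_minus_commute)
  also have "openin pointwise_topology \<dots>"
    using assms * openin_topspace[of pointwise_topology] by (cases "I = {}") (auto intro!: openin_Int openin_INT)
  finally show ?thesis .
qed

lemma pointwise_topology_coordinates_continuous: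
  shows "continuous_map (prod_topology pointwise_topology X) euclideanreal (\<lambda>z. fst z k)"
    and "continuous_map (prod_topology X pointwise_topology) euclideanreal (\<lambda>z. snd z k)"
proof -
  have "continuous_map (prod_topology pointwise_topology X) euclideanreal ((\<lambda>x. x k) \<circ> fst)"
    by (rule continuous_map_compose[OF continuous_map_fst continuous_map_product_projection]) simp
  moreover have "continuous_map (prod_topology X pointwise_topology) euclideanreal ((\<lambda>x. x k) \<circ> snd)"
    by (rule continuous_map_compose[OF continuous_map_snd continuous_map_product_projection]) simp
  ultimately show "continuous_map (prod_topology pointwise_topology X) euclideanreal (\<lambda>z. fst z k)"
    "continuous_map (prod_topology X pointwise_topology) euclideanreal (\<lambda>z. snd z k)" by (simp_all add: o_def)
qed

lemma pointwise_topology_locally_convex: "hausdorff_locally_convex pointwise_topology"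
  unfolding hausdorff_locally_convex_def
proof (intro conjI allI impI)
  show "subspace (topspace pointwise_topology)" by simp
  show "Hausdorff_space pointwise_topology" by (simp add: Hausdorff_space_product_topology)
  show "continuous_map (prod_topology pointwise_topology pointwise_topology) pointwise_topology (\<lambda>(x, y). x + y)"
    unfolding continuous_map_componentwise_UNIV case_prod_unfold plus_fun_def
    by (intro allI continuous_map_add pointwise_topology_coordinates_continuous)
  show "continuous_map (prod_topology euclideanreal pointwise_topology) pointwise_topology (\<lambda>(c, x). c *\<^sub>R x)"
    unfolding continuous_map_componentwise_UNIV case_prod_unfold scaleR_fun_def real_scaleR_def
    by (intro allI continuous_map_real_mult continuous_map_fst pointwise_topology_coordinates_continuous)
  fix U :: "('a \<Rightarrow> real) set" assume "openin pointwise_topology U \<and> 0 \<in> U"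
  then obtain I e where I: "finite I" "e > 0" "\<And>y. (\<And>i. i \<in> I \<Longrightarrow> \<bar>y i - 0 i\<bar> < e) \<Longrightarrow> y \<in> U"
    using pointwise_topology_nbhd by metis
  let ?C = "{y. \<forall>i\<in>I. \<bar>y i - (0::'a \<Rightarrow> real) i\<bar> < e}"
  have "convex ?C"
  proof (rule convexI)
    fix x y :: "'a \<Rightarrow> real" and u v :: real
    assume *: "x \<in> ?C" "y \<in> ?C" "0 \<le> u" "0 \<le> v" "u + v = 1"
    have "\<bar>u * x i + v * y i\<bar> < e" if "i \<in> I" for i
    proof -
      have "\<bar>u * x i + v * y i\<bar> \<le> u * \<bar>x i\<bar> + v * \<bar>y i\<bar>"
        using * by (metis abs_mult abs_of_nonneg abs_triangle_ineq)
      also have "\<dots> < e" using * that by (intro convex_bound_lt) auto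
      finally show ?thesis .
    qed
    thus "u *\<^sub>R x + v *\<^sub>R y \<in> ?C" by (auto simp: scaleR_fun_def plus_fun_def)
  qed
  moreover have "openin pointwise_topology ?C" by (rule pointwise_topology_basic_open[OF I(1)])
  moreover have "0 \<in> ?C" "?C \<subseteq> U" using I by auto
  ultimately show "\<exists>C. openin pointwise_topology C \<and> convex C \<and> 0 \<in> C \<and> C \<subseteq> U" by blast
qed

text \<open>A neighbourhood of \<open>0\<close> on which \<open>f\<close> is bounded restricts only finitely many coordinates, and \<open>f\<close>
  vanishes on the functions that are zero in these coordinates.\<close>

lemma pointwise_continuous_functional:
  assumes lin: "linear_functional_on UNIV f" and cont: "continuous_map pointwise_topology euclideanreal f"
  obtains I where "finite I" "\<And>x. f x = (\<Sum>i\<in>I. f (\<lambda>j. if j = i then 1 else 0) * x i)"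
proof -
  have fadd: "f (x + y) = f x + f y" and fscale: "f (c *\<^sub>R x) = c * f x" for x y c
    using lin by (auto simp: linear_functional_on_def)
  have f0: "f 0 = 0" using fscale[of 0 0] by simp
  obtain U where U: "openin pointwise_topology U" "0 \<in> U" "\<And>y. y \<in> U \<Longrightarrow> \<bar>f y - f 0\<bar> < 1"
    using cont[unfolded continuous_map_real_iff, rule_format, of 0 1] by auto
  obtain I e where I: "finite I" "e > 0" "\<And>y. (\<And>i. i \<in> I \<Longrightarrow> \<bar>y i - 0 i\<bar> < e) \<Longrightarrow> y \<in> U"
    using pointwise_topology_nbhd[OF U(1,2)] by metis
  have zero: "f y = 0" if y: "\<And>i. i \<in> I \<Longrightarrow> y i = 0" for y
  proof (rule ccontr)
    assume ne: "f y \<noteq> 0"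
    have "(1 / f y) *\<^sub>R y \<in> U" using y I(2) by (intro I(3)) (auto simp: scaleR_fun_def)
    hence "\<bar>f ((1 / f y) *\<^sub>R y)\<bar> < 1" using U(3) f0 by fastforce
    thus False using fscale[of "1 / f y" y] ne by simp
  qed
  have fsum: "f (\<Sum>i\<in>J. g i) = (\<Sum>i\<in>J. f (g i))" if "finite J" for J and g :: "'a \<Rightarrow> 'a \<Rightarrow> real"
    using that
  proof (induction J rule: finite_induct)
    case (insert x J)
    have "f (sum g (insert x J)) = f (g x + sum g J)" using insert.hyps by (simp only: sum.insert not_False_eq_True)
    also have "\<dots> = f (g x) + f (sum g J)" by (rule fadd)
    finally show ?case using insert by (simp only: sum.insert not_False_eq_True)
  qed (simp only: sum.empty f0)
  let ?e = "\<lambda>i j. if j = i then 1 else (0::real)"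
  have "f x = (\<Sum>i\<in>I. f (?e i) * x i)" for x
  proof -
    have ev: "(\<Sum>i\<in>J. g i) j = (\<Sum>i\<in>J. g i j)" if "finite J" for J j and g :: "'a \<Rightarrow> 'a \<Rightarrow> real"
      using that by (induction J rule: finite_induct) auto
    have "f (x - (\<Sum>i\<in>I. x i *\<^sub>R ?e i)) = 0"
    proof (rule zero)
      fix j assume "j \<in> I"
      hence "(\<Sum>i\<in>I. x i * (if j = i then 1 else 0)) = x j"
        using I(1) by (simp add: if_distrib[of "\<lambda>z. _ * z"] sum.delta' cong: if_cong)
      thus "(x - (\<Sum>i\<in>I. x i *\<^sub>R ?e i)) j = 0" by (simp add: ev[OF I(1)] scaleR_fun_def)
    qed
    moreover have "f x = f (x - (\<Sum>i\<in>I. x i *\<^sub>R ?e i)) + f (\<Sum>i\<in>I. x i *\<^sub>R ?e i)"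
      by (simp flip: fadd)
    moreover have "f (\<Sum>i\<in>I. x i *\<^sub>R ?e i) = (\<Sum>i\<in>I. f (?e i) * x i)"
      by (simp add: fsum[OF I(1)] fscale mult.commute)
    ultimately show ?thesis by simp
  qed
  with I(1) that show ?thesis by blast
qed

text \<open>As for integral functionals, states are extended by \<open>0\<close> to functions outside of the algebra, so
  that they form a compact set in the product topology on functionals on all functions.\<close>

definition states :: "('s \<Rightarrow> real) set \<Rightarrow> ('s \<Rightarrow> real) set \<Rightarrow> (('s \<Rightarrow> real) \<Rightarrow> real) set" where
  "states A P =
     {\<Lambda>. (\<forall>f. f \<notin> A \<longrightarrow> \<Lambda> f = 0) \<and>
          (\<forall>f\<in>A. \<forall>h\<in>A. \<Lambda> (\<lambda>x. f x + h x) = \<Lambda> f + \<Lambda> h) \<and>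
          (\<forall>c. \<forall>f\<in>A. \<Lambda> (\<lambda>x. c * f x) = c * \<Lambda> f) \<and>
          (\<forall>f\<in>A. f \<in> P \<longrightarrow> 0 \<le> \<Lambda> f) \<and> \<Lambda> (\<lambda>_. 1) = 1}"

abbreviation state_space :: "('s \<Rightarrow> real) set \<Rightarrow> ('s \<Rightarrow> real) set \<Rightarrow> (('s \<Rightarrow> real) \<Rightarrow> real) topology" where
  "state_space A P \<equiv> subtopology pointwise_topology (states A P)"

definition state_action ::
  "('s \<Rightarrow> real) set \<Rightarrow> ('s \<Rightarrow> real) set \<Rightarrow> ('g \<Rightarrow> 's \<Rightarrow> 's) \<Rightarrow>
   'g \<Rightarrow> (('s \<Rightarrow> real) \<Rightarrow> real) \<Rightarrow> (('s \<Rightarrow> real) \<Rightarrow> real)" where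
  "state_action A P \<tau> g = (\<lambda>\<Lambda>\<in>states A P. \<lambda>f. if f \<in> A then \<Lambda> (\<lambda>x. f (\<tau> g x)) else 0)"

text \<open>
  An algebra \<open>A\<close> of functions that are bounded on \<open>S\<close>, ordered by a set \<open>P\<close> of positive
  functions that may be larger than the set of functions nonnegative on \<open>S\<close>: states then
  ignore a part of \<open>S\<close> that is negligible for \<open>P\<close>.
\<close>

locale ordered_function_algebra =
  fixes S :: "'s set" and A P :: "('s \<Rightarrow> real) set"
  assumes const: "(\<lambda>_. c) \<in> A"
    and add: "f \<in> A \<Longrightarrow> h \<in> A \<Longrightarrow> (\<lambda>x. f x + h x) \<in> A"
    and mult: "f \<in> A \<Longrightarrow> h \<in> A \<Longrightarrow> (\<lambda>x. f x * h x) \<in> A"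
    and bounded: "f \<in> A \<Longrightarrow> \<exists>B. \<forall>x\<in>S. \<bar>f x\<bar> \<le> B"
    and nonneg: "f \<in> A \<Longrightarrow> (\<And>x. x \<in> S \<Longrightarrow> 0 \<le> f x) \<Longrightarrow> f \<in> P"
    and P_mult: "f \<in> A \<Longrightarrow> h \<in> A \<Longrightarrow> f \<in> P \<Longrightarrow> h \<in> P \<Longrightarrow> (\<lambda>x. f x * h x) \<in> P"
begin

lemma scale: "f \<in> A \<Longrightarrow> (\<lambda>x. c * f x) \<in> A"
  using mult[OF const[of c], of f] .

lemma diff: "f \<in> A \<Longrightarrow> h \<in> A \<Longrightarrow> (\<lambda>x. f x - h x) \<in> A"
  using add[of f "\<lambda>x. - 1 * h x"] scale[of h "-1"] by simp

lemma sum_mem: "finite I \<Longrightarrow> (\<And>i. i \<in> I \<Longrightarrow> F i \<in> A) \<Longrightarrow> (\<lambda>x. \<Sum>i\<in>I. F i x) \<in> A"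
  by (induction I rule: finite_induct) (use const[of 0] in \<open>auto intro: add\<close>)

context
  fixes \<Lambda> assumes \<Lambda>: "\<Lambda> \<in> states A P"
begin

lemma state_add: "f \<in> A \<Longrightarrow> h \<in> A \<Longrightarrow> \<Lambda> (\<lambda>x. f x + h x) = \<Lambda> f + \<Lambda> h"
  and state_scale: "f \<in> A \<Longrightarrow> \<Lambda> (\<lambda>x. c * f x) = c * \<Lambda> f"
  and state_nonneg: "f \<in> A \<Longrightarrow> f \<in> P \<Longrightarrow> 0 \<le> \<Lambda> f"
  and state_outside: "f \<notin> A \<Longrightarrow> \<Lambda> f = 0"
  using \<Lambda> by (auto simp: states_def)

lemma state_const: "\<Lambda> (\<lambda>_. c) = c"
  using state_scale[OF const[of 1], of c] \<Lambda> by (simp add: states_def)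

lemma state_diff: "f \<in> A \<Longrightarrow> h \<in> A \<Longrightarrow> \<Lambda> (\<lambda>x. f x - h x) = \<Lambda> f - \<Lambda> h"
  using state_add[of f "\<lambda>x. -1 * h x"] scale[of h "-1"] state_scale[of h "-1"] by simp

lemma state_sum: "finite I \<Longrightarrow> (\<And>i. i \<in> I \<Longrightarrow> F i \<in> A) \<Longrightarrow> \<Lambda> (\<lambda>x. \<Sum>i\<in>I. F i x) = (\<Sum>i\<in>I. \<Lambda> (F i))"
  by (induction I rule: finite_induct) (simp_all add: state_const state_add sum_mem)

lemma state_mono_P: "f \<in> A \<Longrightarrow> h \<in> A \<Longrightarrow> (\<lambda>x. h x - f x) \<in> P \<Longrightarrow> \<Lambda> f \<le> \<Lambda> h"
  using state_nonneg[OF diff] state_diff[of h f] by fastforce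

lemma state_mono: "f \<in> A \<Longrightarrow> h \<in> A \<Longrightarrow> (\<And>x. x \<in> S \<Longrightarrow> f x \<le> h x) \<Longrightarrow> \<Lambda> f \<le> \<Lambda> h"
  by (rule state_mono_P) (auto intro!: nonneg diff)

lemma state_cong: "f \<in> A \<Longrightarrow> h \<in> A \<Longrightarrow> (\<And>x. x \<in> S \<Longrightarrow> f x = h x) \<Longrightarrow> \<Lambda> f = \<Lambda> h"
  using state_mono[of f h] state_mono[of h f] by force

lemma state_le: "f \<in> A \<Longrightarrow> (\<And>x. x \<in> S \<Longrightarrow> f x \<le> c) \<Longrightarrow> \<Lambda> f \<le> c"
  using state_mono[of f "\<lambda>_. c"] state_const[of c] const[of c] by simp

lemma state_ge: "f \<in> A \<Longrightarrow> (\<And>x. x \<in> S \<Longrightarrow> c \<le> f x) \<Longrightarrow> c \<le> \<Lambda> f"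
  using state_mono[of "\<lambda>_. c" f] state_const[of c] const[of c] by simp

lemma state_dist: "f \<in> A \<Longrightarrow> h \<in> A \<Longrightarrow> (\<And>x. x \<in> S \<Longrightarrow> \<bar>f x - h x\<bar> \<le> c) \<Longrightarrow> \<bar>\<Lambda> f - \<Lambda> h\<bar> \<le> c"
  using state_le[of "\<lambda>x. f x - h x" c] state_ge[of "\<lambda>x. f x - h x" "-c"] state_diff[of f h] diff[of f h]
  by (auto simp: abs_le_iff) (smt (verit, best))+

end

lemma states_convex: "convex (states A P)"
proof (rule convexI)
  fix x y and u v :: real assume "x \<in> states A P" "y \<in> states A P" "0 \<le> u" "0 \<le> v" "u + v = 1"
  thus "u *\<^sub>R x + v *\<^sub>R y \<in> states A P"
    unfolding states_def by (auto simp: scaleR_fun_def algebra_simps)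
qed

lemma states_compact: "compactin pointwise_topology (states A P)"
proof -
  obtain B where B: "\<And>f x. f \<in> A \<Longrightarrow> x \<in> S \<Longrightarrow> \<bar>f x\<bar> \<le> B f" using bounded by metis
  let ?Q = "\<Pi>\<^sub>E f\<in>UNIV. if f \<in> A then {- B f..B f} else {0}"
  have "compactin pointwise_topology ?Q" unfolding compactin_PiE by auto
  moreover have "states A P \<subseteq> ?Q"
  proof
    fix \<Lambda> assume \<Lambda>: "\<Lambda> \<in> states A P"
    have "\<Lambda> f \<le> B f" "- B f \<le> \<Lambda> f" if "f \<in> A" for f
      using state_le[OF \<Lambda> that, of "B f"] state_ge[OF \<Lambda> that, of "- B f"] B[OF that]
      by (force simp: abs_le_iff)+
    thus "\<Lambda> \<in> ?Q" using state_outside[OF \<Lambda>] by auto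
  qed
  moreover have "closed (states A P)"
    unfolding states_def imp_conv_disj Ball_def
    by (intro closed_Collect_conj closed_Collect_all closed_Collect_disj closed_Collect_const
        closed_Collect_eq closed_Collect_le continuous_intros) auto
  hence "closedin pointwise_topology (states A P)" by (simp add: euclidean_product_topology)
  ultimately show ?thesis by (meson closed_compactin)
qed

lemma state_space_compact_convex: "compact_convex_space (state_space A P)"
  unfolding compact_convex_space_def
  using pointwise_topology_locally_convex states_convex states_compact
  by (auto simp: compact_space_subtopology)

text \<open>A continuous functional on the space of all functionals is a finite linear combination of
  evaluations, and on states this is the evaluation at a single element of \<open>A\<close>.\<close>

lemma states_separation:
  assumes C: "C \<subseteq> states A P" "C \<noteq> {}" "convex C" "closedin (state_space A P) C"
    and \<nu>: "\<nu> \<in> states A P" and le: "\<And>F t. F \<in> A \<Longrightarrow> (\<And>\<kappa>. \<kappa> \<in> C \<Longrightarrow> \<kappa> F \<le> t) \<Longrightarrow> \<nu> F \<le> t"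
  shows "\<nu> \<in> C"
proof (rule ccontr)
  assume "\<nu> \<notin> C"
  have "compactin (state_space A P) C"
    using C(4) closedin_compact_space compact_convex_compact[OF state_space_compact_convex] by blast
  hence "compactin pointwise_topology C" by (simp add: compactin_subtopology)
  hence "closedin pointwise_topology C"
    by (intro compactin_imp_closedin) (auto simp: Hausdorff_space_product_topology)
  then obtain f \<alpha> where f: "linear_functional_on UNIV f" "continuous_map pointwise_topology euclideanreal f"
    "\<And>c. c \<in> C \<Longrightarrow> f c \<le> \<alpha>" "\<alpha> < f \<nu>"
    using lc_separation[OF pointwise_topology_locally_convex C(3) _ C(2), of \<nu>] \<open>\<nu> \<notin> C\<close> by auto
  obtain I where I: "finite I" "\<And>x. f x = (\<Sum>i\<in>I. f (\<lambda>j. if j = i then 1 else 0) * x i)"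
    using pointwise_continuous_functional[OF f(1,2)] by blast
  define F where "F = (\<lambda>s. \<Sum>i\<in>I \<inter> A. f (\<lambda>j. if j = i then 1 else 0) * i s)"
  have F: "F \<in> A" unfolding F_def using I(1) by (intro sum_mem scale) auto
  have eval: "\<kappa> F = f \<kappa>" if \<kappa>: "\<kappa> \<in> states A P" for \<kappa>
  proof -
    have "\<kappa> F = (\<Sum>i\<in>I \<inter> A. f (\<lambda>j. if j = i then 1 else 0) * \<kappa> i)"
      unfolding F_def using I(1) by (subst state_sum[OF \<kappa>]) (auto intro: scale simp: state_scale[OF \<kappa>])
    also have "\<dots> = f \<kappa>"
      unfolding I(2)[of \<kappa>] using I(1) state_outside[OF \<kappa>] by (intro sum.mono_neutral_left) auto
    finally show ?thesis .
  qed
  have "\<nu> F \<le> \<alpha>" 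
  proof (rule le[OF F])
    fix \<kappa> assume "\<kappa> \<in> C"
    thus "\<kappa> F \<le> \<alpha>" using eval[of \<kappa>] f(3)[of \<kappa>] C(1) by auto
  qed
  thus False using f(4) eval[OF \<nu>] by simp
qed

text \<open>If \<open>0 \<le> f \<le> 1\<close>, then \<open>\<omega>\<close> is a convex combination of multiples of \<open>h \<mapsto> \<omega> (f h)\<close> and
  \<open>h \<mapsto> \<omega> ((1 - f) h)\<close>, so these are proportional to an extreme \<open>\<omega>\<close>.\<close>

lemma extreme_state_multiplicative:
  assumes e: "\<omega> extreme_point_of states A P" and f: "f \<in> A" and h: "h \<in> A"
  shows "\<omega> (\<lambda>x. f x * h x) = \<omega> f * \<omega> h"
proof -
  have \<omega>: "\<omega> \<in> states A P" using e by (simp add: extreme_point_of_def)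
  have unit: "\<omega> (\<lambda>x. f x * h x) = \<omega> f * \<omega> h"
    if f: "f \<in> A" and f01: "\<And>x. x \<in> S \<Longrightarrow> 0 \<le> f x" "\<And>x. x \<in> S \<Longrightarrow> f x \<le> 1" and f0: "\<omega> f > 0" "\<omega> f < 1" for f
  proof -
    define t where "t = \<omega> f"
    define \<Lambda> where "\<Lambda> = (\<lambda>f t h. if h \<in> A then \<omega> (\<lambda>x. f x * h x) / t else (0::real))"
    have mem: "\<Lambda> f t \<in> states A P" if f: "f \<in> A" "\<And>x. x \<in> S \<Longrightarrow> 0 \<le> f x" "\<omega> f = t" "t > 0" for f t
      unfolding states_def
    proof (safe)
      fix k l assume k: "k \<in> A" and l: "l \<in> A"
      have "\<omega> (\<lambda>x. f x * (k x + l x)) = \<omega> (\<lambda>x. f x * k x) + \<omega> (\<lambda>x. f x * l x)"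
        using state_add[OF \<omega> mult[OF f(1) k] mult[OF f(1) l]] by (simp add: distrib_left)
      thus "\<Lambda> f t (\<lambda>x. k x + l x) = \<Lambda> f t k + \<Lambda> f t l"
        using k l by (simp add: \<Lambda>_def add add_divide_distrib)
    next
      fix c k assume k: "k \<in> A"
      have "\<omega> (\<lambda>x. f x * (c * k x)) = c * \<omega> (\<lambda>x. f x * k x)"
        using state_scale[OF \<omega> mult[OF f(1) k], of c] by (simp add: algebra_simps)
      thus "\<Lambda> f t (\<lambda>x. c * k x) = c * \<Lambda> f t k" using k by (simp add: \<Lambda>_def scale)
    next
      fix k assume k: "k \<in> A" "k \<in> P"
      have "f \<in> P" using f by (intro nonneg)
      hence "0 \<le> \<omega> (\<lambda>x. f x * k x)" using f k by (intro state_nonneg[OF \<omega>] mult P_mult)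
      thus "0 \<le> \<Lambda> f t k" using f by (simp add: \<Lambda>_def)
    qed (use f const in \<open>auto simp: \<Lambda>_def\<close>)
    have g: "(\<lambda>x. 1 - f x) \<in> A" using diff[OF const f, of 1] .
    have g1: "\<omega> (\<lambda>x. 1 - f x) = 1 - t" using state_diff[OF \<omega> const f, of 1] state_const[OF \<omega>, of 1] by (simp add: t_def)
    have split: "\<omega> (\<lambda>x. (1 - f x) * k x) = \<omega> k - \<omega> (\<lambda>x. f x * k x)" if "k \<in> A" for k
      using state_diff[OF \<omega> that mult[OF f that]] by (simp add: algebra_simps)
    have "\<omega> = \<Lambda> (\<lambda>x. 1 - f x) (1 - t) \<or> \<omega> = \<Lambda> f t"
    proof (rule extreme_point_convex_combination[OF e])
      show "\<Lambda> f t \<in> states A P" using f f01 f0 by (intro mem) (auto simp: t_def)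
      show "\<Lambda> (\<lambda>x. 1 - f x) (1 - t) \<in> states A P" using g f01 f0 g1 by (intro mem) (auto simp: t_def)
      show "\<omega> = (1 - t) *\<^sub>R \<Lambda> (\<lambda>x. 1 - f x) (1 - t) + t *\<^sub>R \<Lambda> f t"
      proof
        fix k show "\<omega> k = ((1 - t) *\<^sub>R \<Lambda> (\<lambda>x. 1 - f x) (1 - t) + t *\<^sub>R \<Lambda> f t) k"
          using split[of k] state_outside[OF \<omega>, of k] f0
          by (cases "k \<in> A") (auto simp: \<Lambda>_def scaleR_fun_def t_def)
      qed
    qed (use f0 in \<open>auto simp: t_def\<close>)
    thus ?thesis
    proof
      assume "\<omega> = \<Lambda> f t"
      hence "\<omega> h = \<omega> (\<lambda>x. f x * h x) / t" using h by (metis \<Lambda>_def)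
      thus ?thesis using f0 by (simp add: t_def)
    next
      assume "\<omega> = \<Lambda> (\<lambda>x. 1 - f x) (1 - t)"
      hence "\<omega> h = (\<omega> h - \<omega> (\<lambda>x. f x * h x)) / (1 - t)" using h split[OF h] by (metis \<Lambda>_def)
      hence "\<omega> h * (1 - t) = \<omega> h - \<omega> (\<lambda>x. f x * h x)" using f0 by (simp add: t_def field_simps)
      thus ?thesis by (simp add: t_def algebra_simps)
    qed
  qed
  \<comment> \<open>The general case follows by rescaling \<open>f\<close> to a function with values in \<open>{1/3..2/3}\<close>.\<close>
  obtain B0 where B0: "\<And>x. x \<in> S \<Longrightarrow> \<bar>f x\<bar> \<le> B0" using bounded[OF f] by blast
  define B where "B = \<bar>B0\<bar> + 1"
  have B: "\<And>x. x \<in> S \<Longrightarrow> \<bar>f x\<bar> \<le> B" "B > 0" using B0 by (auto simp: B_def intro: order_trans[OF B0])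
  define g where "g = (\<lambda>x. 1 / 2 + 1 / (6 * B) * f x)"
  have g: "g \<in> A" unfolding g_def by (intro add scale const f)
  have g3: "1 / 3 \<le> g x" "g x \<le> 2 / 3" if "x \<in> S" for x
    using B(1)[OF that] B(2) by (auto simp: g_def field_simps abs_le_iff)
  have \<omega>g: "\<omega> g = 1 / 2 + 1 / (6 * B) * \<omega> f"
    by (simp only: g_def state_add[OF \<omega> const scale[OF f]] state_const[OF \<omega>] state_scale[OF \<omega> f])
  have gh: "\<omega> (\<lambda>x. g x * h x) = 1 / 2 * \<omega> h + 1 / (6 * B) * \<omega> (\<lambda>x. f x * h x)"
  proof -
    have "(\<lambda>x. g x * h x) = (\<lambda>x. 1 / 2 * h x + 1 / (6 * B) * (f x * h x))"
      by (simp add: g_def algebra_simps)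
    thus ?thesis
      by (simp only: state_add[OF \<omega> scale[OF h] scale[OF mult[OF f h]]]
          state_scale[OF \<omega> h] state_scale[OF \<omega> mult[OF f h]])
  qed
  have "1 / 3 \<le> \<omega> g" "\<omega> g \<le> 2 / 3" 
    by (rule state_ge[OF \<omega> g], erule g3(1)) (rule state_le[OF \<omega> g], erule g3(2))
  hence "\<omega> (\<lambda>x. g x * h x) = \<omega> g * \<omega> h"
    using g3 by (intro unit[OF g]) (force+)
  hence "1 / (6 * B) * \<omega> (\<lambda>x. f x * h x) = 1 / (6 * B) * (\<omega> f * \<omega> h)"
    using gh \<omega>g by (simp add: algebra_simps)
  thus ?thesis using B(2) by simp
qed

lemma ext_closure_state_multiplicative:
  assumes \<omega>: "\<omega> \<in> ext_closure (state_space A P)" and f: "f \<in> A" and h: "h \<in> A"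
  shows "\<omega> (\<lambda>x. f x * h x) = \<omega> f * \<omega> h"
proof -
  let ?M = "{\<omega> :: ('s \<Rightarrow> real) \<Rightarrow> real. \<omega> (\<lambda>x. f x * h x) = \<omega> f * \<omega> h}"
  have "closed ?M" by (intro closed_Collect_eq continuous_on_mult continuous_on_product_coordinates)
  hence "closedin pointwise_topology ?M" by (simp add: euclidean_product_topology)
  hence "closedin (state_space A P) (states A P \<inter> ?M)" by (intro closedin_subtopology_Int_closed)
  moreover have "{x. x extreme_point_of topspace (state_space A P)} \<subseteq> states A P \<inter> ?M"
    using extreme_state_multiplicative[OF _ f h] by (auto simp: extreme_point_of_def)
  ultimately have "ext_closure (state_space A P) \<subseteq> states A P \<inter> ?M"
    unfolding ext_closure_def by (rule closure_of_minimal[rotated])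
  with \<omega> show ?thesis by auto
qed

end

lemma group_actionI:
  assumes "group G" "\<And>g. g \<in> carrier G \<Longrightarrow> \<phi> g \<in> extensional E"
    "\<And>g x. g \<in> carrier G \<Longrightarrow> x \<in> E \<Longrightarrow> \<phi> g x \<in> E"
    "\<And>g h x. g \<in> carrier G \<Longrightarrow> h \<in> carrier G \<Longrightarrow> x \<in> E \<Longrightarrow> \<phi> (g \<otimes>\<^bsub>G\<^esub> h) x = \<phi> g (\<phi> h x)"
    "\<And>x. x \<in> E \<Longrightarrow> \<phi> \<one>\<^bsub>G\<^esub> x = x"
  shows "group_action G E \<phi>"
proof -
  interpret group G by fact
  have bij: "\<phi> g \<in> Bij E" if g: "g \<in> carrier G" for g
  proof -
    have "bij_betw (\<phi> g) E E"
    proof (rule bij_betwI[where g = "\<phi> (inv\<^bsub>G\<^esub> g)"])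
      show "\<phi> (inv\<^bsub>G\<^esub> g) (\<phi> g x) = x" "\<phi> g (\<phi> (inv\<^bsub>G\<^esub> g) x) = x" if "x \<in> E" for x
        using assms(4)[of "inv\<^bsub>G\<^esub> g" g x] assms(4)[of g "inv\<^bsub>G\<^esub> g" x] assms(5)[of x] g that by auto
    qed (use assms(3) g in auto)
    thus ?thesis using assms(2)[OF g] by (simp add: Bij_def)
  qed
  have "\<phi> \<in> hom G (BijGroup E)"
  proof (rule homI)
    fix g h assume gh: "g \<in> carrier G" "h \<in> carrier G"
    show "\<phi> (g \<otimes>\<^bsub>G\<^esub> h) = \<phi> g \<otimes>\<^bsub>BijGroup E\<^esub> \<phi> h"
      using gh bij assms(2)[of "g \<otimes>\<^bsub>G\<^esub> h"] assms(4)[OF gh]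
      by (auto simp: BijGroup_def compose_def intro!: extensionalityI[of _ E])
  qed (use bij in \<open>auto simp: BijGroup_def\<close>)
  thus ?thesis
    by (intro group_action.intro group_hom.intro group_BijGroup) (auto simp: group_hom_axioms_def is_group)
qed

lemma group_action_mult:
  assumes "group_action G E \<phi>" "g \<in> carrier G" "h \<in> carrier G" "x \<in> E"
  shows "\<phi> (g \<otimes>\<^bsub>G\<^esub> h) x = \<phi> g (\<phi> h x)"
  using group_action.composition_rule[OF assms(1,4,2,3)] .

lemma group_action_one:
  assumes "group_action G E \<phi>" "x \<in> E" shows "\<phi> \<one>\<^bsub>G\<^esub> x = x"
  using group_action.id_eq_one[OF assms(1)] assms(2) by (metis restrict_apply')

lemma group_action_closed:
  assumes "group_action G E \<phi>" "g \<in> carrier G" "x \<in> E" shows "\<phi> g x \<in> E"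
  using group_action.element_image[OF assms(1,2,3)] by blast

context ordered_function_algebra
begin

text \<open>The action is jointly continuous because states are contractions: translates of \<open>f\<close> by nearby group
  elements are uniformly close.\<close>

lemma state_affine_flow:
  fixes G :: "('g, 'm) monoid_scheme" and \<tau> :: "'g \<Rightarrow> 's \<Rightarrow> 's"
  assumes G: "group G" and T: "topspace T = carrier G"
    and \<tau>_closed: "\<And>g x. g \<in> carrier G \<Longrightarrow> x \<in> S \<Longrightarrow> \<tau> g x \<in> S"
    and \<tau>_mult: "\<And>g h x. g \<in> carrier G \<Longrightarrow> h \<in> carrier G \<Longrightarrow> x \<in> S \<Longrightarrow> \<tau> (g \<otimes>\<^bsub>G\<^esub> h) x = \<tau> g (\<tau> h x)"
    and \<tau>_one: "\<And>x. x \<in> S \<Longrightarrow> \<tau> \<one>\<^bsub>G\<^esub> x = x"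
    and A_closed: "\<And>g f. g \<in> carrier G \<Longrightarrow> f \<in> A \<Longrightarrow> (\<lambda>x. f (\<tau> g x)) \<in> A"
    and P_closed: "\<And>g f. g \<in> carrier G \<Longrightarrow> f \<in> A \<Longrightarrow> f \<in> P \<Longrightarrow> (\<lambda>x. f (\<tau> g x)) \<in> P"
    and cont: "\<And>g f e. g \<in> carrier G \<Longrightarrow> f \<in> A \<Longrightarrow> e > 0 \<Longrightarrow>
       \<exists>W. openin T W \<and> g \<in> W \<and> (\<forall>g'\<in>W. \<forall>x\<in>S. \<bar>f (\<tau> g' x) - f (\<tau> g x)\<bar> \<le> e)"
    and ne: "states A P \<noteq> {}"
  shows "affine_flow G T (state_space A P) (state_action A P \<tau>)"
proof -
  interpret group G by fact
  let ?a = "state_action A P \<tau>"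
  have mem: "?a g \<Lambda> \<in> states A P" if g: "g \<in> carrier G" and \<Lambda>: "\<Lambda> \<in> states A P" for g \<Lambda>
    using \<Lambda> unfolding state_action_def
    by (subst states_def) (auto simp: add scale const A_closed[OF g] P_closed[OF g]
        state_add[OF \<Lambda>] state_scale[OF \<Lambda>] state_const[OF \<Lambda>] state_nonneg[OF \<Lambda>])
  have act: "group_action G (topspace (state_space A P)) ?a"
  proof (rule group_actionI[OF G])
    fix g h \<Lambda> assume gh: "g \<in> carrier G" "h \<in> carrier G" and "\<Lambda> \<in> topspace (state_space A P)"
    hence \<Lambda>: "\<Lambda> \<in> states A P" by simp
    show "?a (g \<otimes>\<^bsub>G\<^esub> h) \<Lambda> = ?a g (?a h \<Lambda>)"
    proof
      fix f
      have "\<Lambda> (\<lambda>x. f (\<tau> (g \<otimes>\<^bsub>G\<^esub> h) x)) = \<Lambda> (\<lambda>x. f (\<tau> g (\<tau> h x)))" if f: "f \<in> A"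
        using gh f A_closed[OF gh(2) A_closed[OF gh(1) f]]
        by (intro state_cong[OF \<Lambda>] A_closed) (auto simp: \<tau>_mult)
      thus "?a (g \<otimes>\<^bsub>G\<^esub> h) \<Lambda> f = ?a g (?a h \<Lambda>) f"
        using \<Lambda> mem[OF gh(2) \<Lambda>] A_closed gh by (auto simp: state_action_def)
    qed
  next
    fix \<Lambda> assume "\<Lambda> \<in> topspace (state_space A P)"
    hence \<Lambda>: "\<Lambda> \<in> states A P" by simp
    show "?a \<one>\<^bsub>G\<^esub> \<Lambda> = \<Lambda>"
    proof
      fix f
      have "\<Lambda> (\<lambda>x. f (\<tau> \<one>\<^bsub>G\<^esub> x)) = \<Lambda> f" if f: "f \<in> A"
        using f A_closed by (intro state_cong[OF \<Lambda>]) (auto simp: \<tau>_one)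
      thus "?a \<one>\<^bsub>G\<^esub> \<Lambda> f = \<Lambda> f" using \<Lambda> state_outside[OF \<Lambda>, of f] by (auto simp: state_action_def)
    qed
  qed (use mem in \<open>auto simp: state_action_def\<close>)
  have "continuous_map (prod_topology T (state_space A P)) (state_space A P) (\<lambda>(g, x). ?a g x)"
    unfolding continuous_map_in_subtopology continuous_map_componentwise_UNIV
  proof (intro conjI allI)
    show "(\<lambda>(g, x). ?a g x) \<in> topspace (prod_topology T (state_space A P)) \<rightarrow> states A P"
      using mem T by auto
    fix f
    show "continuous_map (prod_topology T (state_space A P)) euclideanreal (\<lambda>x. (\<lambda>(g, x). ?a g x) x f)"
      unfolding continuous_map_real_iff
    proof (intro ballI allI impI)
      fix z and e :: real assume z: "z \<in> topspace (prod_topology T (state_space A P))" and e: "e > 0"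
      obtain g \<Lambda> where gL: "z = (g, \<Lambda>)" "g \<in> carrier G" "\<Lambda> \<in> states A P" using z T by (cases z) auto
      show "\<exists>U. openin (prod_topology T (state_space A P)) U \<and> z \<in> U \<and>
          (\<forall>y\<in>U. \<bar>(\<lambda>(g, x). ?a g x) y f - (\<lambda>(g, x). ?a g x) z f\<bar> < e)"
      proof (cases "f \<in> A")
        case False
        have "openin (prod_topology T (state_space A P)) (topspace (prod_topology T (state_space A P)))"
          by (rule openin_topspace)
        moreover have "\<bar>(\<lambda>(g, x). ?a g x) y f - (\<lambda>(g, x). ?a g x) z f\<bar> < e"
          if "y \<in> topspace (prod_topology T (state_space A P))" for y
          using that False e gL by (auto simp: state_action_def)
        ultimately show ?thesis using z by blast
      next
        case True
        obtain W where W: "openin T W" "g \<in> W" "\<And>g' x. g' \<in> W \<Longrightarrow> x \<in> S \<Longrightarrow> \<bar>f (\<tau> g' x) - f (\<tau> g x)\<bar> \<le> e/2"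
          using cont[OF gL(2) True, of "e/2"] e by auto
        let ?k = "\<lambda>x. f (\<tau> g x)"
        let ?N = "states A P \<inter> {\<Lambda>'. \<forall>i\<in>{?k}. \<bar>\<Lambda>' i - \<Lambda> i\<bar> < e/2}"
        have "openin (state_space A P) ?N"
          using pointwise_topology_basic_open[of "{?k}" \<Lambda> "e/2"] by (intro openin_subtopology_Int2) auto
        hence "openin (prod_topology T (state_space A P)) (W \<times> ?N)" using W(1) by (simp add: openin_prod_Times_iff)
        moreover have "\<bar>?a g' \<Lambda>' f - ?a g \<Lambda> f\<bar> < e" if "g' \<in> W" "\<Lambda>' \<in> ?N" for g' \<Lambda>'
        proof -
          have g': "g' \<in> carrier G" using that(1) W(1) openin_subset T by blast
          have L': "\<Lambda>' \<in> states A P" using that by auto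
          have "\<bar>\<Lambda>' (\<lambda>x. f (\<tau> g' x)) - \<Lambda>' ?k\<bar> \<le> e / 2"
            using W(3)[OF that(1)] True gL(2) g' by (intro state_dist[OF L'] A_closed)
          moreover have "\<bar>\<Lambda>' ?k - \<Lambda> ?k\<bar> < e / 2" using that by auto
          ultimately have "\<bar>\<Lambda>' (\<lambda>x. f (\<tau> g' x)) - \<Lambda> ?k\<bar> < e" by linarith
          thus ?thesis using L' gL(3) True by (simp add: state_action_def)
        qed
        ultimately show ?thesis using W(2) e gL(3) by (intro exI[of _ "W \<times> ?N"]) (auto simp: gL)
      qed
    qed
  qed
  moreover have "affine_map_on (states A P) (?a g)" if "g \<in> carrier G" for g
    using states_convex convexD_alt[OF states_convex] unfolding affine_map_on_def
    by (auto simp: state_action_def scaleR_fun_def fun_eq_iff)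
  ultimately show ?thesis
    unfolding affine_flow_def flow_def
    using state_space_compact_convex act ne compact_convex_Hausdorff[OF state_space_compact_convex]
    by (auto simp: compact_convex_space_def)
qed

end

section \<open>The Riesz representation theorem\<close>

definition C_space :: "'x topology \<Rightarrow> ('x \<Rightarrow> real) set" where
  "C_space X = {f. continuous_map X euclideanreal f}"

definition nonneg_on :: "'s set \<Rightarrow> ('s \<Rightarrow> real) set" where
  "nonneg_on S = {f. \<forall>x\<in>S. 0 \<le> f x}"

lemma continuous_map_real_bounded:
  assumes "compact_space X" "continuous_map X euclideanreal f"
  obtains B where "\<And>x. x \<in> topspace X \<Longrightarrow> \<bar>f x\<bar> \<le> B"
proof -
  have "compact (f ` topspace X)"
    using image_compactin[of X "topspace X" euclideanreal f] assms by (simp add: compact_space_def)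
  thus ?thesis using that compact_imp_bounded bounded_iff by (metis imageI real_norm_def)
qed

lemma C_space_algebra:
  assumes "compact_space X"
  shows "ordered_function_algebra (topspace X) (C_space X) (nonneg_on (topspace X))"
proof
  fix f assume "f \<in> C_space X"
  thus "\<exists>B. \<forall>x\<in>topspace X. \<bar>f x\<bar> \<le> B"
    using continuous_map_real_bounded[OF assms, of f] unfolding C_space_def by (metis mem_Collect_eq)
qed (auto simp: C_space_def nonneg_on_def intro!: continuous_map_add continuous_map_real_mult)

lemma regular_prob_measures_integral:
  assumes X: "compact_space X" and \<mu>: "\<mu> \<in> regular_prob_measures X" and f: "continuous_map X euclideanreal f"
  shows "f \<in> borel_measurable \<mu>" "integrable \<mu> f"
proof -
  interpret prob_space \<mu> using \<mu> by (simp add: regular_prob_measures_def)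
  have sp: "space \<mu> = topspace X" and sets: "sets \<mu> = sigma_sets (topspace X) {U. openin X U}"
    using \<mu> by (auto simp: regular_prob_measures_def)
  show m: "f \<in> borel_measurable \<mu>"
  proof (rule borel_measurableI)
    fix S :: "real set" assume "open S"
    hence "openin X {x \<in> topspace X. f x \<in> S}" using f by (intro openin_continuous_map_preimage) auto
    moreover have "f -` S \<inter> space \<mu> = {x \<in> topspace X. f x \<in> S}" using sp by auto
    ultimately show "f -` S \<inter> space \<mu> \<in> sets \<mu>" using sets by auto
  qed
  obtain B where "\<And>x. x \<in> topspace X \<Longrightarrow> \<bar>f x\<bar> \<le> B" using continuous_map_real_bounded[OF X f] by blast
  hence "AE x in \<mu>. norm (f x) \<le> B" using sp by (intro AE_I2) auto
  thus "integrable \<mu> f" using m by (intro integrable_const_bound)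
qed

lemma integral_functional_state:
  assumes X: "compact_space X" and \<mu>: "\<mu> \<in> regular_prob_measures X"
  shows "integral_functional X \<mu> \<in> states (C_space X) (nonneg_on (topspace X))"
proof -
  interpret prob_space \<mu> using \<mu> by (simp add: regular_prob_measures_def)
  have sp: "space \<mu> = topspace X" using \<mu> by (auto simp: regular_prob_measures_def)
  note int = regular_prob_measures_integral[OF X \<mu>]
  show ?thesis
    unfolding states_def integral_functional_def C_space_def
    using int prob_space sp
    by (auto intro!: continuous_map_add continuous_map_real_mult integral_nonneg_AE AE_I2 simp: nonneg_on_def)
qed

locale riesz_functional =
  fixes X :: "'x topology" and \<Lambda> :: "('x \<Rightarrow> real) \<Rightarrow> real"
  assumes compact: "compact_space X" and Hausdorff: "Hausdorff_space X"
    and state: "\<Lambda> \<in> states (C_space X) (nonneg_on (topspace X))"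
begin

sublocale ordered_function_algebra "topspace X" "C_space X" "nonneg_on (topspace X)"
  by (rule C_space_algebra[OF compact])

definition bumps :: "'x set \<Rightarrow> ('x \<Rightarrow> real) set" where
  "bumps U = {f. continuous_map X euclideanreal f \<and> (\<forall>x\<in>topspace X. 0 \<le> f x \<and> f x \<le> 1) \<and>
     (\<forall>x\<in>topspace X. x \<notin> U \<longrightarrow> f x = 0)}"

definition content :: "'x set \<Rightarrow> real" where
  "content U = (SUP f\<in>bumps U. \<Lambda> f)"

definition outer :: "'x set \<Rightarrow> real" where
  "outer A = (INF U\<in>{U. openin X U \<and> A \<subseteq> U}. content U)"

lemma bumps_C: "f \<in> bumps U \<Longrightarrow> f \<in> C_space X" by (simp add: bumps_def C_space_def)

lemma bumps_mono: "U \<subseteq> V \<Longrightarrow> bumps U \<subseteq> bumps V" by (auto simp: bumps_def)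

lemma zero_bump: "(\<lambda>_. 0) \<in> bumps U" by (simp add: bumps_def)

lemma bump_le_1: "f \<in> bumps U \<Longrightarrow> \<Lambda> f \<le> 1"
  by (rule state_le[OF state]) (auto simp: bumps_def C_space_def)

lemma content_upper: "f \<in> bumps U \<Longrightarrow> \<Lambda> f \<le> content U"
  unfolding content_def by (rule cSUP_upper) (auto intro!: bdd_aboveI2[of _ _ 1] bump_le_1)

lemma content_least: "(\<And>f. f \<in> bumps U \<Longrightarrow> \<Lambda> f \<le> c) \<Longrightarrow> content U \<le> c"
  unfolding content_def using zero_bump by (intro cSUP_least) auto

lemma content_nonneg: "0 \<le> content U"
  using content_upper[OF zero_bump] state_const[OF state, of 0] by simp

lemma content_le_1: "content U \<le> 1" by (rule content_least) (rule bump_le_1)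

lemma content_mono: "U \<subseteq> V \<Longrightarrow> content U \<le> content V"
  using bumps_mono by (intro content_least content_upper) auto

lemma content_empty: "content {} = 0"
proof -
  have "\<Lambda> f \<le> 0" if "f \<in> bumps {}" for f
    using that by (intro state_le[OF state] bumps_C[OF that]) (auto simp: bumps_def)
  thus ?thesis using content_least[of "{}" 0] content_nonneg[of "{}"] by force
qed

lemma content_topspace: "content (topspace X) = 1"
proof -
  have "(\<lambda>_. 1) \<in> bumps (topspace X)" by (simp add: bumps_def)
  thus ?thesis using content_upper[of "\<lambda>_. 1" "topspace X"] state_const[OF state, of 1] content_le_1[of "topspace X"] by linarith
qed

lemma bump_cutoff:
  assumes f: "f \<in> bumps U" and e: "e > 0"
  shows "(\<lambda>x. max (f x - e) 0) \<in> bumps U" "\<Lambda> f \<le> e + \<Lambda> (\<lambda>x. max (f x - e) 0)"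
proof -
  show m: "(\<lambda>x. max (f x - e) 0) \<in> bumps U"
    using f e by (fastforce simp: bumps_def intro!: continuous_map_real_max continuous_map_diff)
  have "\<Lambda> f \<le> \<Lambda> (\<lambda>x. e + max (f x - e) 0)"
    by (rule state_mono[OF state bumps_C[OF f]]) (use bumps_C[OF m] in \<open>auto intro: add const\<close>)
  also have "\<dots> = e + \<Lambda> (\<lambda>x. max (f x - e) 0)"
    using state_add[OF state const bumps_C[OF m]] state_const[OF state] by simp
  finally show "\<Lambda> f \<le> e + \<Lambda> (\<lambda>x. max (f x - e) 0)" .
qed

lemma bump_level_closed: "f \<in> bumps U \<Longrightarrow> closedin X {x \<in> topspace X. f x \<in> {e..}}"
  by (rule closedin_continuous_map_preimage) (auto simp: bumps_def)

lemma bump_mult: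
  assumes "f \<in> bumps U" "continuous_map X euclideanreal u" "\<And>x. x \<in> topspace X \<Longrightarrow> 0 \<le> u x \<and> u x \<le> 1"
    "\<And>x. x \<in> topspace X \<Longrightarrow> x \<notin> V \<Longrightarrow> f x * u x = 0"
  shows "(\<lambda>x. f x * u x) \<in> bumps V"
  using assms by (auto simp: bumps_def intro!: continuous_map_real_mult mult_le_one)

text \<open>Cut \<open>f\<close> off to a compact subset \<open>K\<close> of \<open>U \<union> V\<close> and multiply it by a Urysohn function that is
  \<open>0\<close> on \<open>K - U\<close> and \<open>1\<close> on \<open>K - V\<close> and by the complementary one.\<close>

lemma content_Un:
  assumes U: "openin X U" and V: "openin X V"
  shows "content (U \<union> V) \<le> content U + content V"
proof (rule content_least, rule field_le_epsilon)
  fix f and e :: real assume f: "f \<in> bumps (U \<union> V)" and e: "e > 0"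
  define K where "K = {x \<in> topspace X. f x \<in> {e..}}"
  define g where "g = (\<lambda>x. max (f x - e) 0)"
  have K: "closedin X K" unfolding K_def by (rule bump_level_closed[OF f])
  have KUV: "K \<subseteq> U \<union> V" using f e by (force simp: K_def bumps_def)
  have "normal_space X" using compact Hausdorff compact_Hausdorff_or_regular_imp_normal_space by blast
  moreover have "closedin X (K - U)" "closedin X (K - V)" using K U V by auto
  moreover have "disjnt (K - U) (K - V)" using KUV by (auto simp: disjnt_def)
  ultimately obtain u where u: "continuous_map X (top_of_set {0..1::real}) u" "u ` (K - U) \<subseteq> {0}" "u ` (K - V) \<subseteq> {1}"
    using Urysohn_lemma[of X "K - U" "K - V" 0 1] by auto
  have uc: "continuous_map X euclideanreal u" and u01: "\<And>x. x \<in> topspace X \<Longrightarrow> 0 \<le> u x \<and> u x \<le> 1"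
    using u(1) by (auto simp: continuous_map_in_subtopology Pi_iff)
  have g: "g \<in> bumps (U \<union> V)" "\<Lambda> f \<le> e + \<Lambda> g" unfolding g_def by (rule bump_cutoff[OF f e])+
  have gK: "g x = 0" if "x \<in> topspace X" "x \<notin> K" for x using that by (auto simp: g_def K_def)
  have u0: "u x = 0" if "x \<in> K" "x \<notin> U" for x using u(2) that by blast
  have u1: "u x = 1" if "x \<in> K" "x \<notin> V" for x using u(3) that by blast
  have 1: "(\<lambda>x. g x * u x) \<in> bumps U"
    using gK u0 u01 uc by (intro bump_mult[OF g(1)]) force+
  have 2: "(\<lambda>x. g x * (1 - u x)) \<in> bumps V"
    using gK u1 u01 uc by (intro bump_mult[OF g(1)] continuous_map_diff) force+
  have "\<Lambda> g = \<Lambda> (\<lambda>x. g x * u x) + \<Lambda> (\<lambda>x. g x * (1 - u x))"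
    using state_add[OF state bumps_C[OF 1] bumps_C[OF 2]] by (simp add: algebra_simps)
  thus "\<Lambda> f \<le> content U + content V + e"
    using g(2) content_upper[OF 1] content_upper[OF 2] by simp
qed

lemma content_UN_finite:
  assumes "\<And>i. i < (n::nat) \<Longrightarrow> openin X (U i)"
  shows "content (\<Union>i<n. U i) \<le> (\<Sum>i<n. content (U i))"
  using assms
proof (induction n)
  case (Suc n)
  have "content (\<Union>i<Suc n. U i) = content ((\<Union>i<n. U i) \<union> U n)" by (simp add: lessThan_Suc Un_commute)
  also have "\<dots> \<le> content (\<Union>i<n. U i) + content (U n)" using Suc by (intro content_Un) auto
  finally show ?case using Suc by simp
qed (simp add: content_empty)

lemma bump_UN:
  assumes U: "\<And>i::nat. openin X (U i)" and f: "f \<in> bumps (\<Union>i. U i)" and e: "e > 0"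
  obtains n where "\<Lambda> f \<le> e + (\<Sum>i<n. content (U i))"
proof -
  define K where "K = {x \<in> topspace X. f x \<in> {e..}}"
  have "closedin X K" unfolding K_def by (rule bump_level_closed[OF f])
  hence "compactin X K" using compact closedin_compact_space by blast
  moreover have KU: "K \<subseteq> \<Union>(range U)" using f e by (force simp: K_def bumps_def)
  ultimately obtain \<F> where F: "finite \<F>" "\<F> \<subseteq> range U" "K \<subseteq> \<Union>\<F>"
    using U unfolding compactin_def by (metis (no_types, lifting) rangeE)
  then obtain J where J: "finite J" "\<F> = U ` J" by (meson finite_subset_image)
  define n where "n = Suc (Max (insert 0 J))"
  have "J \<subseteq> {..<n}" using J(1) by (auto simp: n_def less_Suc_eq_le)
  hence KU: "K \<subseteq> (\<Union>i<n. U i)" using F(3) J(2) by blast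
  have g: "(\<lambda>x. max (f x - e) 0) \<in> bumps (\<Union>i<n. U i)"
    using bump_cutoff(1)[OF f e] KU unfolding bumps_def K_def by fastforce
  have "\<Lambda> f \<le> e + content (\<Union>i<n. U i)" using bump_cutoff(2)[OF f e] content_upper[OF g] by simp
  also have "content (\<Union>i<n. U i) \<le> (\<Sum>i<n. content (U i))" by (rule content_UN_finite[OF U])
  finally show ?thesis using that by simp
qed

lemma outer_lower: "openin X U \<Longrightarrow> A \<subseteq> U \<Longrightarrow> outer A \<le> content U"
  unfolding outer_def by (rule cINF_lower) (auto intro!: bdd_belowI2[of _ 0] content_nonneg)

lemma outer_greatest:
  "A \<subseteq> topspace X \<Longrightarrow> (\<And>U. openin X U \<Longrightarrow> A \<subseteq> U \<Longrightarrow> c \<le> content U) \<Longrightarrow> c \<le> outer A"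
  unfolding outer_def by (rule cINF_greatest) auto

lemma outer_open: "openin X U \<Longrightarrow> outer U = content U"
  using outer_lower[of U U] outer_greatest[of U "content U"] content_mono openin_subset[of X U]
  by (simp add: order_antisym)

lemma outer_nonneg: "A \<subseteq> topspace X \<Longrightarrow> 0 \<le> outer A"
  by (rule outer_greatest) (auto intro: content_nonneg)

lemma outer_mono: "A \<subseteq> B \<Longrightarrow> B \<subseteq> topspace X \<Longrightarrow> outer A \<le> outer B"
  by (rule outer_greatest) (auto intro: outer_lower)

lemma outer_approx:
  assumes "A \<subseteq> topspace X" "e > 0" obtains U where "openin X U" "A \<subseteq> U" "content U < outer A + e"
proof -
  have "\<not> (outer A + e \<le> outer A)" using assms by simp
  hence "\<exists>U. openin X U \<and> A \<subseteq> U \<and> \<not> outer A + e \<le> content U"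
    using outer_greatest[OF assms(1), of "outer A + e"] by blast
  thus ?thesis using that by force
qed

lemma outer_countably_subadditive:
  assumes A: "\<And>i::nat. A i \<subseteq> topspace X"
  shows "ennreal (outer (\<Union>i. A i)) \<le> (\<Sum>i. ennreal (outer (A i)))"
proof (rule ennreal_le_epsilon)
  fix e :: real assume e: "e > 0" and fin: "(\<Sum>i. ennreal (outer (A i))) < Orderings.top"
  have "\<exists>U. openin X U \<and> A i \<subseteq> U \<and> content U < outer (A i) + e / 2 * (1/2) ^ Suc i" for i
    using outer_approx[OF A[of i], of "e / 2 * (1/2) ^ Suc i"] e by (metis half_gt_zero mult_pos_pos zero_less_power zero_less_divide_1_iff zero_less_numeral)
  then obtain U where U: "\<And>i. openin X (U i)" "\<And>i. A i \<subseteq> U i"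
    "\<And>i. content (U i) < outer (A i) + e / 2 * (1/2) ^ Suc i" by metis
  define s where "s = enn2real (\<Sum>i. ennreal (outer (A i)))"
  have s: "ennreal s = (\<Sum>i. ennreal (outer (A i)))" using fin by (simp add: s_def)
  have part: "(\<Sum>i<n. outer (A i)) \<le> s" for n
  proof -
    have "ennreal (\<Sum>i<n. outer (A i)) = (\<Sum>i<n. ennreal (outer (A i)))"
      using outer_nonneg[OF A] by (simp add: sum_ennreal)
    also have "\<dots> \<le> ennreal s" unfolding s by (intro sum_le_suminf) auto
    finally show ?thesis by (subst (asm) ennreal_le_iff) (auto simp: s_def)
  qed
  have geo: "(\<Sum>i<n. e / 2 * (1/2) ^ Suc i) \<le> e / 2" for n :: nat
  proof -
    have "(\<Sum>i<n. (1/2) ^ Suc i :: real) = 1 - (1/2) ^ n" by (induction n) auto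
    hence "(\<Sum>i<n. (1/2) ^ Suc i :: real) \<le> 1" by simp
    hence "e / 2 * (\<Sum>i<n. (1/2) ^ Suc i) \<le> e / 2 * 1" using e by (intro mult_left_mono) auto
    thus ?thesis by (simp only: sum_distrib_left mult_1_right)
  qed
  have "outer (\<Union>i. A i) \<le> content (\<Union>i. U i)" using U by (intro outer_lower) auto
  also have "\<dots> \<le> s + e"
  proof (rule content_least)
    fix f assume "f \<in> bumps (\<Union>i. U i)"
    moreover have "e / 2 > 0" using e by simp
    ultimately obtain n where "\<Lambda> f \<le> e / 2 + (\<Sum>i<n. content (U i))"
      using bump_UN[of U f "e / 2", OF U(1)] by blast
    also have "(\<Sum>i<n. content (U i)) \<le> (\<Sum>i<n. outer (A i) + e / 2 * (1/2) ^ Suc i)"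
      using U(3) by (intro sum_mono less_imp_le)
    also have "\<dots> \<le> s + e / 2" using part[of n] geo[of n] by (simp only: sum.distrib)
    finally show "\<Lambda> f \<le> s + e" by simp
  qed
  finally have "ennreal (outer (\<Union>i. A i)) \<le> ennreal (s + e)" by (rule ennreal_leI)
  also have "\<dots> = ennreal s + ennreal e" using e by (simp add: s_def)
  finally show "ennreal (outer (\<Union>i. A i)) \<le> (\<Sum>i. ennreal (outer (A i))) + ennreal e" by (simp add: s)
qed

text \<open>Measurability of open sets in the sense of Caratheodory.  For an open \<open>W\<close> containing \<open>A\<close>, a bump
  function inside \<open>W \<inter> U\<close> and one inside the complement in \<open>W\<close> of the set where the former is large
  add up to a bump function inside \<open>W\<close>.\<close>

lemma outer_split:
  assumes U: "openin X U" and A: "A \<subseteq> topspace X"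
  shows "outer (A \<inter> U) + outer (A - U) \<le> outer A"
proof (rule outer_greatest[OF A])
  fix W assume W: "openin X W" "A \<subseteq> W"
  have "content (W \<inter> U) \<le> content W - outer (A - U)"
  proof (rule content_least, rule field_le_epsilon)
    fix f and e :: real assume f: "f \<in> bumps (W \<inter> U)" and e: "e > 0"
    define K where "K = {x \<in> topspace X. f x \<in> {e..}}"
    have K: "closedin X K" unfolding K_def by (rule bump_level_closed[OF f])
    have KU: "K \<subseteq> U" using f e by (force simp: K_def bumps_def)
    let ?g = "\<lambda>x. max (f x - e) 0"
    note g = bump_cutoff[OF f e]
    have "outer (A - U) \<le> content (W - K)" using W K KU by (intro outer_lower) auto
    also have "\<dots> \<le> content W - \<Lambda> ?g"
    proof (rule content_least)
      fix h assume h: "h \<in> bumps (W - K)"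
      have "(\<lambda>x. h x + ?g x) \<in> bumps W"
        unfolding bumps_def
      proof (intro CollectI conjI ballI impI)
        show "continuous_map X euclideanreal (\<lambda>x. h x + max (f x - e) 0)"
          using h g(1) by (intro continuous_map_add) (auto simp: bumps_def)
        fix x assume x: "x \<in> topspace X"
        have "h x = 0 \<or> f x < e" using h x by (auto simp: bumps_def K_def)
        moreover have "0 \<le> h x" "h x \<le> 1" "0 \<le> ?g x" "?g x \<le> 1" using h g(1) x by (auto simp: bumps_def)
        ultimately show "0 \<le> h x + ?g x" "h x + ?g x \<le> 1" by auto
        assume "x \<notin> W"
        hence "h x = 0" "?g x = 0" using h g(1) x by (auto simp: bumps_def)
        thus "h x + ?g x = 0" by simp
      qed
      from content_upper[OF this] show "\<Lambda> h \<le> content W - \<Lambda> ?g"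
        using state_add[OF state bumps_C[OF h] bumps_C[OF g(1)]] by simp
    qed
    finally show "\<Lambda> f \<le> content W - outer (A - U) + e" using g(2) by simp
  qed
  moreover have "outer (A \<inter> U) \<le> content (W \<inter> U)" using W U by (intro outer_lower) auto
  ultimately show "outer (A \<inter> U) + outer (A - U) \<le> content W" by simp
qed

definition riesz_measure :: "'x measure" where
  "riesz_measure = measure_of (topspace X) {U. openin X U} (\<lambda>A. ennreal (outer A))"

lemma space_riesz: "space riesz_measure = topspace X"
  and sets_riesz: "sets riesz_measure = sigma_sets (topspace X) {U. openin X U}"
proof -
  have "{U. openin X U} \<subseteq> Pow (topspace X)" using openin_subset by blast
  thus "space riesz_measure = topspace X" "sets riesz_measure = sigma_sets (topspace X) {U. openin X U}"
    by (simp_all add: riesz_measure_def)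
qed

lemma emeasure_riesz:
  assumes "A \<in> sets riesz_measure" shows "emeasure riesz_measure A = ennreal (outer A)"
proof -
  let ?f = "\<lambda>A. ennreal (outer A)"
  let ?M = "Pow (topspace X)"
  interpret P: sigma_algebra "topspace X" ?M by (rule sigma_algebra_Pow)
  have outer_empty: "outer {} = 0" using outer_open[of "{}"] content_empty by simp
  have "outer_measure_space ?M ?f"
    unfolding outer_measure_space_def
  proof (intro conjI)
    show "positive ?M ?f" by (simp add: positive_def outer_empty)
    show "increasing ?M ?f" by (auto simp: increasing_def intro!: ennreal_leI outer_mono)
    show "countably_subadditive ?M ?f"
      unfolding countably_subadditive_def by (auto intro!: outer_countably_subadditive)
  qed
  hence ms: "measure_space (topspace X) (lambda_system (topspace X) ?M ?f) ?f"
    by (rule P.caratheodory_lemma)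
  have "U \<in> lambda_system (topspace X) ?M ?f" if U: "openin X U" for U
    unfolding lambda_system_def
  proof (intro CollectI conjI ballI)
    show UX: "U \<in> ?M" using openin_subset[OF U] by simp
    fix A assume A: "A \<in> ?M"
    have eq: "?f (U \<inter> A) + ?f ((topspace X - U) \<inter> A) = ennreal (outer (A \<inter> U) + outer (A - U))"
    proof -
      have "U \<inter> A = A \<inter> U" "(topspace X - U) \<inter> A = A - U" using A by auto
      thus ?thesis using A by (simp add: outer_nonneg ennreal_plus[symmetric] del: ennreal_plus) (metis Diff_subset Int_lower1 dual_order.trans ennreal_plus outer_nonneg)
    qed
    show "?f (U \<inter> A) + ?f ((topspace X - U) \<inter> A) = ?f A"
    proof -
      have "?f A \<le> ?f (U \<inter> A) + ?f ((topspace X - U) \<inter> A)"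
      proof -
        let ?B = "\<lambda>i::nat. if i = 0 then A \<inter> U else if i = 1 then A - U else {}"
        have "A = (\<Union>i. ?B i)" by (auto split: if_splits)
        moreover have "?B i \<subseteq> topspace X" for i using A by auto
        ultimately have "?f A \<le> (\<Sum>i. ?f (?B i))" using outer_countably_subadditive[of ?B] by metis
        also have "\<dots> = (\<Sum>i<2. ?f (?B i))" by (rule suminf_finite) (auto simp: outer_empty)
        also have "\<dots> = ?f (A \<inter> U) + ?f (A - U)" by (simp add: numeral_2_eq_2)
        also have "A \<inter> U = U \<inter> A" by blast
        also have "A - U = (topspace X - U) \<inter> A" using A by auto
        finally show ?thesis .
      qed
      moreover have "ennreal (outer (A \<inter> U) + outer (A - U)) \<le> ?f A"
        using A outer_split[OF U, of A] by (intro ennreal_leI) auto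
      ultimately show ?thesis unfolding eq by (rule order_antisym[rotated])
    qed
  qed
  hence sub: "sigma_sets (topspace X) {U. openin X U} \<subseteq> lambda_system (topspace X) ?M ?f"
    using ms by (intro sigma_algebra.sigma_sets_subset) (auto simp: measure_space_def)
  show ?thesis
  proof (rule emeasure_measure_of[OF riesz_measure_def])
    show "{U. openin X U} \<subseteq> Pow (topspace X)" using openin_subset by blast
    show "positive (sets riesz_measure) ?f" by (simp add: positive_def outer_empty)
    show "countably_additive (sets riesz_measure) ?f"
      using ms sub unfolding sets_riesz measure_space_def countably_additive_def by blast
  qed (use assms in simp)
qed

lemma prob_space_riesz: "prob_space riesz_measure"
proof
  have "topspace X \<in> sets riesz_measure" using space_riesz sets.top by metis
  thus "emeasure riesz_measure (space riesz_measure) = 1"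
    by (simp add: space_riesz emeasure_riesz outer_open content_topspace)
qed

lemma riesz_measure_regular: "riesz_measure \<in> regular_prob_measures X"
  unfolding regular_prob_measures_def
proof (intro CollectI conjI prob_space_riesz space_riesz sets_riesz ballI)
  interpret prob_space riesz_measure by (rule prob_space_riesz)
  have op: "U \<in> events" if "openin X U" for U using that by (auto simp: sets_riesz)
  have ap: "\<exists>U. openin X U \<and> A \<subseteq> U \<and> prob U < prob A + e" if A: "A \<in> events" and e: "e > 0" for A e
  proof -
    have AX: "A \<subseteq> topspace X" using sets.sets_into_space[OF A] space_riesz by simp
    obtain U where "openin X U" "A \<subseteq> U" "content U < outer A + e" using outer_approx[OF AX e] by blast
    moreover have "prob U = outer U" "prob A = outer A"
      using emeasure_riesz A op[OF \<open>openin X U\<close>] outer_nonneg AX openin_subset[OF \<open>openin X U\<close>]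
      by (simp_all add: measure_def)
    ultimately show ?thesis using outer_open by auto
  qed
  fix A assume A: "A \<in> events"
  show "emeasure riesz_measure A = (INF U\<in>{U. A \<subseteq> U \<and> openin X U}. emeasure riesz_measure U)"
  proof (rule antisym)
    show "emeasure riesz_measure A \<le> (INF U\<in>{U. A \<subseteq> U \<and> openin X U}. emeasure riesz_measure U)"
      using op by (intro INF_greatest emeasure_mono) auto
    show "(INF U\<in>{U. A \<subseteq> U \<and> openin X U}. emeasure riesz_measure U) \<le> emeasure riesz_measure A"
    proof (rule ennreal_le_epsilon)
      fix e :: real assume "e > 0"
      then obtain U where U: "openin X U" "A \<subseteq> U" "prob U < prob A + e" using ap[OF A] by blast
      have "(INF U\<in>{U. A \<subseteq> U \<and> openin X U}. emeasure riesz_measure U) \<le> emeasure riesz_measure U"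
        using U by (intro INF_lower) auto
      also have "\<dots> \<le> ennreal (prob A + e)" using U(3) by (simp add: emeasure_eq_measure ennreal_leI)
      also have "\<dots> = emeasure riesz_measure A + ennreal e" using \<open>e > 0\<close> by (simp add: emeasure_eq_measure)
      finally show "(INF U\<in>{U. A \<subseteq> U \<and> openin X U}. emeasure riesz_measure U) \<le> emeasure riesz_measure A + ennreal e" .
    qed
  qed
  have cp: "closedin X C \<and> C \<in> events" if "compactin X C" for C
  proof -
    have c: "closedin X C" using that Hausdorff compactin_imp_closedin by blast
    hence "space riesz_measure - (topspace X - C) \<in> events" using op[of "topspace X - C"] by (intro sets.compl_sets) blast
    hence "topspace X - (topspace X - C) \<in> events" by (simp add: space_riesz)
    thus ?thesis using c closedin_subset[OF c] by (simp add: double_diff)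
  qed
  show "emeasure riesz_measure A = (SUP C\<in>{C. C \<subseteq> A \<and> compactin X C}. emeasure riesz_measure C)"
  proof (rule antisym)
    show "(SUP C\<in>{C. C \<subseteq> A \<and> compactin X C}. emeasure riesz_measure C) \<le> emeasure riesz_measure A"
      using A by (intro SUP_least emeasure_mono) auto
    show "emeasure riesz_measure A \<le> (SUP C\<in>{C. C \<subseteq> A \<and> compactin X C}. emeasure riesz_measure C)"
    proof (rule ennreal_le_epsilon)
      fix e :: real assume e: "e > 0"
      have "space riesz_measure - A \<in> events" using A by auto
      then obtain U where U: "openin X U" "space riesz_measure - A \<subseteq> U" "prob U < prob (space riesz_measure - A) + e"
        using ap[OF _ e] by blast
      have "closedin X (topspace X - U)" using U(1) by blast
      hence "compactin X (topspace X - U)" using closedin_compact_space compact by blast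
      moreover have "topspace X - U \<subseteq> A" using U(2) space_riesz by auto
      ultimately have "emeasure riesz_measure (topspace X - U) \<le> (SUP C\<in>{C. C \<subseteq> A \<and> compactin X C}. emeasure riesz_measure C)"
        by (intro SUP_upper) auto
      moreover have "prob A \<le> prob (topspace X - U) + e"
        using U(3) prob_compl[OF A] prob_compl[OF op[OF U(1)]] space_riesz by simp
      hence "emeasure riesz_measure A \<le> emeasure riesz_measure (topspace X - U) + ennreal e"
        using e by (simp add: emeasure_eq_measure ennreal_leI flip: ennreal_plus)
      ultimately show "emeasure riesz_measure A \<le> (SUP C\<in>{C. C \<subseteq> A \<and> compactin X C}. emeasure riesz_measure C) + ennreal e"
        by (meson add_right_mono order_trans)
    qed
  qed
qed

text \<open>Slice \<open>f\<close> horizontally into \<open>n\<close> pieces of height \<open>1 / n\<close>: the piece above level \<open>i / n\<close> is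
  bounded by \<open>1 / n\<close> times the indicator of \<open>{f > i / n}\<close> from above, and of \<open>{f > (i + 1) / n}\<close>
  from below.\<close>

lemma riesz_le_integral:
  assumes f: "continuous_map X euclideanreal f" and f01: "\<And>x. x \<in> topspace X \<Longrightarrow> 0 \<le> f x \<and> f x \<le> 1"
  shows "\<Lambda> f \<le> (\<integral>x. f x \<partial>riesz_measure)"
proof (rule field_le_epsilon)
  interpret prob_space riesz_measure by (rule prob_space_riesz)
  note int = regular_prob_measures_integral[OF compact riesz_measure_regular]
  fix e :: real assume "e > 0"
  then obtain n where n: "n > 0" "inverse (real n) < e" using ex_inverse_of_nat_less by blast
  define g where "g = (\<lambda>(i::nat) x. min (f x) (real (Suc i) / n) - min (f x) (real i / n))"
  define U where "U = (\<lambda>i::nat. {x \<in> topspace X. f x \<in> {real i / n<..}})"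
  have g: "continuous_map X euclideanreal (g i)" for i
    unfolding g_def using f by (intro continuous_map_diff continuous_map_real_min) auto
  have Uo: "openin X (U i)" for i unfolding U_def by (rule openin_continuous_map_preimage[OF f]) auto
  hence Ue: "U i \<in> events" for i by (auto simp: sets_riesz)
  have probU: "prob (U i) = content (U i)" for i
    using emeasure_riesz[OF Ue] outer_open[OF Uo] content_nonneg by (simp add: measure_def)
  have sumg: "(\<Sum>i<n. g i x) = f x" if "x \<in> topspace X" for x
    using sum_lessThan_telescope[of "\<lambda>i. min (f x) (real i / n)" n] f01[OF that] n(1) by (simp add: g_def)
  have mono: "real i / n \<le> real (Suc i) / n" for i :: nat using n by (intro divide_right_mono) auto
  have step: "real (Suc i) / n - real i / n = 1 / n" for i :: nat by (simp add: add_divide_distrib)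
  have up: "\<Lambda> (g i) \<le> 1 / n * prob (U i)" for i
  proof -
    have "(\<lambda>x. n * g i x) \<in> bumps (U i)"
      unfolding bumps_def
    proof (intro CollectI conjI ballI impI)
      show "continuous_map X euclideanreal (\<lambda>x. n * g i x)" using g by (intro continuous_map_real_mult) auto
      fix x assume x: "x \<in> topspace X"
      show "0 \<le> real n * g i x" using mono[of i] by (auto simp: g_def)
      have "g i x \<le> 1 / n" unfolding g_def using step[of i] mono[of i] by linarith
      thus "real n * g i x \<le> 1" using n(1) by (simp add: field_simps)
      assume "x \<notin> U i"
      thus "real n * g i x = 0" using x mono[of i] by (auto simp: g_def U_def)
    qed
    from content_upper[OF this] have "n * \<Lambda> (g i) \<le> prob (U i)"
      using state_scale[OF state, of "g i" "real n"] g probU by (simp add: C_space_def)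
    thus ?thesis using n(1) by (simp add: field_simps)
  qed
  have lo: "1 / n * prob (U (Suc i)) \<le> (\<integral>x. g i x \<partial>riesz_measure)" for i
  proof -
    have "(\<integral>x. 1 / n * indicator (U (Suc i)) x \<partial>riesz_measure) \<le> (\<integral>x. g i x \<partial>riesz_measure)"
    proof (rule integral_mono)
      show "integrable riesz_measure (\<lambda>x. 1 / n * indicator (U (Suc i)) x)"
        using Ue by (intro integrable_mult_right integrable_real_indicator) (auto simp: emeasure_eq_measure)
      show "integrable riesz_measure (g i)" by (rule int(2)[OF g])
      fix x assume "x \<in> space riesz_measure"
      show "1 / real n * indicator (U (Suc i)) x \<le> g i x"
        using mono[of i] step[of i] by (auto simp: g_def U_def indicator_def)
    qed
    thus ?thesis using Ue[of "Suc i"] by simp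
  qed
  have "\<Lambda> f = \<Lambda> (\<lambda>x. \<Sum>i<n. g i x)"
    using f g sumg by (intro state_cong[OF state]) (auto simp: C_space_def intro!: continuous_map_sum)
  also have "\<dots> = (\<Sum>i<n. \<Lambda> (g i))" using g by (intro state_sum[OF state]) (auto simp: C_space_def)
  also have "\<dots> \<le> (\<Sum>i<n. 1 / n * prob (U i))" by (intro sum_mono up)
  also have "\<dots> = (\<Sum>i<n. 1 / n * prob (U (Suc i))) - 1 / n * (\<Sum>i<n. prob (U (Suc i)) - prob (U i))"
    by (simp add: sum_distrib_left sum_subtractf algebra_simps)
  also have "(\<Sum>i<n. prob (U (Suc i)) - prob (U i)) = prob (U n) - prob (U 0)"
    by (rule sum_lessThan_telescope)
  also have "(\<Sum>i<n. 1 / n * prob (U (Suc i))) - 1 / n * (prob (U n) - prob (U 0)) \<le>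
      (\<Sum>i<n. \<integral>x. g i x \<partial>riesz_measure) + 1 / n"
  proof -
    have "prob (U 0) - prob (U n) \<le> 1" using prob_le_1[of "U 0"] measure_nonneg[of riesz_measure "U n"] by linarith
    hence "1 / n * (prob (U 0) - prob (U n)) \<le> 1 / n * 1" by (intro mult_left_mono) auto
    hence "- (1 / n * (prob (U n) - prob (U 0))) \<le> 1 / n" by (simp add: algebra_simps)
    moreover have "(\<Sum>i<n. 1 / n * prob (U (Suc i))) \<le> (\<Sum>i<n. \<integral>x. g i x \<partial>riesz_measure)"
      by (intro sum_mono lo)
    ultimately show ?thesis by linarith
  qed
  also have "(\<Sum>i<n. \<integral>x. g i x \<partial>riesz_measure) = (\<integral>x. (\<Sum>i<n. g i x) \<partial>riesz_measure)"
    by (rule Bochner_Integration.integral_sum[symmetric]) (rule int(2)[OF g])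
  also have "\<dots> = (\<integral>x. f x \<partial>riesz_measure)"
    using sumg by (intro Bochner_Integration.integral_cong) (auto simp: space_riesz)
  finally show "\<Lambda> f \<le> (\<integral>x. f x \<partial>riesz_measure) + e" using n(2) by (simp add: inverse_eq_divide)
qed

theorem riesz_representation: "integral_functional X riesz_measure = \<Lambda>"
proof
  interpret prob_space riesz_measure by (rule prob_space_riesz)
  note int = regular_prob_measures_integral[OF compact riesz_measure_regular]
  note s = integral_functional_state[OF compact riesz_measure_regular]
  have unit: "\<Lambda> f = integral_functional X riesz_measure f"
    if f: "f \<in> C_space X" and f01: "\<And>x. x \<in> topspace X \<Longrightarrow> 0 \<le> f x \<and> f x \<le> 1" for f
  proof (rule antisym)
    have c: "continuous_map X euclideanreal f" "continuous_map X euclideanreal (\<lambda>x. 1 - f x)"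
      using f by (auto simp: C_space_def intro: continuous_map_diff)
    show "\<Lambda> f \<le> integral_functional X riesz_measure f"
      using riesz_le_integral[OF c(1) f01] c by (simp add: integral_functional_def)
    have "\<Lambda> (\<lambda>x. 1 - f x) \<le> integral_functional X riesz_measure (\<lambda>x. 1 - f x)"
      using riesz_le_integral[OF c(2)] f01 c by (simp add: integral_functional_def)
    thus "integral_functional X riesz_measure f \<le> \<Lambda> f"
      using state_diff[OF s const f, of 1] state_diff[OF state const f, of 1] state_const[OF s] state_const[OF state] by simp
  qed
  fix f
  show "integral_functional X riesz_measure f = \<Lambda> f"
  proof (cases "f \<in> C_space X")
    case False
    thus ?thesis using state_outside[OF s False] state_outside[OF state False] by simp
  next
    case True
    obtain B0 where B0: "\<And>x. x \<in> topspace X \<Longrightarrow> \<bar>f x\<bar> \<le> B0" using bounded[OF True] by blast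
    define B where "B = \<bar>B0\<bar> + 1"
    have B: "\<And>x. x \<in> topspace X \<Longrightarrow> \<bar>f x\<bar> \<le> B" "B > 0" using B0 by (auto simp: B_def intro: order_trans[OF B0])
    define g where "g = (\<lambda>x. 1 / 2 + 1 / (2 * B) * f x)"
    have g: "g \<in> C_space X" unfolding g_def by (intro add scale const True)
    have "0 \<le> g x \<and> g x \<le> 1" if "x \<in> topspace X" for x
      using B(1)[OF that] B(2) by (auto simp: g_def field_simps abs_le_iff)
    hence "\<Lambda> g = integral_functional X riesz_measure g" by (rule unit[OF g])
    moreover have "\<Lambda> g = 1 / 2 + 1 / (2 * B) * \<Lambda> f"
      by (simp only: g_def state_add[OF state const scale[OF True]] state_const[OF state] state_scale[OF state True])
    moreover have "integral_functional X riesz_measure g = 1 / 2 + 1 / (2 * B) * integral_functional X riesz_measure f"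
      by (simp only: g_def state_add[OF s const scale[OF True]] state_const[OF s] state_scale[OF s True])
    ultimately show ?thesis using B(2) by simp
  qed
qed

end

lemma P_space_eq_state_space:
  assumes "compact_space X" "Hausdorff_space X"
  shows "P_space X = state_space (C_space X) (nonneg_on (topspace X))"
proof -
  have "integral_functional X ` regular_prob_measures X = states (C_space X) (nonneg_on (topspace X))"
  proof (intro equalityI subsetI)
    fix \<Lambda> assume "\<Lambda> \<in> states (C_space X) (nonneg_on (topspace X))"
    then interpret riesz_functional X \<Lambda> using assms by unfold_locales
    show "\<Lambda> \<in> integral_functional X ` regular_prob_measures X"
      using riesz_representation riesz_measure_regular by (metis imageI)
  qed (use integral_functional_state[OF assms(1)] in auto)
  thus ?thesis by (simp add: P_space_def)
qed

text \<open>By the change of variables formula the result does not depend on the measure that is chosen to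
  represent a functional.\<close>

lemma P_action_eq_state_action:
  assumes X: "compact_space X" "Hausdorff_space X" and a: "continuous_map X X (a g)"
  shows "P_action X a g = state_action (C_space X) (nonneg_on (topspace X)) a g"
proof -
  have "integral_functional X (distr \<mu> \<mu> (a g)) f =
      (if f \<in> C_space X then integral_functional X \<mu> (\<lambda>x. f (a g x)) else 0)"
    if \<mu>: "\<mu> \<in> regular_prob_measures X" for \<mu> f
  proof (cases "f \<in> C_space X")
    case True
    have sp: "space \<mu> = topspace X" and sets: "sets \<mu> = sigma_sets (topspace X) {U. openin X U}"
      using \<mu> by (auto simp: regular_prob_measures_def)
    have f: "continuous_map X euclideanreal f" using True by (simp add: C_space_def)
    have "a g \<in> measurable \<mu> \<mu>"
    proof (rule measurable_sigma_sets[OF sets])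
      show "{U. openin X U} \<subseteq> Pow (topspace X)" using openin_subset by blast
      show "a g \<in> space \<mu> \<rightarrow> topspace X" using a sp by (auto simp: continuous_map_def)
      fix U assume "U \<in> {U. openin X U}"
      hence "openin X {x \<in> topspace X. a g x \<in> U}" using openin_continuous_map_preimage[OF a] by blast
      moreover have "a g -` U \<inter> space \<mu> = {x \<in> topspace X. a g x \<in> U}" using sp by auto
      ultimately show "a g -` U \<inter> space \<mu> \<in> sets \<mu>" using sets by auto
    qed
    hence "(\<integral>x. f x \<partial>distr \<mu> \<mu> (a g)) = (\<integral>x. f (a g x) \<partial>\<mu>)"
      using regular_prob_measures_integral(1)[OF X(1) \<mu> f] by (rule integral_distr)
    moreover have "continuous_map X euclideanreal (\<lambda>x. f (a g x))"
      using continuous_map_compose[OF a f] by (simp add: o_def)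
    ultimately show ?thesis using f True by (simp add: integral_functional_def)
  qed (simp add: integral_functional_def C_space_def)
  moreover have "inv_into (regular_prob_measures X) (integral_functional X) \<Lambda> \<in> regular_prob_measures X"
    "integral_functional X (inv_into (regular_prob_measures X) (integral_functional X) \<Lambda>) = \<Lambda>"
    if "\<Lambda> \<in> topspace (P_space X)" for \<Lambda>
    using that by (auto simp: P_space_def intro: inv_into_into f_inv_into_f)
  moreover have "topspace (P_space X) = states (C_space X) (nonneg_on (topspace X))"
    by (simp add: P_space_eq_state_space[OF X])
  ultimately show ?thesis
    unfolding P_action_def state_action_def Let_def by (auto simp: fun_eq_iff restrict_def)
qed

section \<open>Length functions on topological groups\<close>

locale top_group = group G for G :: "('g, 'm) monoid_scheme" (structure) +
  fixes T :: "'g topology"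
  assumes top_group: "topological_group G T"
begin

lemma topspace_T: "topspace T = carrier G" using top_group by (simp add: topological_group_def)

lemma open_carrier: "openin T U \<Longrightarrow> u \<in> U \<Longrightarrow> u \<in> carrier G"
  using openin_subset topspace_T by blast

lemma mult_continuous:
  assumes "continuous_map X T f" "continuous_map X T h" shows "continuous_map X T (\<lambda>x. f x \<otimes> h x)"
proof -
  have "continuous_map X T ((\<lambda>(x, y). x \<otimes> y) \<circ> (\<lambda>x. (f x, h x)))"
    using assms top_group
    by (intro continuous_map_compose[of _ "prod_topology T T"] continuous_map_pairedI) (auto simp: topological_group_def)
  thus ?thesis by (simp add: o_def)
qed

lemma inv_continuous: "continuous_map T T (\<lambda>x. inv x)"
  using top_group by (simp add: topological_group_def)

lemma open_inv: "openin T U \<Longrightarrow> openin T {x \<in> carrier G. inv x \<in> U}"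
  using openin_continuous_map_preimage[OF inv_continuous, of U] by (simp add: topspace_T)

lemma open_translate:
  assumes "openin T U" "a \<in> carrier G" "b \<in> carrier G"
  shows "openin T {x \<in> carrier G. a \<otimes> x \<otimes> b \<in> U}"
proof -
  have "continuous_map T T (\<lambda>x. a \<otimes> x \<otimes> b)"
    using assms topspace_T by (intro mult_continuous) auto
  from openin_continuous_map_preimage[OF this assms(1)] show ?thesis by (simp add: topspace_T)
qed

lemma nbhd_square:
  assumes U: "openin T U" "\<one> \<in> U"
  obtains V where "openin T V" "\<one> \<in> V" "\<And>x y. x \<in> V \<Longrightarrow> y \<in> V \<Longrightarrow> x \<otimes> y \<in> U"
proof -
  define Z where "Z = {z \<in> topspace (prod_topology T T). (\<lambda>(x, y). x \<otimes> y) z \<in> U}"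
  have "continuous_map (prod_topology T T) T (\<lambda>(x, y). x \<otimes> y)"
    using top_group by (simp add: topological_group_def)
  hence "openin (prod_topology T T) Z"
    unfolding Z_def using U(1) by (rule openin_continuous_map_preimage)
  moreover have "(\<one>, \<one>) \<in> Z" using U(2) by (simp add: topspace_T Z_def)
  ultimately obtain A B where AB: "openin T A" "openin T B" "\<one> \<in> A" "\<one> \<in> B" "A \<times> B \<subseteq> Z"
    using openin_prod_topology_alt[of T T Z] by blast
  have "x \<otimes> y \<in> U" if "x \<in> A" "y \<in> B" for x y using AB(5) that by (auto simp: Z_def)
  note AB = AB this
  show ?thesis using AB by (intro that[of "A \<inter> B"]) auto
qed

lemma nbhd_cube:
  assumes U: "openin T U" "\<one> \<in> U"
  shows "\<exists>V. openin T V \<and> \<one> \<in> V \<and> (\<forall>x\<in>V. inv x \<in> V) \<and> (\<forall>x\<in>V. \<forall>y\<in>V. \<forall>z\<in>V. x \<otimes> y \<otimes> z \<in> U)"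
proof -
  obtain V1 where V1: "openin T V1" "\<one> \<in> V1" "\<And>x y. x \<in> V1 \<Longrightarrow> y \<in> V1 \<Longrightarrow> x \<otimes> y \<in> U"
    using nbhd_square[OF U] by blast
  obtain V2 where V2: "openin T V2" "\<one> \<in> V2" "\<And>x y. x \<in> V2 \<Longrightarrow> y \<in> V2 \<Longrightarrow> x \<otimes> y \<in> V1"
    using nbhd_square[OF V1(1,2)] by blast
  let ?V = "V2 \<inter> {x \<in> carrier G. inv x \<in> V2}"
  have "openin T ?V" using V2(1) open_inv by blast
  moreover have "\<one> \<in> ?V" using V2(2) by simp
  moreover have "x \<otimes> y \<otimes> z \<in> U" if "x \<in> ?V" "y \<in> ?V" "z \<in> ?V" for x y z
    using V1(3)[OF V2(3)[of x y] V2(3)[of \<one> z]] V2(2) that by auto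
  ultimately show ?thesis by (intro exI[of _ ?V]) auto
qed

text \<open>A chain is a factorization of a group element; a factor \<open>v\<close> in the \<open>n\<close>-th neighbourhood is listed
  as \<open>(n, v)\<close> and costs \<open>(1/2) ^ n\<close>.\<close>

definition chain_prod :: "(nat \<times> 'g) list \<Rightarrow> 'g" where
  "chain_prod xs = foldr (\<lambda>(n, v) p. v \<otimes> p) xs \<one>"

definition chain_sum :: "(nat \<times> 'g) list \<Rightarrow> real" where
  "chain_sum xs = (\<Sum>(n, v)\<leftarrow>xs. (1/2) ^ n)"

lemma chain_sum_simps [simp]: "chain_sum [] = 0" "chain_sum (x # xs) = (1/2) ^ fst x + chain_sum xs"
  "chain_sum (xs @ ys) = chain_sum xs + chain_sum ys"
  by (auto simp: chain_sum_def case_prod_unfold)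

lemma chain_sum_nonneg: "0 \<le> chain_sum xs" by (induction xs) auto

lemma chain_prod_simps [simp]: "chain_prod [] = \<one>" "chain_prod (x # xs) = snd x \<otimes> chain_prod xs"
  by (auto simp: chain_prod_def case_prod_unfold)

lemma chain_prod_closed: "snd ` set xs \<subseteq> carrier G \<Longrightarrow> chain_prod xs \<in> carrier G"
  by (induction xs) auto

lemma chain_prod_append:
  "snd ` set xs \<subseteq> carrier G \<Longrightarrow> snd ` set ys \<subseteq> carrier G \<Longrightarrow> chain_prod (xs @ ys) = chain_prod xs \<otimes> chain_prod ys"
  by (induction xs) (auto simp: m_assoc chain_prod_closed)

text \<open>Every chain has an entry such that the parts before and after it carry at most half of
  the sum each.\<close>

lemma chain_split:
  assumes "xs \<noteq> []"
  obtains ys z zs where "xs = ys @ z # zs" "chain_sum ys \<le> chain_sum xs / 2" "chain_sum zs \<le> chain_sum xs / 2"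
proof -
  \<comment> \<open>An arbitrary threshold \<open>c\<close> makes the statement inductive.\<close>
  have "\<exists>ys z zs. xs = ys @ z # zs \<and> chain_sum ys \<le> c \<and> chain_sum zs \<le> chain_sum xs - c"
    if "xs \<noteq> []" "0 \<le> c" "c \<le> chain_sum xs" for xs c
    using that
  proof (induction xs arbitrary: c)
    case (Cons x xs)
    show ?case
    proof (cases "c \<le> (1/2) ^ fst x \<or> xs = []")
      case True
      thus ?thesis using Cons.prems by (intro exI[of _ "[]"] exI[of _ x] exI[of _ xs]) auto
    next
      case False
      then obtain ys z zs where "xs = ys @ z # zs" "chain_sum ys \<le> c - (1/2) ^ fst x"
        "chain_sum zs \<le> chain_sum xs - (c - (1/2) ^ fst x)"
        using Cons.IH[of "c - (1/2) ^ fst x"] Cons.prems False by (metis add_diff_cancel_left' chain_sum_simps(2) diff_ge_0_iff_ge diff_right_mono linorder_le_cases)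
      thus ?thesis by (intro exI[of _ "x # ys"] exI[of _ z] exI[of _ zs]) auto
    qed
  qed simp
  from this[OF assms, of "chain_sum xs / 2"] chain_sum_nonneg[of xs] show ?thesis using that by auto
qed

text \<open>Split the chain at an entry such that the two remaining parts are at most half as expensive.  By
  induction each of the three factors lies in \<open>V (Suc k)\<close>.\<close>

lemma chain_prod_small:
  assumes V: "\<And>n. \<one> \<in> V n" "\<And>n x y z. x \<in> V (Suc n) \<Longrightarrow> y \<in> V (Suc n) \<Longrightarrow> z \<in> V (Suc n) \<Longrightarrow> x \<otimes> y \<otimes> z \<in> V n"
    and carr: "\<And>n. V n \<subseteq> carrier G"
  shows "\<forall>(n, v)\<in>set xs. v \<in> V n \<Longrightarrow> chain_sum xs < (1/2) ^ k \<Longrightarrow> chain_prod xs \<in> V k"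
proof (induction "length xs" arbitrary: xs k rule: less_induct)
  case less
  have dec: "V (Suc n) \<subseteq> V n" for n using V(1) V(2)[of _ n \<one> \<one>] carr[of "Suc n"] by force
  have antimono: "V m \<subseteq> V n" if "n \<le> m" for m n using lift_Suc_antimono_le[of V, OF dec that] .
  show ?case
  proof (cases "xs = []")
    case True thus ?thesis using V(1) by simp
  next
    case False
    obtain ys z zs where xs: "xs = ys @ z # zs" "chain_sum ys \<le> chain_sum xs / 2" "chain_sum zs \<le> chain_sum xs / 2"
      using chain_split[OF False] by blast
    have "chain_prod ys \<in> V (Suc k)" "chain_prod zs \<in> V (Suc k)"
      using xs less.prems by (intro less.hyps; force)+
    moreover have "snd z \<in> V (Suc k)"
    proof -
      have "(1/2) ^ fst z < (1/2 :: real) ^ k"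
        using less.prems(2) chain_sum_nonneg[of ys] chain_sum_nonneg[of zs]
        unfolding xs(1) chain_sum_simps by linarith
      moreover have "(1/2 :: real) ^ k \<le> (1/2) ^ fst z" if "fst z \<le> k"
        using that by (intro power_decreasing) auto
      ultimately have "k < fst z" by (meson leD linorder_not_less)
      thus ?thesis using antimono[of "Suc k" "fst z"] less.prems(1) xs(1) by fastforce
    qed
    moreover have "chain_prod xs = chain_prod ys \<otimes> snd z \<otimes> chain_prod zs"
    proof -
      have "snd ` set ys \<subseteq> carrier G" "snd ` set (z # zs) \<subseteq> carrier G"
        using less.prems(1) carr unfolding xs(1) by fastforce+
      thus ?thesis unfolding xs(1) by (subst chain_prod_append) (auto simp: m_assoc chain_prod_closed)
    qed
    ultimately show ?thesis using V(2) by simp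
  qed
qed

text \<open>The Birkhoff--Kakutani construction: the length of a group element is the infimum of the costs
  of its factorizations.\<close>

theorem length_function:
  assumes U: "openin T U" "\<one> \<in> U"
  obtains l :: "'g \<Rightarrow> real"
  where "\<And>x. 0 \<le> l x" "\<And>x. l x \<le> 1" "l \<one> = 0"
    "\<And>x y. x \<in> carrier G \<Longrightarrow> y \<in> carrier G \<Longrightarrow> l (x \<otimes> y) \<le> l x + l y"
    "\<And>x. x \<in> carrier G \<Longrightarrow> l (inv x) = l x"
    "\<And>e. e > 0 \<Longrightarrow> \<exists>W. openin T W \<and> \<one> \<in> W \<and> (\<forall>w\<in>W. l w < e)"
    "\<And>x. x \<notin> U \<Longrightarrow> l x = 1"
proof -
  define P where "P = (\<lambda>V. openin T V \<and> \<one> \<in> V \<and> (\<forall>x\<in>V. inv x \<in> V))"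
  obtain V0 where V0: "P V0" "V0 \<subseteq> U"
  proof -
    obtain V where "openin T V" "\<one> \<in> V" "\<forall>x\<in>V. inv x \<in> V" "\<forall>x\<in>V. \<forall>y\<in>V. \<forall>z\<in>V. x \<otimes> y \<otimes> z \<in> U"
      using nbhd_cube[OF U] by blast
    moreover have "V \<subseteq> U" using calculation open_carrier by (metis r_one subsetI one_closed)
    ultimately show ?thesis using that by (auto simp: P_def)
  qed
  obtain V where V: "V 0 = V0" "\<And>n. P (V n)"
    "\<And>n. \<forall>x\<in>V (Suc n). \<forall>y\<in>V (Suc n). \<forall>z\<in>V (Suc n). x \<otimes> y \<otimes> z \<in> V n"
  proof -
    have "\<exists>V. \<forall>n. (P (V n) \<and> (n = 0 \<longrightarrow> V n = V0)) \<and>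
        (\<forall>x\<in>V (Suc n). \<forall>y\<in>V (Suc n). \<forall>z\<in>V (Suc n). x \<otimes> y \<otimes> z \<in> V n)"
    proof (rule dependent_nat_choice)
      fix W and n :: nat assume "P W \<and> (n = 0 \<longrightarrow> W = V0)"
      then obtain Y where "openin T Y" "\<one> \<in> Y" "\<forall>x\<in>Y. inv x \<in> Y" "\<forall>x\<in>Y. \<forall>y\<in>Y. \<forall>z\<in>Y. x \<otimes> y \<otimes> z \<in> W"
        using nbhd_cube[of W] by (auto simp: P_def)
      thus "\<exists>Y. (P Y \<and> (Suc n = 0 \<longrightarrow> Y = V0)) \<and> (\<forall>x\<in>Y. \<forall>y\<in>Y. \<forall>z\<in>Y. x \<otimes> y \<otimes> z \<in> W)"
        by (auto simp: P_def)
    qed (use V0 in auto)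
    thus ?thesis using that by blast
  qed
  have carr: "V n \<subseteq> carrier G" for n using V(2)[of n] open_carrier by (auto simp: P_def)
  have one: "\<one> \<in> V n" for n using V(2)[of n] by (simp add: P_def)
  have inv: "inv x \<in> V n" if "x \<in> V n" for x n using V(2)[of n] that by (simp add: P_def)
  define chains where "chains = (\<lambda>x. {xs. (\<forall>(n, v)\<in>set xs. v \<in> V n) \<and> chain_prod xs = x})"
  have ccarr: "snd ` set xs \<subseteq> carrier G" if "xs \<in> chains x" for xs x
    using that carr by (fastforce simp: chains_def)
  define l where "l = (\<lambda>x. Inf (insert 1 (chain_sum ` chains x)))"
  have lower: "l x \<le> chain_sum xs" if "xs \<in> chains x" for x xs
    unfolding l_def using that chain_sum_nonneg by (intro cInf_lower bdd_belowI[of _ 0]) auto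
  have le1: "l x \<le> 1" for x
    unfolding l_def using chain_sum_nonneg by (intro cInf_lower bdd_belowI[of _ 0]) auto
  have greatest: "c \<le> l x" if "c \<le> 1" "\<And>xs. xs \<in> chains x \<Longrightarrow> c \<le> chain_sum xs" for x c
    unfolding l_def using that by (intro cInf_greatest) auto
  have nonneg: "0 \<le> l x" for x by (rule greatest) (auto simp: chain_sum_nonneg)
  show ?thesis
  proof (rule that[of l])
    show "l \<one> = 0" using lower[of "[]" \<one>] nonneg[of \<one>] by (simp add: chains_def)
  next
    fix x y assume xy: "x \<in> carrier G" "y \<in> carrier G"
    have "l (x \<otimes> y) \<le> chain_sum xs + chain_sum ys" if "xs \<in> chains x" "ys \<in> chains y" for xs ys
    proof -
      have "xs @ ys \<in> chains (x \<otimes> y)"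
        using that ccarr[OF that(1)] ccarr[OF that(2)] by (auto simp: chains_def chain_prod_append)
      from lower[OF this] show ?thesis by simp
    qed
    moreover have "l (x \<otimes> y) \<le> c + d" if "c = 1 \<or> d = 1" "0 \<le> c" "0 \<le> d" for c d
      using le1[of "x \<otimes> y"] that by auto
    ultimately have *: "l (x \<otimes> y) \<le> c + d"
      if "c \<in> insert 1 (chain_sum ` chains x)" "d \<in> insert 1 (chain_sum ` chains y)" for c d
    proof -
      assume "\<And>xs ys. xs \<in> chains x \<Longrightarrow> ys \<in> chains y \<Longrightarrow> l (x \<otimes> y) \<le> chain_sum xs + chain_sum ys"
        and 1: "\<And>c d. c = 1 \<or> d = 1 \<Longrightarrow> 0 \<le> c \<Longrightarrow> 0 \<le> d \<Longrightarrow> l (x \<otimes> y) \<le> c + d"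
      moreover have "0 \<le> c" "0 \<le> d" using that chain_sum_nonneg by auto
      ultimately show ?thesis using that by blast
    qed
    have "l (x \<otimes> y) - c \<le> l y" if c: "c \<in> insert 1 (chain_sum ` chains x)" for c
    proof (rule greatest)
      show "l (x \<otimes> y) - c \<le> 1" using *[OF c, of 1] by simp
      show "l (x \<otimes> y) - c \<le> chain_sum ys" if "ys \<in> chains y" for ys
        using *[OF c, of "chain_sum ys"] that by simp
    qed
    note ** = this
    have "l (x \<otimes> y) - l y \<le> l x"
    proof (rule greatest)
      show "l (x \<otimes> y) - l y \<le> 1" using **[of 1] by simp
      show "l (x \<otimes> y) - l y \<le> chain_sum xs" if "xs \<in> chains x" for xs
        using **[of "chain_sum xs"] that by simp
    qed
    thus "l (x \<otimes> y) \<le> l x + l y" by simp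
  next
    have half: "l (inv x) \<le> l x" if x: "x \<in> carrier G" for x
    proof (rule greatest[OF le1])
      fix xs assume xs: "xs \<in> chains x"
      have gen: "(\<forall>(n, v)\<in>set xs. v \<in> V n) \<Longrightarrow>
        chain_prod (rev (map (\<lambda>(n, v). (n, inv v)) xs)) = inv (chain_prod xs) \<and>
        chain_sum (rev (map (\<lambda>(n, v). (n, inv v)) xs)) = chain_sum xs" for xs
      proof (induction xs)
        case (Cons a xs)
        have "snd ` set (a # xs) \<subseteq> carrier G" using Cons.prems carr by fastforce
        hence c: "snd a \<in> carrier G" "snd ` set xs \<subseteq> carrier G" by auto
        hence c': "snd ` set (rev (map (\<lambda>(n, v). (n, inv v)) xs)) \<subseteq> carrier G" by auto
        show ?case using Cons c c'
          by (cases a) (simp add: chain_prod_append inv_mult_group chain_prod_closed)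
      qed simp
      let ?ys = "rev (map (\<lambda>(n, v). (n, inv v)) xs)"
      have "\<forall>(n, v)\<in>set xs. v \<in> V n" using xs by (simp add: chains_def)
      from gen[OF this] have "?ys \<in> chains (inv x)" "chain_sum ?ys = chain_sum xs"
        using xs inv by (auto simp: chains_def)
      thus "l (inv x) \<le> chain_sum xs" using lower[of ?ys "inv x"] by simp
    qed
    fix x assume x: "x \<in> carrier G"
    show "l (inv x) = l x" using half[OF x] half[of "inv x"] x by simp
  next
    fix e :: real assume "e > 0"
    then obtain n where n: "(1/2) ^ n < e" using real_arch_pow_inv[of e "1/2"] by auto
    have "l w < e" if "w \<in> V n" for w
      using lower[of "[(n, w)]" w] that carr[of n] n by (auto simp: chains_def subset_iff)
    moreover have "openin T (V n)" using V(2)[of n] by (simp add: P_def)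
    ultimately show "\<exists>W. openin T W \<and> \<one> \<in> W \<and> (\<forall>w\<in>W. l w < e)" using one by blast
  next
    fix x assume "x \<notin> U"
    hence "x \<notin> V 0" using V(1) V0(2) by blast
    have "1 \<le> l x"
    proof (rule greatest)
      fix xs assume "xs \<in> chains x"
      hence "\<forall>(n, v)\<in>set xs. v \<in> V n" "chain_prod xs = x" by (auto simp: chains_def)
      thus "1 \<le> chain_sum xs"
        using chain_prod_small[of V xs 0, OF one _ carr] V(3) \<open>x \<notin> V 0\<close> by (metis linorder_not_less power_0)
    qed simp
    thus "l x = 1" using le1[of x] by simp
  qed (use nonneg le1 in auto)
qed

end

section \<open>The Samuel compactification of a coset space\<close>

locale coset_space = top_group G T for G :: "('g, 'm) monoid_scheme" (structure) and T :: "'g topology" +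
  fixes H :: "'g set"
  assumes subgroup_H: "subgroup H G"
begin

abbreviation cosets :: "'g set set" where "cosets \<equiv> lcosets\<^bsub>G\<^esub> H"

lemma H_carrier: "H \<subseteq> carrier G" using subgroup_H by (rule subgroup.subset)

lemma coset_mem: "g \<in> carrier G \<Longrightarrow> g <# H \<in> cosets" by (auto simp: LCOSETS_def)

lemma cosetE: assumes "x \<in> cosets" obtains g where "g \<in> carrier G" "x = g <# H"
  using assms by (auto simp: LCOSETS_def)

lemma coset_subset: "x \<in> cosets \<Longrightarrow> x \<subseteq> carrier G"
  using H_carrier l_coset_subset_G by (auto simp: LCOSETS_def)

lemma coset_action: "g \<in> carrier G \<Longrightarrow> x \<in> cosets \<Longrightarrow> g <# x \<in> cosets"
  using H_carrier by (auto elim!: cosetE simp: lcos_m_assoc intro!: coset_mem)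

lemma coset_action_mult:
  "g \<in> carrier G \<Longrightarrow> h \<in> carrier G \<Longrightarrow> x \<in> cosets \<Longrightarrow> (g \<otimes> h) <# x = g <# (h <# x)"
  using coset_subset by (simp add: lcos_m_assoc)

lemma coset_action_one: "x \<in> cosets \<Longrightarrow> \<one> <# x = x"
  using coset_subset by (simp add: lcos_mult_one)

lemma coset_of_H: "h \<in> H \<Longrightarrow> h <# H = H"
  using coset_join3 subgroup_H H_carrier by blast

lemma H_coset: "H \<in> cosets" using coset_mem[OF one_closed] coset_of_H subgroup.one_closed[OF subgroup_H] by simp

text \<open>The uniformity condition in the definition of \<open>RUC\<close>.\<close>

definition uniform_at_one :: "('s \<Rightarrow> 'b::metric_space) \<Rightarrow> ('g \<Rightarrow> 's \<Rightarrow> 's) \<Rightarrow> 's set \<Rightarrow> bool" where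
  "uniform_at_one f act S \<longleftrightarrow> (\<forall>\<epsilon>>0. \<exists>U. openin T U \<and> \<one> \<in> U \<and> (\<forall>u\<in>U. \<forall>x\<in>S. dist (f (act u x)) (f x) < \<epsilon>))"

lemma RUC_iff: "f \<in> RUC G T H \<longleftrightarrow> f \<in> extensional cosets \<and> bounded (f ` cosets) \<and> uniform_at_one f (\<lambda>g x. g <# x) cosets"
  by (simp add: RUC_def uniform_at_one_def dist_norm)

lemma RUC_bounded: assumes "f \<in> RUC G T H" obtains B where "\<And>x. x \<in> cosets \<Longrightarrow> cmod (f x) \<le> B"
  using assms unfolding RUC_iff bounded_iff by blast

text \<open>Bounded functions take values in a compact set, on which \<open>\<Phi>\<close> is uniformly continuous.\<close>

lemma RUC_compose:
  assumes f: "f \<in> RUC G T H" and h: "h \<in> RUC G T H" and \<Phi>: "continuous_on UNIV (\<lambda>z :: complex \<times> complex. \<Phi> z)"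
  shows "(\<lambda>x\<in>cosets. \<Phi> (f x, h x)) \<in> RUC G T H"
proof -
  obtain B where B: "\<And>x. x \<in> cosets \<Longrightarrow> cmod (f x) \<le> B" using RUC_bounded[OF f] by blast
  obtain C where C: "\<And>x. x \<in> cosets \<Longrightarrow> cmod (h x) \<le> C" using RUC_bounded[OF h] by blast
  let ?K = "cball 0 B \<times> cball 0 C :: (complex \<times> complex) set"
  have K: "compact ?K" by (intro compact_Times compact_cball)
  have cont: "continuous_on ?K \<Phi>" using \<Phi> continuous_on_subset by blast
  have mem: "(f x, h x) \<in> ?K" if "x \<in> cosets" for x using B C that by simp
  have "bounded (\<Phi> ` ?K)" by (intro compact_imp_bounded compact_continuous_image cont K)
  moreover have "(\<lambda>x\<in>cosets. \<Phi> (f x, h x)) ` cosets \<subseteq> \<Phi> ` ?K" using mem by auto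
  ultimately have b: "bounded ((\<lambda>x\<in>cosets. \<Phi> (f x, h x)) ` cosets)" by (rule bounded_subset)
  have "uniform_at_one (\<lambda>x\<in>cosets. \<Phi> (f x, h x)) (\<lambda>g x. g <# x) cosets"
    unfolding uniform_at_one_def
  proof (intro allI impI)
    fix \<epsilon> :: real assume "\<epsilon> > 0"
    then obtain d where d: "d > 0" "\<And>z w. z \<in> ?K \<Longrightarrow> w \<in> ?K \<Longrightarrow> dist w z < d \<Longrightarrow> dist (\<Phi> w) (\<Phi> z) < \<epsilon>"
      using compact_uniformly_continuous[OF cont K] unfolding uniformly_continuous_on_def by metis
    obtain U where U: "openin T U" "\<one> \<in> U" "\<And>u x. u \<in> U \<Longrightarrow> x \<in> cosets \<Longrightarrow> dist (f (u <# x)) (f x) < d / 2"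
      using f d(1) unfolding RUC_iff uniform_at_one_def by (meson half_gt_zero)
    obtain V where V: "openin T V" "\<one> \<in> V" "\<And>u x. u \<in> V \<Longrightarrow> x \<in> cosets \<Longrightarrow> dist (h (u <# x)) (h x) < d / 2"
      using h d(1) unfolding RUC_iff uniform_at_one_def by (meson half_gt_zero)
    have "dist (\<Phi> (f (u <# x), h (u <# x))) (\<Phi> (f x, h x)) < \<epsilon>" if ux: "u \<in> U \<inter> V" "x \<in> cosets" for u x
    proof (rule d(2))
      have "u <# x \<in> cosets" using ux U(1) open_carrier coset_action by blast
      thus "(f x, h x) \<in> ?K" "(f (u <# x), h (u <# x)) \<in> ?K" using mem ux(2) by blast+
      have "dist (f (u <# x), h (u <# x)) (f x, h x) \<le> dist (f (u <# x)) (f x) + dist (h (u <# x)) (h x)"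
        by (simp add: dist_Pair_Pair sqrt_sum_squares_le_sum)
      also have "\<dots> < d" using U(3)[of u x] V(3)[of u x] ux by auto
      finally show "dist (f (u <# x), h (u <# x)) (f x, h x) < d" .
    qed
    moreover have "u <# x \<in> cosets" if "u \<in> U \<inter> V" "x \<in> cosets" for u x
      using that U(1) open_carrier coset_action by blast
    ultimately show "\<exists>U. openin T U \<and> \<one> \<in> U \<and> (\<forall>u\<in>U. \<forall>x\<in>cosets.
        dist ((\<lambda>x\<in>cosets. \<Phi> (f x, h x)) (u <# x)) ((\<lambda>x\<in>cosets. \<Phi> (f x, h x)) x) < \<epsilon>)"
      using U(1,2) V(1,2) by (intro exI[of _ "U \<inter> V"]) auto
  qed
  with b show ?thesis by (auto simp: RUC_iff)
qed

lemma RUC_const: "(\<lambda>x\<in>cosets. c) \<in> RUC G T H"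
proof -
  have "uniform_at_one (\<lambda>x\<in>cosets. c) (\<lambda>g x. g <# x) cosets"
    unfolding uniform_at_one_def
  proof (intro allI impI exI conjI)
    show "openin T (topspace T)" by (rule openin_topspace)
  qed (auto simp: topspace_T coset_action)
  thus ?thesis by (auto simp: RUC_iff intro: bounded_subset[of "{c}"])
qed

lemma RUC_translate:
  assumes f: "f \<in> RUC G T H" and g: "g \<in> carrier G"
  shows "(\<lambda>x\<in>cosets. f (g <# x)) \<in> RUC G T H"
proof -
  have "(\<lambda>x\<in>cosets. f (g <# x)) ` cosets \<subseteq> f ` cosets" using coset_action[OF g] by auto
  hence "bounded ((\<lambda>x\<in>cosets. f (g <# x)) ` cosets)" using f bounded_subset by (auto simp: RUC_iff)
  moreover have "uniform_at_one (\<lambda>x\<in>cosets. f (g <# x)) (\<lambda>g x. g <# x) cosets"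
    unfolding uniform_at_one_def
  proof (intro allI impI)
    fix \<epsilon> :: real assume "\<epsilon> > 0"
    then obtain U where U: "openin T U" "\<one> \<in> U" "\<And>u x. u \<in> U \<Longrightarrow> x \<in> cosets \<Longrightarrow> dist (f (u <# x)) (f x) < \<epsilon>"
      using f unfolding RUC_iff uniform_at_one_def by meson
    let ?V = "{u \<in> carrier G. g \<otimes> u \<otimes> inv g \<in> U}"
    have "openin T ?V" using U g by (intro open_translate) auto
    moreover have "\<one> \<in> ?V" using U g by simp
    moreover have "dist (f (g <# (u <# x))) (f (g <# x)) < \<epsilon>" if u: "u \<in> ?V" and x: "x \<in> cosets" for u x
    proof -
      have "g <# (u <# x) = (g \<otimes> u \<otimes> inv g) <# (g <# x)"
        using u x g by (simp add: coset_action_mult[symmetric] coset_action m_assoc)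
      thus ?thesis using U(3)[of "g \<otimes> u \<otimes> inv g" "g <# x"] u x g coset_action by simp
    qed
    ultimately show "\<exists>U. openin T U \<and> \<one> \<in> U \<and> (\<forall>u\<in>U. \<forall>x\<in>cosets.
        dist ((\<lambda>x\<in>cosets. f (g <# x)) (u <# x)) ((\<lambda>x\<in>cosets. f (g <# x)) x) < \<epsilon>)"
      by (intro exI[of _ ?V]) (auto simp: coset_action)
  qed
  ultimately show ?thesis by (auto simp: RUC_iff)
qed

abbreviation "R_H \<equiv> RUC G T H"
abbreviation "SaX \<equiv> Sa G T H"

lemma RUC_closed:
  assumes "f \<in> R_H" "h \<in> R_H"
  shows RUC_add: "(\<lambda>x\<in>cosets. f x + h x) \<in> R_H" and RUC_mult: "(\<lambda>x\<in>cosets. f x * h x) \<in> R_H"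
    and RUC_scale: "(\<lambda>x\<in>cosets. c * f x) \<in> R_H" and RUC_cnj: "(\<lambda>x\<in>cosets. cnj (f x)) \<in> R_H"
proof -
  have "continuous_on UNIV (\<lambda>z :: complex \<times> complex. fst z + snd z)"
    "continuous_on UNIV (\<lambda>z :: complex \<times> complex. fst z * snd z)"
    "continuous_on UNIV (\<lambda>z :: complex \<times> complex. c * fst z)"
    "continuous_on UNIV (\<lambda>z :: complex \<times> complex. cnj (fst z))"
    by (intro continuous_intros)+
  note this[THEN RUC_compose[OF assms]]
  thus "(\<lambda>x\<in>cosets. f x + h x) \<in> R_H" "(\<lambda>x\<in>cosets. f x * h x) \<in> R_H"
    "(\<lambda>x\<in>cosets. c * f x) \<in> R_H" "(\<lambda>x\<in>cosets. cnj (f x)) \<in> R_H"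
    by (simp_all only: fst_conv snd_conv)
qed

text \<open>Values below \<open>\<delta>\<close> do not occur, so the reciprocal may be replaced by a continuous function.\<close>

lemma RUC_inverse:
  assumes f: "f \<in> R_H" and d: "\<delta> > 0" "\<And>x. x \<in> cosets \<Longrightarrow> \<delta> \<le> cmod (f x)"
  shows "(\<lambda>x\<in>cosets. 1 / f x) \<in> R_H"
proof -
  let ?\<Phi> = "\<lambda>z :: complex \<times> complex. cnj (fst z) / of_real (max (\<delta>\<^sup>2) ((cmod (fst z))\<^sup>2))"
  have pos: "max (\<delta>\<^sup>2) r > 0" for r using d(1) by (simp add: less_max_iff_disj)
  have "continuous_on UNIV ?\<Phi>"
    using pos by (intro continuous_intros) (auto simp: less_le)
  from RUC_compose[OF f f this] have "(\<lambda>x\<in>cosets. ?\<Phi> (f x, f x)) \<in> R_H" .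
  moreover have "(\<lambda>x\<in>cosets. ?\<Phi> (f x, f x)) = (\<lambda>x\<in>cosets. 1 / f x)"
  proof (rule restrict_ext)
    fix x assume x: "x \<in> cosets"
    have nz: "f x \<noteq> 0" using d(2)[OF x] d(1) by auto
    have "\<delta>\<^sup>2 \<le> (cmod (f x))\<^sup>2" using d(2)[OF x] d(1) by (intro power_mono) auto
    hence "max (\<delta>\<^sup>2) ((cmod (f x))\<^sup>2) = (cmod (f x))\<^sup>2" by simp
    hence "?\<Phi> (f x, f x) = cnj (f x) / (f x * cnj (f x))" by (simp only: fst_conv complex_norm_square)
    thus "?\<Phi> (f x, f x) = 1 / f x" using nz by (simp add: field_simps)
  qed
  ultimately show ?thesis by simp
qed

definition character :: "(('g set \<Rightarrow> complex) \<Rightarrow> complex) \<Rightarrow> bool" where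
  "character \<omega> \<longleftrightarrow> \<omega> (\<lambda>x\<in>cosets. 1) = 1 \<and>
     (\<forall>c. \<forall>f\<in>R_H. \<omega> (\<lambda>x\<in>cosets. c * f x) = c * \<omega> f) \<and>
     (\<forall>f\<in>R_H. \<forall>h\<in>R_H. \<omega> (\<lambda>x\<in>cosets. f x + h x) = \<omega> f + \<omega> h) \<and>
     (\<forall>f\<in>R_H. \<forall>h\<in>R_H. \<omega> (\<lambda>x\<in>cosets. f x * h x) = \<omega> f * \<omega> h)"

lemma Sa_eq: "SaX = subtopology (product_topology (\<lambda>_. euclidean) R_H) {\<omega> \<in> extensional R_H. character \<omega>}"
  by (simp add: Sa_def gelfand_spectrum_def character_def)

lemma topspace_Sa: "topspace SaX = {\<omega> \<in> extensional R_H. character \<omega>}"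
  by (auto simp: Sa_eq PiE_def)

lemma character_const: assumes "character \<omega>" shows "\<omega> (\<lambda>x\<in>cosets. c) = c"
proof -
  have "\<omega> (\<lambda>x\<in>cosets. c * (\<lambda>x\<in>cosets. 1) x) = c * \<omega> (\<lambda>x\<in>cosets. 1)"
    using assms RUC_const[of 1] unfolding character_def by blast
  moreover have "(\<lambda>x\<in>cosets. c * (\<lambda>x\<in>cosets. 1) x) = (\<lambda>x\<in>cosets. c)" by (rule restrict_ext) simp
  ultimately show ?thesis using assms by (simp add: character_def)
qed

lemma character_sum_of_squares:
  assumes \<omega>: "character \<omega>" and "finite F" "F \<subseteq> R_H"
  shows "\<exists>q\<in>R_H. \<omega> q = 0 \<and> (\<forall>x\<in>cosets. \<exists>r\<ge>0. q x = complex_of_real r \<and> (\<forall>f\<in>F. (cmod (f x - \<omega> f))\<^sup>2 \<le> r))"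
  using assms(2,3)
proof (induction F rule: finite_induct)
  case empty
  show ?case
  proof (intro bexI conjI ballI)
    show "\<omega> (\<lambda>x\<in>cosets. 0) = 0" "(\<lambda>x\<in>cosets. 0) \<in> R_H"
      by (rule character_const[OF \<omega>], rule RUC_const)
  qed auto
next
  case (insert f F)
  then obtain q where q: "q \<in> R_H" "\<omega> q = 0"
    "\<And>x. x \<in> cosets \<Longrightarrow> \<exists>r\<ge>0. q x = complex_of_real r \<and> (\<forall>f\<in>F. (cmod (f x - \<omega> f))\<^sup>2 \<le> r)" by auto
  have f: "f \<in> R_H" using insert by auto
  define k where "k = (\<lambda>x\<in>cosets. f x + (\<lambda>x\<in>cosets. - \<omega> f) x)"
  have k: "k \<in> R_H" unfolding k_def by (rule RUC_add[OF f RUC_const])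
  have \<omega>k: "\<omega> k = 0"
  proof -
    have "\<omega> k = \<omega> f + \<omega> (\<lambda>x\<in>cosets. - \<omega> f)"
      using \<omega> f RUC_const[of "- \<omega> f"] unfolding k_def character_def by blast
    thus ?thesis using character_const[OF \<omega>, of "- \<omega> f"] by simp
  qed
  define kk where "kk = (\<lambda>x\<in>cosets. k x * (\<lambda>x\<in>cosets. cnj (k x)) x)"
  have kk: "kk \<in> R_H" unfolding kk_def by (rule RUC_mult[OF k RUC_cnj[OF k k]])
  have \<omega>kk: "\<omega> kk = 0" 
  proof -
    have "\<omega> kk = \<omega> k * \<omega> (\<lambda>x\<in>cosets. cnj (k x))"
      using \<omega> k RUC_cnj[OF k k] unfolding kk_def character_def by blast
    thus ?thesis using \<omega>k by simp
  qed
  have "(\<lambda>x\<in>cosets. q x + kk x) \<in> R_H" by (rule RUC_add[OF q(1) kk])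
  moreover have "\<omega> (\<lambda>x\<in>cosets. q x + kk x) = 0" using \<omega> q kk \<omega>kk unfolding character_def by simp
  moreover have "\<exists>r\<ge>0. q x + kk x = complex_of_real r \<and> (\<forall>f\<in>insert f F. (cmod (f x - \<omega> f))\<^sup>2 \<le> r)"
    if x: "x \<in> cosets" for x
  proof -
    obtain r where r: "r \<ge> 0" "q x = complex_of_real r" "\<And>f. f \<in> F \<Longrightarrow> (cmod (f x - \<omega> f))\<^sup>2 \<le> r" using q(3)[OF x] by blast
    have "kk x = (f x - \<omega> f) * cnj (f x - \<omega> f)" using x by (simp add: kk_def k_def)
    also have "\<dots> = complex_of_real ((cmod (f x - \<omega> f))\<^sup>2)" by (rule complex_norm_square[symmetric])
    finally have "kk x = complex_of_real ((cmod (f x - \<omega> f))\<^sup>2)" .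
    thus ?thesis using r by (intro exI[of _ "r + (cmod (f x - \<omega> f))\<^sup>2"]) (auto intro: order_trans[OF r(3)])
  qed
  ultimately show ?case
  proof (intro bexI[of _ "\<lambda>x\<in>cosets. q x + kk x"] conjI ballI, goal_cases)
    case (2 x)
    have "(\<lambda>x\<in>cosets. q x + kk x) x = q x + kk x" using 2(4) by simp
    thus ?case using 2(3)[OF 2(4)] by metis
  qed
qed

text \<open>Otherwise the sum of the \<open>\<bar>f - \<omega> f\<bar>\<^sup>2\<close> would be an invertible element of the kernel of \<open>\<omega>\<close>.\<close>

lemma character_approx:
  assumes \<omega>: "character \<omega>" and F: "finite F" "F \<subseteq> R_H" and d: "\<delta> > 0"
  obtains x where "x \<in> cosets" "\<And>f. f \<in> F \<Longrightarrow> cmod (f x - \<omega> f) < \<delta>"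
proof (rule ccontr)
  assume "\<not> thesis"
  hence no: "\<exists>f\<in>F. \<delta> \<le> cmod (f x - \<omega> f)" if "x \<in> cosets" for x
    using that \<open>\<And>x. x \<in> cosets \<Longrightarrow> (\<And>f. f \<in> F \<Longrightarrow> cmod (f x - \<omega> f) < \<delta>) \<Longrightarrow> thesis\<close> by (meson linorder_not_less)
  obtain q where q: "q \<in> R_H" "\<omega> q = 0"
    "\<And>x. x \<in> cosets \<Longrightarrow> \<exists>r\<ge>0. q x = complex_of_real r \<and> (\<forall>f\<in>F. (cmod (f x - \<omega> f))\<^sup>2 \<le> r)"
    using character_sum_of_squares[OF \<omega> F] by blast
  have big: "\<delta>\<^sup>2 \<le> cmod (q x)" if x: "x \<in> cosets" for x
  proof -
    obtain r where r: "r \<ge> 0" "q x = complex_of_real r" "\<And>f. f \<in> F \<Longrightarrow> (cmod (f x - \<omega> f))\<^sup>2 \<le> r" using q(3)[OF x] by blast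
    obtain f where "f \<in> F" "\<delta> \<le> cmod (f x - \<omega> f)" using no[OF x] by blast
    hence "\<delta>\<^sup>2 \<le> (cmod (f x - \<omega> f))\<^sup>2" using d by (intro power_mono) auto
    also have "\<dots> \<le> r" using r(3) \<open>f \<in> F\<close> by blast
    finally have "\<delta>\<^sup>2 \<le> r" .
    thus ?thesis using r by simp
  qed
  have inv: "(\<lambda>x\<in>cosets. 1 / q x) \<in> R_H" using d by (intro RUC_inverse[OF q(1) _ big]) auto
  have "\<omega> (\<lambda>x\<in>cosets. q x * (\<lambda>x\<in>cosets. 1 / q x) x) = \<omega> q * \<omega> (\<lambda>x\<in>cosets. 1 / q x)"
    using \<omega> q(1) inv unfolding character_def by blast
  moreover have "(\<lambda>x\<in>cosets. q x * (\<lambda>x\<in>cosets. 1 / q x) x) = (\<lambda>x\<in>cosets. 1)"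
  proof (rule restrict_ext)
    fix x assume x: "x \<in> cosets"
    have "0 < cmod (q x)" using big[OF x] d by (smt (verit) zero_less_power)
    thus "q x * (\<lambda>x\<in>cosets. 1 / q x) x = 1" using x by simp
  qed
  ultimately show False using q(2) \<omega> by (simp add: character_def)
qed

lemma character_bound:
  assumes \<omega>: "character \<omega>" and f: "f \<in> R_H" and B: "\<And>x. x \<in> cosets \<Longrightarrow> cmod (f x) \<le> B"
  shows "cmod (\<omega> f) \<le> B"
proof (rule field_le_epsilon)
  fix e :: real assume "e > 0"
  then obtain x where "x \<in> cosets" "cmod (f x - \<omega> f) < e" using character_approx[OF \<omega>, of "{f}" e] f by auto
  thus "cmod (\<omega> f) \<le> B + e" using B[of x] norm_triangle_sub[of "\<omega> f" "f x"] by (simp add: norm_minus_commute)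
qed

definition point_eval :: "'g set \<Rightarrow> ('g set \<Rightarrow> complex) \<Rightarrow> complex" where
  "point_eval x = (\<lambda>f\<in>R_H. f x)"

lemma point_eval_Sa: "x \<in> cosets \<Longrightarrow> point_eval x \<in> topspace SaX"
  using RUC_const RUC_closed by (auto simp: topspace_Sa point_eval_def character_def)

lemma point_eval_dense: "topspace SaX \<subseteq> SaX closure_of (point_eval ` cosets)"
proof
  fix \<omega> assume \<omega>: "\<omega> \<in> topspace SaX"
  show "\<omega> \<in> SaX closure_of (point_eval ` cosets)"
    unfolding in_closure_of
  proof (intro conjI allI impI \<omega>)
    fix W assume W: "\<omega> \<in> W \<and> openin SaX W"
    then obtain W' where W': "openin (product_topology (\<lambda>_. euclidean) R_H) W'"
      "W = W' \<inter> {\<omega> \<in> extensional R_H. character \<omega>}" by (auto simp: Sa_eq openin_subtopology)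
    then obtain X where X: "\<omega> \<in> (\<Pi>\<^sub>E f\<in>R_H. X f)" "\<And>f. openin euclidean (X f)"
      "finite {f. X f \<noteq> topspace euclidean}" "(\<Pi>\<^sub>E f\<in>R_H. X f) \<subseteq> W'"
      using product_topology_open_contains_basis[of "\<lambda>_. euclidean" R_H W' \<omega>] W by auto
    define F where "F = {f \<in> R_H. X f \<noteq> UNIV}"
    have F: "finite F" "F \<subseteq> R_H" using X(3) by (auto simp: F_def intro: finite_subset)
    have "\<exists>e>0. ball (\<omega> f) e \<subseteq> X f" if "f \<in> F" for f
    proof -
      have "\<omega> f \<in> X f" using X(1) that F by auto
      moreover have "open (X f)" using X(2)[of f] by simp
      ultimately show ?thesis by (meson openE)
    qed
    then obtain e where e: "\<And>f. f \<in> F \<Longrightarrow> e f > 0" "\<And>f. f \<in> F \<Longrightarrow> ball (\<omega> f) (e f) \<subseteq> X f" by metis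
    define d where "d = Min (insert 1 (e ` F))"
    have d: "d > 0" "\<And>f. f \<in> F \<Longrightarrow> d \<le> e f" using F(1) e(1) by (auto simp: d_def)
    have "character \<omega>" using \<omega> by (simp add: topspace_Sa)
    then obtain x where x: "x \<in> cosets" "\<And>f. f \<in> F \<Longrightarrow> cmod (f x - \<omega> f) < d"
      using character_approx[OF _ F d(1)] by blast
    have "point_eval x f \<in> X f" if f: "f \<in> R_H" for f
    proof (cases "f \<in> F")
      case True
      hence "f x \<in> ball (\<omega> f) (e f)" using x(2)[OF True] d(2)[OF True] by (simp add: dist_norm norm_minus_commute)
      thus ?thesis using e(2)[OF True] f by (auto simp: point_eval_def)
    next
      case False thus ?thesis using f by (auto simp: F_def)
    qed
    hence "point_eval x \<in> W'" using X(4) by (auto simp: point_eval_def PiE_iff)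
    hence "point_eval x \<in> W" using point_eval_Sa[OF x(1)] W'(2) by (simp add: topspace_Sa)
    thus "\<exists>y. y \<in> point_eval ` cosets \<and> y \<in> W" using x(1) by blast
  qed
qed

lemma eval_continuous: "f \<in> R_H \<Longrightarrow> continuous_map SaX euclidean (\<lambda>\<omega>. \<omega> f)"
  unfolding Sa_eq by (intro continuous_map_from_subtopology continuous_map_product_projection)

lemma Sa_compact: "compact_space SaX" and Sa_Hausdorff: "Hausdorff_space SaX"
proof -
  let ?P = "product_topology (\<lambda>_. euclidean :: complex topology) R_H"
  have Haus: "Hausdorff_space ?P" by (simp add: Hausdorff_space_product_topology)
  thus "Hausdorff_space SaX" unfolding Sa_eq by (rule Hausdorff_space_subtopology)
  have "\<exists>B. \<forall>x\<in>cosets. cmod (f x) \<le> B" if "f \<in> R_H" for f using RUC_bounded[OF that] by meson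
  then obtain B where B: "\<And>f x. f \<in> R_H \<Longrightarrow> x \<in> cosets \<Longrightarrow> cmod (f x) \<le> B f" by metis
  have eval: "continuous_map ?P euclidean (\<lambda>\<omega>. \<omega> f)" if "f \<in> R_H" for f
    using that by (rule continuous_map_product_projection)
  have eq: "closedin ?P {\<omega> \<in> topspace ?P. \<phi> \<omega> = \<psi> \<omega>}"
    if "continuous_map ?P (euclidean :: complex topology) \<phi>" "continuous_map ?P euclidean \<psi>" for \<phi> \<psi>
    using that by (intro closedin_continuous_maps_eq) auto
  have all: "closedin X {\<omega> \<in> topspace X. \<forall>i\<in>I. Q i \<omega>}" if "\<And>i. i \<in> I \<Longrightarrow> closedin X {\<omega> \<in> topspace X. Q i \<omega>}"
    for X :: "'z topology" and I :: "'i set" and Q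
  proof -
    have "{\<omega> \<in> topspace X. \<forall>i\<in>I. Q i \<omega>} = \<Inter> (insert (topspace X) ((\<lambda>i. {\<omega> \<in> topspace X. Q i \<omega>}) ` I))" by auto
    also have "closedin X \<dots>" using that by (intro closedin_Inter) auto
    finally show ?thesis .
  qed
  have mul: "continuous_map ?P euclidean (\<lambda>\<omega>. f \<omega> * h \<omega>)" "continuous_map ?P euclidean (\<lambda>\<omega>. f \<omega> + h \<omega>)"
    if "continuous_map ?P (euclidean :: complex topology) f" "continuous_map ?P euclidean h" for f h
    using that by (simp_all add: continuous_map_atin tendsto_mult tendsto_add)
  have "{\<omega> \<in> extensional R_H. character \<omega>} =
      {\<omega> \<in> topspace ?P. \<omega> (\<lambda>x\<in>cosets. 1) = 1} \<inter>
      {\<omega> \<in> topspace ?P. \<forall>c\<in>UNIV. \<omega> \<in> topspace ?P \<and> (\<forall>f\<in>R_H. \<omega> (\<lambda>x\<in>cosets. c * f x) = c * \<omega> f)} \<inter>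
      {\<omega> \<in> topspace ?P. \<forall>f\<in>R_H. \<omega> \<in> topspace ?P \<and> (\<forall>h\<in>R_H. \<omega> (\<lambda>x\<in>cosets. f x + h x) = \<omega> f + \<omega> h)} \<inter>
      {\<omega> \<in> topspace ?P. \<forall>f\<in>R_H. \<omega> \<in> topspace ?P \<and> (\<forall>h\<in>R_H. \<omega> (\<lambda>x\<in>cosets. f x * h x) = \<omega> f * \<omega> h)}"
    by (auto simp: character_def PiE_def)
  also have "closedin ?P \<dots>"
    by (intro closedin_Int; (rule all, simp del: topspace_product_topology, rule all)?; intro eq mul eval RUC_const RUC_closed)
       (auto intro: RUC_const RUC_closed)
  finally have closed: "closedin ?P {\<omega> \<in> extensional R_H. character \<omega>}" .
  have "compactin ?P (\<Pi>\<^sub>E f\<in>R_H. cball 0 (B f))" unfolding compactin_PiE by auto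
  moreover have "{\<omega> \<in> extensional R_H. character \<omega>} \<subseteq> (\<Pi>\<^sub>E f\<in>R_H. cball 0 (B f))"
  proof
    fix \<omega> assume \<omega>: "\<omega> \<in> {\<omega> \<in> extensional R_H. character \<omega>}"
    hence "\<omega> f \<in> cball 0 (B f)" if "f \<in> R_H" for f using character_bound[of \<omega> f "B f"] B that by simp
    thus "\<omega> \<in> (\<Pi>\<^sub>E f\<in>R_H. cball 0 (B f))" using \<omega> by (simp add: PiE_iff)
  qed
  ultimately have "compactin ?P {\<omega> \<in> extensional R_H. character \<omega>}" using closed closed_compactin by blast
  thus "compact_space SaX" unfolding Sa_eq by (rule compact_space_subtopology)
qed

abbreviation "act \<equiv> Sa_action G T H"

lemma Sa_action_eval: "\<omega> \<in> topspace SaX \<Longrightarrow> f \<in> R_H \<Longrightarrow> act g \<omega> f = \<omega> (\<lambda>x\<in>cosets. f (g <# x))"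
  by (simp add: Sa_action_def)

lemma Sa_action_closed:
  assumes g: "g \<in> carrier G" and \<omega>: "\<omega> \<in> topspace SaX" shows "act g \<omega> \<in> topspace SaX"
proof -
  have ch: "character \<omega>" using \<omega> by (simp add: topspace_Sa)
  let ?t = "\<lambda>f. \<lambda>x\<in>cosets. f (g <# x)"
  have t: "?t f \<in> R_H" if "f \<in> R_H" for f using RUC_translate[OF that g] .
  have e1: "?t (\<lambda>x\<in>cosets. 1) = (\<lambda>x\<in>cosets. 1)" by (rule restrict_ext) (simp add: coset_action[OF g])
  have e2: "?t (\<lambda>x\<in>cosets. c * f x) = (\<lambda>x\<in>cosets. c * ?t f x)" for c f by (rule restrict_ext) (simp add: coset_action[OF g])
  have e3: "?t (\<lambda>x\<in>cosets. f x + h x) = (\<lambda>x\<in>cosets. ?t f x + ?t h x)" for f h by (rule restrict_ext) (simp add: coset_action[OF g])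
  have e4: "?t (\<lambda>x\<in>cosets. f x * h x) = (\<lambda>x\<in>cosets. ?t f x * ?t h x)" for f h by (rule restrict_ext) (simp add: coset_action[OF g])
  have ev: "act g \<omega> f = \<omega> (?t f)" if "f \<in> R_H" for f by (rule Sa_action_eval[OF \<omega> that])
  have "character (act g \<omega>)"
    unfolding character_def
  proof (intro conjI allI ballI)
    show "act g \<omega> (\<lambda>x\<in>cosets. 1) = 1" unfolding ev[OF RUC_const] e1 using ch by (simp add: character_def)
  next
    fix c f assume f: "f \<in> R_H"
    show "act g \<omega> (\<lambda>x\<in>cosets. c * f x) = c * act g \<omega> f"
      unfolding ev[OF RUC_scale[OF f f]] ev[OF f] e2 using ch t[OF f] unfolding character_def by blast
  next
    fix f h assume f: "f \<in> R_H" and h: "h \<in> R_H"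
    show "act g \<omega> (\<lambda>x\<in>cosets. f x + h x) = act g \<omega> f + act g \<omega> h"
      unfolding ev[OF RUC_add[OF f h]] ev[OF f] ev[OF h] e3 using ch t[OF f] t[OF h] unfolding character_def by blast
    show "act g \<omega> (\<lambda>x\<in>cosets. f x * h x) = act g \<omega> f * act g \<omega> h"
      unfolding ev[OF RUC_mult[OF f h]] ev[OF f] ev[OF h] e4 using ch t[OF f] t[OF h] unfolding character_def by blast
  qed
  thus ?thesis using \<omega> by (simp add: topspace_Sa Sa_action_def)
qed

lemma Sa_action_point_eval:
  assumes "g \<in> carrier G" "x \<in> cosets" shows "act g (point_eval x) = point_eval (g <# x)"
proof
  fix f show "act g (point_eval x) f = point_eval (g <# x) f"
    using point_eval_Sa[OF assms(2)] RUC_translate[OF _ assms(1)] assms(2)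
    by (auto simp: Sa_action_def point_eval_def)
qed

lemma Sa_flow: "flow G T SaX act"
proof -
  have "group_action G (topspace SaX) act"
  proof (rule group_actionI[OF is_group])
    fix g h \<omega> assume gh: "g \<in> carrier G" "h \<in> carrier G" and \<omega>: "\<omega> \<in> topspace SaX"
    show "act (g \<otimes> h) \<omega> = act g (act h \<omega>)"
    proof
      fix f :: "'g set \<Rightarrow> complex"
      have "(\<lambda>x\<in>cosets. f ((g \<otimes> h) <# x)) = (\<lambda>x\<in>cosets. (\<lambda>x\<in>cosets. f (g <# x)) (h <# x))"
        by (rule restrict_ext) (simp add: coset_action gh coset_action_mult)
      thus "act (g \<otimes> h) \<omega> f = act g (act h \<omega>) f"
        using \<omega> Sa_action_closed[OF gh(2) \<omega>] RUC_translate gh by (cases "f \<in> R_H") (auto simp: Sa_action_def)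
    qed
  next
    fix \<omega> assume \<omega>: "\<omega> \<in> topspace SaX"
    show "act \<one> \<omega> = \<omega>"
    proof
      fix f
      have "(\<lambda>x\<in>cosets. f (\<one> <# x)) = f" if "f \<in> R_H"
      proof
        fix x show "(\<lambda>x\<in>cosets. f (\<one> <# x)) x = f x"
          using that by (auto simp: coset_action_one RUC_iff extensional_def)
      qed
      moreover have "\<omega> f = undefined" if "f \<notin> R_H" using \<omega> that by (auto simp: topspace_Sa extensional_def)
      ultimately show "act \<one> \<omega> f = \<omega> f" using \<omega> by (auto simp: Sa_action_def)
    qed
  qed (auto simp: Sa_action_closed, simp add: Sa_action_def)
  moreover have "continuous_map (prod_topology T SaX) SaX (\<lambda>(g, x). act g x)"
  proof -
    have "continuous_map (prod_topology T SaX) (product_topology (\<lambda>_. euclidean) R_H) (\<lambda>(g, x). act g x)"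
      unfolding continuous_map_componentwise
    proof (intro conjI ballI)
      show "(\<lambda>(g, x). act g x) ` topspace (prod_topology T SaX) \<subseteq> extensional R_H"
        using Sa_action_closed by (auto simp: topspace_T topspace_Sa)
      fix f assume f: "f \<in> R_H"
      show "continuous_map (prod_topology T SaX) euclidean (\<lambda>x. (\<lambda>(g, x). act g x) x f)"
      proof (subst Met_TC.continuous_map_to_metric[unfolded mtopology_is_euclidean], intro ballI allI impI)
        fix z and e :: real assume z: "z \<in> topspace (prod_topology T SaX)" and e: "e > 0"
        obtain g \<omega> where gw: "z = (g, \<omega>)" "g \<in> carrier G" "\<omega> \<in> topspace SaX" using z by (cases z) (auto simp: topspace_T)
        obtain U where U: "openin T U" "\<one> \<in> U" "\<And>u x. u \<in> U \<Longrightarrow> x \<in> cosets \<Longrightarrow> dist (f (u <# x)) (f x) < e / 2"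
          using f e unfolding RUC_iff uniform_at_one_def by (meson half_gt_zero)
        let ?t = "\<lambda>g. \<lambda>x\<in>cosets. f (g <# x)"
        have t: "?t g \<in> R_H" if "g \<in> carrier G" for g using RUC_translate[OF f that] .
        let ?W = "{g' \<in> carrier G. \<one> \<otimes> g' \<otimes> inv g \<in> U}"
        let ?N = "{\<omega>' \<in> topspace SaX. \<omega>' (?t g) \<in> ball (\<omega> (?t g)) (e / 2)}"
        have "openin T ?W" using U gw(2) by (intro open_translate) auto
        moreover have "openin SaX ?N" by (rule openin_continuous_map_preimage[OF eval_continuous[OF t[OF gw(2)]]]) simp
        ultimately have "openin (prod_topology T SaX) (?W \<times> ?N)" by (simp add: openin_prod_Times_iff)
        moreover have "z \<in> ?W \<times> ?N" using gw U(2) e by simp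
        moreover have "dist (\<omega> (?t g)) (\<omega>' (?t g')) < e" if g': "g' \<in> ?W" and w': "\<omega>' \<in> ?N" for g' \<omega>'
        proof -
          have ch: "character \<omega>'" using w' by (simp add: topspace_Sa)
          let ?d = "\<lambda>x\<in>cosets. ?t g' x + (\<lambda>x\<in>cosets. -1 * ?t g x) x"
          have m: "(\<lambda>x\<in>cosets. -1 * ?t g x) \<in> R_H" by (rule RUC_scale[OF t[OF gw(2)] t[OF gw(2)]])
          have d: "?d \<in> R_H" using g' by (intro RUC_add m t) auto
          have "\<omega>' ?d = \<omega>' (?t g') + \<omega>' (\<lambda>x\<in>cosets. -1 * ?t g x)"
            using ch t[of g'] g' m unfolding character_def by blast
          also have "\<omega>' (\<lambda>x\<in>cosets. -1 * ?t g x) = -1 * \<omega>' (?t g)"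
            using ch t[OF gw(2)] unfolding character_def by blast
          finally have eq: "\<omega>' ?d = \<omega>' (?t g') - \<omega>' (?t g)"
            by (simp only: mult_minus1 add_uminus_conv_diff)
          have "cmod (\<omega>' ?d) \<le> e / 2"
          proof (rule character_bound[OF ch d])
            fix x assume x: "x \<in> cosets"
            have "g' <# x = (\<one> \<otimes> g' \<otimes> inv g) <# (g <# x)"
              using x g' gw by (simp add: coset_action_mult[symmetric] coset_action m_assoc)
            hence "dist (f (g' <# x)) (f (g <# x)) < e / 2"
              using U(3)[of "\<one> \<otimes> g' \<otimes> inv g" "g <# x"] g' x gw(2) coset_action by force
            thus "cmod (?d x) \<le> e / 2" using x by (simp add: dist_norm)
          qed
          hence "dist (\<omega>' (?t g')) (\<omega>' (?t g)) \<le> e / 2" using eq by (simp add: dist_norm)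
          moreover have "dist (\<omega> (?t g)) (\<omega>' (?t g)) < e / 2" using w' by simp
          ultimately show ?thesis using dist_triangle[of "\<omega> (?t g)" "\<omega>' (?t g')" "\<omega>' (?t g)"] by (simp add: dist_commute)
        qed
        ultimately show "\<exists>U. openin (prod_topology T SaX) U \<and> z \<in> U \<and>
            (\<forall>y\<in>U. (\<lambda>(g, x). act g x) y f \<in> Met_TC.mball ((\<lambda>(g, x). act g x) z f) e)"
          using gw f by (intro exI[of _ "?W \<times> ?N"]) (auto simp: Sa_action_eval mball_eq_ball)
      qed
    qed
    moreover have "(\<lambda>(g, x). act g x) \<in> topspace (prod_topology T SaX) \<rightarrow> topspace SaX"
      using Sa_action_closed by (auto simp: topspace_T)
    ultimately show ?thesis
      using topspace_Sa by (simp add: Sa_eq continuous_map_in_subtopology)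
  qed
  ultimately show ?thesis
    unfolding flow_def using Sa_compact Sa_Hausdorff point_eval_Sa[OF H_coset] by auto
qed

lemma RUC_extension:
  assumes bound: "\<And>x. x \<in> cosets \<Longrightarrow> \<bar>F x\<bar> \<le> B" and unif: "uniform_at_one F (\<lambda>g x. g <# x) cosets"
  obtains f where "continuous_map SaX euclideanreal f" "\<And>x. x \<in> cosets \<Longrightarrow> f (point_eval x) = F x"
proof -
  let ?F = "\<lambda>x\<in>cosets. complex_of_real (F x)"
  have "uniform_at_one ?F (\<lambda>g x. g <# x) cosets"
    unfolding uniform_at_one_def
  proof (intro allI impI)
    fix \<epsilon> :: real assume "\<epsilon> > 0"
    then obtain U where "openin T U" "\<one> \<in> U" "\<And>u x. u \<in> U \<Longrightarrow> x \<in> cosets \<Longrightarrow> dist (F (u <# x)) (F x) < \<epsilon>"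
      using unif unfolding uniform_at_one_def by meson
    moreover have "u <# x \<in> cosets" if "u \<in> U" "x \<in> cosets" for u x
      using that \<open>openin T U\<close> open_carrier coset_action by blast
    ultimately show "\<exists>U. openin T U \<and> \<one> \<in> U \<and> (\<forall>u\<in>U. \<forall>x\<in>cosets. dist (?F (u <# x)) (?F x) < \<epsilon>)"
      by (intro exI[of _ U]) (auto simp: dist_of_real)
  qed
  moreover have "bounded (?F ` cosets)" using bound unfolding bounded_iff by (intro exI[of _ B]) auto
  ultimately have F: "?F \<in> R_H" by (simp add: RUC_iff)
  have "continuous_map SaX euclideanreal (Re \<circ> (\<lambda>\<omega>. \<omega> ?F))"
    by (intro continuous_map_compose[OF eval_continuous[OF F]]) (simp add: continuous_on_Re)
  moreover have "(Re \<circ> (\<lambda>\<omega>. \<omega> ?F)) (point_eval x) = F x" if "x \<in> cosets" for x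
    using F that by (simp add: point_eval_def)
  ultimately show ?thesis using that by blast
qed

text \<open>The function \<open>gH \<mapsto> inf (l (g h))\<close>, for a length function \<open>l\<close>, separates \<open>H\<close> from the cosets
  that do not meet a neighbourhood of the identity.\<close>

lemma coset_bump:
  assumes U: "openin T U" "\<one> \<in> U"
  obtains F where "\<And>x. x \<in> cosets \<Longrightarrow> 0 \<le> F x \<and> F x \<le> (1::real)" "uniform_at_one F (\<lambda>g x. g <# x) cosets"
    "F H = 0" "\<And>x. x \<in> cosets \<Longrightarrow> x \<inter> U = {} \<Longrightarrow> F x = 1"
proof -
  obtain l :: "'g \<Rightarrow> real" where l: "\<And>x. 0 \<le> l x" "\<And>x. l x \<le> 1" "l \<one> = 0"
    "\<And>x y. x \<in> carrier G \<Longrightarrow> y \<in> carrier G \<Longrightarrow> l (x \<otimes> y) \<le> l x + l y"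
    "\<And>x. x \<in> carrier G \<Longrightarrow> l (inv x) = l x"
    "\<And>e. e > 0 \<Longrightarrow> \<exists>W. openin T W \<and> \<one> \<in> W \<and> (\<forall>w\<in>W. l w < e)"
    "\<And>x. x \<notin> U \<Longrightarrow> l x = 1"
    using length_function[OF U] by blast
  define F where "F = (\<lambda>x. INF g\<in>x. l g)"
  have ne: "x \<noteq> {}" if "x \<in> cosets" for x
    using that subgroup.one_closed[OF subgroup_H] by (auto elim!: cosetE simp: l_coset_def)
  have lower: "F x \<le> l g" if "g \<in> x" for x g
    unfolding F_def using that l(1) by (intro cINF_lower bdd_belowI2[of _ 0]) auto
  have greatest: "c \<le> F x" if "x \<in> cosets" "\<And>g. g \<in> x \<Longrightarrow> c \<le> l g" for c x
    unfolding F_def using that ne by (intro cINF_greatest) auto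
  have F01: "0 \<le> F x \<and> F x \<le> 1" if x: "x \<in> cosets" for x
  proof
    show "0 \<le> F x" using l(1) by (intro greatest x)
    obtain g where "g \<in> x" using ne[OF x] by blast
    from lower[OF this] show "F x \<le> 1" using l(2)[of g] by simp
  qed
  have half: "F (u <# x) \<le> F x + l u" if u: "u \<in> carrier G" and x: "x \<in> cosets" for u x
  proof -
    have "F (u <# x) - l u \<le> F x"
    proof (rule greatest[OF x])
      fix g assume g: "g \<in> x"
      hence "u \<otimes> g \<in> u <# x" by (auto simp: l_coset_def)
      hence "F (u <# x) \<le> l (u \<otimes> g)" by (rule lower)
      also have "\<dots> \<le> l u + l g" using u g coset_subset[OF x] by (intro l) auto
      finally show "F (u <# x) - l u \<le> l g" by simp
    qed
    thus ?thesis by simp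
  qed
  have lip: "\<bar>F (u <# x) - F x\<bar> \<le> l u" if u: "u \<in> carrier G" and x: "x \<in> cosets" for u x
  proof -
    have "F (inv u <# (u <# x)) \<le> F (u <# x) + l (inv u)" using u x coset_action by (intro half) auto
    moreover have "inv u <# (u <# x) = x" using coset_action_mult[of "inv u" u x] u x by (simp add: coset_action_one)
    ultimately show ?thesis using half[OF u x] l(5)[OF u] by (simp add: abs_le_iff)
  qed
  show ?thesis
  proof (rule that[of F, OF F01])
    show "uniform_at_one F (\<lambda>g x. g <# x) cosets"
      unfolding uniform_at_one_def
    proof (intro allI impI)
      fix \<epsilon> :: real assume \<epsilon>: "\<epsilon> > 0"
      obtain W where W: "openin T W" "\<one> \<in> W" "\<And>w. w \<in> W \<Longrightarrow> l w < \<epsilon>" using l(6)[OF \<epsilon>] by blast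
      have "dist (F (u <# x)) (F x) < \<epsilon>" if "u \<in> W" "x \<in> cosets" for u x
        using lip[of u x] W(3)[OF that(1)] that open_carrier[OF W(1)] by (auto simp: dist_real_def intro: le_less_trans)
      with W show "\<exists>U. openin T U \<and> \<one> \<in> U \<and> (\<forall>u\<in>U. \<forall>x\<in>cosets. dist (F (u <# x)) (F x) < \<epsilon>)" by blast
    qed
    show "F H = 0" using lower[of \<one> H] F01[OF H_coset] l(3) subgroup.one_closed[OF subgroup_H] by simp
    show "F x = 1" if x: "x \<in> cosets" "x \<inter> U = {}" for x
    proof -
      have "1 \<le> F x" using x l(7) by (intro greatest) force+
      thus ?thesis using F01[OF x(1)] by simp
    qed
  qed
qed

end

section \<open>Minimal flows\<close>

definition minimal_flow :: "('g, 'm) monoid_scheme \<Rightarrow> 'g topology \<Rightarrow> 'x topology \<Rightarrow> ('g \<Rightarrow> 'x \<Rightarrow> 'x) \<Rightarrow> bool" where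
  "minimal_flow G T X a \<longleftrightarrow> flow G T X a \<and>
     (\<forall>N. closedin X N \<and> N \<noteq> {} \<and> (\<forall>g\<in>carrier G. a g ` N \<subseteq> N) \<longrightarrow> N = topspace X)"

lemma flow_continuous:
  assumes "flow G T X a" "topspace T = carrier G" "g \<in> carrier G" shows "continuous_map X X (a g)"
proof -
  have "continuous_map X X ((\<lambda>(g, x). a g x) \<circ> (\<lambda>x. (g, x)))"
    using assms by (intro continuous_map_compose[of _ "prod_topology T X"] continuous_map_pairedI) (auto simp: flow_def)
  thus ?thesis by (simp add: o_def)
qed

lemma flow_closed: "flow G T X a \<Longrightarrow> g \<in> carrier G \<Longrightarrow> x \<in> topspace X \<Longrightarrow> a g x \<in> topspace X"
  using group_action_closed by (auto simp: flow_def)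

lemma flow_mult:
  "flow G T X a \<Longrightarrow> g \<in> carrier G \<Longrightarrow> h \<in> carrier G \<Longrightarrow> x \<in> topspace X \<Longrightarrow> a (g \<otimes>\<^bsub>G\<^esub> h) x = a g (a h x)"
  using group_action_mult by (auto simp: flow_def)

lemma flow_one: "flow G T X a \<Longrightarrow> x \<in> topspace X \<Longrightarrow> a \<one>\<^bsub>G\<^esub> x = x"
  using group_action_one by (auto simp: flow_def)

lemma flow_group: "flow G T X a \<Longrightarrow> group G"
  by (auto simp: flow_def group_action_def group_hom_def)

lemma flow_subflow:
  assumes X: "flow G T X a" and M: "closedin X M" "M \<noteq> {}" "\<And>g. g \<in> carrier G \<Longrightarrow> a g ` M \<subseteq> M"
    and T: "topspace T = carrier G"
  shows "flow G T (subtopology X M) (\<lambda>g. restrict (a g) M)"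
proof -
  have MX: "M \<subseteq> topspace X" using M(1) by (rule closedin_subset)
  have tM: "topspace (subtopology X M) = M" using MX by auto
  interpret group G using flow_group[OF X] .
  have aM: "a g x \<in> M" if "g \<in> carrier G" "x \<in> M" for g x using M(3) that by blast
  have xX: "x \<in> topspace X" if "x \<in> M" for x using MX that by blast
  have "group_action G M (\<lambda>g. restrict (a g) M)"
    by (rule group_actionI[OF is_group]) (auto simp: aM flow_mult[OF X _ _ xX] flow_one[OF X xX])
  moreover have "continuous_map (prod_topology T (subtopology X M)) (subtopology X M) (\<lambda>(g, x). restrict (a g) M x)"
  proof -
    have "continuous_map (prod_topology T (subtopology X M)) X (\<lambda>(g, x). a g x)"
      using X continuous_map_from_subtopology[of "prod_topology T X" X "\<lambda>(g, x). a g x" "topspace T \<times> M"]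
      by (simp add: flow_def prod_topology_subtopology)
    hence "continuous_map (prod_topology T (subtopology X M)) X (\<lambda>(g, x). restrict (a g) M x)"
      by (rule continuous_map_eq) (auto simp: tM)
    thus ?thesis using aM T by (auto simp: continuous_map_in_subtopology tM)
  qed
  moreover have "compact_space (subtopology X M)"
    using X M(1) by (intro compact_space_subtopology closedin_compact_space) (auto simp: flow_def)
  ultimately show ?thesis using X M(2) by (auto simp: flow_def tM Hausdorff_space_subtopology Int_absorb1 MX)
qed

lemma minimal_subflow_exists:
  assumes X: "flow G T X a" and T: "topspace T = carrier G"
  obtains M where "closedin X M" "M \<noteq> {}" "\<And>g. g \<in> carrier G \<Longrightarrow> a g ` M \<subseteq> M"
    "minimal_flow G T (subtopology X M) (\<lambda>g. restrict (a g) M)"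
proof -
  obtain M where M: "closedin X M" "M \<noteq> {}" "\<forall>g\<in>carrier G. a g ` M \<subseteq> M"
    "\<And>N. closedin X N \<Longrightarrow> N \<noteq> {} \<Longrightarrow> \<forall>g\<in>carrier G. a g ` N \<subseteq> N \<Longrightarrow> N \<subseteq> M \<Longrightarrow> N = M"
  proof (rule minimal_closed_subset[of X "topspace X" "\<lambda>N. \<forall>g\<in>carrier G. a g ` N \<subseteq> N"])
    show "\<forall>g\<in>carrier G. a g ` topspace X \<subseteq> topspace X" using flow_closed[OF X] by blast
    show "\<forall>g\<in>carrier G. a g ` \<Inter>C \<subseteq> \<Inter>C"
      if "C \<noteq> {}" "\<And>B. B \<in> C \<Longrightarrow> \<forall>g\<in>carrier G. a g ` B \<subseteq> B" for C using that by blast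
  qed (use X in \<open>auto simp: flow_def\<close>)
  have MX: "M \<subseteq> topspace X" using M(1) by (rule closedin_subset)
  have "minimal_flow G T (subtopology X M) (\<lambda>g. restrict (a g) M)"
    unfolding minimal_flow_def
  proof (intro conjI allI impI)
    show "flow G T (subtopology X M) (\<lambda>g. restrict (a g) M)" using M T by (intro flow_subflow[OF X]) auto
    fix N assume N: "closedin (subtopology X M) N \<and> N \<noteq> {} \<and> (\<forall>g\<in>carrier G. restrict (a g) M ` N \<subseteq> N)"
    hence "closedin X N" "N \<subseteq> M" using M(1) closedin_closed_subtopology by blast+
    moreover have "\<forall>g\<in>carrier G. a g ` N \<subseteq> N" using N \<open>N \<subseteq> M\<close> by fastforce
    ultimately have "N = M" using N by (intro M(4)) auto
    thus "N = topspace (subtopology X M)" using MX by auto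
  qed
  with M(1-3) show ?thesis by (intro that) auto
qed

lemma minimal_flow_hits_open:
  assumes X: "minimal_flow G T X a" and T: "topspace T = carrier G"
    and W: "openin X W" "W \<noteq> {}" and x: "x \<in> topspace X"
  obtains g where "g \<in> carrier G" "a g x \<in> W"
proof -
  have fl: "flow G T X a" using X by (simp add: minimal_flow_def)
  interpret group G using flow_group[OF fl] .
  let ?orb = "(\<lambda>g. a g x) ` carrier G"
  have orb: "?orb \<subseteq> topspace X" using flow_closed[OF fl _ x] by blast
  have "a g ` (X closure_of ?orb) \<subseteq> X closure_of ?orb" if g: "g \<in> carrier G" for g
  proof -
    have "a g ` (X closure_of ?orb) \<subseteq> X closure_of (a g ` ?orb)"
      using flow_continuous[OF fl T g] continuous_map_image_closure_subset by blast
    also have "a g ` ?orb \<subseteq> ?orb" using g x by (auto simp: flow_mult[OF fl, symmetric])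
    hence "X closure_of (a g ` ?orb) \<subseteq> X closure_of ?orb" by (rule closure_of_mono)
    finally show ?thesis .
  qed
  moreover have "X closure_of ?orb \<noteq> {}" using closure_of_subset[OF orb] one_closed by blast
  ultimately have "X closure_of ?orb = topspace X" using X by (auto simp: minimal_flow_def)
  moreover obtain z where "z \<in> W" using W(2) by blast
  ultimately have "z \<in> X closure_of ?orb" using openin_subset[OF W(1)] by blast
  thus ?thesis using W(1) \<open>z \<in> W\<close> that unfolding in_closure_of by blast
qed

section \<open>Transport of flows along injections\<close>

text \<open>The topology on the image of an injection \<open>e\<close> for which \<open>e\<close> is a homeomorphism.\<close>

definition image_topology :: "('x \<Rightarrow> 'y) \<Rightarrow> 'x topology \<Rightarrow> 'y topology" where
  "image_topology e X = pullback_topology (e ` topspace X) (inv_into (topspace X) e) X"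

lemma image_topology_homeomorphic:
  assumes e: "inj_on e (topspace X)"
  shows "homeomorphic_maps X (image_topology e X) e (inv_into (topspace X) e)"
  unfolding homeomorphic_maps_def
proof (intro conjI ballI)
  have "continuous_map X X (inv_into (topspace X) e \<circ> e)"
    by (rule continuous_map_eq[OF continuous_map_id]) (simp add: e)
  thus "continuous_map X (image_topology e X) e"
    unfolding image_topology_def by (rule continuous_map_pullback') auto
  have "continuous_map (image_topology e X) X (id \<circ> inv_into (topspace X) e)"
    unfolding image_topology_def by (rule continuous_map_pullback) simp
  thus "continuous_map (image_topology e X) X (inv_into (topspace X) e)" by simp
  show "e (inv_into (topspace X) e y) = y" if "y \<in> topspace (image_topology e X)" for y
    using that by (auto simp: image_topology_def topspace_pullback_topology f_inv_into_f)
qed (simp add: e)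

lemma topspace_image_topology: "inj_on e (topspace X) \<Longrightarrow> topspace (image_topology e X) = e ` topspace X"
  using image_topology_homeomorphic homeomorphic_imp_surjective_map homeomorphic_maps_map by metis

definition image_action :: "('x \<Rightarrow> 'y) \<Rightarrow> 'x topology \<Rightarrow> ('g \<Rightarrow> 'x \<Rightarrow> 'x) \<Rightarrow> 'g \<Rightarrow> 'y \<Rightarrow> 'y" where
  "image_action e X a g = (\<lambda>y\<in>e ` topspace X. e (a g (inv_into (topspace X) e y)))"

lemma image_action_apply:
  "inj_on e (topspace X) \<Longrightarrow> x \<in> topspace X \<Longrightarrow> image_action e X a g (e x) = e (a g x)"
  by (simp add: image_action_def)

lemma image_flow:
  assumes X: "flow G T X a" and e: "inj_on e (topspace X)"
  shows "flow G T (image_topology e X) (image_action e X a)"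
proof -
  let ?Y = "image_topology e X" and ?b = "image_action e X a" and ?i = "inv_into (topspace X) e"
  note hom = image_topology_homeomorphic[OF e]
  have top: "topspace ?Y = e ` topspace X" by (rule topspace_image_topology[OF e])
  have homs: "X homeomorphic_space ?Y" using hom homeomorphic_space_def by blast
  note ap = image_action_apply[OF e]
  have "group_action G (topspace ?Y) ?b"
    unfolding top
    by (rule group_actionI[OF flow_group[OF X]])
       (auto simp: ap flow_closed[OF X] flow_mult[OF X] flow_one[OF X], simp add: image_action_def)
  moreover have "continuous_map (prod_topology T ?Y) ?Y (\<lambda>(g, y). ?b g y)"
  proof -
    have "continuous_map (prod_topology T ?Y) (prod_topology T X) (\<lambda>z. (fst z, ?i (snd z)))"
      using hom continuous_map_compose[OF continuous_map_snd, of ?Y X ?i T]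
      by (intro continuous_map_pairedI continuous_map_fst) (auto simp: homeomorphic_maps_def o_def)
    moreover have "continuous_map (prod_topology T X) X (\<lambda>(g, x). a g x)" using X by (simp add: flow_def)
    moreover have "continuous_map X ?Y e" using hom by (simp add: homeomorphic_maps_def)
    ultimately have "continuous_map (prod_topology T ?Y) ?Y (e \<circ> ((\<lambda>(g, x). a g x) \<circ> (\<lambda>z. (fst z, ?i (snd z)))))"
      by (intro continuous_map_compose)
    thus ?thesis by (rule continuous_map_eq) (auto simp: top image_action_def)
  qed
  moreover have "compact_space ?Y" "Hausdorff_space ?Y"
    using X homs homeomorphic_compact_space homeomorphic_Hausdorff_space by (auto simp: flow_def)
  moreover have "topspace ?Y \<noteq> {}" using X top by (simp add: flow_def)
  ultimately show ?thesis by (simp add: flow_def)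
qed

lemma image_proximal:
  assumes X: "flow G T X a" "proximal G X a" and e: "inj_on e (topspace X)"
  shows "proximal G (image_topology e X) (image_action e X a)"
  unfolding proximal_def topspace_image_topology[OF e]
proof (intro ballI)
  fix x' y' assume "x' \<in> e ` topspace X" "y' \<in> e ` topspace X"
  then obtain x y where xy: "x \<in> topspace X" "y \<in> topspace X" "x' = e x" "y' = e y" by blast
  then obtain F z where F: "F \<noteq> bot" "eventually (\<lambda>g. g \<in> carrier G) F"
    "limitin X (\<lambda>g. a g x) z F" "limitin X (\<lambda>g. a g y) z F" using X(2) unfolding proximal_def by blast
  have "continuous_map X (image_topology e X) e"
    using image_topology_homeomorphic[OF e] by (simp add: homeomorphic_maps_def)
  note lim = continuous_map_limit[OF this]
  have "limitin (image_topology e X) (\<lambda>g. image_action e X a g x') (e z) F"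
    using lim[OF F(3)] xy by (simp add: o_def image_action_apply[OF e])
  moreover have "limitin (image_topology e X) (\<lambda>g. image_action e X a g y') (e z) F"
    using lim[OF F(4)] xy by (simp add: o_def image_action_apply[OF e])
  ultimately show "\<exists>F z. F \<noteq> bot \<and> eventually (\<lambda>g. g \<in> carrier G) F \<and>
      limitin (image_topology e X) (\<lambda>g. image_action e X a g x') z F \<and>
      limitin (image_topology e X) (\<lambda>g. image_action e X a g y') z F"
    using F(1,2) by blast
qed

lemma proximal_subflow:
  assumes X: "flow G T X a" "proximal G X a" and M: "closedin X M" "\<And>g. g \<in> carrier G \<Longrightarrow> a g ` M \<subseteq> M"
  shows "proximal G (subtopology X M) (\<lambda>g. restrict (a g) M)"
  unfolding proximal_def
proof (intro ballI)
  fix x y assume xy: "x \<in> topspace (subtopology X M)" "y \<in> topspace (subtopology X M)"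
  then obtain F z where F: "F \<noteq> bot" "eventually (\<lambda>g. g \<in> carrier G) F"
    "limitin X (\<lambda>g. a g x) z F" "limitin X (\<lambda>g. a g y) z F" using X(2) unfolding proximal_def by force
  have ev: "eventually (\<lambda>g. a g x \<in> M) F" "eventually (\<lambda>g. a g y \<in> M) F"
    using F(2) by (eventually_elim; use M(2) xy in force)+
  have "z \<in> M" using limitin_closedin[OF F(3) M(1) ev(1) F(1)] .
  hence "limitin (subtopology X M) (\<lambda>g. restrict (a g) M x) z F" "limitin (subtopology X M) (\<lambda>g. restrict (a g) M y) z F"
    using F ev xy by (auto simp: limitin_subtopology)
  thus "\<exists>F z. F \<noteq> bot \<and> eventually (\<lambda>g. g \<in> carrier G) F \<and>
      limitin (subtopology X M) (\<lambda>g. restrict (a g) M x) z F \<and>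
      limitin (subtopology X M) (\<lambda>g. restrict (a g) M y) z F"
    using F(1,2) by blast
qed

text \<open>In a minimal flow the orbit of \<open>m\<close> is dense, so a point is determined by the sets of group
  elements along which the orbit of \<open>m\<close> accumulates at it.\<close>

lemma minimal_flow_embedding:
  assumes X: "minimal_flow G T X a" and T: "topspace T = carrier G" and m: "m \<in> topspace X"
  shows "inj_on (\<lambda>x. {A. x \<in> X closure_of ((\<lambda>g. a g m) ` (A \<inter> carrier G))}) (topspace X)"
proof (rule inj_onI, rule ccontr)
  fix x y assume xy: "x \<in> topspace X" "y \<in> topspace X" "x \<noteq> y"
    and eq: "{A. x \<in> X closure_of ((\<lambda>g. a g m) ` (A \<inter> carrier G))} = {A. y \<in> X closure_of ((\<lambda>g. a g m) ` (A \<inter> carrier G))}"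
  have "Hausdorff_space X" using X by (simp add: minimal_flow_def flow_def)
  then obtain U V where UV: "openin X U" "openin X V" "x \<in> U" "y \<in> V" "disjnt U V"
    using xy unfolding Hausdorff_space_def by metis
  define A where "A = {g. a g m \<in> U}"
  have "x \<in> X closure_of ((\<lambda>g. a g m) ` (A \<inter> carrier G))"
    unfolding in_closure_of
  proof (intro conjI xy(1) allI impI)
    fix W assume "x \<in> W \<and> openin X W"
    hence "openin X (W \<inter> U)" "W \<inter> U \<noteq> {}" using UV by auto
    then obtain g where "g \<in> carrier G" "a g m \<in> W \<inter> U" using minimal_flow_hits_open[OF X T _ _ m] by blast
    thus "\<exists>z. z \<in> (\<lambda>g. a g m) ` (A \<inter> carrier G) \<and> z \<in> W" by (auto simp: A_def)
  qed
  hence "y \<in> X closure_of ((\<lambda>g. a g m) ` (A \<inter> carrier G))" using eq by blast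
  then obtain z where "z \<in> (\<lambda>g. a g m) ` (A \<inter> carrier G)" "z \<in> V" using UV unfolding in_closure_of by blast
  thus False using UV(5) by (auto simp: A_def disjnt_def)
qed

text \<open>Flows of any size are covered, since a minimal subflow embeds in the type over which the
  definition quantifies.\<close>

theorem strongly_amenable_fixed_point:
  fixes G :: "('g, 'm) monoid_scheme" and Y :: "'y topology"
  assumes sa: "strongly_amenable TYPE('x) G T" and T: "topspace T = carrier G"
    and Y: "flow G T Y a" "proximal G Y a"
  shows "has_fixed_point G Y a"
proof -
  obtain M where M: "closedin Y M" "M \<noteq> {}" "\<And>g. g \<in> carrier G \<Longrightarrow> a g ` M \<subseteq> M"
    "minimal_flow G T (subtopology Y M) (\<lambda>g. restrict (a g) M)"
    using minimal_subflow_exists[OF Y(1) T] by blast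
  let ?X = "subtopology Y M" and ?a = "\<lambda>g. restrict (a g) M"
  have MY: "M \<subseteq> topspace Y" using closedin_subset[OF M(1)] .
  hence top: "topspace ?X = M" by auto
  obtain m where m: "m \<in> M" using M(2) by blast
  define e where "e = (\<lambda>x. Inr {A. x \<in> ?X closure_of ((\<lambda>g. ?a g m) ` (A \<inter> carrier G))} :: 'x + 'g set set)"
  have e: "inj_on e (topspace ?X)"
  proof -
    have "m \<in> topspace ?X" using m top by simp
    from minimal_flow_embedding[OF M(4) T this] show ?thesis
      unfolding e_def inj_on_def sum.inject by blast
  qed
  have fl: "flow G T ?X ?a" using M(4) by (simp add: minimal_flow_def)
  have "proximal G ?X ?a" using proximal_subflow[OF Y M(1,3)] .
  hence "has_fixed_point G (image_topology e ?X) (image_action e ?X ?a)"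
    using sa image_flow[OF fl e] image_proximal[OF fl _ e] unfolding strongly_amenable_def by blast
  then obtain x where x: "x \<in> M" "\<And>g. g \<in> carrier G \<Longrightarrow> image_action e ?X ?a g (e x) = e x"
    unfolding has_fixed_point_def topspace_image_topology[OF e] top by blast
  have "a g x = x" if g: "g \<in> carrier G" for g
  proof -
    have "e (?a g x) = e x" using x(2)[OF g] image_action_apply[OF e, of x ?a g] x(1) unfolding top by simp
    moreover have "?a g x \<in> M" using M(3)[OF g] x(1) by auto
    ultimately have "?a g x = x" using e x(1) unfolding top inj_on_def by blast
    thus ?thesis using x(1) by simp
  qed
  thus ?thesis using x(1) MY unfolding has_fixed_point_def by blast
qed

lemma group_action_extensional:
  assumes "group_action G E \<phi>" "g \<in> carrier G" shows "\<phi> g \<in> extensional E"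
proof -
  have "\<phi> g \<in> carrier (BijGroup E)"
    using group_action.group_hom[OF assms(1)] assms(2) by (rule group_hom.hom_closed)
  thus ?thesis by (simp add: BijGroup_def Bij_def)
qed

section \<open>The state space of the Samuel compactification\<close>

lemma flow_uniform:
  assumes X: "flow G T X a" and T: "topspace T = carrier G" and f: "continuous_map X euclideanreal f"
    and g: "g \<in> carrier G" and e: "e > 0"
  obtains W where "openin T W" "g \<in> W" "\<And>g' x. g' \<in> W \<Longrightarrow> x \<in> topspace X \<Longrightarrow> \<bar>f (a g' x) - f (a g x)\<bar> < e"
proof -
  have "continuous_map (prod_topology T X) euclideanreal (f \<circ> (\<lambda>(g, x). a g x))"
    using X f by (intro continuous_map_compose) (auto simp: flow_def)
  note c = this[unfolded continuous_map_real_iff, rule_format]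
  have "\<exists>W N. openin T W \<and> openin X N \<and> g \<in> W \<and> x \<in> N \<and> (\<forall>g'\<in>W. \<forall>x'\<in>N. \<bar>f (a g' x') - f (a g x)\<bar> < e / 2)"
    if x: "x \<in> topspace X" for x
  proof -
    obtain U where U: "openin (prod_topology T X) U" "(g, x) \<in> U"
      "\<And>z. z \<in> U \<Longrightarrow> \<bar>(f \<circ> (\<lambda>(g, x). a g x)) z - (f \<circ> (\<lambda>(g, x). a g x)) (g, x)\<bar> < e / 2"
    proof -
      have "(g, x) \<in> topspace (prod_topology T X)" "e / 2 > 0" using x g T e by auto
      from c[OF this] show ?thesis using that by blast
    qed
    then obtain W N where "openin T W" "openin X N" "g \<in> W" "x \<in> N" "W \<times> N \<subseteq> U"
      using openin_prod_topology_alt[of T X U] by blast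
    moreover have "\<bar>f (a g' x') - f (a g x)\<bar> < e / 2" if "g' \<in> W" "x' \<in> N" for g' x'
      using U(3)[of "(g', x')"] calculation that by auto
    ultimately show ?thesis by blast
  qed
  hence "\<forall>x\<in>topspace X. \<exists>p. openin T (fst p) \<and> openin X (snd p) \<and> g \<in> fst p \<and> x \<in> snd p \<and>
      (\<forall>g'\<in>fst p. \<forall>x'\<in>snd p. \<bar>f (a g' x') - f (a g x)\<bar> < e / 2)" by (metis fst_conv snd_conv)
  then obtain p where p: "\<forall>x\<in>topspace X. openin T (fst (p x)) \<and> openin X (snd (p x)) \<and> g \<in> fst (p x) \<and> x \<in> snd (p x) \<and>
      (\<forall>g'\<in>fst (p x). \<forall>x'\<in>snd (p x). \<bar>f (a g' x') - f (a g x)\<bar> < e / 2)" by (rule bchoice[THEN exE])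
  define W where "W = (\<lambda>x. fst (p x))"
  define N where "N = (\<lambda>x. snd (p x))"
  have WN: "\<And>x. x \<in> topspace X \<Longrightarrow> openin T (W x)" "\<And>x. x \<in> topspace X \<Longrightarrow> openin X (N x)"
    "\<And>x. x \<in> topspace X \<Longrightarrow> g \<in> W x" "\<And>x. x \<in> topspace X \<Longrightarrow> x \<in> N x"
    "\<And>x g' x'. x \<in> topspace X \<Longrightarrow> g' \<in> W x \<Longrightarrow> x' \<in> N x \<Longrightarrow> \<bar>f (a g' x') - f (a g x)\<bar> < e / 2"
    using p unfolding W_def N_def by blast+
  have "compactin X (topspace X)" using X by (simp add: flow_def compact_space_def)
  moreover have "topspace X \<subseteq> \<Union>(N ` topspace X)" "\<forall>U\<in>N ` topspace X. openin X U" using WN by auto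
  ultimately obtain \<F> where "finite \<F>" "\<F> \<subseteq> N ` topspace X" "topspace X \<subseteq> \<Union>\<F>"
    unfolding compactin_def by meson
  then obtain I where I: "finite I" "I \<subseteq> topspace X" "topspace X \<subseteq> \<Union>(N ` I)"
    by (metis finite_subset_image)
  let ?W = "topspace T \<inter> \<Inter>(W ` I)"
  have "openin T ?W"
    using I WN(1) by (cases "I = {}") (auto intro!: openin_Int openin_Inter)
  moreover have "g \<in> ?W" using g T WN(3) I by auto
  moreover have "\<bar>f (a g' x') - f (a g x')\<bar> < e" if g': "g' \<in> ?W" and x': "x' \<in> topspace X" for g' x'
  proof -
    obtain x where x: "x \<in> I" "x' \<in> N x" using I(3) x' by blast
    hence xX: "x \<in> topspace X" using I by blast
    have "\<bar>f (a g' x') - f (a g x)\<bar> < e / 2" using WN(5)[OF xX _ x(2)] g' x(1) by blast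
    moreover have "\<bar>f (a g x') - f (a g x)\<bar> < e / 2" using WN(5)[OF xX WN(3)[OF xX] x(2)] .
    ultimately show ?thesis by linarith
  qed
  ultimately show ?thesis using that by blast
qed

context coset_space
begin

abbreviation "C_Sa \<equiv> C_space SaX"
abbreviation "P_Sa \<equiv> nonneg_on (topspace SaX)"
abbreviation "K \<equiv> state_space C_Sa P_Sa"
abbreviation "K_action \<equiv> state_action C_Sa P_Sa act"

sublocale K: ordered_function_algebra "topspace SaX" C_Sa P_Sa
  by (rule C_space_algebra[OF Sa_compact])

definition dirac :: "'g \<Rightarrow> ((('g set \<Rightarrow> complex) \<Rightarrow> complex) \<Rightarrow> real) \<Rightarrow> real" where
  "dirac g = (\<lambda>f. if f \<in> C_Sa then f (point_eval (g <# H)) else 0)"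

lemma dirac_eval: "f \<in> C_Sa \<Longrightarrow> dirac g f = f (point_eval (g <# H))"
  by (simp add: dirac_def)

lemma dirac_state: "g \<in> carrier G \<Longrightarrow> dirac g \<in> states C_Sa P_Sa"
  using point_eval_Sa[OF coset_mem, of g]
  unfolding states_def dirac_def by (auto simp: K.add K.scale K.const nonneg_on_def)

lemma Sa_act_continuous: "g \<in> carrier G \<Longrightarrow> continuous_map SaX SaX (act g)"
  by (rule flow_continuous[OF Sa_flow topspace_T])

abbreviation "GH \<equiv> G\<lparr>carrier := H\<rparr>"
abbreviation "TH \<equiv> subtopology T H"

lemma TH_top: "topspace TH = carrier GH" using H_carrier by (auto simp: topspace_T)

lemma C_Sa_translate: "f \<in> C_Sa \<Longrightarrow> g \<in> carrier G \<Longrightarrow> (\<lambda>x. f (act g x)) \<in> C_Sa"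
  using continuous_map_compose[OF Sa_act_continuous] by (fastforce simp: C_space_def o_def)

lemma K_flow: "affine_flow G T K K_action"
proof (rule K.state_affine_flow[OF is_group topspace_T])
  fix g f and e :: real assume g: "g \<in> carrier G" and f: "f \<in> C_Sa" and e: "e > 0"
  have "continuous_map SaX euclideanreal f" using f by (simp add: C_space_def)
  from flow_uniform[OF Sa_flow topspace_T this g e]
  obtain W where "openin T W" "g \<in> W" "\<And>g' x. g' \<in> W \<Longrightarrow> x \<in> topspace SaX \<Longrightarrow> \<bar>f (act g' x) - f (act g x)\<bar> < e"
    by blast
  thus "\<exists>W. openin T W \<and> g \<in> W \<and> (\<forall>g'\<in>W. \<forall>x\<in>topspace SaX. \<bar>f (act g' x) - f (act g x)\<bar> \<le> e)"
    by (meson less_imp_le)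
next
  show "states C_Sa P_Sa \<noteq> {}" using dirac_state by blast
qed (use flow_closed[OF Sa_flow] flow_mult[OF Sa_flow] flow_one[OF Sa_flow] C_Sa_translate in \<open>auto simp: nonneg_on_def\<close>)

lemma K_action_dirac:
  assumes "g \<in> carrier G" "h \<in> carrier G" shows "K_action g (dirac h) = dirac (g \<otimes> h)"
proof
  fix f show "K_action g (dirac h) f = dirac (g \<otimes> h) f"
    using assms dirac_state[of h] C_Sa_translate[of f g] Sa_action_point_eval[of g "h <# H"]
      coset_mem[of h] H_carrier
    by (auto simp: state_action_def dirac_def lcos_m_assoc)
qed

lemma dirac_one: "h \<in> H \<Longrightarrow> dirac h = dirac \<one>"
  using coset_of_H subgroup.one_closed[OF subgroup_H] by (simp add: dirac_def fun_eq_iff)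

text \<open>A state that vanishes on \<open>(f - f x)\<^sup>2\<close> agrees with the evaluation at \<open>x\<close> on \<open>f\<close>, because
  \<open>\<bar>t\<bar> \<le> e / 2 + t\<^sup>2 / (2 e)\<close>.\<close>

lemma dirac_extreme:
  assumes g: "g \<in> carrier G" shows "dirac g extreme_point_of states C_Sa P_Sa"
  unfolding extreme_point_of_def
proof (intro conjI ballI notI dirac_state g)
  fix \<Lambda> \<Lambda>' assume L: "\<Lambda> \<in> states C_Sa P_Sa" "\<Lambda>' \<in> states C_Sa P_Sa" and seg: "dirac g \<in> open_segment \<Lambda> \<Lambda>'"
  obtain u where u: "0 < u" "u < 1" "dirac g = (1 - u) *\<^sub>R \<Lambda> + u *\<^sub>R \<Lambda>'" and ne: "\<Lambda> \<noteq> \<Lambda>'"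
    using seg by (auto simp: in_segment)
  have eval: "M f = f (point_eval (g <# H))"
    if M: "M \<in> states C_Sa P_Sa" and f: "f \<in> C_Sa"
      and zero: "M (\<lambda>x. (f x - f (point_eval (g <# H))) * (f x - f (point_eval (g <# H)))) = 0" for M f
  proof -
    let ?c = "f (point_eval (g <# H))"
    let ?q = "\<lambda>x. (f x - ?c) * (f x - ?c)"
    have d: "(\<lambda>x. f x - ?c) \<in> C_Sa" by (intro K.diff f K.const)
    have q: "?q \<in> C_Sa" by (intro K.mult d)
    have "\<bar>M (\<lambda>x. f x - ?c) - 0\<bar> \<le> e" if e: "e > 0" for e
    proof -
      have 1: "M (\<lambda>x. e / 2 + 1 / (2 * e) * ?q x) = e / 2"
        using zero by (simp only: K.state_add[OF M K.const K.scale[OF q]] K.state_const[OF M] K.state_scale[OF M q])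
      have am: "\<bar>t\<bar> \<le> e / 2 + 1 / (2 * e) * (t * t)" for t :: real
      proof -
        have "0 \<le> (\<bar>t\<bar> - e)\<^sup>2" by simp
        hence "2 * e * \<bar>t\<bar> \<le> e * e + t * t" by (simp add: power2_eq_square algebra_simps)
        thus ?thesis using e by (simp add: field_simps)
      qed
      have up: "M (\<lambda>x. f x - ?c) \<le> M (\<lambda>x. e / 2 + 1 / (2 * e) * ?q x)"
      proof (rule K.state_mono[OF M d])
        show "(\<lambda>x. e / 2 + 1 / (2 * e) * ?q x) \<in> C_Sa" by (intro K.add K.const K.scale q)
        show "f x - ?c \<le> e / 2 + 1 / (2 * e) * ?q x" for x
          using am[of "f x - ?c"] abs_ge_self[of "f x - ?c"] by (rule order_trans[rotated])
      qed
      have "M (\<lambda>x. - 1 * (f x - ?c)) \<le> M (\<lambda>x. e / 2 + 1 / (2 * e) * ?q x)"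
      proof (rule K.state_mono[OF M K.scale[OF d]])
        show "(\<lambda>x. e / 2 + 1 / (2 * e) * ?q x) \<in> C_Sa" by (intro K.add K.const K.scale q)
        show "- 1 * (f x - ?c) \<le> e / 2 + 1 / (2 * e) * ?q x" for x
          using am[of "f x - ?c"] abs_ge_minus_self[of "f x - ?c"] unfolding mult_minus1 by (rule order_trans[rotated])
      qed
      thus ?thesis using up 1 e unfolding K.state_scale[OF M d] by (simp add: abs_le_iff)
    qed
    note small = this
    have "\<bar>M (\<lambda>x. f x - ?c) - 0\<bar> \<le> 0"
    proof (rule field_le_epsilon)
      fix e :: real assume "e > 0"
      from small[OF this] show "\<bar>M (\<lambda>x. f x - ?c) - 0\<bar> \<le> 0 + e" by (simp only: add_0)
    qed
    hence "M (\<lambda>x. f x - ?c) = 0" by simp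
    thus ?thesis using K.state_diff[OF M f K.const] K.state_const[OF M] by simp
  qed
  have "\<Lambda> f = \<Lambda>' f" for f
  proof (cases "f \<in> C_Sa")
    case False
    thus ?thesis using K.state_outside[OF L(1)] K.state_outside[OF L(2)] by simp
  next
    case f: True
    let ?q = "\<lambda>x. (f x - f (point_eval (g <# H))) * (f x - f (point_eval (g <# H)))"
    have q: "?q \<in> C_Sa" by (intro K.mult K.diff f K.const)
    have qP: "?q \<in> P_Sa" by (simp add: nonneg_on_def)
    have "(1 - u) * \<Lambda> ?q + u * \<Lambda>' ?q = 0"
      using fun_cong[OF u(3), of ?q] q by (simp add: dirac_eval scaleR_fun_def)
    moreover have "0 \<le> \<Lambda> ?q" "0 \<le> \<Lambda>' ?q" using K.state_nonneg[OF L(1) q qP] K.state_nonneg[OF L(2) q qP] .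
    ultimately have "\<Lambda> ?q = 0" "\<Lambda>' ?q = 0"
      using u(1,2) by (smt (verit) mult_nonneg_nonneg mult_pos_pos)+
    thus ?thesis using eval[OF L(1) f] eval[OF L(2) f] by simp
  qed
  with ne show False by blast
qed

lemma Sa_le_on_closure:
  assumes f: "f \<in> C_Sa" and le: "\<And>g. g \<in> carrier G \<Longrightarrow> f (point_eval (g <# H)) \<le> t" and x: "x \<in> topspace SaX"
  shows "f x \<le> t"
proof -
  have "closedin SaX {x \<in> topspace SaX. f x \<in> {..t}}"
    using f by (intro closedin_continuous_map_preimage) (auto simp: C_space_def)
  moreover have "point_eval ` cosets \<subseteq> {x \<in> topspace SaX. f x \<in> {..t}}"
    using le point_eval_Sa coset_mem by (auto elim!: cosetE)
  ultimately have "SaX closure_of (point_eval ` cosets) \<subseteq> {x \<in> topspace SaX. f x \<in> {..t}}"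
    by (rule closure_of_minimal[rotated])
  thus ?thesis using point_eval_dense x by blast
qed

text \<open>Otherwise a continuous function on the compactification would be larger at a state than on the dense
  set of cosets.\<close>

lemma K_hull:
  assumes C: "closedin K C" "convex C" "\<And>g. g \<in> carrier G \<Longrightarrow> dirac g \<in> C"
  shows "C = topspace K"
proof
  show "C \<subseteq> topspace K" using C(1) by (rule closedin_subset)
  show "topspace K \<subseteq> C"
  proof
    fix \<nu> assume \<nu>: "\<nu> \<in> topspace K"
    show "\<nu> \<in> C"
    proof (rule K.states_separation)
      show "C \<subseteq> states C_Sa P_Sa" using closedin_subset[OF C(1)] by simp
      show "C \<noteq> {}" using C(3) by blast
      show "\<nu> \<in> states C_Sa P_Sa" using \<nu> by simp
      fix F t assume F: "F \<in> C_Sa" "\<And>\<kappa>. \<kappa> \<in> C \<Longrightarrow> \<kappa> F \<le> t"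
      have "F x \<le> t" if "x \<in> topspace SaX" for x
        using Sa_le_on_closure[OF F(1) _ that] F(2)[OF C(3)] dirac_eval[OF F(1)] by simp
      moreover have "\<nu> \<in> states C_Sa P_Sa" using \<nu> by simp
      ultimately show "\<nu> F \<le> t" using K.state_le[OF _ F(1)] by blast
    qed (use C in auto)
  qed
qed

lemma ext_closure_K: "ext_closure K \<subseteq> K closure_of (dirac ` carrier G)"
  unfolding ext_closure_def
proof (rule closure_of_minimal)
  have sub: "dirac ` carrier G \<subseteq> K closure_of (dirac ` carrier G)"
    by (rule closure_of_subset) (use dirac_state in auto)
  show "{x. x extreme_point_of topspace K} \<subseteq> K closure_of (dirac ` carrier G)"
  proof
    fix e assume "e \<in> {x. x extreme_point_of topspace K}"
    hence e: "e extreme_point_of topspace K" by simp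
    show "e \<in> K closure_of (dirac ` carrier G)"
    proof (rule milman[OF K.state_space_compact_convex _ _ e])
      fix C assume "closedin K C" "convex C" "K closure_of (dirac ` carrier G) \<subseteq> C"
      thus "C = topspace K" using sub by (intro K_hull) auto
    qed simp
  qed
qed simp

lemma dirac_ext_closure: "dirac \<one> \<in> ext_closure K"
proof -
  have "{x. x extreme_point_of topspace K} \<subseteq> topspace K" by (auto simp: extreme_point_of_def)
  from closure_of_subset[OF this] show ?thesis
    using dirac_extreme[OF one_closed] unfolding ext_closure_def by auto
qed

end

section \<open>Strong amenability implies proximal irreducibility\<close>

lemma affine_flow_extreme:
  assumes L: "affine_flow G T L b" and g: "g \<in> carrier G" and e: "e extreme_point_of topspace L"
  shows "b g e extreme_point_of topspace L"
proof -
  have fl: "flow G T L b" using L by (simp add: affine_flow_def)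
  interpret group G using flow_group[OF fl] .
  have eL: "e \<in> topspace L" using e by (simp add: extreme_point_of_def)
  have ig: "inv\<^bsub>G\<^esub> g \<in> carrier G" using g by simp
  have inv1: "b (inv\<^bsub>G\<^esub> g) (b g x) = x" "b g (b (inv\<^bsub>G\<^esub> g) x) = x" if "x \<in> topspace L" for x
    using flow_mult[OF fl ig g that] flow_mult[OF fl g ig that] flow_one[OF fl that] g by auto
  show ?thesis
    unfolding extreme_point_of_def
  proof (intro conjI ballI notI flow_closed[OF fl g eL])
    fix p q assume pq: "p \<in> topspace L" "q \<in> topspace L" "b g e \<in> open_segment p q"
    obtain u where u: "0 < u" "u < 1" "b g e = (1 - u) *\<^sub>R p + u *\<^sub>R q" "p \<noteq> q" using pq(3) by (auto simp: in_segment)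
    have "affine_map_on (topspace L) (b (inv\<^bsub>G\<^esub> g))" using L ig by (simp add: affine_flow_def)
    hence "b (inv\<^bsub>G\<^esub> g) (b g e) = (1 - u) *\<^sub>R b (inv\<^bsub>G\<^esub> g) p + u *\<^sub>R b (inv\<^bsub>G\<^esub> g) q"
      using pq u unfolding affine_map_on_def by simp
    hence "e = (1 - u) *\<^sub>R b (inv\<^bsub>G\<^esub> g) p + u *\<^sub>R b (inv\<^bsub>G\<^esub> g) q" using inv1(1)[OF eL] by simp
    moreover have "b (inv\<^bsub>G\<^esub> g) p \<noteq> b (inv\<^bsub>G\<^esub> g) q" using inv1(2)[OF pq(1)] inv1(2)[OF pq(2)] u(4) by metis
    ultimately have "e \<in> open_segment (b (inv\<^bsub>G\<^esub> g) p) (b (inv\<^bsub>G\<^esub> g) q)" using u(1,2) unfolding in_segment by blast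
    thus False using e flow_closed[OF fl ig] pq unfolding extreme_point_of_def by blast
  qed
qed

lemma affine_flow_ext_closure:
  assumes L: "affine_flow G T L b" and T: "topspace T = carrier G" and g: "g \<in> carrier G" and x: "x \<in> ext_closure L"
  shows "b g x \<in> ext_closure L"
proof -
  have fl: "flow G T L b" using L by (simp add: affine_flow_def)
  have "b g ` ext_closure L \<subseteq> L closure_of (b g ` {x. x extreme_point_of topspace L})"
    using flow_continuous[OF fl T g] continuous_map_image_closure_subset unfolding ext_closure_def by blast
  also have "\<dots> \<subseteq> ext_closure L"
    unfolding ext_closure_def using affine_flow_extreme[OF L g] by (intro closure_of_mono) auto
  finally show ?thesis using x by blast
qed

lemma convex_affine_preimage:
  assumes "convex S" "affine_map_on S f" "convex C" shows "convex {x \<in> S. f x \<in> C}"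
  unfolding convex_alt
proof (intro ballI allI impI)
  fix x y and u :: real assume "x \<in> {x \<in> S. f x \<in> C}" "y \<in> {x \<in> S. f x \<in> C}" "0 \<le> u \<and> u \<le> 1"
  thus "(1 - u) *\<^sub>R x + u *\<^sub>R y \<in> {x \<in> S. f x \<in> C}"
    using assms(2) convexD_alt[OF assms(1)] convexD_alt[OF assms(3)] by (auto simp: affine_map_on_def)
qed

lemma extreme_preimage_face:
  assumes S: "convex S" and f: "affine_map_on S f" "f ` S \<subseteq> S'" and y: "y extreme_point_of S'"
  shows "{x \<in> S. f x \<in> {y}} face_of S"
  unfolding face_of_def
proof (intro conjI ballI impI)
  show "convex {x \<in> S. f x \<in> {y}}" by (rule convex_affine_preimage[OF S f(1)]) simp
  fix p q x assume *: "p \<in> S" "q \<in> S" "x \<in> {x \<in> S. f x \<in> {y}}" "x \<in> open_segment p q"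
  obtain u where u: "0 < u" "u < 1" "x = (1 - u) *\<^sub>R p + u *\<^sub>R q" using *(4) by (auto simp: in_segment)
  have eq: "y = (1 - u) *\<^sub>R f p + u *\<^sub>R f q" using f(1) * u unfolding affine_map_on_def by auto
  have "f p = f q"
  proof (rule ccontr)
    assume "f p \<noteq> f q"
    hence "y \<in> open_segment (f p) (f q)" using u eq unfolding in_segment by blast
    moreover have "f p \<in> S'" "f q \<in> S'" using f(2) * by blast+
    ultimately show False using y unfolding extreme_point_of_def by blast
  qed
  hence "f p = y" "f q = y" using eq by (simp_all flip: scaleR_add_left)
  thus "p \<in> {x \<in> S. f x \<in> {y}}" "q \<in> {x \<in> S. f x \<in> {y}}" using * by auto
qed auto

locale irreducible_extension = coset_space G T H
  for G :: "('g, 'm) monoid_scheme" (structure) and T :: "'g topology" and H :: "'g set" +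
  fixes L :: "'v::real_vector topology" and b :: "'g \<Rightarrow> 'v \<Rightarrow> 'v"
    and \<phi> :: "'v \<Rightarrow> ((('g set \<Rightarrow> complex) \<Rightarrow> complex) \<Rightarrow> real) \<Rightarrow> real"
  assumes irr: "proximally_irreducible_extension G T L b K K_action \<phi>"
begin

lemma L_flow: "affine_flow G T L b" and flow_L: "flow G T L b"
  and \<phi>_cont: "continuous_map L K \<phi>" and \<phi>_surj: "\<phi> ` topspace L = topspace K"
  and \<phi>_affine: "affine_map_on (topspace L) \<phi>"
  and \<phi>_equiv: "g \<in> carrier G \<Longrightarrow> x \<in> topspace L \<Longrightarrow> \<phi> (b g x) = K_action g (\<phi> x)"
  using irr by (auto simp: proximally_irreducible_extension_def affine_extension_def affine_flow_def)

lemma L_cc: "compact_convex_space L" by (rule affine_flow_imp_compact_convex[OF L_flow])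

lemma K_Hausdorff: "Hausdorff_space K"
  by (rule compact_convex_Hausdorff[OF K.state_space_compact_convex])

text \<open>The flow of \<open>H\<close> to which strong amenability is going to be applied.\<close>

definition Y :: "'v set" where "Y = ext_closure L \<inter> {x \<in> topspace L. \<phi> x \<in> {dirac \<one>}}"

lemma dirac_closed: "closedin K {dirac \<one>}"
  using dirac_state[OF one_closed] K_Hausdorff by (intro closedin_Hausdorff_singleton) auto

lemma Y_closed: "closedin L Y"
  unfolding Y_def ext_closure_def
  by (intro closedin_Int closedin_closure_of closedin_continuous_map_preimage[OF \<phi>_cont] dirac_closed)

lemma Y_subset: "Y \<subseteq> topspace L" by (auto simp: Y_def)

lemma Y_orbit: "x \<in> Y \<Longrightarrow> g \<in> carrier G \<Longrightarrow> \<phi> (b g x) = dirac g"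
  using \<phi>_equiv K_action_dirac[OF _ one_closed] by (auto simp: Y_def)

lemma Y_H_invariant: "h \<in> H \<Longrightarrow> x \<in> Y \<Longrightarrow> b h x \<in> Y"
  using Y_orbit[of x h] dirac_one[of h] H_carrier affine_flow_ext_closure[OF L_flow topspace_T]
    flow_closed[OF flow_L, of h x] Y_subset by (auto simp: Y_def)

abbreviation "pairs x y \<equiv> prod_topology L L closure_of ((\<lambda>g. (b g x, b g y)) ` carrier G)"

abbreviation "midpt x y \<equiv> (1/2 :: real) *\<^sub>R x + (1/2 :: real) *\<^sub>R y"

lemma midpt_continuous: "continuous_map (prod_topology L L) L (\<lambda>z. midpt (fst z) (snd z))"
  using convex_combination_continuous[OF L_cc continuous_map_fst continuous_map_snd, of "\<lambda>_. 1/2"] by simp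

lemma pairs_subset: "x \<in> topspace L \<Longrightarrow> y \<in> topspace L \<Longrightarrow>
    (\<lambda>g. (b g x, b g y)) ` carrier G \<subseteq> topspace (prod_topology L L)"
  using flow_closed[OF flow_L] by auto

lemma pairs_compact: "compactin (prod_topology L L) (pairs x y)"
  using compact_convex_compact[OF L_cc]
  by (intro closedin_compact_space) (auto simp: compact_space_prod_topology)

lemma b_midpt: "g \<in> carrier G \<Longrightarrow> x \<in> topspace L \<Longrightarrow> y \<in> topspace L \<Longrightarrow> b g (midpt x y) = midpt (b g x) (b g y)"
proof -
  assume *: "g \<in> carrier G" "x \<in> topspace L" "y \<in> topspace L"
  have "affine_map_on (topspace L) (b g)" using L_flow * by (simp add: affine_flow_def)
  hence "b g ((1 - 1/2) *\<^sub>R x + (1/2) *\<^sub>R y) = (1 - 1/2) *\<^sub>R b g x + (1/2 :: real) *\<^sub>R b g y"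
    using * unfolding affine_map_on_def by fastforce
  thus ?thesis by simp
qed

lemma midpt_L: "x \<in> topspace L \<Longrightarrow> y \<in> topspace L \<Longrightarrow> midpt x y \<in> topspace L"
  using convexD[OF compact_convex_convex[OF L_cc], of x y "1/2" "1/2"] by simp

text \<open>Limits of \<open>(g x, g y)\<close> lie over a common point of \<open>K\<close>, and their midpoints over all of the
  closure of the extreme points; so the midpoint of \<open>x\<close> and \<open>y\<close> generates \<open>L\<close>.\<close>

lemma midpoint_generates:
  assumes x: "x \<in> Y" and y: "y \<in> Y" and C: "closedin L C" "convex C"
    and orb: "\<And>g. g \<in> carrier G \<Longrightarrow> b g (midpt x y) \<in> C"
  shows "C = topspace L"
proof -
  have xL: "x \<in> topspace L" "y \<in> topspace L" using x y Y_subset by auto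
  define \<C> where "\<C> = {C. closedin L C \<and> convex C \<and> (\<forall>g\<in>carrier G. b g (midpt x y) \<in> C)}"
  have CC: "C \<in> \<C>" using C orb by (simp add: \<C>_def)
  define D where "D = \<Inter>\<C>"
  have D: "closedin L D" "convex D" "\<And>g. g \<in> carrier G \<Longrightarrow> b g (midpt x y) \<in> D"
    using CC by (auto simp: D_def \<C>_def intro!: closedin_Inter convex_Inter)
  have DL: "D \<subseteq> topspace L" using D(1) by (rule closedin_subset)
  have sub: "affine_subflow G L b D"
    unfolding affine_subflow_def
  proof (intro conjI ballI D)
    show "D \<noteq> {}" using D(3)[OF one_closed] by blast
    fix g assume g: "g \<in> carrier G"
    have "{z \<in> topspace L. b g z \<in> D} \<in> \<C>"
      unfolding \<C>_def
    proof (intro CollectI conjI ballI)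
      show "closedin L {z \<in> topspace L. b g z \<in> D}"
        using flow_continuous[OF flow_L topspace_T g] D(1) by (rule closedin_continuous_map_preimage)
      show "convex {z \<in> topspace L. b g z \<in> D}"
        using L_flow g D(2) by (intro convex_affine_preimage) (auto simp: affine_flow_def)
      fix h assume h: "h \<in> carrier G"
      have "b g (b h (midpt x y)) = b (g \<otimes> h) (midpt x y)"
        using flow_mult[OF flow_L g h midpt_L[OF xL]] by simp
      thus "b h (midpt x y) \<in> topspace L" "b g (b h (midpt x y)) \<in> D"
        using flow_closed[OF flow_L h midpt_L[OF xL]] D(3)[of "g \<otimes> h"] g h by auto
    qed
    thus "b g ` D \<subseteq> D" unfolding D_def by blast
  qed
  have "D \<inter> convex hull (ext_closure L \<inter> \<phi> -` {k}) \<noteq> {}" if k: "k \<in> ext_closure K" for k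
  proof -
    have fc: "continuous_map (prod_topology L L) K (\<lambda>z. \<phi> (fst z))" "continuous_map (prod_topology L L) K (\<lambda>z. \<phi> (snd z))"
      using continuous_map_compose[OF continuous_map_fst \<phi>_cont] continuous_map_compose[OF continuous_map_snd \<phi>_cont]
      by (auto simp: o_def)
    have "closedin K ((\<lambda>z. \<phi> (fst z)) ` pairs x y)"
      using image_compactin[OF pairs_compact fc(1)] compactin_imp_closedin[OF K_Hausdorff] by blast
    moreover have "dirac ` carrier G \<subseteq> (\<lambda>z. \<phi> (fst z)) ` pairs x y"
    proof
      fix k assume "k \<in> dirac ` carrier G"
      then obtain g where "g \<in> carrier G" "k = \<phi> (b g x)" using Y_orbit[OF x] by auto
      thus "k \<in> (\<lambda>z. \<phi> (fst z)) ` pairs x y"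
        using closure_of_subset[OF pairs_subset[OF xL]] by force
    qed
    ultimately have "K closure_of (dirac ` carrier G) \<subseteq> (\<lambda>z. \<phi> (fst z)) ` pairs x y"
      by (rule closure_of_minimal[rotated])
    then obtain z where z: "z \<in> pairs x y" "\<phi> (fst z) = k" using ext_closure_K k by blast
    let ?Z = "{z \<in> topspace (prod_topology L L). \<phi> (fst z) = \<phi> (snd z)} \<inter>
        {z \<in> topspace (prod_topology L L). midpt (fst z) (snd z) \<in> D} \<inter> (ext_closure L \<times> ext_closure L)"
    have "closedin (prod_topology L L) ?Z"
      by (intro closedin_Int closedin_continuous_maps_eq[OF K_Hausdorff fc]
          closedin_continuous_map_preimage[OF midpt_continuous D(1)])
         (simp add: closedin_prod_Times_iff ext_closure_def)
    moreover have "(\<lambda>g. (b g x, b g y)) ` carrier G \<subseteq> ?Z"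
    proof
      fix z assume "z \<in> (\<lambda>g. (b g x, b g y)) ` carrier G"
      then obtain g where g: "g \<in> carrier G" "z = (b g x, b g y)" by blast
      have "midpt (b g x) (b g y) \<in> D" using D(3)[OF g(1)] b_midpt[OF g(1) xL] by simp
      thus "z \<in> ?Z"
        using g x y flow_closed[OF flow_L g(1)] xL affine_flow_ext_closure[OF L_flow topspace_T g(1)]
        by (simp add: Y_orbit) (simp add: Y_def)
    qed
    ultimately have "pairs x y \<subseteq> ?Z" by (rule closure_of_minimal[rotated])
    hence z': "\<phi> (snd z) = k" "midpt (fst z) (snd z) \<in> D" "fst z \<in> ext_closure L" "snd z \<in> ext_closure L"
      using z by (auto simp: mem_Times_iff)
    have "midpt (fst z) (snd z) \<in> convex hull (ext_closure L \<inter> \<phi> -` {k})"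
      using z z' by (intro convexD[OF convex_convex_hull] hull_inc) auto
    thus ?thesis using z'(2) by blast
  qed
  hence "D = topspace L" using irr sub unfolding proximally_irreducible_extension_def by blast
  moreover have "D \<subseteq> C" using CC by (auto simp: D_def)
  ultimately show ?thesis using closedin_subset[OF C(1)] by blast
qed

lemma extreme_point_in_Y:
  obtains e where "e \<in> Y" "e \<in> topspace L" "\<phi> e = dirac \<one>" "e extreme_point_of topspace L"
proof -
  have "closedin L {x \<in> topspace L. \<phi> x \<in> {dirac \<one>}}"
    by (rule closedin_continuous_map_preimage[OF \<phi>_cont dirac_closed])
  note closed = this
  have "dirac \<one> \<in> \<phi> ` topspace L" unfolding \<phi>_surj using dirac_state[OF one_closed] by simp
  hence ne: "{x \<in> topspace L. \<phi> x \<in> {dirac \<one>}} \<noteq> {}" by force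
  have fibre_face: "{x \<in> topspace L. \<phi> x \<in> {dirac \<one>}} face_of topspace L"
    using \<phi>_surj dirac_extreme[OF one_closed] by (intro extreme_preimage_face[OF compact_convex_convex[OF L_cc] \<phi>_affine]) auto
  obtain e where e: "e \<in> {x \<in> topspace L. \<phi> x \<in> {dirac \<one>}}" "e extreme_point_of topspace L"
    by (rule closed_face_contains_extreme_point[OF L_cc fibre_face closed ne])
  have "{x. x extreme_point_of topspace L} \<subseteq> ext_closure L"
    unfolding ext_closure_def by (rule closure_of_subset) (auto simp: extreme_point_of_def)
  thus ?thesis using e by (intro that[of e]) (auto simp: Y_def)
qed

text \<open>An extreme point \<open>e\<close> over the base point is a limit of midpoints of \<open>g x\<close> and \<open>g y\<close>, hence
  of both \<open>g x\<close> and \<open>g y\<close>.  Then \<open>g H\<close> tends to \<open>H\<close>, and \<open>g\<close> may be corrected by a small group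
  element to lie in \<open>H\<close>.\<close>

lemma Y_proximal_pair:
  assumes x: "x \<in> Y" and y: "y \<in> Y"
  obtains e where "e \<in> Y" "\<And>N. openin L N \<Longrightarrow> e \<in> N \<Longrightarrow> \<exists>h\<in>H. b h x \<in> N \<and> b h y \<in> N"
proof -
  have xL: "x \<in> topspace L" "y \<in> topspace L" using x y Y_subset by auto
  obtain e where eY: "e \<in> Y" and e: "e \<in> topspace L" "\<phi> e = dirac \<one>" "e extreme_point_of topspace L"
    by (rule extreme_point_in_Y)
  let ?Q = "(\<lambda>z. midpt (fst z) (snd z)) ` pairs x y"
  have "closedin L ?Q"
    using image_compactin[OF pairs_compact midpt_continuous] compactin_imp_closedin compact_convex_Hausdorff[OF L_cc] by blast
  moreover have "b g (midpt x y) \<in> ?Q" if g: "g \<in> carrier G" for g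
    using closure_of_subset[OF pairs_subset[OF xL]] g b_midpt[OF g xL] by force
  ultimately have "e \<in> ?Q"
  proof (intro milman[OF L_cc _ _ e(3)])
    fix C assume orb: "\<And>g. g \<in> carrier G \<Longrightarrow> b g (midpt x y) \<in> ?Q"
      and C: "closedin L C" "convex C" "?Q \<subseteq> C"
    show "C = topspace L" by (rule midpoint_generates[OF x y C(1,2)]) (use orb C(3) in blast)
  qed
  then obtain z where z: "z \<in> pairs x y" "e = midpt (fst z) (snd z)" by (rule imageE) simp
  define p q where "p = fst z" and "q = snd z"
  have pq: "(p, q) \<in> pairs x y" "e = midpt p q" using z by (simp_all add: p_def q_def)
  have "p \<in> topspace L" "q \<in> topspace L" using pq(1) closure_of_subset_topspace[of "prod_topology L L"] by fastforce+
  hence pe: "p = e" "q = e" using extreme_midpoint[OF e(3) _ _ pq(2)] by blast+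
  have ee: "(e, e) \<in> pairs x y" using pq(1) unfolding pe .
  have "\<exists>h\<in>H. b h x \<in> N \<and> b h y \<in> N" if N: "openin L N" "e \<in> N" for N
  proof -
    have "continuous_map (prod_topology T L) (prod_topology T L) (\<lambda>z. (inv (fst z), snd z))"
      using continuous_map_compose[OF continuous_map_fst inv_continuous, of L]
      by (intro continuous_map_pairedI continuous_map_snd) (simp add: o_def)
    moreover have "continuous_map (prod_topology T L) L (\<lambda>(g, z). b g z)" using flow_L by (simp add: flow_def)
    ultimately have "continuous_map (prod_topology T L) L ((\<lambda>(g, z). b g z) \<circ> (\<lambda>z. (inv (fst z), snd z)))"
      by (rule continuous_map_compose)
    from openin_continuous_map_preimage[OF this N(1)]
    have "openin (prod_topology T L) {z \<in> topspace (prod_topology T L). b (inv (fst z)) (snd z) \<in> N}" by simp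
    moreover have "(\<one>, e) \<in> {z \<in> topspace (prod_topology T L). b (inv (fst z)) (snd z) \<in> N}"
      using N e flow_one[OF flow_L e(1)] by (simp add: topspace_T)
    ultimately obtain U N' where U: "openin T U" "openin L N'" "\<one> \<in> U" "e \<in> N'"
      "U \<times> N' \<subseteq> {z \<in> topspace (prod_topology T L). b (inv (fst z)) (snd z) \<in> N}"
      unfolding openin_prod_topology_alt by meson
    obtain F where F: "\<And>x. x \<in> cosets \<Longrightarrow> 0 \<le> F x \<and> F x \<le> (1::real)" "uniform_at_one F (\<lambda>g x. g <# x) cosets"
      "F H = 0" "\<And>x. x \<in> cosets \<Longrightarrow> x \<inter> U = {} \<Longrightarrow> F x = 1"
      using coset_bump[OF U(1,3)] by blast
    have "\<bar>F x\<bar> \<le> 1" if "x \<in> cosets" for x using F(1)[OF that] by auto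
    then obtain f where f: "continuous_map SaX euclideanreal f" "\<And>x. x \<in> cosets \<Longrightarrow> f (point_eval x) = F x"
      using RUC_extension[of F 1, OF _ F(2)] by blast
    have fC: "f \<in> C_Sa" using f(1) by (simp add: C_space_def)
    have df: "dirac g f = F (g <# H)" if "g \<in> carrier G" for g
      using dirac_eval[OF fC] f(2) coset_mem[OF that] by simp
    have "continuous_map K euclideanreal (\<lambda>k. k f)"
      by (intro continuous_map_from_subtopology continuous_map_product_projection) simp
    hence "continuous_map L euclideanreal ((\<lambda>k. k f) \<circ> \<phi>)" by (rule continuous_map_compose[OF \<phi>_cont])
    from openin_continuous_map_preimage[OF this, of "{..<1}"]
    have oN: "openin L {z \<in> topspace L. \<phi> z f \<in> {..<1}}" by simp
    define M where "M = N' \<inter> {z \<in> topspace L. \<phi> z f \<in> {..<1}}"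
    have "dirac \<one> f = 0" using df[OF one_closed] F(3) H_carrier by (simp add: lcos_mult_one)
    hence "e \<in> M" using U(4) e by (simp add: M_def)
    moreover have "openin L M" unfolding M_def using oN U(2) by (rule openin_Int[rotated])
    ultimately have "(e, e) \<in> M \<times> M \<and> openin (prod_topology L L) (M \<times> M)"
      by (auto simp: openin_prod_Times_iff)
    hence "\<exists>z. z \<in> (\<lambda>g. (b g x, b g y)) ` carrier G \<and> z \<in> M \<times> M"
      using ee unfolding in_closure_of by meson
    then obtain g where g: "g \<in> carrier G" "b g x \<in> M" "b g y \<in> M" by blast
    have "F (g <# H) < 1" using g(2) Y_orbit[OF x g(1)] df[OF g(1)] by (simp add: M_def)
    hence "(g <# H) \<inter> U \<noteq> {}" using F(4)[OF coset_mem[OF g(1)]] by auto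
    then obtain h where h: "h \<in> H" "g \<otimes> h \<in> U" by (auto simp: l_coset_def)
    have hG: "h \<in> carrier G" using h(1) H_carrier by blast
    have "b (inv h) z \<in> N" if z: "z \<in> topspace L" "b g z \<in> N'" for z
    proof -
      have "b (inv (g \<otimes> h)) (b g z) \<in> N" using U(5) h(2) z(2) by auto
      moreover have "b (inv (g \<otimes> h)) (b g z) = b (inv (g \<otimes> h) \<otimes> g) z"
        using flow_mult[OF flow_L _ g(1) z(1)] g(1) hG by simp
      moreover have "inv (g \<otimes> h) \<otimes> g = inv h" using g(1) hG by (simp add: inv_mult_group m_assoc)
      ultimately show ?thesis by simp
    qed
    moreover have "inv h \<in> H" using subgroup.m_inv_closed[OF subgroup_H h(1)] .
    ultimately show ?thesis using g(2,3) xL unfolding M_def by blast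
  qed
  with eY that show ?thesis by blast
qed

lemma Y_flow: "flow GH TH (subtopology L Y) (\<lambda>h. restrict (b h) Y)"
proof (rule flow_subflow[OF _ Y_closed])
  have "group_action GH (topspace L) b"
  proof (rule group_actionI)
    show "group GH" using subgroup.subgroup_is_group[OF subgroup_H is_group] .
    have act: "group_action G (topspace L) b" using flow_L by (simp add: flow_def)
    fix h assume "h \<in> carrier GH"
    hence h: "h \<in> carrier G" using H_carrier by auto
    show "b h \<in> extensional (topspace L)" by (rule group_action_extensional[OF act h])
    show "b h x \<in> topspace L" if "x \<in> topspace L" for x by (rule flow_closed[OF flow_L h that])
    show "b (h \<otimes>\<^bsub>GH\<^esub> k) x = b h (b k x)" if "k \<in> carrier GH" "x \<in> topspace L" for k x
      using flow_mult[OF flow_L h _ that(2)] that(1) H_carrier by auto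
  qed (use flow_one[OF flow_L] in simp)
  moreover have "continuous_map (prod_topology TH L) L (\<lambda>(g, x). b g x)"
    using flow_L continuous_map_from_subtopology[of "prod_topology T L" L "\<lambda>(g, x). b g x" "H \<times> topspace L"]
    by (simp add: flow_def prod_topology_subtopology)
  ultimately show "flow GH TH L b" using flow_L by (simp add: flow_def)
  show "Y \<noteq> {}"
    using extreme_point_in_Y by blast
  show "topspace TH = carrier GH" by (rule TH_top)
qed (use Y_H_invariant in auto)

lemma Y_proximal: "proximal GH (subtopology L Y) (\<lambda>h. restrict (b h) Y)"
  unfolding proximal_def
proof (intro ballI)
  fix x y assume "x \<in> topspace (subtopology L Y)" "y \<in> topspace (subtopology L Y)"
  hence xy: "x \<in> Y" "y \<in> Y" by auto
  obtain e where e: "e \<in> Y" "\<And>N. openin L N \<Longrightarrow> e \<in> N \<Longrightarrow> \<exists>h\<in>H. b h x \<in> N \<and> b h y \<in> N"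
    using Y_proximal_pair[OF xy] by blast
  define B where "B = {N. openin L N \<and> e \<in> N}"
  define S where "S = (\<lambda>N. {h \<in> H. b h x \<in> N \<and> b h y \<in> N})"
  define F where "F = (INF N\<in>B. principal (S N))"
  have ev: "eventually P F \<longleftrightarrow> (\<exists>N\<in>B. \<forall>h\<in>S N. P h)" for P
    unfolding F_def
  proof (subst eventually_INF_base)
    show "B \<noteq> {}" using e(1) Y_subset by (auto simp: B_def intro!: exI[of _ "topspace L"])
    show "\<exists>M\<in>B. principal (S M) \<le> inf (principal (S N)) (principal (S N'))" if "N \<in> B" "N' \<in> B" for N N'
      using that by (intro bexI[of _ "N \<inter> N'"]) (auto simp: B_def S_def)
  qed (simp add: eventually_principal)
  have "F \<noteq> bot"
  proof
    assume "F = bot"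
    hence "eventually (\<lambda>_. False) F" by simp
    then obtain N where "N \<in> B" "S N = {}" unfolding ev by blast
    thus False using e(2)[of N] by (auto simp: B_def S_def)
  qed
  moreover have "eventually (\<lambda>h. h \<in> carrier GH) F"
    unfolding ev using e(1) Y_subset by (intro bexI[of _ "topspace L"]) (auto simp: B_def S_def)
  moreover have "limitin (subtopology L Y) (\<lambda>h. restrict (b h) Y z) e F" if z: "z = x \<or> z = y" for z
  proof -
    have "limitin L (\<lambda>h. restrict (b h) Y z) e F"
      unfolding limitin_def
    proof (intro conjI allI impI)
      show "e \<in> topspace L" using e(1) Y_subset by blast
      fix U assume "openin L U \<and> e \<in> U"
      thus "eventually (\<lambda>h. restrict (b h) Y z \<in> U) F"
        unfolding ev using z xy by (intro bexI[of _ U]) (auto simp: B_def S_def)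
    qed
    moreover have "eventually (\<lambda>h. restrict (b h) Y z \<in> Y) F"
      unfolding ev using e(1) Y_subset Y_H_invariant z xy by (intro bexI[of _ "topspace L"]) (auto simp: B_def S_def)
    ultimately show ?thesis using e(1) by (simp add: limitin_subtopology)
  qed
  ultimately show "\<exists>F z. F \<noteq> bot \<and> eventually (\<lambda>g. g \<in> carrier GH) F \<and>
      limitin (subtopology L Y) (\<lambda>g. restrict (b g) Y x) z F \<and>
      limitin (subtopology L Y) (\<lambda>g. restrict (b g) Y y) z F" by blast
qed

text \<open>A continuous affine function \<open>f\<close> on \<open>L\<close> induces the function \<open>gH \<mapsto> f (g x)\<close> on \<open>G/H\<close>, and so
  a continuous affine function on \<open>K\<close> whose pullback to \<open>L\<close> agrees with \<open>f\<close> on the orbit of \<open>x\<close>.\<close>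

lemma fixed_point_imp_injective:
  assumes x: "x \<in> Y" and fixed: "\<And>h. h \<in> H \<Longrightarrow> b h x = x"
  shows "inj_on \<phi> (topspace L)"
proof (rule inj_onI, rule ccontr)
  fix p q assume pq: "p \<in> topspace L" "q \<in> topspace L" "\<phi> p = \<phi> q" "p \<noteq> q"
  have xL: "x \<in> topspace L" using x Y_subset by blast
  obtain f where f: "continuous_map L euclideanreal f" "affine_map_on (topspace L) f" "f p < f q"
    using compact_convex_separation_points[OF L_cc pq(1,2,4)] by blast
  \<comment> \<open>The choice of a representative does not matter since \<open>H\<close> fixes \<open>x\<close>.\<close>
  define F where "F = (\<lambda>c. f (b (SOME g. g \<in> c) x))"
  have F: "F (g <# H) = f (b g x)" if g: "g \<in> carrier G" for g
  proof -
    have "g \<in> g <# H" using g subgroup_H by (rule lcos_self)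
    hence "(SOME g'. g' \<in> g <# H) \<in> g <# H" by (rule someI)
    then obtain h where h: "h \<in> H" "(SOME g'. g' \<in> g <# H) = g \<otimes> h" by (auto simp: l_coset_def)
    have "b (g \<otimes> h) x = b g (b h x)" using flow_mult[OF flow_L g _ xL] h(1) H_carrier by blast
    thus ?thesis using fixed[OF h(1)] h(2) by (simp add: F_def)
  qed
  obtain B where B: "\<And>z. z \<in> topspace L \<Longrightarrow> \<bar>f z\<bar> \<le> B"
    using continuous_map_real_bounded[OF compact_convex_compact[OF L_cc] f(1)] by blast
  have "\<bar>F c\<bar> \<le> B" if "c \<in> cosets" for c
    using that B flow_closed[OF flow_L _ xL] by (auto elim!: cosetE simp: F)
  moreover have "uniform_at_one F (\<lambda>g x. g <# x) cosets"
    unfolding uniform_at_one_def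
  proof (intro allI impI)
    fix \<epsilon> :: real assume "\<epsilon> > 0"
    then obtain W where W: "openin T W" "\<one> \<in> W"
      "\<And>u z. u \<in> W \<Longrightarrow> z \<in> topspace L \<Longrightarrow> \<bar>f (b u z) - f (b \<one> z)\<bar> < \<epsilon>"
      using flow_uniform[OF flow_L topspace_T f(1) one_closed] by blast
    have "dist (F (u <# c)) (F c) < \<epsilon>" if u: "u \<in> W" and c: "c \<in> cosets" for u c
    proof -
      obtain g where g: "g \<in> carrier G" "c = g <# H" using c by (rule cosetE)
      have uG: "u \<in> carrier G" using u W(1) open_carrier by blast
      have gx: "b g x \<in> topspace L" using flow_closed[OF flow_L g(1) xL] .
      have "F (u <# c) = f (b u (b g x))"
        using F[of "u \<otimes> g"] flow_mult[OF flow_L uG g(1) xL] g uG H_carrier by (simp add: lcos_m_assoc)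
      moreover have "F c = f (b \<one> (b g x))" using F[OF g(1)] g(2) flow_one[OF flow_L gx] by simp
      ultimately show ?thesis using W(3)[OF u gx] by (simp add: dist_real_def)
    qed
    with W show "\<exists>U. openin T U \<and> \<one> \<in> U \<and> (\<forall>u\<in>U. \<forall>x\<in>cosets. dist (F (u <# x)) (F x) < \<epsilon>)" by blast
  qed
  ultimately obtain k where k: "continuous_map SaX euclideanreal k" "\<And>c. c \<in> cosets \<Longrightarrow> k (point_eval c) = F c"
    using RUC_extension by blast
  have kC: "k \<in> C_Sa" using k(1) by (simp add: C_space_def)
  let ?C = "{z \<in> topspace L. \<phi> z k = f z}"
  have "continuous_map K euclideanreal (\<lambda>\<kappa>. \<kappa> k)"
    by (intro continuous_map_from_subtopology continuous_map_product_projection) simp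
  hence "continuous_map L euclideanreal ((\<lambda>\<kappa>. \<kappa> k) \<circ> \<phi>)" by (rule continuous_map_compose[OF \<phi>_cont])
  hence "continuous_map L euclideanreal (\<lambda>z. \<phi> z k)" by (simp add: o_def)
  hence "closedin L ?C" using f(1) by (intro closedin_continuous_maps_eq[of euclideanreal]) auto
  moreover have "convex ?C"
    unfolding convex_alt
  proof (intro ballI allI impI)
    fix y z and u :: real assume yz: "y \<in> ?C" "z \<in> ?C" and u: "0 \<le> u \<and> u \<le> 1"
    have "\<phi> ((1 - u) *\<^sub>R y + u *\<^sub>R z) = (1 - u) *\<^sub>R \<phi> y + u *\<^sub>R \<phi> z"
      "f ((1 - u) *\<^sub>R y + u *\<^sub>R z) = (1 - u) *\<^sub>R f y + u *\<^sub>R f z"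
      using \<phi>_affine f(2) yz u by (auto simp: affine_map_on_def)
    moreover have "(1 - u) *\<^sub>R y + u *\<^sub>R z \<in> topspace L"
      using yz u compact_convex_convex[OF L_cc] by (intro convexD_alt) auto
    ultimately show "(1 - u) *\<^sub>R y + u *\<^sub>R z \<in> ?C" using yz by (simp add: scaleR_fun_def)
  qed
  moreover have "b g (midpt x x) \<in> ?C" if g: "g \<in> carrier G" for g
  proof -
    have "midpt x x = x" by (simp flip: scaleR_add_left)
    moreover have "\<phi> (b g x) k = f (b g x)"
      using Y_orbit[OF x g] dirac_eval[OF kC] k(2)[OF coset_mem[OF g]] F[OF g] by simp
    ultimately show ?thesis using flow_closed[OF flow_L g xL] by simp
  qed
  ultimately have "?C = topspace L" by (rule midpoint_generates[OF x x])
  hence "\<phi> p k = f p" "\<phi> q k = f q" using pq by blast+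
  thus False using f(3) pq(3) by simp
qed

theorem strongly_amenable_imp_isomorphism:
  assumes "strongly_amenable TYPE('x) GH TH" shows "homeomorphic_map L K \<phi>"
proof -
  have "has_fixed_point GH (subtopology L Y) (\<lambda>h. restrict (b h) Y)"
    by (rule strongly_amenable_fixed_point[OF assms TH_top Y_flow Y_proximal])
  then obtain x where "x \<in> Y" "\<And>h. h \<in> H \<Longrightarrow> b h x = x" by (auto simp: has_fixed_point_def)
  hence "inj_on \<phi> (topspace L)" by (rule fixed_point_imp_injective)
  thus ?thesis
    using compact_convex_compact[OF L_cc] K_Hausdorff \<phi>_cont \<phi>_surj by (intro continuous_imp_homeomorphic_map)
qed

end

section \<open>The extension induced by a proximal flow without fixed points\<close>

locale proximal_flow = coset_space G T H
  for G :: "('g, 'm) monoid_scheme" (structure) and T :: "'g topology" and H :: "'g set" +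
  fixes M :: "'y topology" and \<alpha> :: "'g \<Rightarrow> 'y \<Rightarrow> 'y" and m0 :: 'y
  assumes minimal: "minimal_flow GH TH M \<alpha>" and prox: "proximal GH M \<alpha>" and m0: "m0 \<in> topspace M"
begin

lemma M_flow: "flow GH TH M \<alpha>" using minimal by (simp add: minimal_flow_def)

lemma M_compact: "compact_space M" and M_Hausdorff: "Hausdorff_space M"
  using M_flow by (auto simp: flow_def)

lemma M_normal: "normal_space M"
  using M_compact M_Hausdorff compact_Hausdorff_or_regular_imp_normal_space by blast

lemma one_H: "\<one> \<in> H" using subgroup.one_closed[OF subgroup_H] .

lemma H_mult: "h \<in> H \<Longrightarrow> k \<in> H \<Longrightarrow> h \<otimes> k \<in> H" using subgroup.m_closed[OF subgroup_H] .

lemma H_inv: "h \<in> H \<Longrightarrow> inv h \<in> H" using subgroup.m_inv_closed[OF subgroup_H] .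

lemma H_in: "h \<in> H \<Longrightarrow> h \<in> carrier G" using H_carrier by blast

lemma \<alpha>_closed: "h \<in> H \<Longrightarrow> m \<in> topspace M \<Longrightarrow> \<alpha> h m \<in> topspace M"
  using flow_closed[OF M_flow] by simp

lemma \<alpha>_mult: "h \<in> H \<Longrightarrow> k \<in> H \<Longrightarrow> m \<in> topspace M \<Longrightarrow> \<alpha> (h \<otimes> k) m = \<alpha> h (\<alpha> k m)"
  using flow_mult[OF M_flow, of h k m] by simp

lemma \<alpha>_one: "m \<in> topspace M \<Longrightarrow> \<alpha> \<one> m = m"
  using flow_one[OF M_flow] by simp

lemma \<alpha>_continuous: "h \<in> H \<Longrightarrow> continuous_map M M (\<alpha> h)"
  using flow_continuous[OF M_flow TH_top] by simp

lemma hits: 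
  assumes "openin M W" "W \<noteq> {}" "x \<in> topspace M" obtains h where "h \<in> H" "\<alpha> h x \<in> W"
  using minimal_flow_hits_open[OF minimal TH_top assms] by auto

text \<open>
  Functions of \<open>h\<close> that oscillate little on suitable nonempty open sets of points \<open>h m0\<close>.  This
  is weaker than being induced by a continuous function on \<open>M\<close>, and it covers the infima of
  continuous functions that arise when functions are extended from \<open>H\<close> to \<open>G\<close>.
\<close>

definition small_osc :: "('g \<Rightarrow> real) \<Rightarrow> bool" where
  "small_osc b \<longleftrightarrow> (\<forall>\<epsilon>>0. \<forall>W. openin M W \<and> W \<noteq> {} \<longrightarrow>
     (\<exists>V. openin M V \<and> V \<noteq> {} \<and> V \<subseteq> W \<and>
       (\<forall>h\<in>H. \<forall>k\<in>H. \<alpha> h m0 \<in> V \<longrightarrow> \<alpha> k m0 \<in> V \<longrightarrow> \<bar>b h - b k\<bar> \<le> \<epsilon>)))"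

definition densely_nonneg :: "('g \<Rightarrow> real) \<Rightarrow> bool" where
  "densely_nonneg b \<longleftrightarrow> (\<forall>\<epsilon>>0. \<forall>W. openin M W \<and> W \<noteq> {} \<longrightarrow>
     (\<exists>V. openin M V \<and> V \<noteq> {} \<and> V \<subseteq> W \<and> (\<forall>h\<in>H. \<alpha> h m0 \<in> V \<longrightarrow> - \<epsilon> \<le> b h)))"

lemma small_oscE:
  assumes "small_osc b" "\<epsilon> > 0" "openin M W" "W \<noteq> {}"
  obtains V where "openin M V" "V \<noteq> {}" "V \<subseteq> W"
    "\<And>h k. h \<in> H \<Longrightarrow> k \<in> H \<Longrightarrow> \<alpha> h m0 \<in> V \<Longrightarrow> \<alpha> k m0 \<in> V \<Longrightarrow> \<bar>b h - b k\<bar> \<le> \<epsilon>"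
  using assms unfolding small_osc_def by meson

lemma densely_nonnegE:
  assumes "densely_nonneg b" "\<epsilon> > 0" "openin M W" "W \<noteq> {}"
  obtains V where "openin M V" "V \<noteq> {}" "V \<subseteq> W" "\<And>h. h \<in> H \<Longrightarrow> \<alpha> h m0 \<in> V \<Longrightarrow> - \<epsilon> \<le> b h"
  using assms unfolding densely_nonneg_def by meson

text \<open>A function \<open>F\<close> in this algebra stands for the function on \<open>G \<times>\<^sub>H M\<close> that takes the class of
  \<open>(g, h m0)\<close> to \<open>F (g h)\<close>, defined over the dense orbit of \<open>m0\<close>; then \<open>h \<mapsto> F (g h)\<close> is its
  restriction to the fibre over \<open>g H\<close>.\<close>

definition A :: "('g \<Rightarrow> real) set" where
  "A = {F. (\<exists>B. \<forall>g\<in>carrier G. \<bar>F g\<bar> \<le> B) \<and> uniform_at_one F (\<lambda>g x. g \<otimes> x) (carrier G) \<and>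
     (\<forall>g\<in>carrier G. small_osc (\<lambda>h. F (g \<otimes> h)))}"

definition P :: "('g \<Rightarrow> real) set" where
  "P = {F. \<forall>g\<in>carrier G. densely_nonneg (\<lambda>h. F (g \<otimes> h))}"

lemma A_bounded:
  assumes "F \<in> A" obtains B where "B > 0" "\<And>g. g \<in> carrier G \<Longrightarrow> \<bar>F g\<bar> \<le> B"
proof -
  obtain B where B: "\<And>g. g \<in> carrier G \<Longrightarrow> \<bar>F g\<bar> \<le> B" using assms unfolding A_def by blast
  have "\<bar>F g\<bar> \<le> \<bar>B\<bar> + 1" if "g \<in> carrier G" for g using B[OF that] by linarith
  thus ?thesis using that[of "\<bar>B\<bar> + 1"] by simp
qed

lemma A_uniform:
  assumes "F \<in> A" "\<epsilon> > 0"
  obtains U where "openin T U" "\<one> \<in> U" "\<And>u x. u \<in> U \<Longrightarrow> x \<in> carrier G \<Longrightarrow> \<bar>F (u \<otimes> x) - F x\<bar> < \<epsilon>"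
  using assms unfolding A_def uniform_at_one_def dist_real_def by blast

lemma A_small_osc: "F \<in> A \<Longrightarrow> g \<in> carrier G \<Longrightarrow> small_osc (\<lambda>h. F (g \<otimes> h))" by (simp add: A_def)

lemma const_A: "(\<lambda>_. c) \<in> A"
proof -
  have "uniform_at_one (\<lambda>_. c) (\<lambda>g x. g \<otimes> x) (carrier G)"
    unfolding uniform_at_one_def
  proof (intro allI impI exI conjI)
    show "openin T (topspace T)" by (rule openin_topspace)
  qed (auto simp: topspace_T)
  thus ?thesis by (auto simp: A_def small_osc_def)
qed

text \<open>A common proof for sums and products: \<open>\<bar>k (F x, J x) - k (F y, J y)\<bar>\<close> is bounded by a multiple
  of \<open>\<bar>F x - F y\<bar> + \<bar>J x - J y\<bar>\<close>.\<close>

lemma lipschitz_A: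
  assumes F: "F \<in> A" and J: "J \<in> A" and C: "C > 0"
    and lip: "\<And>x y. x \<in> carrier G \<Longrightarrow> y \<in> carrier G \<Longrightarrow> \<bar>k x - k y\<bar> \<le> C * (\<bar>F x - F y\<bar> + \<bar>J x - J y\<bar>)"
    and bound: "\<And>x. x \<in> carrier G \<Longrightarrow> \<bar>k x\<bar> \<le> (B :: real)"
  shows "k \<in> A"
proof -
  have small: "\<bar>k x - k y\<bar> \<le> e" if "x \<in> carrier G" "y \<in> carrier G" "\<bar>F x - F y\<bar> \<le> e / (2 * C)" "\<bar>J x - J y\<bar> \<le> e / (2 * C)" for x y e
  proof -
    have "C * (\<bar>F x - F y\<bar> + \<bar>J x - J y\<bar>) \<le> C * (e / (2 * C) + e / (2 * C))"
      using that C by (intro mult_left_mono add_mono) auto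
    also have "\<dots> = e" using C by (simp add: field_simps)
    finally show ?thesis using lip[OF that(1,2)] by simp
  qed
  have "uniform_at_one k (\<lambda>g x. g \<otimes> x) (carrier G)"
    unfolding uniform_at_one_def
  proof (intro allI impI)
    fix \<epsilon> :: real assume \<epsilon>: "\<epsilon> > 0"
    hence e: "\<epsilon> / 2 / (2 * C) > 0" using C by simp
    obtain U where U: "openin T U" "\<one> \<in> U" "\<And>u x. u \<in> U \<Longrightarrow> x \<in> carrier G \<Longrightarrow> \<bar>F (u \<otimes> x) - F x\<bar> < \<epsilon> / 2 / (2 * C)"
      using A_uniform[OF F e] by blast
    obtain V where V: "openin T V" "\<one> \<in> V" "\<And>u x. u \<in> V \<Longrightarrow> x \<in> carrier G \<Longrightarrow> \<bar>J (u \<otimes> x) - J x\<bar> < \<epsilon> / 2 / (2 * C)"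
      using A_uniform[OF J e] by blast
    have "dist (k (u \<otimes> x)) (k x) < \<epsilon>" if "u \<in> U \<inter> V" "x \<in> carrier G" for u x
    proof -
      have "u \<in> carrier G" using that U(1) open_carrier by blast
      hence "\<bar>k (u \<otimes> x) - k x\<bar> \<le> \<epsilon> / 2"
        using U(3)[of u x] V(3)[of u x] that by (intro small) auto
      thus ?thesis using \<epsilon> by (simp add: dist_real_def)
    qed
    thus "\<exists>U. openin T U \<and> \<one> \<in> U \<and> (\<forall>u\<in>U. \<forall>x\<in>carrier G. dist (k (u \<otimes> x)) (k x) < \<epsilon>)"
      using U(1,2) V(1,2) by (intro exI[of _ "U \<inter> V"]) auto
  qed
  moreover have "small_osc (\<lambda>h. k (g \<otimes> h))" if g: "g \<in> carrier G" for g
    unfolding small_osc_def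
  proof (intro allI impI)
    fix \<epsilon> :: real and W assume \<epsilon>: "\<epsilon> > 0" and W: "openin M W \<and> W \<noteq> {}"
    have e: "\<epsilon> / (2 * C) > 0" using \<epsilon> C by simp
    obtain V where V: "openin M V" "V \<noteq> {}" "V \<subseteq> W"
      "\<And>h k. h \<in> H \<Longrightarrow> k \<in> H \<Longrightarrow> \<alpha> h m0 \<in> V \<Longrightarrow> \<alpha> k m0 \<in> V \<Longrightarrow> \<bar>F (g \<otimes> h) - F (g \<otimes> k)\<bar> \<le> \<epsilon> / (2 * C)"
      using small_oscE[OF A_small_osc[OF F g] e] W by blast
    obtain V' where V': "openin M V'" "V' \<noteq> {}" "V' \<subseteq> V"
      "\<And>h k. h \<in> H \<Longrightarrow> k \<in> H \<Longrightarrow> \<alpha> h m0 \<in> V' \<Longrightarrow> \<alpha> k m0 \<in> V' \<Longrightarrow> \<bar>J (g \<otimes> h) - J (g \<otimes> k)\<bar> \<le> \<epsilon> / (2 * C)"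
      using small_oscE[OF A_small_osc[OF J g] e V(1,2)] by blast
    have "\<bar>k (g \<otimes> h) - k (g \<otimes> h')\<bar> \<le> \<epsilon>" if "h \<in> H" "h' \<in> H" "\<alpha> h m0 \<in> V'" "\<alpha> h' m0 \<in> V'" for h h'
    proof -
      have "\<alpha> h m0 \<in> V" "\<alpha> h' m0 \<in> V" using that V'(3) by blast+
      thus ?thesis using that V'(4) V(4) g H_in by (intro small) auto
    qed
    thus "\<exists>V. openin M V \<and> V \<noteq> {} \<and> V \<subseteq> W \<and>
        (\<forall>h\<in>H. \<forall>h'\<in>H. \<alpha> h m0 \<in> V \<longrightarrow> \<alpha> h' m0 \<in> V \<longrightarrow> \<bar>k (g \<otimes> h) - k (g \<otimes> h')\<bar> \<le> \<epsilon>)"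
      using V' V(3) by (intro exI[of _ V']) auto
  qed
  ultimately show ?thesis using bound by (auto simp: A_def)
qed

sublocale A: ordered_function_algebra "carrier G" A P
proof
  show "(\<lambda>_. c) \<in> A" for c by (rule const_A)
next
  fix F J assume F: "F \<in> A" and J: "J \<in> A"
  obtain B where B: "B > 0" "\<And>g. g \<in> carrier G \<Longrightarrow> \<bar>F g\<bar> \<le> B" using A_bounded[OF F] by blast
  obtain C where C: "C > 0" "\<And>g. g \<in> carrier G \<Longrightarrow> \<bar>J g\<bar> \<le> C" using A_bounded[OF J] by blast
  show "(\<lambda>x. F x + J x) \<in> A"
  proof (rule lipschitz_A[OF F J zero_less_one])
    show "\<bar>F x + J x\<bar> \<le> B + C" if "x \<in> carrier G" for x using B(2)[OF that] C(2)[OF that] by linarith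
    show "\<bar>F x + J x - (F y + J y)\<bar> \<le> 1 * (\<bar>F x - F y\<bar> + \<bar>J x - J y\<bar>)" for x y
      using abs_triangle_ineq[of "F x - F y" "J x - J y"] by (simp add: algebra_simps)
  qed
  show "(\<lambda>x. F x * J x) \<in> A"
  proof (rule lipschitz_A[OF F J, of "B + C"])
    show "\<bar>F x * J x\<bar> \<le> B * C" if "x \<in> carrier G" for x
      using B(2)[OF that] C(2)[OF that] B(1) by (simp add: abs_mult mult_mono)
    fix x y assume xy: "x \<in> carrier G" "y \<in> carrier G"
    have "\<bar>F x * J x - F y * J y\<bar> = \<bar>F x * (J x - J y) + (F x - F y) * J y\<bar>" by (simp add: algebra_simps)
    also have "\<dots> \<le> \<bar>F x\<bar> * \<bar>J x - J y\<bar> + \<bar>F x - F y\<bar> * \<bar>J y\<bar>" by (metis abs_mult abs_triangle_ineq)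
    also have "\<dots> \<le> (B + C) * \<bar>J x - J y\<bar> + \<bar>F x - F y\<bar> * (B + C)"
      using B(2)[OF xy(1)] C(2)[OF xy(2)] B(1) C(1) by (intro add_mono mult_right_mono mult_left_mono) auto
    finally show "\<bar>F x * J x - F y * J y\<bar> \<le> (B + C) * (\<bar>F x - F y\<bar> + \<bar>J x - J y\<bar>)" by (simp add: algebra_simps)
  qed (use B(1) C(1) in simp)
  assume FP: "F \<in> P" and JP: "J \<in> P"
  show "(\<lambda>x. F x * J x) \<in> P"
    unfolding P_def densely_nonneg_def
  proof (intro CollectI ballI allI impI)
    fix g and \<epsilon> :: real and W assume g: "g \<in> carrier G" and \<epsilon>: "\<epsilon> > 0" and W: "openin M W \<and> W \<noteq> {}"
    define \<delta> where "\<delta> = \<epsilon> / (B + C)"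
    have \<delta>: "\<delta> > 0" "\<delta> * (B + C) = \<epsilon>" using \<epsilon> B(1) C(1) by (auto simp: \<delta>_def)
    have "densely_nonneg (\<lambda>h. F (g \<otimes> h))" "densely_nonneg (\<lambda>h. J (g \<otimes> h))" using FP JP g by (auto simp: P_def)
    note dn = this
    obtain V where V: "openin M V" "V \<noteq> {}" "V \<subseteq> W" "\<And>h. h \<in> H \<Longrightarrow> \<alpha> h m0 \<in> V \<Longrightarrow> - \<delta> \<le> F (g \<otimes> h)"
      using densely_nonnegE[OF dn(1) \<delta>(1)] W by blast
    obtain V' where V': "openin M V'" "V' \<noteq> {}" "V' \<subseteq> V" "\<And>h. h \<in> H \<Longrightarrow> \<alpha> h m0 \<in> V' \<Longrightarrow> - \<delta> \<le> J (g \<otimes> h)"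
      using densely_nonnegE[OF dn(2) \<delta>(1) V(1,2)] by blast
    have "- \<epsilon> \<le> F (g \<otimes> h) * J (g \<otimes> h)" if h: "h \<in> H" "\<alpha> h m0 \<in> V'" for h
    proof -
      define s t where "s = F (g \<otimes> h)" and "t = J (g \<otimes> h)"
      have s: "- \<delta> \<le> s" "\<bar>s\<bar> \<le> B" and t: "- \<delta> \<le> t" "\<bar>t\<bar> \<le> C"
        using V(4)[of h] V'(3) V'(4)[of h] h B(2)[of "g \<otimes> h"] C(2)[of "g \<otimes> h"] g H_in by (auto simp: s_def t_def)
      consider "0 \<le> s * t" | "s < 0" "0 < t" | "0 < s" "t < 0" by (metis linorder_not_less mult_nonneg_nonneg mult_nonpos_nonpos mult_zero_left mult_zero_right order_le_less)
      hence "- (\<delta> * (B + C)) \<le> s * t"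
      proof cases
        case 1
        moreover have "0 \<le> \<delta> * (B + C)" using \<delta> \<epsilon> by simp
        ultimately show ?thesis by linarith
      next
        case 2
        have "(- s) * t \<le> \<delta> * (B + C)" using 2 s t \<delta>(1) B(1) by (intro mult_mono) auto
        thus ?thesis by simp
      next
        case 3
        have "(- t) * s \<le> \<delta> * (B + C)" using 3 s t \<delta>(1) C(1) by (intro mult_mono) auto
        thus ?thesis by (simp add: mult.commute)
      qed
      thus ?thesis using \<delta>(2) by (simp add: s_def t_def)
    qed
    thus "\<exists>V. openin M V \<and> V \<noteq> {} \<and> V \<subseteq> W \<and> (\<forall>h\<in>H. \<alpha> h m0 \<in> V \<longrightarrow> - \<epsilon> \<le> F (g \<otimes> h) * J (g \<otimes> h))"
      using V' V(3) by (intro exI[of _ V']) auto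
  qed
next
  fix F assume "F \<in> A"
  thus "\<exists>B. \<forall>x\<in>carrier G. \<bar>F x\<bar> \<le> B" by (simp add: A_def)
  assume F: "\<And>x. x \<in> carrier G \<Longrightarrow> 0 \<le> F x"
  have "0 \<le> F (g \<otimes> h)" if "g \<in> carrier G" "h \<in> H" for g h using F[of "g \<otimes> h"] that H_in by simp
  thus "F \<in> P" unfolding P_def densely_nonneg_def by (fastforce intro: order_trans[of _ 0])
qed

lemma translate_A:
  assumes g: "g \<in> carrier G" and F: "F \<in> A" shows "(\<lambda>x. F (g \<otimes> x)) \<in> A"
proof -
  obtain B where B: "\<And>g. g \<in> carrier G \<Longrightarrow> \<bar>F g\<bar> \<le> B" using A_bounded[OF F] by blast
  have "\<forall>x\<in>carrier G. \<bar>F (g \<otimes> x)\<bar> \<le> B" using B g by simp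
  moreover have "uniform_at_one (\<lambda>x. F (g \<otimes> x)) (\<lambda>g x. g \<otimes> x) (carrier G)"
    unfolding uniform_at_one_def
  proof (intro allI impI)
    fix \<epsilon> :: real assume "\<epsilon> > 0"
    then obtain U where U: "openin T U" "\<one> \<in> U" "\<And>u x. u \<in> U \<Longrightarrow> x \<in> carrier G \<Longrightarrow> \<bar>F (u \<otimes> x) - F x\<bar> < \<epsilon>"
      using A_uniform[OF F] by blast
    let ?V = "{u \<in> carrier G. g \<otimes> u \<otimes> inv g \<in> U}"
    have "openin T ?V" using U g by (intro open_translate) auto
    moreover have "\<one> \<in> ?V" using U g by simp
    moreover have "dist (F (g \<otimes> (u \<otimes> x))) (F (g \<otimes> x)) < \<epsilon>" if u: "u \<in> ?V" and x: "x \<in> carrier G" for u x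
    proof -
      have "(g \<otimes> u \<otimes> inv g) \<otimes> (g \<otimes> x) = g \<otimes> (u \<otimes> x)"
        using u x g by (simp add: m_assoc flip: m_assoc[of "inv g" g x])
      moreover have "\<bar>F ((g \<otimes> u \<otimes> inv g) \<otimes> (g \<otimes> x)) - F (g \<otimes> x)\<bar> < \<epsilon>"
        using U(3)[of "g \<otimes> u \<otimes> inv g" "g \<otimes> x"] u x g by blast
      ultimately show ?thesis by (simp add: dist_real_def)
    qed
    ultimately show "\<exists>U. openin T U \<and> \<one> \<in> U \<and> (\<forall>u\<in>U. \<forall>x\<in>carrier G. dist (F (g \<otimes> (u \<otimes> x))) (F (g \<otimes> x)) < \<epsilon>)"
      by blast
  qed
  moreover have "small_osc (\<lambda>h. F (g \<otimes> (g' \<otimes> h)))" if g': "g' \<in> carrier G" for g'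
  proof -
    have "F (g \<otimes> (g' \<otimes> h)) = F ((g \<otimes> g') \<otimes> h)" if "h \<in> H" for h using that g g' H_in by (simp add: m_assoc)
    thus ?thesis using A_small_osc[OF F, of "g \<otimes> g'"] g g' unfolding small_osc_def by simp
  qed
  ultimately show ?thesis by (auto simp: A_def)
qed

lemma translate_P:
  assumes g: "g \<in> carrier G" and F: "F \<in> P" shows "(\<lambda>x. F (g \<otimes> x)) \<in> P"
proof -
  have "densely_nonneg (\<lambda>h. F (g \<otimes> (g' \<otimes> h)))" if g': "g' \<in> carrier G" for g'
  proof -
    have "F (g \<otimes> (g' \<otimes> h)) = F ((g \<otimes> g') \<otimes> h)" if "h \<in> H" for h using that g g' H_in by (simp add: m_assoc)
    moreover have "densely_nonneg (\<lambda>h. F ((g \<otimes> g') \<otimes> h))" using F g g' by (simp add: P_def)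
    ultimately show ?thesis unfolding densely_nonneg_def by simp
  qed
  thus ?thesis by (simp add: P_def)
qed

abbreviation "L \<equiv> state_space A P"
abbreviation "L_action \<equiv> state_action A P (\<lambda>g x. g \<otimes> x)"

definition pull :: "((('g set \<Rightarrow> complex) \<Rightarrow> complex) \<Rightarrow> real) \<Rightarrow> 'g \<Rightarrow> real" where
  "pull f = (\<lambda>g. f (point_eval (g <# H)))"

lemma pull_H: "g \<in> carrier G \<Longrightarrow> h \<in> H \<Longrightarrow> pull f (g \<otimes> h) = pull f g"
  using coset_of_H H_in H_carrier by (simp add: pull_def flip: lcos_m_assoc)

lemma pull_A:
  assumes f: "f \<in> C_Sa" shows "pull f \<in> A"
proof -
  have fc: "continuous_map SaX euclideanreal f" using f by (simp add: C_space_def)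
  have pe: "point_eval (g <# H) \<in> topspace SaX" if "g \<in> carrier G" for g using point_eval_Sa coset_mem that by blast
  obtain B where B: "\<And>x. x \<in> topspace SaX \<Longrightarrow> \<bar>f x\<bar> \<le> B" using continuous_map_real_bounded[OF Sa_compact fc] by blast
  have "\<forall>g\<in>carrier G. \<bar>pull f g\<bar> \<le> B" using B pe by (simp add: pull_def)
  moreover have "uniform_at_one (pull f) (\<lambda>g x. g \<otimes> x) (carrier G)"
    unfolding uniform_at_one_def
  proof (intro allI impI)
    fix \<epsilon> :: real assume "\<epsilon> > 0"
    then obtain W where W: "openin T W" "\<one> \<in> W"
      "\<And>u x. u \<in> W \<Longrightarrow> x \<in> topspace SaX \<Longrightarrow> \<bar>f (act u x) - f (act \<one> x)\<bar> < \<epsilon>"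
      using flow_uniform[OF Sa_flow topspace_T fc one_closed] by blast
    have "dist (pull f (u \<otimes> x)) (pull f x) < \<epsilon>" if u: "u \<in> W" and x: "x \<in> carrier G" for u x
    proof -
      have uG: "u \<in> carrier G" using u W(1) open_carrier by blast
      have "act u (point_eval (x <# H)) = point_eval ((u \<otimes> x) <# H)"
        using Sa_action_point_eval[OF uG coset_mem[OF x]] uG x H_carrier by (simp add: lcos_m_assoc)
      thus ?thesis using W(3)[OF u pe[OF x]] flow_one[OF Sa_flow pe[OF x]] by (simp add: pull_def dist_real_def)
    qed
    with W show "\<exists>U. openin T U \<and> \<one> \<in> U \<and> (\<forall>u\<in>U. \<forall>x\<in>carrier G. dist (pull f (u \<otimes> x)) (pull f x) < \<epsilon>)" by blast
  qed
  moreover have "small_osc (\<lambda>h. pull f (g \<otimes> h))" if "g \<in> carrier G" for g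
    using pull_H[OF that] unfolding small_osc_def by fastforce
  ultimately show ?thesis by (auto simp: A_def)
qed

definition \<phi> :: "(('g \<Rightarrow> real) \<Rightarrow> real) \<Rightarrow> ((('g set \<Rightarrow> complex) \<Rightarrow> complex) \<Rightarrow> real) \<Rightarrow> real" where
  "\<phi> \<Lambda> = (\<lambda>f. if f \<in> C_Sa then \<Lambda> (pull f) else 0)"

lemma \<phi>_state:
  assumes \<Lambda>: "\<Lambda> \<in> states A P" shows "\<phi> \<Lambda> \<in> states C_Sa P_Sa"
proof -
  have "pull f \<in> P" if "f \<in> C_Sa" "f \<in> P_Sa" for f
    using that point_eval_Sa coset_mem by (intro A.nonneg pull_A) (auto simp: pull_def nonneg_on_def)
  moreover have "\<Lambda> (pull (\<lambda>x. f x + h x)) = \<Lambda> (pull f) + \<Lambda> (pull h)" if "f \<in> C_Sa" "h \<in> C_Sa" for f h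
    using A.state_add[OF \<Lambda> pull_A[OF that(1)] pull_A[OF that(2)]] by (simp add: pull_def)
  moreover have "\<Lambda> (pull (\<lambda>x. c * f x)) = c * \<Lambda> (pull f)" if "f \<in> C_Sa" for f c
    using A.state_scale[OF \<Lambda> pull_A[OF that]] by (simp add: pull_def)
  moreover have "\<Lambda> (pull (\<lambda>_. 1)) = 1" using A.state_const[OF \<Lambda>] by (simp add: pull_def)
  ultimately show ?thesis
    unfolding states_def \<phi>_def using K.add K.scale K.const A.state_nonneg[OF \<Lambda> pull_A] by auto
qed

lemma \<phi>_continuous: "continuous_map L K \<phi>"
proof -
  have "continuous_map L euclideanreal (\<lambda>\<Lambda>. \<phi> \<Lambda> f)" for f
    unfolding \<phi>_def
    by (cases "f \<in> C_Sa") (auto intro: continuous_map_from_subtopology continuous_map_product_projection)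
  thus ?thesis using \<phi>_state by (auto simp: continuous_map_in_subtopology continuous_map_componentwise_UNIV)
qed

lemma \<phi>_affine: "affine_map_on (states A P) \<phi>"
  by (auto simp: affine_map_on_def \<phi>_def scaleR_fun_def)

lemma \<phi>_equivariant:
  assumes g: "g \<in> carrier G" and \<Lambda>: "\<Lambda> \<in> states A P" shows "\<phi> (L_action g \<Lambda>) = K_action g (\<phi> \<Lambda>)"
proof
  fix f
  have "\<Lambda> (\<lambda>x. pull f (g \<otimes> x)) = \<Lambda> (pull (\<lambda>x. f (act g x)))" if f: "f \<in> C_Sa"
  proof (rule A.state_cong[OF \<Lambda> translate_A[OF g pull_A[OF f]] pull_A[OF C_Sa_translate[OF f g]]])
    fix x assume x: "x \<in> carrier G"
    show "pull f (g \<otimes> x) = pull (\<lambda>x. f (act g x)) x"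
      using Sa_action_point_eval[OF g coset_mem[OF x]] g x H_carrier by (simp add: pull_def lcos_m_assoc)
  qed
  thus "\<phi> (L_action g \<Lambda>) f = K_action g (\<phi> \<Lambda>) f"
    using \<Lambda> \<phi>_state[OF \<Lambda>] pull_A C_Sa_translate[OF _ g] by (auto simp: \<phi>_def state_action_def)
qed

text \<open>A linear functional dominated by the essential supremum \<open>p F\<close> of \<open>F\<close> over \<open>H\<close> is such a state.\<close>

lemma state_over_base: obtains \<Lambda> where "\<Lambda> \<in> states A P" "\<phi> \<Lambda> = dirac \<one>"
proof -
  \<comment> \<open>\<open>S F\<close> consists of the numbers that bound \<open>F\<close> on a dense family of open sets.\<close>
  define S where "S = (\<lambda>F. {t. \<forall>W. openin M W \<and> W \<noteq> {} \<longrightarrow>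
     (\<exists>V. openin M V \<and> V \<noteq> {} \<and> V \<subseteq> W \<and> (\<forall>h\<in>H. \<alpha> h m0 \<in> V \<longrightarrow> F h \<le> (t::real)))})"
  define p where "p = (\<lambda>F. Inf (S F))"
  have SE: "\<exists>V. openin M V \<and> V \<noteq> {} \<and> V \<subseteq> W \<and> (\<forall>h\<in>H. \<alpha> h m0 \<in> V \<longrightarrow> F h \<le> t)"
    if "t \<in> S F" "openin M W \<and> W \<noteq> {}" for F t W using that by (simp add: S_def)
  have bound: "t \<in> S F" if "\<And>h. h \<in> H \<Longrightarrow> F h \<le> t" for F t using that unfolding S_def by blast
  have low: "c \<le> t" if t: "t \<in> S F" and c: "\<And>h. h \<in> H \<Longrightarrow> c \<le> F h" for F t c
  proof -
    have "openin M (topspace M) \<and> topspace M \<noteq> {}" using m0 by auto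
    from SE[OF t this]
    obtain V where V: "openin M V" "V \<noteq> {}" "\<And>h. h \<in> H \<Longrightarrow> \<alpha> h m0 \<in> V \<Longrightarrow> F h \<le> t" by blast
    obtain h where "h \<in> H" "\<alpha> h m0 \<in> V" using hits[OF V(1,2) m0] by blast
    thus ?thesis using V(3) c by force
  qed
  have bH: "\<exists>B. \<forall>h\<in>H. \<bar>F h\<bar> \<le> B" if "F \<in> A" for F using A.bounded[OF that] H_in by blast
  have ne: "S F \<noteq> {}" and bdd: "bdd_below (S F)" if F: "F \<in> A" for F
  proof -
    obtain B where B: "\<And>h. h \<in> H \<Longrightarrow> \<bar>F h\<bar> \<le> B" using bH[OF F] by blast
    have "B \<in> S F" using B by (intro bound) (auto simp: abs_le_iff)
    thus "S F \<noteq> {}" by blast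
    show "bdd_below (S F)"
    proof (rule bdd_belowI[of _ "- B"])
      fix t assume "t \<in> S F"
      thus "- B \<le> t" by (rule low) (use B in \<open>force simp: abs_le_iff\<close>)
    qed
  qed
  have le: "p F \<le> t" if "t \<in> S F" "F \<in> A" for F t unfolding p_def using that bdd by (intro cInf_lower)
  have gr: "c \<le> p F" if "F \<in> A" "\<And>t. t \<in> S F \<Longrightarrow> c \<le> t" for F c unfolding p_def using that ne by (intro cInf_greatest)
  have V: "subspace A"
    unfolding subspace_def using A.const[of 0] A.add A.scale
    by (auto simp: zero_fun_def plus_fun_def scaleR_fun_def)
  have "sublinear_on A p"
    unfolding sublinear_on_def
  proof (intro conjI ballI allI impI)
    fix F J assume F: "F \<in> A" and J: "J \<in> A"
    have FJ: "F + J \<in> A" using A.add[OF F J] by (simp add: plus_fun_def)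
    have "p (F + J) \<le> s + t" if s: "s \<in> S F" and t: "t \<in> S J" for s t
    proof (rule le[OF _ FJ])
      show "s + t \<in> S (F + J)"
        unfolding S_def
      proof (intro CollectI allI impI)
        fix W assume W: "openin M W \<and> W \<noteq> {}"
        obtain V where V: "openin M V \<and> V \<noteq> {}" "V \<subseteq> W" "\<And>h. h \<in> H \<Longrightarrow> \<alpha> h m0 \<in> V \<Longrightarrow> F h \<le> s"
          using SE[OF s W] by blast
        obtain V' where V': "openin M V'" "V' \<noteq> {}" "V' \<subseteq> V" "\<And>h. h \<in> H \<Longrightarrow> \<alpha> h m0 \<in> V' \<Longrightarrow> J h \<le> t"
          using SE[OF t V(1)] by blast
        show "\<exists>V. openin M V \<and> V \<noteq> {} \<and> V \<subseteq> W \<and> (\<forall>h\<in>H. \<alpha> h m0 \<in> V \<longrightarrow> (F + J) h \<le> s + t)"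
          using V' V(2,3) by (intro exI[of _ V']) (auto intro!: add_mono)
      qed
    qed
    note st = this
    have *: "p (F + J) - s \<le> p J" if "s \<in> S F" for s
    proof (rule gr[OF J])
      fix t assume "t \<in> S J"
      from st[OF that this] show "p (F + J) - s \<le> t" by simp
    qed
    have "p (F + J) - p J \<le> p F"
    proof (rule gr[OF F])
      fix s assume "s \<in> S F"
      from *[OF this] show "p (F + J) - p J \<le> s" by simp
    qed
    thus "p (F + J) \<le> p F + p J" by simp
  next
    fix F and c :: real assume F: "F \<in> A" and c: "c > 0"
    have sc: "c * t \<in> S (c *\<^sub>R F)" if "t \<in> S F" "c > 0" for F c t
      using that unfolding S_def scaleR_fun_def by simp
    have cF: "c *\<^sub>R F \<in> A" for c using A.scale[OF F] by (simp add: scaleR_fun_def)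
    have "p (c *\<^sub>R F) / c \<le> p F"
    proof (rule gr[OF F])
      fix t assume "t \<in> S F"
      from le[OF sc[OF this c] cF] show "p (c *\<^sub>R F) / c \<le> t" using c by (simp add: field_simps)
    qed
    moreover have "c * p F \<le> p (c *\<^sub>R F)"
    proof (rule gr[OF cF])
      fix t assume "t \<in> S (c *\<^sub>R F)"
      from sc[OF this, of "1 / c"] have "t / c \<in> S F" using c by (simp add: scaleR_fun_def)
      from le[OF this F] show "c * p F \<le> t" using c by (simp add: field_simps)
    qed
    ultimately show "p (c *\<^sub>R F) = c * p F" using c by (simp add: field_simps)
  qed
  from hahn_banach_dominated[OF V this]
  obtain l where l: "linear_functional_on A l" "\<And>F. F \<in> A \<Longrightarrow> l F \<le> p F" by blast
  define \<Lambda> where "\<Lambda> = (\<lambda>F. if F \<in> A then l F else 0)"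
  have ladd: "l (\<lambda>x. F x + J x) = l F + l J" if "F \<in> A" "J \<in> A" for F J
    using l(1) that unfolding linear_functional_on_def plus_fun_def by blast
  have lscale: "l (\<lambda>x. c * F x) = c * l F" if "F \<in> A" for F c
    using l(1) that unfolding linear_functional_on_def scaleR_fun_def by simp
  have lle: "l F \<le> t" if F: "F \<in> A" and t: "\<And>h. h \<in> H \<Longrightarrow> F h \<le> t" for F t
    using l(2)[OF F] le[OF bound[OF t] F] by simp
  have leq: "l F = t" if F: "F \<in> A" and t: "\<And>h. h \<in> H \<Longrightarrow> F h = t" for F t
  proof (rule antisym)
    show "l F \<le> t" using t by (intro lle[OF F]) simp
    have "l (\<lambda>x. - 1 * F x) \<le> - t" using t by (intro lle A.scale F) simp
    thus "t \<le> l F" using lscale[OF F, of "-1"] by simp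
  qed
  have "\<Lambda> \<in> states A P"
    unfolding states_def
  proof (intro CollectI conjI allI ballI impI)
    fix F assume F: "F \<in> A" "F \<in> P"
    have nF: "(\<lambda>x. - 1 * F x) \<in> A" by (rule A.scale[OF F(1)])
    have "l (\<lambda>x. - 1 * F x) \<le> 0 + e" if e: "e > 0" for e
    proof -
      have "densely_nonneg (\<lambda>h. F (\<one> \<otimes> h))" using F(2) by (simp add: P_def)
      hence "e \<in> S (\<lambda>x. - 1 * F x)"
        unfolding S_def densely_nonneg_def
      proof (intro CollectI allI impI)
        fix W assume dn: "\<forall>\<epsilon>>0. \<forall>W. openin M W \<and> W \<noteq> {} \<longrightarrow>
          (\<exists>V. openin M V \<and> V \<noteq> {} \<and> V \<subseteq> W \<and> (\<forall>h\<in>H. \<alpha> h m0 \<in> V \<longrightarrow> - \<epsilon> \<le> F (\<one> \<otimes> h)))"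
          and W: "openin M W \<and> W \<noteq> {}"
        obtain V where V: "openin M V" "V \<noteq> {}" "V \<subseteq> W" "\<And>h. h \<in> H \<Longrightarrow> \<alpha> h m0 \<in> V \<Longrightarrow> - e \<le> F (\<one> \<otimes> h)"
          using dn e W by meson
        have "- 1 * F h \<le> e" if "h \<in> H" "\<alpha> h m0 \<in> V" for h
          using V(4)[OF that] H_in[OF that(1)] by simp
        thus "\<exists>V. openin M V \<and> V \<noteq> {} \<and> V \<subseteq> W \<and> (\<forall>h\<in>H. \<alpha> h m0 \<in> V \<longrightarrow> - 1 * F h \<le> e)"
          using V(1-3) by blast
      qed
      thus ?thesis using l(2)[OF nF] le[OF _ nF] by fastforce
    qed
    hence "l (\<lambda>x. - 1 * F x) \<le> 0" by (rule field_le_epsilon)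
    thus "0 \<le> \<Lambda> F" using lscale[OF F(1), of "-1"] F(1) by (simp add: \<Lambda>_def)
  qed (use A.add A.scale A.const ladd lscale leq[OF A.const] in \<open>auto simp: \<Lambda>_def\<close>)
  moreover have "\<phi> \<Lambda> = dirac \<one>"
  proof
    fix f
    have "l (pull f) = f (point_eval (\<one> <# H))" if f: "f \<in> C_Sa"
      using pull_H[OF one_closed, of _ f] H_in by (intro leq[OF pull_A[OF f]]) (simp add: pull_def)
    thus "\<phi> \<Lambda> f = dirac \<one> f" using pull_A by (simp add: \<phi>_def dirac_def \<Lambda>_def)
  qed
  ultimately show ?thesis by (rule that)
qed

lemma L_affine_flow: "affine_flow G T L L_action"
proof (rule A.state_affine_flow[OF is_group topspace_T])
  fix g F and e :: real assume g: "g \<in> carrier G" and F: "F \<in> A" and e: "e > 0"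
  obtain U where U: "openin T U" "\<one> \<in> U" "\<And>u x. u \<in> U \<Longrightarrow> x \<in> carrier G \<Longrightarrow> \<bar>F (u \<otimes> x) - F x\<bar> < e"
    using A_uniform[OF F e] by blast
  let ?W = "{g' \<in> carrier G. \<one> \<otimes> g' \<otimes> inv g \<in> U}"
  have "openin T ?W" using U g by (intro open_translate) auto
  moreover have "g \<in> ?W" using U g by simp
  moreover have "\<bar>F (g' \<otimes> x) - F (g \<otimes> x)\<bar> \<le> e" if g': "g' \<in> ?W" and x: "x \<in> carrier G" for g' x
  proof -
    have "(\<one> \<otimes> g' \<otimes> inv g) \<otimes> (g \<otimes> x) = g' \<otimes> x"
      using g' x g by (simp add: m_assoc flip: m_assoc[of "inv g" g x])
    moreover have "\<bar>F ((\<one> \<otimes> g' \<otimes> inv g) \<otimes> (g \<otimes> x)) - F (g \<otimes> x)\<bar> < e"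
      using U(3)[of "\<one> \<otimes> g' \<otimes> inv g" "g \<otimes> x"] g' x g by blast
    ultimately show ?thesis by simp
  qed
  ultimately show "\<exists>W. openin T W \<and> g \<in> W \<and> (\<forall>g'\<in>W. \<forall>x\<in>carrier G. \<bar>F (g' \<otimes> x) - F (g \<otimes> x)\<bar> \<le> e)" by blast
next
  obtain \<Lambda> where "\<Lambda> \<in> states A P" by (rule state_over_base)
  thus "states A P \<noteq> {}" by blast
qed (auto simp: m_assoc translate_A translate_P)

lemma \<phi>_surjective: "\<phi> ` topspace L = topspace K"
proof (rule K_hull)
  have cp: "compactin K (\<phi> ` topspace L)"
    using compact_convex_compact[OF A.state_space_compact_convex]
    by (intro image_compactin[OF _ \<phi>_continuous]) (simp add: compact_space_def)
  show "closedin K (\<phi> ` topspace L)"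
    using compactin_imp_closedin[OF compact_convex_Hausdorff[OF K.state_space_compact_convex] cp] .
  show "convex (\<phi> ` topspace L)"
    unfolding convex_alt
  proof (intro ballI allI impI)
    fix x y and u :: real assume "x \<in> \<phi> ` topspace L" "y \<in> \<phi> ` topspace L" and u: "0 \<le> u \<and> u \<le> 1"
    then obtain a b where ab: "a \<in> states A P" "b \<in> states A P" "x = \<phi> a" "y = \<phi> b" by auto
    have "(1 - u) *\<^sub>R x + u *\<^sub>R y = \<phi> ((1 - u) *\<^sub>R a + u *\<^sub>R b)"
      using \<phi>_affine ab u unfolding affine_map_on_def by auto
    moreover have "(1 - u) *\<^sub>R a + u *\<^sub>R b \<in> states A P"
      using ab u by (intro convexD_alt[OF A.states_convex]) auto
    ultimately show "(1 - u) *\<^sub>R x + u *\<^sub>R y \<in> \<phi> ` topspace L" by simp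
  qed
  fix g assume g: "g \<in> carrier G"
  obtain \<Lambda> where \<Lambda>: "\<Lambda> \<in> states A P" "\<phi> \<Lambda> = dirac \<one>" by (rule state_over_base)
  have "\<phi> (L_action g \<Lambda>) = dirac g"
    using \<phi>_equivariant[OF g \<Lambda>(1)] \<Lambda>(2) K_action_dirac[OF g one_closed] g by simp
  moreover have "L_action g \<Lambda> \<in> topspace L"
    using L_affine_flow flow_closed[OF _ g, of T L L_action \<Lambda>] \<Lambda>(1) by (simp add: affine_flow_def)
  ultimately show "dirac g \<in> \<phi> ` topspace L" by (metis imageI)
qed

lemma L_extension: "affine_extension G T L L_action K K_action \<phi>"
  unfolding affine_extension_def
  using L_affine_flow K_flow \<phi>_continuous \<phi>_surjective \<phi>_affine \<phi>_equivariant by auto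

text \<open>If \<open>F \<ge> c\<close> on \<open>H\<close>, then \<open>F \<ge> c - \<epsilon>\<close> on \<open>U H\<close> for a neighbourhood \<open>U\<close> of the identity, and
  outside of \<open>U H\<close> there is a function on \<open>G/H\<close> that vanishes at \<open>H\<close> to dominate \<open>c - F\<close>.\<close>

lemma over_base_ge:
  assumes \<omega>: "\<omega> \<in> states A P" "\<phi> \<omega> = dirac \<one>" and F: "F \<in> A" and c: "\<And>h. h \<in> H \<Longrightarrow> c \<le> F h"
  shows "c \<le> \<omega> F"
proof (rule field_le_epsilon)
  fix \<epsilon> :: real assume \<epsilon>: "\<epsilon> > 0"
  obtain B where B: "B > 0" "\<And>g. g \<in> carrier G \<Longrightarrow> \<bar>F g\<bar> \<le> B" using A_bounded[OF F] by blast
  obtain U where U: "openin T U" "\<one> \<in> U" "\<And>u x. u \<in> U \<Longrightarrow> x \<in> carrier G \<Longrightarrow> \<bar>F (u \<otimes> x) - F x\<bar> < \<epsilon>"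
    using A_uniform[OF F \<epsilon>] by blast
  obtain k where k: "\<And>x. x \<in> cosets \<Longrightarrow> 0 \<le> k x \<and> k x \<le> (1::real)" "uniform_at_one k (\<lambda>g x. g <# x) cosets"
    "k H = 0" "\<And>x. x \<in> cosets \<Longrightarrow> x \<inter> U = {} \<Longrightarrow> k x = 1"
    using coset_bump[OF U(1,2)] by blast
  have "\<bar>k x\<bar> \<le> 1" if "x \<in> cosets" for x using k(1)[OF that] by auto
  then obtain f where f: "continuous_map SaX euclideanreal f" "\<And>x. x \<in> cosets \<Longrightarrow> f (point_eval x) = k x"
    using RUC_extension[of k 1, OF _ k(2)] by blast
  have fC: "f \<in> C_Sa" using f(1) by (simp add: C_space_def)
  have pf: "pull f g = k (g <# H)" if "g \<in> carrier G" for g using f(2)[OF coset_mem[OF that]] by (simp add: pull_def)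
  define C where "C = B + \<bar>c\<bar>"
  have "c - \<epsilon> \<le> F g + C * pull f g" if g: "g \<in> carrier G" for g
  proof (cases "(g <# H) \<inter> U = {}")
    case True
    hence "pull f g = 1" using pf[OF g] k(4) coset_mem[OF g] by simp
    thus ?thesis using B(2)[OF g] \<epsilon> by (simp add: C_def abs_le_iff) linarith
  next
    case False
    then obtain h where h: "h \<in> H" "g \<otimes> h \<in> U" by (auto simp: l_coset_def)
    have "(g \<otimes> h) \<otimes> inv h = g" using g h H_in by (simp add: m_assoc)
    hence "\<bar>F g - F (inv h)\<bar> < \<epsilon>" using U(3)[OF h(2), of "inv h"] h H_in by simp
    hence "c - \<epsilon> \<le> F g" using c[OF H_inv[OF h(1)]] by linarith
    moreover have "0 \<le> C * pull f g" using pf[OF g] k(1)[OF coset_mem[OF g]] B(1) by (simp add: C_def)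
    ultimately show ?thesis by linarith
  qed
  hence "c - \<epsilon> \<le> \<omega> (\<lambda>g. F g + C * pull f g)"
    using F by (intro A.state_ge[OF \<omega>(1)] A.add A.scale pull_A[OF fC]) auto
  also have "\<dots> = \<omega> F + C * \<omega> (pull f)"
    using A.state_add[OF \<omega>(1) F A.scale[OF pull_A[OF fC]]] A.state_scale[OF \<omega>(1) pull_A[OF fC]] by simp
  also have "\<omega> (pull f) = 0"
  proof -
    have "\<omega> (pull f) = dirac \<one> f" using fun_cong[OF \<omega>(2), of f] fC by (simp add: \<phi>_def)
    also have "\<dots> = k H" using dirac_eval[OF fC] f(2)[OF coset_mem[OF one_closed]] H_carrier by (simp add: lcos_mult_one)
    finally show ?thesis using k(3) by simp
  qed
  finally show "c \<le> \<omega> F + \<epsilon>" by simp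
qed

text \<open>
  A McShane type extension of \<open>h \<mapsto> c (h m0)\<close> from \<open>H\<close> to \<open>G\<close>.  On a coset \<open>g H\<close> it is an upper
  semicontinuous function of the point of \<open>M\<close>; such functions have small oscillation near points
  where they almost attain the infimum over an open set, but they need not be continuous.
\<close>

lemma approximate_extension:
  assumes c: "continuous_map M euclideanreal c" and \<epsilon>: "\<epsilon> > 0"
  obtains F where "F \<in> A" "\<And>k. k \<in> H \<Longrightarrow> \<bar>F k - c (\<alpha> k m0)\<bar> \<le> \<epsilon>"
proof -
  obtain B where B: "\<And>m. m \<in> topspace M \<Longrightarrow> \<bar>c m\<bar> \<le> B" using continuous_map_real_bounded[OF M_compact c] by blast
  have B0: "0 \<le> B" using B[OF m0] by simp
  obtain W where W: "openin TH W" "\<one> \<in> W"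
    "\<And>u m. u \<in> W \<Longrightarrow> m \<in> topspace M \<Longrightarrow> \<bar>c (\<alpha> u m) - c (\<alpha> \<one> m)\<bar> < \<epsilon>"
    using flow_uniform[OF M_flow TH_top c _ \<epsilon>, of \<one>] one_H by auto
  obtain U where U: "openin T U" "W = U \<inter> H" using W(1) by (auto simp: openin_subtopology)
  have "\<one> \<in> U" using W(2) U(2) by blast
  then obtain l :: "'g \<Rightarrow> real" where l: "\<And>x. 0 \<le> l x" "\<And>x. l x \<le> 1" "l \<one> = 0"
    "\<And>x y. x \<in> carrier G \<Longrightarrow> y \<in> carrier G \<Longrightarrow> l (x \<otimes> y) \<le> l x + l y"
    "\<And>x. x \<in> carrier G \<Longrightarrow> l (inv x) = l x"
    "\<And>e. e > 0 \<Longrightarrow> \<exists>W. openin T W \<and> \<one> \<in> W \<and> (\<forall>w\<in>W. l w < e)"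
    "\<And>x. x \<notin> U \<Longrightarrow> l x = 1"
    using length_function[OF U(1)] by blast
  \<comment> \<open>Outside of \<open>U\<close> the penalty \<open>N * l\<close> is at least any difference of two values of \<open>c\<close>.\<close>
  define N where "N = 2 * B"
  have N: "0 \<le> N" using B0 by (simp add: N_def)
  define \<Phi> where "\<Phi> = (\<lambda>g m. INF h\<in>H. c (\<alpha> h m) + N * l (g \<otimes> inv h))"
  define F where "F = (\<lambda>g. \<Phi> g m0)"
  have lb: "- B \<le> c (\<alpha> h m) + N * l (g \<otimes> inv h)" if "h \<in> H" "m \<in> topspace M" for h m g
    using B[OF \<alpha>_closed[OF that]] l(1)[of "g \<otimes> inv h"] N mult_nonneg_nonneg[of N "l (g \<otimes> inv h)"] by linarith
  have lower: "\<Phi> g m \<le> c (\<alpha> h m) + N * l (g \<otimes> inv h)" if "h \<in> H" "m \<in> topspace M" for g m h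
    unfolding \<Phi>_def using that lb by (intro cINF_lower bdd_belowI2[of _ "- B"]) auto
  have greatest: "t \<le> \<Phi> g m" if "\<And>h. h \<in> H \<Longrightarrow> t \<le> c (\<alpha> h m) + N * l (g \<otimes> inv h)" for t g m
    unfolding \<Phi>_def using that one_H by (intro cINF_greatest) auto
  have half: "F (v \<otimes> g) \<le> F g + N * l v" if v: "v \<in> carrier G" and g: "g \<in> carrier G" for v g
  proof -
    have "F (v \<otimes> g) - N * l v \<le> \<Phi> g m0"
    proof (rule greatest)
      fix h assume h: "h \<in> H"
      have "l (v \<otimes> g \<otimes> inv h) \<le> l v + l (g \<otimes> inv h)" using l(4)[of v "g \<otimes> inv h"] v g h H_in by (simp add: m_assoc)
      hence "N * l (v \<otimes> g \<otimes> inv h) \<le> N * (l v + l (g \<otimes> inv h))" using N by (rule mult_left_mono)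
      moreover have "F (v \<otimes> g) \<le> c (\<alpha> h m0) + N * l (v \<otimes> g \<otimes> inv h)" unfolding F_def by (rule lower[OF h m0])
      ultimately show "F (v \<otimes> g) - N * l v \<le> c (\<alpha> h m0) + N * l (g \<otimes> inv h)" by (simp add: algebra_simps)
    qed
    thus ?thesis by (simp add: F_def)
  qed
  have lip: "\<bar>F (v \<otimes> g) - F g\<bar> \<le> N * l v" if v: "v \<in> carrier G" and g: "g \<in> carrier G" for v g
  proof -
    have "F (inv v \<otimes> (v \<otimes> g)) \<le> F (v \<otimes> g) + N * l (inv v)" using v g by (intro half) auto
    moreover have "inv v \<otimes> (v \<otimes> g) = g" using v g by (simp flip: m_assoc)
    ultimately show ?thesis using half[OF v g] l(5)[OF v] by (simp add: abs_le_iff)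
  qed
  have bF: "\<bar>F g\<bar> \<le> B + N" if g: "g \<in> carrier G" for g
  proof -
    have "- B \<le> F g" unfolding F_def using lb m0 by (intro greatest) auto
    moreover have "F g \<le> c (\<alpha> \<one> m0) + N * l (g \<otimes> inv \<one>)" unfolding F_def by (rule lower[OF one_H m0])
    moreover have "N * l (g \<otimes> inv \<one>) \<le> N * 1" using l(2) N by (rule mult_left_mono)
    ultimately show ?thesis using B[OF \<alpha>_closed[OF one_H m0]] N by (simp add: abs_le_iff)
  qed
  have unif: "uniform_at_one F (\<lambda>g x. g \<otimes> x) (carrier G)"
    unfolding uniform_at_one_def
  proof (intro allI impI)
    fix e :: real assume e: "e > 0"
    hence "e / (N + 1) > 0" using N by simp
    then obtain V where V: "openin T V" "\<one> \<in> V" "\<And>w. w \<in> V \<Longrightarrow> l w < e / (N + 1)" using l(6) by meson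
    have "dist (F (v \<otimes> x)) (F x) < e" if v: "v \<in> V" and x: "x \<in> carrier G" for v x
    proof -
      have "N * l v \<le> (N + 1) * l v" using l(1)[of v] by (simp add: algebra_simps)
      also have "\<dots> < e" using V(3)[OF v] N by (simp add: field_simps)
      finally show ?thesis using lip[OF open_carrier[OF V(1) v] x] by (simp add: dist_real_def)
    qed
    with V show "\<exists>U. openin T U \<and> \<one> \<in> U \<and> (\<forall>u\<in>U. \<forall>x\<in>carrier G. dist (F (u \<otimes> x)) (F x) < e)" by blast
  qed
  have shift: "F (g \<otimes> k) = \<Phi> g (\<alpha> k m0)" if g: "g \<in> carrier G" and k: "k \<in> H" for g k
  proof (rule antisym)
    show "F (g \<otimes> k) \<le> \<Phi> g (\<alpha> k m0)"
    proof (rule greatest)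
      fix h assume h: "h \<in> H"
      have "F (g \<otimes> k) \<le> c (\<alpha> (h \<otimes> k) m0) + N * l (g \<otimes> k \<otimes> inv (h \<otimes> k))"
        unfolding F_def by (rule lower[OF H_mult[OF h k] m0])
      moreover have "g \<otimes> k \<otimes> inv (h \<otimes> k) = g \<otimes> inv h"
        using g h k H_in by (simp add: inv_mult_group m_assoc flip: m_assoc[of k "inv k" "inv h"])
      ultimately show "F (g \<otimes> k) \<le> c (\<alpha> h (\<alpha> k m0)) + N * l (g \<otimes> inv h)" using \<alpha>_mult[OF h k m0] by simp
    qed
    show "\<Phi> g (\<alpha> k m0) \<le> F (g \<otimes> k)"
      unfolding F_def
    proof (rule greatest)
      fix h assume h: "h \<in> H"
      have hk: "h \<otimes> inv k \<in> H" using H_mult[OF h H_inv[OF k]] .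
      have "\<Phi> g (\<alpha> k m0) \<le> c (\<alpha> (h \<otimes> inv k) (\<alpha> k m0)) + N * l (g \<otimes> inv (h \<otimes> inv k))"
        by (rule lower[OF hk \<alpha>_closed[OF k m0]])
      moreover have "\<alpha> (h \<otimes> inv k) (\<alpha> k m0) = \<alpha> h m0"
        using \<alpha>_mult[OF hk k m0] h k H_in by (simp add: m_assoc)
      moreover have "g \<otimes> inv (h \<otimes> inv k) = g \<otimes> k \<otimes> inv h"
        using g h k H_in by (simp add: inv_mult_group m_assoc)
      ultimately show "\<Phi> g (\<alpha> k m0) \<le> c (\<alpha> h m0) + N * l (g \<otimes> k \<otimes> inv h)" by simp
    qed
  qed
  have osc: "small_osc (\<lambda>h. F (g \<otimes> h))" if g: "g \<in> carrier G" for g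
    unfolding small_osc_def
  proof (intro allI impI)
    fix e :: real and W assume e: "e > 0" and W: "openin M W \<and> W \<noteq> {}"
    have WM: "W \<subseteq> topspace M" using W openin_subset by blast
    define s where "s = (INF m\<in>W. \<Phi> g m)"
    have bdd: "bdd_below (\<Phi> g ` W)" using lb WM by (intro bdd_belowI2[of _ "- B"] greatest) auto
    have slow: "s \<le> \<Phi> g m" if "m \<in> W" for m unfolding s_def using that bdd by (intro cINF_lower)
    obtain m1 where m1: "m1 \<in> W" "\<Phi> g m1 < s + e"
      using cINF_less_iff[of W "\<Phi> g" "s + e"] bdd W e by (auto simp: s_def)
    have "\<not> (s + e \<le> \<Phi> g m1)" using m1(2) by simp
    then obtain h where h: "h \<in> H" "c (\<alpha> h m1) + N * l (g \<otimes> inv h) < s + e"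
      using greatest[of "s + e" m1 g] by force
    \<comment> \<open>The single function \<open>?d\<close> bounds \<open>\<Phi> g\<close> by \<open>s + e\<close> on an open set, and \<open>s\<close> bounds it from below.\<close>
    let ?d = "\<lambda>m. c (\<alpha> h m) + N * l (g \<otimes> inv h)"
    let ?V = "W \<inter> {m \<in> topspace M. ?d m \<in> {..<s + e}}"
    have "continuous_map M euclideanreal (c \<circ> \<alpha> h)" by (rule continuous_map_compose[OF \<alpha>_continuous[OF h(1)] c])
    hence "continuous_map M euclideanreal ?d" by (intro continuous_map_add) (auto simp: o_def)
    hence "openin M {m \<in> topspace M. ?d m \<in> {..<s + e}}" by (rule openin_continuous_map_preimage) simp
    hence "openin M ?V" using W by blast
    moreover have "m1 \<in> ?V" using m1(1) h(2) WM by auto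
    moreover have "\<bar>F (g \<otimes> h1) - F (g \<otimes> h2)\<bar> \<le> e"
      if "h1 \<in> H" "h2 \<in> H" "\<alpha> h1 m0 \<in> ?V" "\<alpha> h2 m0 \<in> ?V" for h1 h2
    proof -
      have "s \<le> \<Phi> g m \<and> \<Phi> g m \<le> s + e" if "m \<in> ?V" for m
        using slow[of m] lower[OF h(1), of m g] that by auto
      from this[OF that(3)] this[OF that(4)] show ?thesis
        unfolding shift[OF g that(1)] shift[OF g that(2)] by linarith
    qed
    ultimately show "\<exists>V. openin M V \<and> V \<noteq> {} \<and> V \<subseteq> W \<and>
        (\<forall>h\<in>H. \<forall>k\<in>H. \<alpha> h m0 \<in> V \<longrightarrow> \<alpha> k m0 \<in> V \<longrightarrow> \<bar>F (g \<otimes> h) - F (g \<otimes> k)\<bar> \<le> e)"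
      by (intro exI[of _ ?V]) blast
  qed
  have "\<bar>F k - c (\<alpha> k m0)\<bar> \<le> \<epsilon>" if k: "k \<in> H" for k
  proof -
    have kM: "\<alpha> k m0 \<in> topspace M" by (rule \<alpha>_closed[OF k m0])
    have "F k \<le> c (\<alpha> k m0) + N * l (k \<otimes> inv k)" unfolding F_def by (rule lower[OF k m0])
    hence "F k \<le> c (\<alpha> k m0)" using k H_in l(3) by simp
    moreover have "c (\<alpha> k m0) - \<epsilon> \<le> F k"
      unfolding F_def
    proof (rule greatest)
      fix h assume h: "h \<in> H"
      have hM: "\<alpha> h m0 \<in> topspace M" by (rule \<alpha>_closed[OF h m0])
      show "c (\<alpha> k m0) - \<epsilon> \<le> c (\<alpha> h m0) + N * l (k \<otimes> inv h)"
      proof (cases "k \<otimes> inv h \<in> U")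
        case True
        have kh: "k \<otimes> inv h \<in> H" using H_mult[OF k H_inv[OF h]] .
        hence "k \<otimes> inv h \<in> W" using True U(2) by blast
        hence "\<bar>c (\<alpha> (k \<otimes> inv h) (\<alpha> h m0)) - c (\<alpha> \<one> (\<alpha> h m0))\<bar> < \<epsilon>" using W(3) hM by blast
        moreover have "\<alpha> (k \<otimes> inv h) (\<alpha> h m0) = \<alpha> k m0"
          using \<alpha>_mult[OF kh h m0] h k H_in by (simp add: m_assoc)
        moreover have "0 \<le> N * l (k \<otimes> inv h)" using N l(1) by simp
        ultimately show ?thesis using \<alpha>_one[OF hM] by (simp add: abs_less_iff)
      next
        case False
        hence "N * l (k \<otimes> inv h) = 2 * B" using l(7) by (simp add: N_def)
        thus ?thesis using B[OF hM] B[OF kM] \<epsilon> by (simp add: abs_le_iff)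
      qed
    qed
    ultimately show ?thesis using \<epsilon> by (simp add: abs_le_iff)
  qed
  moreover have "F \<in> A" using bF unif osc by (auto simp: A_def)
  ultimately show ?thesis using that by blast
qed

end

context proximal_flow
begin

definition represents :: "(('g \<Rightarrow> real) \<Rightarrow> real) \<Rightarrow> 'y \<Rightarrow> bool" where
  "represents \<omega> m \<longleftrightarrow> (\<forall>c F \<epsilon>. continuous_map M euclideanreal c \<longrightarrow> F \<in> A \<longrightarrow>
     (\<forall>k\<in>H. \<bar>F k - c (\<alpha> k m0)\<bar> \<le> \<epsilon>) \<longrightarrow> \<bar>\<omega> F - c m\<bar> \<le> \<epsilon>)"

text \<open>
  A multiplicative state over the base point is given by a point of \<open>M\<close> on the functions that
  come from \<open>C(M)\<close>.  Otherwise a finite sum of functions \<open>(F - \<omega> F)\<^sup>2\<close>, on which \<open>\<omega>\<close> vanishes,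
  would be bounded away from \<open>0\<close> on \<open>H\<close>, by compactness of \<open>M\<close>.
\<close>

lemma multiplicative_represents:
  assumes \<omega>: "\<omega> \<in> states A P" "\<phi> \<omega> = dirac \<one>"
    and mult: "\<And>F J. F \<in> A \<Longrightarrow> J \<in> A \<Longrightarrow> \<omega> (\<lambda>x. F x * J x) = \<omega> F * \<omega> J"
  obtains m where "m \<in> topspace M" "represents \<omega> m"
proof (rule ccontr)
  assume "\<not> thesis"
  hence "\<not> represents \<omega> m" if "m \<in> topspace M" for m using \<open>\<And>m. m \<in> topspace M \<Longrightarrow> represents \<omega> m \<Longrightarrow> thesis\<close> that by blast
  hence "\<forall>m\<in>topspace M. \<exists>p. continuous_map M euclideanreal (fst p) \<and> fst (snd p) \<in> A \<and>
     (\<forall>k\<in>H. \<bar>fst (snd p) k - fst p (\<alpha> k m0)\<bar> \<le> snd (snd p)) \<and> snd (snd p) < \<bar>\<omega> (fst (snd p)) - fst p m\<bar>"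
    unfolding represents_def by (simp add: not_le)
  then obtain p where p: "\<forall>m\<in>topspace M. continuous_map M euclideanreal (fst (p m)) \<and> fst (snd (p m)) \<in> A \<and>
     (\<forall>k\<in>H. \<bar>fst (snd (p m)) k - fst (p m) (\<alpha> k m0)\<bar> \<le> snd (snd (p m))) \<and>
     snd (snd (p m)) < \<bar>\<omega> (fst (snd (p m))) - fst (p m) m\<bar>"
    by (rule bchoice[THEN exE])
  define c F e where "c = (\<lambda>m. fst (p m))" and "F = (\<lambda>m. fst (snd (p m)))" and "e = (\<lambda>m. snd (snd (p m)))"
  have c: "continuous_map M euclideanreal (c m)" and F: "F m \<in> A" and
    approx: "\<And>k. k \<in> H \<Longrightarrow> \<bar>F m k - c m (\<alpha> k m0)\<bar> \<le> e m" and
    far: "e m < \<bar>\<omega> (F m) - c m m\<bar>" if "m \<in> topspace M" for m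
    using p that by (auto simp: c_def F_def e_def)
  define d where "d = (\<lambda>m x. max 0 (\<bar>c m x - \<omega> (F m)\<bar> - e m))"
  have dc: "continuous_map M euclideanreal (d m)" if "m \<in> topspace M" for m
    unfolding d_def using c[OF that]
    by (intro continuous_map_real_max continuous_map_diff continuous_map_real_abs) auto
  define U where "U = (\<lambda>m. {x \<in> topspace M. d m x \<in> {0<..}})"
  have Uo: "\<forall>V\<in>U ` topspace M. openin M V"
    unfolding U_def using dc openin_continuous_map_preimage[of M euclideanreal _ "{0<..}"] by auto
  have "m \<in> U m" if "m \<in> topspace M" for m
    using far[OF that] that by (simp add: U_def d_def less_max_iff_disj abs_minus_commute)
  hence "topspace M \<subseteq> \<Union>(U ` topspace M)" by blast
  then obtain \<F> where "finite \<F>" "\<F> \<subseteq> U ` topspace M" "topspace M \<subseteq> \<Union>\<F>"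
    using M_compact Uo unfolding compact_space_def compactin_def by meson
  then obtain I where I: "finite I" "I \<subseteq> topspace M" "topspace M \<subseteq> \<Union>(U ` I)" by (metis finite_subset_image)
  define D where "D = (\<lambda>x. \<Sum>m\<in>I. d m x * d m x)"
  have "continuous_map M euclideanreal D"
    unfolding D_def using dc I by (intro continuous_map_sum continuous_map_real_mult) auto
  hence "compact (D ` topspace M)" using M_compact image_compactin[of M "topspace M" euclideanreal D] by (simp add: compact_space_def)
  then obtain x0 where x0: "x0 \<in> topspace M" "\<And>x. x \<in> topspace M \<Longrightarrow> D x0 \<le> D x"
  proof -
    have "D ` topspace M \<noteq> {}" using m0 by blast
    then obtain s where "s \<in> D ` topspace M" "\<forall>t\<in>D ` topspace M. s \<le> t"
      using compact_attains_inf[OF \<open>compact (D ` topspace M)\<close>] by blast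
    thus ?thesis using that by blast
  qed
  have "0 < D x0"
  proof -
    obtain m where m: "m \<in> I" "0 < d m x0" using I(3) x0(1) by (auto simp: U_def)
    have "0 < d m x0 * d m x0" using m(2) by simp
    also have "\<dots> \<le> D x0" unfolding D_def using I(1) m(1) by (intro member_le_sum) auto
    finally show ?thesis .
  qed
  define J where "J = (\<lambda>m x. F m x - \<omega> (F m))"
  have J: "J m \<in> A" if "m \<in> I" for m unfolding J_def using I(2) that by (intro A.diff F A.const) blast
  have JJ: "(\<lambda>x. J m x * J m x) \<in> A" if "m \<in> I" for m by (rule A.mult[OF J[OF that] J[OF that]])
  have sum: "(\<lambda>x. \<Sum>m\<in>I. J m x * J m x) \<in> A" by (rule A.sum_mem[OF I(1) JJ])
  have "\<omega> (J m) = 0" if m: "m \<in> I" for m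
  proof -
    have "F m \<in> A" using F I(2) m by blast
    thus ?thesis unfolding J_def using A.state_diff[OF \<omega>(1) _ A.const] A.state_const[OF \<omega>(1)] by simp
  qed
  hence "\<omega> (\<lambda>x. J m x * J m x) = 0" if "m \<in> I" for m using mult[OF J[OF that] J[OF that]] that by simp
  hence zero: "\<omega> (\<lambda>x. \<Sum>m\<in>I. J m x * J m x) = 0" using A.state_sum[OF \<omega>(1) I(1) JJ] by simp
  have "D x0 \<le> \<omega> (\<lambda>x. \<Sum>m\<in>I. J m x * J m x)"
  proof (rule over_base_ge[OF \<omega> sum])
    fix k assume k: "k \<in> H"
    have "D x0 \<le> D (\<alpha> k m0)" by (rule x0(2)[OF \<alpha>_closed[OF k m0]])
    also have "\<dots> \<le> (\<Sum>m\<in>I. J m k * J m k)"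
      unfolding D_def
    proof (rule sum_mono)
      fix m assume "m \<in> I"
      hence m: "m \<in> topspace M" using I(2) by blast
      have "d m (\<alpha> k m0) \<le> \<bar>J m k\<bar>" using approx[OF m k] by (auto simp: d_def J_def)
      hence "d m (\<alpha> k m0) * d m (\<alpha> k m0) \<le> \<bar>J m k\<bar> * \<bar>J m k\<bar>"
        by (intro mult_mono) (auto simp: d_def)
      thus "d m (\<alpha> k m0) * d m (\<alpha> k m0) \<le> J m k * J m k" by simp
    qed
    finally show "D x0 \<le> (\<Sum>m\<in>I. J m k * J m k)" .
  qed
  thus False using zero \<open>0 < D x0\<close> by simp
qed

lemma ext_closure_represents:
  assumes "\<omega> \<in> ext_closure L" "\<phi> \<omega> = dirac \<one>" obtains m where "m \<in> topspace M" "represents \<omega> m"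
proof -
  have "ext_closure L \<subseteq> states A P" using closure_of_subset_topspace[of L] unfolding ext_closure_def by auto
  thus ?thesis
    using multiplicative_represents[of \<omega>] A.ext_closure_state_multiplicative[OF assms(1)] assms that by blast
qed

text \<open>By proximality and minimality any two points can be moved into any nonempty open set
  simultaneously; by compactness this extends to finitely many points.\<close>

lemma proximal_two:
  assumes W: "openin M W" "W \<noteq> {}" and xy: "x \<in> topspace M" "y \<in> topspace M"
  obtains h where "h \<in> H" "\<alpha> h x \<in> W" "\<alpha> h y \<in> W"
proof -
  obtain F z where F: "F \<noteq> bot" "eventually (\<lambda>g. g \<in> carrier GH) F"
    "limitin M (\<lambda>g. \<alpha> g x) z F" "limitin M (\<lambda>g. \<alpha> g y) z F"
    using prox xy unfolding proximal_def by blast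
  have z: "z \<in> topspace M" using F(3) by (simp add: limitin_def)
  obtain k where k: "k \<in> H" "\<alpha> k z \<in> W" using hits[OF W z] by blast
  let ?V = "{m \<in> topspace M. \<alpha> k m \<in> W}"
  have "openin M ?V" using openin_continuous_map_preimage[OF \<alpha>_continuous[OF k(1)] W(1)] .
  hence "eventually (\<lambda>g. \<alpha> g x \<in> ?V) F" "eventually (\<lambda>g. \<alpha> g y \<in> ?V) F"
    using F(3,4) z k(2) unfolding limitin_def by blast+
  hence "eventually (\<lambda>g. g \<in> carrier GH \<and> \<alpha> g x \<in> ?V \<and> \<alpha> g y \<in> ?V) F" using F(2) by (simp add: eventually_conj_iff)
  then obtain g where "g \<in> H" "\<alpha> g x \<in> ?V" "\<alpha> g y \<in> ?V" using F(1) eventually_happens' by fastforce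
  thus ?thesis using that[of "k \<otimes> g"] H_mult[OF k(1)] \<alpha>_mult[OF k(1)] xy by simp
qed

lemma proximal_finite:
  assumes "finite J" "J \<subseteq> topspace M" "openin M W" "W \<noteq> {}"
  shows "\<exists>h\<in>H. \<forall>m\<in>J. \<alpha> h m \<in> W"
  using assms
proof (induction J arbitrary: W rule: finite_induct)
  case empty thus ?case using one_H by blast
next
  case (insert m J)
  have J: "J \<subseteq> topspace M" and m: "m \<in> topspace M" using insert.prems by auto
  \<comment> \<open>A point \<open>w\<close> of all \<open>Q N\<close> is a limit of \<open>h m\<close> along \<open>h\<close> that move \<open>J\<close> to \<open>m0\<close>; it remains to move \<open>m0\<close> and \<open>w\<close>.\<close>
  define Q where "Q = (\<lambda>N. M closure_of {\<alpha> h m | h. h \<in> H \<and> (\<forall>j\<in>J. \<alpha> h j \<in> N)})"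
  let ?\<U> = "Q ` {N. openin M N \<and> m0 \<in> N}"
  have mono: "Q N \<subseteq> Q N'" if "N \<subseteq> N'" for N N' unfolding Q_def using that by (intro closure_of_mono) blast
  have ne: "Q N \<noteq> {}" if N: "openin M N" "m0 \<in> N" for N
  proof -
    obtain h where h: "h \<in> H" "\<forall>j\<in>J. \<alpha> h j \<in> N" using insert.IH[OF J N(1)] N(2) by blast
    have "{\<alpha> h m | h. h \<in> H \<and> (\<forall>j\<in>J. \<alpha> h j \<in> N)} \<subseteq> topspace M" using \<alpha>_closed m by blast
    thus ?thesis using closure_of_subset h unfolding Q_def by blast
  qed
  have "\<Inter>?\<U> \<noteq> {}"
  proof (rule M_compact[unfolded compact_space_fip, rule_format], intro conjI ballI allI impI)
    show "closedin M B" if "B \<in> ?\<U>" for B using that by (auto simp: Q_def)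
    fix \<F> assume \<F>: "finite \<F> \<and> \<F> \<subseteq> ?\<U>"
    then obtain I where I: "finite I" "I \<subseteq> {N. openin M N \<and> m0 \<in> N}" "\<F> = Q ` I" by (meson finite_subset_image)
    let ?N = "topspace M \<inter> \<Inter>I"
    have "openin M ?N" using I by (cases "I = {}") (auto intro!: openin_Int openin_Inter)
    moreover have "m0 \<in> ?N" using m0 I(2) by auto
    ultimately have "Q ?N \<noteq> {}" by (rule ne)
    moreover have "Q ?N \<subseteq> Q N" if "N \<in> I" for N using that by (intro mono) blast
    ultimately show "\<Inter>\<F> \<noteq> {}" using I(3) by blast
  qed
  then obtain w where w: "\<And>N. openin M N \<Longrightarrow> m0 \<in> N \<Longrightarrow> w \<in> Q N" by blast
  have "w \<in> topspace M" using w[of "topspace M"] m0 closure_of_subset_topspace unfolding Q_def by fastforce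
  then obtain g where g: "g \<in> H" "\<alpha> g m0 \<in> W" "\<alpha> g w \<in> W" using proximal_two[OF insert.prems(2,3) m0] by blast
  let ?N = "{x \<in> topspace M. \<alpha> g x \<in> W}"
  have N: "openin M ?N" using openin_continuous_map_preimage[OF \<alpha>_continuous[OF g(1)] insert.prems(2)] .
  have "w \<in> Q ?N" using w[OF N] g(2) m0 by simp
  moreover have "w \<in> ?N" using g(3) \<open>w \<in> topspace M\<close> by simp
  ultimately have "\<exists>y. y \<in> {\<alpha> h m | h. h \<in> H \<and> (\<forall>j\<in>J. \<alpha> h j \<in> ?N)} \<and> y \<in> ?N"
    using N unfolding Q_def in_closure_of by meson
  then obtain h where h: "h \<in> H" "\<forall>j\<in>J. \<alpha> h j \<in> ?N" "\<alpha> h m \<in> ?N" by blast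
  have "\<alpha> (g \<otimes> h) j \<in> W" if "j \<in> insert m J" for j
    using that h J m \<alpha>_mult[OF g(1) h(1), of j] by auto
  thus ?case using H_mult[OF g(1) h(1)] by blast
qed

text \<open>
  Move the points of \<open>M\<close> that represent the states in \<open>S\<close> into \<open>V\<close>.  A continuous function on
  \<open>M\<close> with support in \<open>V\<close> gives a lower bound of the translates of \<open>F\<close> that is large at these points.
\<close>

lemma translate_exceeds_at_states:
  assumes \<nu>: "finite S" "\<And>\<omega>. \<omega> \<in> S \<Longrightarrow> \<omega> \<in> states A P \<and> \<phi> \<omega> = dirac \<one> \<and> (\<exists>m\<in>topspace M. represents \<omega> m)"
    and F: "F \<in> A" and g: "g \<in> carrier G" and V: "openin M V" "V \<noteq> {}"
    and big: "\<And>h. h \<in> H \<Longrightarrow> \<alpha> h m0 \<in> V \<Longrightarrow> t' \<le> F (g \<otimes> h)" and t: "t < t'"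
  obtains h where "h \<in> H" "\<And>\<omega>. \<omega> \<in> S \<Longrightarrow> t < \<omega> (\<lambda>x. F ((g \<otimes> h) \<otimes> x))"
proof -
  obtain B0 where B0: "B0 > 0" "\<And>g. g \<in> carrier G \<Longrightarrow> \<bar>F g\<bar> \<le> B0" using A_bounded[OF F] by blast
  define B where "B = B0 + \<bar>t'\<bar>"
  have B: "\<bar>F g\<bar> \<le> B" if "g \<in> carrier G" for g using B0(2)[OF that] by (simp add: B_def)
  \<comment> \<open>For a bump function \<open>c\<close> on \<open>V\<close>, the function \<open>D c - B\<close> is at most \<open>t'\<close> on \<open>V\<close> and equal to \<open>- B\<close> elsewhere.\<close>
  define D where "D = t' + B"
  have D: "0 < D" using B0(1) by (auto simp: D_def B_def abs_if)
  \<comment> \<open>Three errors of size \<open>D \<eta>\<close> occur: two in the approximation of \<open>c\<close> by \<open>J\<close> and one in moving points to \<open>c > 1 - \<eta>\<close>.\<close>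
  define \<eta> where "\<eta> = min (1/2) ((t' - t) / (8 * D))"
  have \<eta>: "0 < \<eta>" "D * \<eta> \<le> (t' - t) / 8"
  proof -
    show "0 < \<eta>" using t D by (simp add: \<eta>_def)
    have "D * \<eta> \<le> D * ((t' - t) / (8 * D))" using D by (intro mult_left_mono) (auto simp: \<eta>_def)
    thus "D * \<eta> \<le> (t' - t) / 8" using D by simp
  qed
  obtain n where n: "n \<in> V" using V(2) by blast
  have nM: "n \<in> topspace M" using n openin_subset[OF V(1)] by blast
  have "closedin M {n}" using nM M_Hausdorff by (intro closedin_Hausdorff_singleton)
  moreover have "closedin M (topspace M - V)" using V(1) by blast
  moreover have "disjnt (topspace M - V) {n}" using n by (auto simp: disjnt_def)
  ultimately obtain c where c: "continuous_map M (top_of_set {0..1::real}) c" "c ` (topspace M - V) \<subseteq> {0}" "c ` {n} \<subseteq> {1}"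
    using Urysohn_lemma[OF M_normal, of "topspace M - V" "{n}" 0 1] by auto
  have cc: "continuous_map M euclideanreal c" and c01: "\<And>x. x \<in> topspace M \<Longrightarrow> 0 \<le> c x \<and> c x \<le> 1"
    using c(1) by (auto simp: continuous_map_in_subtopology Pi_iff)
  let ?V' = "{x \<in> topspace M. c x \<in> {1 - \<eta><..}}"
  have V': "openin M ?V'" using cc by (rule openin_continuous_map_preimage) auto
  have V'ne: "?V' \<noteq> {}" using c(3) nM \<eta>(1) by auto
  have "\<forall>\<omega>\<in>S. \<exists>m. m \<in> topspace M \<and> represents \<omega> m" using \<nu>(2) by blast
  then obtain m where m: "\<And>\<omega>. \<omega> \<in> S \<Longrightarrow> m \<omega> \<in> topspace M" "\<And>\<omega>. \<omega> \<in> S \<Longrightarrow> represents \<omega> (m \<omega>)" by metis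
  have "\<exists>h\<in>H. \<forall>x\<in>m ` S. \<alpha> h x \<in> ?V'" using \<nu>(1) m(1) V' V'ne by (intro proximal_finite) auto
  then obtain h where h: "h \<in> H" "\<And>\<omega>. \<omega> \<in> S \<Longrightarrow> 1 - \<eta> < c (\<alpha> h (m \<omega>))" by auto
  have hG: "h \<in> carrier G" using H_in[OF h(1)] .
  have ch: "continuous_map M euclideanreal (\<lambda>x. c (\<alpha> h x))"
    using continuous_map_compose[OF \<alpha>_continuous[OF h(1)] cc] by (simp add: o_def)
  obtain J where J: "J \<in> A" "\<And>k. k \<in> H \<Longrightarrow> \<bar>J k - c (\<alpha> h (\<alpha> k m0))\<bar> \<le> \<eta>"
    using approximate_extension[OF ch \<eta>(1)] by blast
  have trans: "(\<lambda>x. F ((g \<otimes> h) \<otimes> x)) \<in> A" using g hG F by (intro translate_A) auto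
  have ineq: "- B - D * \<eta> \<le> F ((g \<otimes> h) \<otimes> k) - D * J k" if k: "k \<in> H" for k
  proof -
    have hk: "h \<otimes> k \<in> H" using H_mult[OF h(1) k] .
    have eq: "(g \<otimes> h) \<otimes> k = g \<otimes> (h \<otimes> k)" using g hG H_in[OF k] by (simp add: m_assoc)
    have x: "\<alpha> h (\<alpha> k m0) = \<alpha> (h \<otimes> k) m0" using \<alpha>_mult[OF h(1) k m0] by simp
    have xM: "\<alpha> (h \<otimes> k) m0 \<in> topspace M" by (rule \<alpha>_closed[OF hk m0])
    have "D * c (\<alpha> (h \<otimes> k) m0) - B \<le> F (g \<otimes> (h \<otimes> k))"
    proof (cases "\<alpha> (h \<otimes> k) m0 \<in> V")
      case True
      have "D * c (\<alpha> (h \<otimes> k) m0) \<le> D * 1" using c01[OF xM] D by (intro mult_left_mono) auto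
      thus ?thesis using big[OF hk True] by (simp add: D_def)
    next
      case False
      hence "c (\<alpha> (h \<otimes> k) m0) = 0" using c(2) xM by blast
      thus ?thesis using B[of "g \<otimes> (h \<otimes> k)"] g H_in[OF hk] by (simp add: abs_le_iff)
    qed
    moreover have "D * J k \<le> D * (c (\<alpha> (h \<otimes> k) m0) + \<eta>)"
      using J(2)[OF k] D x by (intro mult_left_mono) (auto simp: abs_le_iff)
    ultimately show ?thesis unfolding eq by (simp add: distrib_left)
  qed
  have "t < \<omega> (\<lambda>x. F ((g \<otimes> h) \<otimes> x))" if \<omega>S: "\<omega> \<in> S" for \<omega>
  proof -
    have \<omega>: "\<omega> \<in> states A P" "\<phi> \<omega> = dirac \<one>" using \<nu>(2)[OF \<omega>S] by auto
    have "- B - D * \<eta> \<le> \<omega> (\<lambda>x. F ((g \<otimes> h) \<otimes> x) - D * J x)"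
      using ineq by (intro over_base_ge[OF \<omega>] A.diff A.scale trans J(1))
    also have "\<dots> = \<omega> (\<lambda>x. F ((g \<otimes> h) \<otimes> x)) - D * \<omega> J"
      using A.state_diff[OF \<omega>(1) trans A.scale[OF J(1)]] A.state_scale[OF \<omega>(1) J(1)] by simp
    finally have 1: "- B - D * \<eta> + D * \<omega> J \<le> \<omega> (\<lambda>x. F ((g \<otimes> h) \<otimes> x))" by simp
    have "\<bar>\<omega> J - c (\<alpha> h (m \<omega>))\<bar> \<le> \<eta>"
      using m(2)[OF \<omega>S] ch J unfolding represents_def by blast
    hence "1 - 2 * \<eta> \<le> \<omega> J" using h(2)[OF \<omega>S] by linarith
    hence "D * (1 - 2 * \<eta>) \<le> D * \<omega> J" using D by (intro mult_left_mono) auto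
    hence "D - 2 * (D * \<eta>) \<le> D * \<omega> J" by (simp add: algebra_simps)
    hence "t' - 3 * (D * \<eta>) \<le> \<omega> (\<lambda>x. F ((g \<otimes> h) \<otimes> x))" using 1 by (simp add: D_def)
    moreover define v where "v = \<omega> (\<lambda>x. F ((g \<otimes> h) \<otimes> x))"
    ultimately have "t' - 3 * (D * \<eta>) \<le> v" by simp
    hence "t < v" using \<eta>(2) t by argo
    thus ?thesis by (simp add: v_def)
  qed
  with h(1) that show ?thesis by blast
qed

text \<open>
  If \<open>F \<le> t\<close> on \<open>C\<close> but not on \<open>L\<close>, then a translate of \<open>F\<close> exceeds \<open>t\<close> on a nonempty open set of
  points of \<open>M\<close>.  Hence some translate of \<open>F\<close> exceeds \<open>t\<close> at all states in the convex combination
  that \<open>C\<close> contains, and \<open>F\<close> itself exceeds \<open>t\<close> at a translate of this convex combination.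
\<close>

lemma L_irreducible:
  assumes C: "affine_subflow G L L_action C"
    and meets: "C \<inter> convex hull (ext_closure L \<inter> \<phi> -` {dirac \<one>}) \<noteq> {}"
  shows "C = topspace L"
proof
  have cl: "closedin L C" and cv: "convex C" using C by (auto simp: affine_subflow_def)
  show "C \<subseteq> topspace L" using closedin_subset[OF cl] .
  hence CS: "C \<subseteq> states A P" by simp
  obtain \<nu> where \<nu>: "\<nu> \<in> C" "\<nu> \<in> convex hull (ext_closure L \<inter> \<phi> -` {dirac \<one>})" using meets by blast
  then obtain S u where S: "finite S" "S \<subseteq> ext_closure L \<inter> \<phi> -` {dirac \<one>}" "\<forall>x\<in>S. 0 \<le> u x" "sum u S = 1"
    "(\<Sum>v\<in>S. u v *\<^sub>R v) = \<nu>" unfolding convex_hull_explicit by blast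
  have extS: "ext_closure L \<subseteq> states A P" using closure_of_subset_topspace[of L] unfolding ext_closure_def by auto
  have Sprop: "\<omega> \<in> states A P \<and> \<phi> \<omega> = dirac \<one> \<and> (\<exists>m\<in>topspace M. represents \<omega> m)" if "\<omega> \<in> S" for \<omega>
  proof -
    have \<omega>: "\<omega> \<in> ext_closure L" "\<phi> \<omega> = dirac \<one>" using S(2) that by auto
    obtain m where "m \<in> topspace M" "represents \<omega> m" by (rule ext_closure_represents[OF \<omega>])
    thus ?thesis using \<omega> extS by blast
  qed
  have sumS: "(\<Sum>v\<in>I. u v *\<^sub>R v) F = (\<Sum>v\<in>I. u v * v F)" if "finite I" for I and F :: "'g \<Rightarrow> real"
    using that by (induction I rule: finite_induct) (auto simp: scaleR_fun_def)
  show "topspace L \<subseteq> C"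
  proof
    fix \<mu> assume "\<mu> \<in> topspace L"
    hence \<mu>: "\<mu> \<in> states A P" by simp
    show "\<mu> \<in> C"
    proof (rule A.states_separation[OF CS _ cv cl \<mu>])
      show "C \<noteq> {}" using \<nu>(1) by blast
      fix F t assume F: "F \<in> A" and le: "\<And>\<kappa>. \<kappa> \<in> C \<Longrightarrow> \<kappa> F \<le> t"
      have "(\<lambda>x. t - F x) \<in> P"
      proof (rule ccontr)
        assume "(\<lambda>x. t - F x) \<notin> P"
        then obtain g where g: "g \<in> carrier G" and "\<not> densely_nonneg (\<lambda>h. t - F (g \<otimes> h))"
          unfolding P_def by blast
        then obtain \<epsilon> W where \<epsilon>: "\<epsilon> > 0" and W: "openin M W" "W \<noteq> {}"
          and no': "\<not> (\<exists>V. openin M V \<and> V \<noteq> {} \<and> V \<subseteq> W \<and> (\<forall>h\<in>H. \<alpha> h m0 \<in> V \<longrightarrow> - \<epsilon> \<le> t - F (g \<otimes> h)))"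
          unfolding densely_nonneg_def by blast
        have no: "\<exists>h\<in>H. \<alpha> h m0 \<in> V \<and> t - F (g \<otimes> h) < - \<epsilon>" if "openin M V" "V \<noteq> {}" "V \<subseteq> W" for V
          using no' that by (meson not_le)
        have \<epsilon>2: "\<epsilon> / 2 > 0" using \<epsilon> by simp
        obtain V where V: "openin M V" "V \<noteq> {}" "V \<subseteq> W"
          "\<And>h k. h \<in> H \<Longrightarrow> k \<in> H \<Longrightarrow> \<alpha> h m0 \<in> V \<Longrightarrow> \<alpha> k m0 \<in> V \<Longrightarrow> \<bar>F (g \<otimes> h) - F (g \<otimes> k)\<bar> \<le> \<epsilon> / 2"
          using small_oscE[OF A_small_osc[OF F g] \<epsilon>2 W] by blast
        obtain h1 where h1: "h1 \<in> H" "\<alpha> h1 m0 \<in> V" "t - F (g \<otimes> h1) < - \<epsilon>" using no[OF V(1-3)] by blast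
        have big: "t + \<epsilon> / 2 \<le> F (g \<otimes> h)" if "h \<in> H" "\<alpha> h m0 \<in> V" for h
          using abs_le_D2[OF V(4)[OF that(1) h1(1) that(2) h1(2)]] h1(3) by argo
        obtain h where h: "h \<in> H" "\<And>\<omega>. \<omega> \<in> S \<Longrightarrow> t < \<omega> (\<lambda>x. F ((g \<otimes> h) \<otimes> x))"
          using translate_exceeds_at_states[OF S(1) Sprop F g V(1,2) big, of t] \<epsilon> by auto
        have gh: "g \<otimes> h \<in> carrier G" using g H_in[OF h(1)] by simp
        have "L_action (g \<otimes> h) \<nu> \<in> C" using C gh \<nu>(1) unfolding affine_subflow_def by blast
        hence "L_action (g \<otimes> h) \<nu> F \<le> t" by (rule le)
        moreover have "L_action (g \<otimes> h) \<nu> F = (\<Sum>v\<in>S. u v * v (\<lambda>x. F ((g \<otimes> h) \<otimes> x)))"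
          using \<nu>(1) CS F S(5) sumS[OF S(1), of "\<lambda>x. F ((g \<otimes> h) \<otimes> x)"] by (auto simp: state_action_def)
        moreover have "t < (\<Sum>v\<in>S. u v * v (\<lambda>x. F ((g \<otimes> h) \<otimes> x)))"
        proof -
          have "\<exists>v\<in>S. 0 < u v"
          proof (rule ccontr)
            assume "\<not> (\<exists>v\<in>S. 0 < u v)"
            hence "sum u S \<le> 0" by (intro sum_nonpos) (auto simp: not_less)
            thus False using S(4) by simp
          qed
          then obtain v0 where v0: "v0 \<in> S" "0 < u v0" by blast
          have "(\<Sum>v\<in>S. u v * t) < (\<Sum>v\<in>S. u v * v (\<lambda>x. F ((g \<otimes> h) \<otimes> x)))"
          proof (rule sum_strict_mono_ex1[OF S(1)])
            show "\<forall>v\<in>S. u v * t \<le> u v * v (\<lambda>x. F ((g \<otimes> h) \<otimes> x))"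
              using h(2) S(3) by (simp add: mult_left_mono less_imp_le)
            show "\<exists>v\<in>S. u v * t < u v * v (\<lambda>x. F ((g \<otimes> h) \<otimes> x))"
              using v0 h(2)[OF v0(1)] by (intro bexI[of _ v0]) simp_all
          qed
          thus ?thesis using S(4) by (simp flip: sum_distrib_right)
        qed
        ultimately show False by simp
      qed
      hence "\<mu> F \<le> \<mu> (\<lambda>_. t)" using F by (intro A.state_mono_P[OF \<mu>] A.const)
      thus "\<mu> F \<le> t" using A.state_const[OF \<mu>] by simp
    qed
  qed
qed

lemma L_proximally_irreducible_extension: "proximally_irreducible_extension G T L L_action K K_action \<phi>"
  unfolding proximally_irreducible_extension_def
  using L_extension L_irreducible dirac_ext_closure by blast

text \<open>If \<open>\<phi>\<close> is injective, then the extreme point over the base point is fixed by \<open>H\<close>, and so is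
  the point of \<open>M\<close> that represents it.\<close>

lemma injective_imp_fixed_point:
  assumes inj: "inj_on \<phi> (topspace L)" shows "has_fixed_point GH M \<alpha>"
proof -
  note cc = A.state_space_compact_convex
  have dcl: "closedin K {dirac \<one>}"
    using dirac_state[OF one_closed] compact_convex_Hausdorff[OF K.state_space_compact_convex]
    by (intro closedin_Hausdorff_singleton) auto
  have face: "{x \<in> topspace L. \<phi> x \<in> {dirac \<one>}} face_of topspace L"
    using dirac_extreme[OF one_closed] \<phi>_surjective \<phi>_affine A.states_convex
    by (intro extreme_preimage_face) auto
  have closed: "closedin L {x \<in> topspace L. \<phi> x \<in> {dirac \<one>}}"
    by (rule closedin_continuous_map_preimage[OF \<phi>_continuous dcl])
  obtain \<Lambda> where "\<Lambda> \<in> states A P" "\<phi> \<Lambda> = dirac \<one>" by (rule state_over_base)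
  hence ne: "{x \<in> topspace L. \<phi> x \<in> {dirac \<one>}} \<noteq> {}" by auto
  obtain e where e: "e \<in> {x \<in> topspace L. \<phi> x \<in> {dirac \<one>}}" "e extreme_point_of topspace L"
    by (rule closed_face_contains_extreme_point[OF cc face closed ne])
  have es: "e \<in> states A P" "\<phi> e = dirac \<one>" using e(1) by auto
  have ee: "e extreme_point_of states A P" using e(2) by simp
  obtain m where m: "m \<in> topspace M" "represents e m"
    using multiplicative_represents[OF es A.extreme_state_multiplicative[OF ee]] by blast
  have "\<alpha> h m = m" if h: "h \<in> H" for h
  proof (rule ccontr)
    assume ne: "\<alpha> h m \<noteq> m"
    have hM: "\<alpha> h m \<in> topspace M" by (rule \<alpha>_closed[OF h m(1)])
    have "closedin M {m}" "closedin M {\<alpha> h m}" using m(1) hM M_Hausdorff by (auto intro: closedin_Hausdorff_singleton)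
    moreover have "disjnt {m} {\<alpha> h m}" using ne by auto
    ultimately obtain c where c: "continuous_map M euclideanreal c" "c ` {m} \<subseteq> {0}" "c ` {\<alpha> h m} \<subseteq> {1}"
      using Urysohn_lemma_alt[OF M_normal, of "{m}" "{\<alpha> h m}" 0 1] by metis
    \<comment> \<open>Two errors of \<open>1/4\<close> cannot bridge the gap between the values \<open>0\<close> and \<open>1\<close> of \<open>c\<close>.\<close>
    obtain F where F: "F \<in> A" "\<And>k. k \<in> H \<Longrightarrow> \<bar>F k - c (\<alpha> k m0)\<bar> \<le> 1/4"
      using approximate_extension[OF c(1), of "1/4"] by auto
    have "\<bar>e F - c m\<bar> \<le> 1/4" using m(2) c(1) F unfolding represents_def by blast
    moreover have "\<bar>e (\<lambda>x. F (h \<otimes> x)) - c (\<alpha> h m)\<bar> \<le> 1/4"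
    proof -
      have "continuous_map M euclideanreal (\<lambda>x. c (\<alpha> h x))"
        using continuous_map_compose[OF \<alpha>_continuous[OF h] c(1)] by (simp add: o_def)
      moreover have "\<bar>F (h \<otimes> k) - c (\<alpha> h (\<alpha> k m0))\<bar> \<le> 1/4" if "k \<in> H" for k
        using F(2)[OF H_mult[OF h that]] \<alpha>_mult[OF h that m0] by simp
      ultimately show ?thesis using m(2) translate_A[OF H_in[OF h] F(1)] unfolding represents_def by blast
    qed
    moreover have "e (\<lambda>x. F (h \<otimes> x)) = e F"
    proof -
      have hG: "h \<in> carrier G" by (rule H_in[OF h])
      have "\<phi> (L_action h e) = \<phi> e"
        using \<phi>_equivariant[OF hG es(1)] es(2) K_action_dirac[OF hG one_closed] hG dirac_one[OF h] by simp
      moreover have "L_action h e \<in> topspace L"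
        using L_affine_flow flow_closed[OF _ hG, of T L L_action e] es(1) by (simp add: affine_flow_def)
      ultimately have "L_action h e = e" using inj es(1) by (auto dest: inj_onD)
      moreover have "L_action h e F = e (\<lambda>x. F (h \<otimes> x))" using es(1) F(1) by (simp add: state_action_def)
      ultimately show ?thesis by simp
    qed
    ultimately show False using c(2,3) by auto
  qed
  thus ?thesis using m(1) by (auto simp: has_fixed_point_def)
qed

end

section \<open>Transport of extensions along linear injections\<close>

lemma image_locally_convex:
  fixes e :: "'v::real_vector \<Rightarrow> 'w::real_vector"
  assumes E: "hausdorff_locally_convex E" and e: "linear e" "inj e"
  shows "hausdorff_locally_convex (image_topology e E)"
proof -
  let ?F = "image_topology e E" and ?i = "inv_into (topspace E) e"
  have inj: "inj_on e (topspace E)" using e(2) by (rule inj_on_subset) simp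
  note hom = image_topology_homeomorphic[OF inj]
  have ec: "continuous_map E ?F e" and ic: "continuous_map ?F E ?i"
    using hom by (auto simp: homeomorphic_maps_def)
  have top: "topspace ?F = e ` topspace E" by (rule topspace_image_topology[OF inj])
  have ei: "e (?i y) = y" if "y \<in> topspace ?F" for y using that unfolding top by (rule f_inv_into_f)
  have ie: "?i (e x) = x" if "x \<in> topspace E" for x using inj that by (rule inv_into_f_f)
  have V: "subspace (topspace E)" using E by (simp add: hausdorff_locally_convex_def)
  show ?thesis
    unfolding hausdorff_locally_convex_def
  proof (intro conjI allI impI)
    show "subspace (topspace ?F)" unfolding top by (rule linear_subspace_image[OF e(1) V])
    show "Hausdorff_space ?F"
    proof -
      have "E homeomorphic_space ?F" using hom unfolding homeomorphic_space_def by blast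
      moreover have "Hausdorff_space E" using E by (simp add: hausdorff_locally_convex_def)
      ultimately show ?thesis using homeomorphic_Hausdorff_space by blast
    qed
    have "continuous_map (prod_topology ?F ?F) ?F (e \<circ> (\<lambda>z. ?i (fst z) + ?i (snd z)))"
      using continuous_map_compose[OF continuous_map_fst ic, of ?F] continuous_map_compose[OF continuous_map_snd ic, of ?F]
      by (intro continuous_map_compose[OF _ ec] lc_continuous_add[OF E]) (auto simp: o_def)
    thus "continuous_map (prod_topology ?F ?F) ?F (\<lambda>(x, y). x + y)"
      by (rule continuous_map_eq) (auto simp: linear_add[OF e(1)] ei)
    have "continuous_map (prod_topology euclideanreal ?F) ?F (e \<circ> (\<lambda>z. fst z *\<^sub>R ?i (snd z)))"
      using continuous_map_compose[OF continuous_map_snd ic, of euclideanreal]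
      by (intro continuous_map_compose[OF _ ec] lc_continuous_scale[OF E] continuous_map_fst) (auto simp: o_def)
    thus "continuous_map (prod_topology euclideanreal ?F) ?F (\<lambda>(c, x). c *\<^sub>R x)"
      by (rule continuous_map_eq) (auto simp: linear_scale[OF e(1)] ei)
    fix U assume U: "openin ?F U \<and> 0 \<in> U"
    have "openin E {x \<in> topspace E. e x \<in> U}" using U openin_continuous_map_preimage[OF ec] by blast
    moreover have "0 \<in> {x \<in> topspace E. e x \<in> U}" using U V subspace_0 by (auto simp: linear_0[OF e(1)])
    ultimately obtain C where C: "openin E C" "convex C" "0 \<in> C" "C \<subseteq> {x \<in> topspace E. e x \<in> U}"
      using E unfolding hausdorff_locally_convex_def by meson
    have "openin ?F {y \<in> topspace ?F. ?i y \<in> C}" by (rule openin_continuous_map_preimage[OF ic C(1)])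
    moreover have "{y \<in> topspace ?F. ?i y \<in> C} = e ` C"
    proof
      show "{y \<in> topspace ?F. ?i y \<in> C} \<subseteq> e ` C" using ei by (metis (mono_tags, lifting) imageI mem_Collect_eq subsetI)
      show "e ` C \<subseteq> {y \<in> topspace ?F. ?i y \<in> C}" using C(4) ie by (auto simp: top)
    qed
    ultimately have "openin ?F (e ` C)" by simp
    moreover have "convex (e ` C)" by (rule convex_linear_image[OF e(1) C(2)])
    moreover have "0 \<in> e ` C" using C(3) linear_0[OF e(1)] by force
    moreover have "e ` C \<subseteq> U" using C(4) by blast
    ultimately show "\<exists>C. openin ?F C \<and> convex C \<and> 0 \<in> C \<and> C \<subseteq> U" by blast
  qed
qed

lemma image_topology_subtopology:
  assumes e: "inj e" shows "image_topology e (subtopology E S) = subtopology (image_topology e E) (e ` S)"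
proof (rule topology_eq[THEN iffD2], intro allI)
  fix U
  have inj: "inj_on e X" for X using e by (rule inj_on_subset) simp
  have inv: "inv_into X e (e x) = x" if "x \<in> X" for X x by (rule inv_into_f_f[OF inj that])
  have pre: "inv_into X e -` V \<inter> e ` X = e ` (V \<inter> X)" for V X using inv by (auto simp: image_iff)
  have l: "openin (image_topology e X) U \<longleftrightarrow> (\<exists>V. openin X V \<and> U = e ` (V \<inter> topspace X))" for X U
    unfolding image_topology_def openin_pullback_topology pre by simp
  have img: "e ` (X \<inter> Y) = e ` X \<inter> e ` Y" for X Y using image_Int[OF e] .
  show "openin (image_topology e (subtopology E S)) U \<longleftrightarrow> openin (subtopology (image_topology e E) (e ` S)) U"
  proof
    assume "openin (image_topology e (subtopology E S)) U"
    then obtain V where V: "openin E V" "U = e ` ((V \<inter> S) \<inter> (topspace E \<inter> S))"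
      unfolding l openin_subtopology by auto
    have "U = e ` (V \<inter> topspace E) \<inter> e ` S" unfolding V(2) img by blast
    thus "openin (subtopology (image_topology e E) (e ` S)) U"
      unfolding openin_subtopology l using V(1) by blast
  next
    assume "openin (subtopology (image_topology e E) (e ` S)) U"
    then obtain V where V: "openin E V" "U = e ` (V \<inter> topspace E) \<inter> e ` S"
      unfolding openin_subtopology l by blast
    have "U = e ` ((V \<inter> S) \<inter> (topspace E \<inter> S))" unfolding V(2) img by blast
    thus "openin (image_topology e (subtopology E S)) U"
      unfolding l openin_subtopology using V(1) by auto
  qed
qed

lemma image_extreme_point:
  fixes e :: "'v::real_vector \<Rightarrow> 'w::real_vector"
  assumes e: "linear e" "inj e"
  shows "e x extreme_point_of (e ` S) \<longleftrightarrow> x extreme_point_of S"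
proof -
  have seg: "e x \<in> open_segment (e a) (e b) \<longleftrightarrow> x \<in> open_segment a b" for a b
    unfolding in_segment using inj_eq[OF e(2)]
    by (simp flip: linear_scale[OF e(1)] linear_add[OF e(1)] add: inj_eq[OF e(2)])
  show ?thesis unfolding extreme_point_of_def by (auto simp: seg inj_eq[OF e(2)])
qed

lemma image_ext_closure:
  fixes e :: "'v::real_vector \<Rightarrow> 'w::real_vector"
  assumes e: "linear e" "inj e" shows "ext_closure (image_topology e L) = e ` ext_closure L"
proof -
  have inj: "inj_on e (topspace L)" using e(2) by (rule inj_on_subset) simp
  have hom: "homeomorphic_map L (image_topology e L) e"
    using image_topology_homeomorphic[OF inj] homeomorphic_maps_map by blast
  have "{x. x extreme_point_of topspace (image_topology e L)} = e ` {x. x extreme_point_of topspace L}"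
    unfolding topspace_image_topology[OF inj]
  proof (intro equalityI subsetI)
    fix y assume "y \<in> {x. x extreme_point_of e ` topspace L}"
    hence y: "y extreme_point_of e ` topspace L" by simp
    then obtain x where "y = e x" unfolding extreme_point_of_def by blast
    thus "y \<in> e ` {x. x extreme_point_of topspace L}" using y image_extreme_point[OF e] by blast
  next
    fix y assume "y \<in> e ` {x. x extreme_point_of topspace L}"
    thus "y \<in> {x. x extreme_point_of e ` topspace L}" using image_extreme_point[OF e] by blast
  qed
  moreover have "{x. x extreme_point_of topspace L} \<subseteq> topspace L" by (auto simp: extreme_point_of_def)
  ultimately show ?thesis unfolding ext_closure_def using homeomorphic_map_closure_of[OF hom] by simp
qed

lemma image_affine_flow:
  fixes e :: "'v::real_vector \<Rightarrow> 'w::real_vector"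
  assumes L: "affine_flow G T L b" and e: "linear e" "inj e"
  shows "affine_flow G T (image_topology e L) (image_action e L b)"
  unfolding affine_flow_def
proof (intro conjI ballI)
  have inj: "inj_on e (topspace L)" using e(2) by (rule inj_on_subset) simp
  note top = topspace_image_topology[OF inj]
  obtain E where E: "hausdorff_locally_convex E" "L = subtopology E (topspace L)" using L by (auto simp: affine_flow_def)
  have "image_topology e L = subtopology (image_topology e E) (topspace (image_topology e L))"
    using image_topology_subtopology[OF e(2), of E "topspace L"] E(2) top by metis
  thus "\<exists>F. hausdorff_locally_convex F \<and> image_topology e L = subtopology F (topspace (image_topology e L))"
    using image_locally_convex[OF E(1) e] by blast
  have conv: "convex (topspace L)" using L by (simp add: affine_flow_def)
  thus "convex (topspace (image_topology e L))" unfolding top by (rule convex_linear_image[OF e(1)])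
  have fl: "flow G T L b" using L by (simp add: affine_flow_def)
  show "flow G T (image_topology e L) (image_action e L b)" by (rule image_flow[OF fl inj])
  fix g assume g: "g \<in> carrier G"
  have aff: "affine_map_on (topspace L) (b g)" using L g by (simp add: affine_flow_def)
  show "affine_map_on (topspace (image_topology e L)) (image_action e L b g)"
    unfolding affine_map_on_def top
  proof (intro ballI)
    fix x y and t :: real assume "x \<in> e ` topspace L" "y \<in> e ` topspace L" and t: "t \<in> {0..1}"
    then obtain p q where pq: "p \<in> topspace L" "q \<in> topspace L" "x = e p" "y = e q" by blast
    have z: "(1 - t) *\<^sub>R p + t *\<^sub>R q \<in> topspace L" using convexD_alt[OF conv pq(1,2)] t by simp
    have "(1 - t) *\<^sub>R x + t *\<^sub>R y = e ((1 - t) *\<^sub>R p + t *\<^sub>R q)"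
      by (simp add: pq linear_add[OF e(1)] linear_scale[OF e(1)])
    hence "image_action e L b g ((1 - t) *\<^sub>R x + t *\<^sub>R y) = e (b g ((1 - t) *\<^sub>R p + t *\<^sub>R q))"
      using image_action_apply[OF inj z] by simp
    also have "\<dots> = (1 - t) *\<^sub>R e (b g p) + t *\<^sub>R e (b g q)"
      using aff pq t by (simp add: affine_map_on_def linear_add[OF e(1)] linear_scale[OF e(1)])
    finally show "image_action e L b g ((1 - t) *\<^sub>R x + t *\<^sub>R y) =
        (1 - t) *\<^sub>R image_action e L b g x + t *\<^sub>R image_action e L b g y"
      using image_action_apply[OF inj pq(1), of b g] image_action_apply[OF inj pq(2), of b g] pq(3,4) by simp
  qed
qed

text \<open>A linear injection carries extreme points, convex hulls and affine subflows to their images.\<close>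

lemma image_proximally_irreducible_extension:
  fixes e :: "'v::real_vector \<Rightarrow> 'w::real_vector"
  assumes irr: "proximally_irreducible_extension G T L b K a \<phi>" and e: "linear e" "inj e"
  shows "proximally_irreducible_extension G T (image_topology e L) (image_action e L b) K a (\<phi> \<circ> inv_into UNIV e)"
proof -
  let ?L = "image_topology e L" and ?b = "image_action e L b" and ?\<phi> = "\<phi> \<circ> inv_into UNIV e"
  have inj: "inj_on e (topspace L)" using e(2) by (rule inj_on_subset) simp
  note top = topspace_image_topology[OF inj] and ap = image_action_apply[OF inj]
  have hom: "continuous_map L ?L e" "continuous_map ?L L (inv_into (topspace L) e)"
    using image_topology_homeomorphic[OF inj] by (auto simp: homeomorphic_maps_def)
  have ext: "affine_extension G T L b K a \<phi>" using irr by (simp add: proximally_irreducible_extension_def)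
  have \<phi>e: "?\<phi> (e x) = \<phi> x" for x using e(2) by simp
  have flow: "flow G T L b" using ext by (simp add: affine_extension_def affine_flow_def)
  have L: "affine_flow G T L b" using ext by (simp add: affine_extension_def)
  have conv: "convex (topspace L)" using L by (simp add: affine_flow_def)
  have inve: "inv_into UNIV e (e x) = x" for x using e(2) by simp
  have "affine_extension G T ?L ?b K a ?\<phi>"
    unfolding affine_extension_def
  proof (intro conjI ballI)
    show "affine_flow G T ?L ?b" by (rule image_affine_flow[OF L e])
    show "affine_flow G T K a" using ext by (simp add: affine_extension_def)
    have "continuous_map ?L K (\<phi> \<circ> inv_into (topspace L) e)"
      using ext hom(2) by (intro continuous_map_compose) (auto simp: affine_extension_def)
    thus "continuous_map ?L K ?\<phi>" by (rule continuous_map_eq) (auto simp: top inve inv_into_f_f[OF inj])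
    show "?\<phi> ` topspace ?L = topspace K" using ext unfolding top affine_extension_def by (simp add: image_image inve)
    show "affine_map_on (topspace ?L) ?\<phi>"
      unfolding affine_map_on_def top
    proof (intro ballI)
      fix x y and t :: real assume "x \<in> e ` topspace L" "y \<in> e ` topspace L" and t: "t \<in> {0..1}"
      then obtain p q where pq: "p \<in> topspace L" "q \<in> topspace L" "x = e p" "y = e q" by blast
      have "(1 - t) *\<^sub>R x + t *\<^sub>R y = e ((1 - t) *\<^sub>R p + t *\<^sub>R q)"
        by (simp add: pq linear_add[OF e(1)] linear_scale[OF e(1)])
      thus "?\<phi> ((1 - t) *\<^sub>R x + t *\<^sub>R y) = (1 - t) *\<^sub>R ?\<phi> x + t *\<^sub>R ?\<phi> y"
        using ext pq t by (simp add: \<phi>e inve affine_extension_def affine_map_on_def)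
    qed
    fix g y assume g: "g \<in> carrier G" and "y \<in> topspace ?L"
    then obtain x where x: "x \<in> topspace L" "y = e x" unfolding top by blast
    thus "?\<phi> (?b g y) = a g (?\<phi> y)" using ext g by (simp add: ap inve affine_extension_def)
  qed
  moreover have "C = topspace ?L"
    if C: "affine_subflow G ?L ?b C" and meets: "\<forall>y\<in>ext_closure K. C \<inter> convex hull (ext_closure ?L \<inter> ?\<phi> -` {y}) \<noteq> {}" for C
  proof -
    have CL: "C \<subseteq> e ` topspace L" using C closedin_subset[of ?L C] by (simp add: affine_subflow_def top)
    define D where "D = {x \<in> topspace L. e x \<in> C}"
    have CD: "C = e ` D" using CL by (auto simp: D_def)
    have "affine_subflow G L b D"
      unfolding affine_subflow_def
    proof (intro conjI ballI)
      show "D \<noteq> {}" using C CD by (auto simp: affine_subflow_def)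
      show "closedin L D" unfolding D_def using C by (intro closedin_continuous_map_preimage[OF hom(1)]) (simp add: affine_subflow_def)
      have "affine_map_on (topspace L) e"
        by (simp add: affine_map_on_def linear_add[OF e(1)] linear_scale[OF e(1)])
      thus "convex D" unfolding D_def using C by (intro convex_affine_preimage[OF conv]) (auto simp: affine_subflow_def)
      fix g assume g: "g \<in> carrier G"
      show "b g ` D \<subseteq> D"
      proof
        fix y assume "y \<in> b g ` D"
        then obtain x where x: "x \<in> topspace L" "e x \<in> C" "y = b g x" by (auto simp: D_def)
        have "?b g (e x) \<in> C" using C g x(2) unfolding affine_subflow_def by blast
        thus "y \<in> D" using ap[OF x(1), of b g] x(3) flow_closed[OF flow g x(1)] by (simp add: D_def)
      qed
    qed
    moreover have "D \<inter> convex hull (ext_closure L \<inter> \<phi> -` {y}) \<noteq> {}" if y: "y \<in> ext_closure K" for y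
    proof -
      have "ext_closure ?L \<inter> ?\<phi> -` {y} = e ` (ext_closure L \<inter> \<phi> -` {y})"
        unfolding image_ext_closure[OF e] by (auto simp: inve)
      hence "e ` D \<inter> e ` (convex hull (ext_closure L \<inter> \<phi> -` {y})) \<noteq> {}"
        using meets y CD convex_hull_linear_image[OF e(1)] by metis
      thus ?thesis using image_Int[OF e(2)] by (metis image_is_empty)
    qed
    ultimately have "D = topspace L" using irr unfolding proximally_irreducible_extension_def by blast
    thus ?thesis using CD top by simp
  qed
  ultimately show ?thesis unfolding proximally_irreducible_extension_def by blast
qed

section \<open>The characterization of strong amenability\<close>

lemma affine_flow_cong:
  assumes a: "affine_flow G T K a" and eq: "\<And>g. g \<in> carrier G \<Longrightarrow> a g = a' g" and T: "topspace T = carrier G"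
  shows "affine_flow G T K a'"
proof -
  have fl: "flow G T K a" using a by (simp add: affine_flow_def)
  interpret group G using flow_group[OF fl] .
  have act: "group_action G (topspace K) a" using fl by (simp add: flow_def)
  have "group_action G (topspace K) a'"
  proof (rule group_actionI[OF is_group])
    fix g h x assume gh: "g \<in> carrier G" "h \<in> carrier G" "x \<in> topspace K"
    have "g \<otimes>\<^bsub>G\<^esub> h \<in> carrier G" using gh by simp
    thus "a' (g \<otimes>\<^bsub>G\<^esub> h) x = a' g (a' h x)" using flow_mult[OF fl gh] eq gh by simp
  next
    show "a' \<one>\<^bsub>G\<^esub> x = x" if "x \<in> topspace K" for x using flow_one[OF fl that] eq[OF one_closed] by simp
  next
    fix g assume g: "g \<in> carrier G"
    show "a' g \<in> extensional (topspace K)" using group_action_extensional[OF act g] eq[OF g] by simp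
    show "a' g x \<in> topspace K" if "x \<in> topspace K" for x using flow_closed[OF fl g that] eq[OF g] by simp
  qed
  moreover have "continuous_map (prod_topology T K) K (\<lambda>(g, x). a g x)" using fl by (simp add: flow_def)
  hence "continuous_map (prod_topology T K) K (\<lambda>(g, x). a' g x)"
    by (rule continuous_map_eq) (auto simp: T eq)
  ultimately have "flow G T K a'" using fl by (simp add: flow_def)
  thus ?thesis using a eq by (auto simp: affine_flow_def)
qed

lemma proximally_irreducible_extension_cong:
  assumes irr: "proximally_irreducible_extension G T L b K a \<phi>"
    and eq: "\<And>g. g \<in> carrier G \<Longrightarrow> a g = a' g" and T: "topspace T = carrier G"
  shows "proximally_irreducible_extension G T L b K a' \<phi>"
proof -
  have ext: "affine_extension G T L b K a \<phi>" using irr by (simp add: proximally_irreducible_extension_def)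
  hence "affine_flow G T K a'" using affine_flow_cong[OF _ eq T] by (simp add: affine_extension_def)
  hence "affine_extension G T L b K a' \<phi>" using ext eq by (simp add: affine_extension_def)
  thus ?thesis using irr by (simp add: proximally_irreducible_extension_def)
qed

lemma proximally_irreducible_cong:
  fixes G :: "('a, 'm) monoid_scheme" and K :: "'b::real_vector topology"
  assumes eq: "\<And>g. g \<in> carrier G \<Longrightarrow> a g = a' g" and T: "topspace T = carrier G"
  shows "proximally_irreducible TYPE('v::real_vector) G T K a \<longleftrightarrow> proximally_irreducible TYPE('v) G T K a'"
proof -
  have half: "proximally_irreducible TYPE('v) G T K a'"
    if irr: "proximally_irreducible TYPE('v) G T K a" and eq: "\<And>g. g \<in> carrier G \<Longrightarrow> a g = a' g" for a a'
    unfolding proximally_irreducible_def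
  proof (intro conjI allI impI)
    show "affine_flow G T K a'"
      using irr affine_flow_cong[OF _ eq T] by (simp add: proximally_irreducible_def)
    fix L :: "('v \<times> (('b \<times> 'a \<Rightarrow> real) \<Rightarrow> real)) topology" and b \<phi>
    assume ext: "proximally_irreducible_extension G T L b K a' \<phi>"
    have "proximally_irreducible_extension G T L b K a \<phi>"
      by (rule proximally_irreducible_extension_cong[OF ext _ T]) (simp add: eq)
    thus "homeomorphic_map L K \<phi>" using irr unfolding proximally_irreducible_def by blast
  qed
  show ?thesis using half[of a a'] half[of a' a] eq by (metis (no_types))
qed

context coset_space
begin

lemma strongly_amenable_imp_proximally_irreducible:
  assumes "strongly_amenable TYPE('x) GH TH"
  shows "proximally_irreducible TYPE('v::real_vector) G T K K_action"
  unfolding proximally_irreducible_def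
proof (intro conjI allI impI K_flow)
  fix L :: "('v \<times> (((((('g set \<Rightarrow> complex) \<Rightarrow> complex) \<Rightarrow> real) \<Rightarrow> real) \<times> 'g \<Rightarrow> real) \<Rightarrow> real)) topology" and b \<phi>
  assume "proximally_irreducible_extension G T L b K K_action \<phi>"
  then interpret irreducible_extension G T H L b \<phi> by unfold_locales
  show "homeomorphic_map L K \<phi>" by (rule strongly_amenable_imp_isomorphism[OF assms])
qed

text \<open>A state on functions on \<open>'g\<close> acts on functions of two variables by fixing the first one; this
  embeds the extension in the type over which proximal irreducibility quantifies.\<close>

lemma proximally_irreducible_imp_strongly_amenable:
  assumes K: "proximally_irreducible TYPE('v::real_vector) G T K K_action"
  shows "strongly_amenable TYPE('x) GH TH"
  unfolding strongly_amenable_def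
proof (intro allI impI, rule ccontr)
  fix X :: "('x + 'g set set) topology" and a
  assume X: "flow GH TH X a \<and> proximal GH X a" and no: "\<not> has_fixed_point GH X a"
  obtain N where N: "closedin X N" "N \<noteq> {}" "\<And>g. g \<in> carrier GH \<Longrightarrow> a g ` N \<subseteq> N"
    "minimal_flow GH TH (subtopology X N) (\<lambda>g. restrict (a g) N)"
    using minimal_subflow_exists[OF _ TH_top] X by blast
  obtain m0 where m0: "m0 \<in> N" using N(2) by blast
  have NX: "N \<subseteq> topspace X" using closedin_subset[OF N(1)] .
  interpret F: proximal_flow G T H "subtopology X N" "\<lambda>g. restrict (a g) N" m0
  proof
    show "minimal_flow GH TH (subtopology X N) (\<lambda>g. restrict (a g) N)" by (rule N(4))
    show "proximal GH (subtopology X N) (\<lambda>g. restrict (a g) N)" using proximal_subflow[of GH TH X a N] X N(1,3) by blast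
    show "m0 \<in> topspace (subtopology X N)" using m0 NX by auto
  qed
  define e :: "(('g \<Rightarrow> real) \<Rightarrow> real) \<Rightarrow> 'v \<times> (((((('g set \<Rightarrow> complex) \<Rightarrow> complex) \<Rightarrow> real) \<Rightarrow> real) \<times> 'g \<Rightarrow> real) \<Rightarrow> real)"
    where "e = (\<lambda>\<Lambda>. (0, \<lambda>J. \<Lambda> (\<lambda>g. J (undefined, g))))"
  have lin: "linear e"
    by (rule linearI) (simp_all add: e_def plus_fun_def scaleR_fun_def)
  have inj: "inj e"
  proof (rule injI, rule ext)
    fix \<Lambda> \<Lambda>' f assume "e \<Lambda> = e \<Lambda>'"
    hence "(\<lambda>J :: ((((('g set \<Rightarrow> complex) \<Rightarrow> complex) \<Rightarrow> real) \<Rightarrow> real) \<times> 'g \<Rightarrow> real). \<Lambda> (\<lambda>g. J (undefined, g))) =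
        (\<lambda>J. \<Lambda>' (\<lambda>g. J (undefined, g)))" by (simp add: e_def)
    from fun_cong[OF this, of "\<lambda>z. f (snd z)"] show "\<Lambda> f = \<Lambda>' f" by simp
  qed
  have "proximally_irreducible_extension G T (image_topology e F.L) (image_action e F.L F.L_action) K K_action
      (F.\<phi> \<circ> inv_into UNIV e)"
    by (rule image_proximally_irreducible_extension[OF F.L_proximally_irreducible_extension lin inj])
  hence hom: "homeomorphic_map (image_topology e F.L) K (F.\<phi> \<circ> inv_into UNIV e)"
    using K unfolding proximally_irreducible_def by blast
  have ie: "inj_on e (topspace F.L)" using inj by (rule inj_on_subset) simp
  have "inj_on (F.\<phi> \<circ> inv_into UNIV e) (e ` topspace F.L)"
    using homeomorphic_imp_injective_map[OF hom] unfolding topspace_image_topology[OF ie] .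
  note injc = this
  have "inj_on F.\<phi> (topspace F.L)"
  proof (rule inj_onI)
    fix x y assume xy: "x \<in> topspace F.L" "y \<in> topspace F.L" "F.\<phi> x = F.\<phi> y"
    have "(F.\<phi> \<circ> inv_into UNIV e) (e x) = (F.\<phi> \<circ> inv_into UNIV e) (e y)" using xy(3) inj by (simp del: PiE_UNIV_domain)
    hence "e x = e y" using inj_onD[OF injc] xy(1,2) by blast
    thus "x = y" using inj by (rule injD[rotated])
  qed
  hence "has_fixed_point GH (subtopology X N) (\<lambda>g. restrict (a g) N)" by (rule F.injective_imp_fixed_point)
  then obtain x where "x \<in> N" "\<forall>g\<in>H. a g x = x" by (auto simp: has_fixed_point_def)
  thus False using no NX by (auto simp: has_fixed_point_def)
qed

end

theorem theorem5p9:
  fixes G :: "('g, 'm) monoid_scheme" and T :: "'g topology" and H :: "'g set"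
  assumes "polish_group G T"
    and "subgroup H G"
    and "closedin T H"
  shows "strongly_amenable TYPE('x) (G\<lparr>carrier := H\<rparr>) (subtopology T H) \<longleftrightarrow>
         proximally_irreducible TYPE('v::real_vector) G T
           (P_space (Sa G T H)) (P_action (Sa G T H) (Sa_action G T H))"
proof -
  have tg: "topological_group G T" using assms(1) by (simp add: polish_group_def)
  interpret group G using tg by (simp add: topological_group_def)
  interpret coset_space G T H 
    by (intro coset_space.intro top_group.intro top_group_axioms.intro coset_space_axioms.intro is_group tg assms(2))
  have "P_space SaX = K" by (rule P_space_eq_state_space[OF Sa_compact Sa_Hausdorff])
  moreover have "P_action SaX act g = K_action g" if "g \<in> carrier G" for g
    by (rule P_action_eq_state_action[where X = SaX and a = act and g = g, OF Sa_compact Sa_Hausdorff Sa_act_continuous[OF that]])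
  hence "proximally_irreducible TYPE('v) G T K (P_action SaX act) \<longleftrightarrow>
      proximally_irreducible TYPE('v) G T K K_action"
    by (rule proximally_irreducible_cong[OF _ topspace_T])
  ultimately show ?thesis
    using strongly_amenable_imp_proximally_irreducible proximally_irreducible_imp_strongly_amenable by metis
qed

end
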